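(* Let $\delta\in\mathbb Z/2\mathbb Z$. (a) If $\sigma\in\mathcal S'(\mathbb R)$ vanishes to infinite order at the origin, then $M_\delta\widehat\sigma(s)=(-1)^\delta G_\delta(s)\,M_\delta\sigma(1-s)$ for $\operatorname{Re}s\gg0$. (b) Suppose that $\sigma\in\mathcal S'_\delta(\mathbb R)$ extends canonically across infinity and vanishes to order $k_0\ge1$ at the origin. Then $\widehat\sigma$ vanishes to infinite order at the origin if and only if $G_\delta(s)\,M_\delta\sigma(1-s)$ is regular for $\operatorname{Re}s<1$. When that is the case, $M_\delta\widehat\sigma(s)=(-1)^\delta G_\delta(s)\,M_\delta\sigma(1-s)$ for $\operatorname{Re}s<1$.
   Context: Distributions on a one-dimensional smooth manifold $M$ (here $\mathbb R$, or $\mathbb{RP}^1=\mathbb R\cup\{\infty\}$ with coordinate $1/x$ near $\infty$) are the dual of compactly supported smooth measures; they transform like functions, and the pairing is written as an integral. A differential operator $D$ (linear, $C^\infty$ coefficients) near $p\in M$ is tangential to $\{p\}$ if for every $k$ it maps smooth functions vanishing to order $k$ at $p$ to such functions. A distribution $\sigma$ vanishes to order $k\ge0$ at $p$ if on some neighborhood $U_p$ of $p$, $\sigma=\sum_{j=1}^N f_jD_jh_j$ with $h_j\in L^\infty_{\rm loc}(U_p)$, $D_j$ tangential to $\{p\}$, $f_j\in C^\infty(U_p)$ vanishing to order $k$ at $p$; it vanishes to order $-k$ ($k>0$) at $p$ if $z^k\sigma$ vanishes to order $0$, where $z$ is a smooth function near $p$ vanishing exactly to first order at $p$; it vanishes to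 infinite order if it does so to every order. A distribution on $M-\{p\}$ extends canonically across $p$ if it is the restriction of a (necessarily unique) distribution on $M$ vanishing to infinite order at $p$. $\mathcal S'_\delta(\mathbb R)$ is the space of tempered distributions with $\sigma(-x)=(-1)^\delta\sigma(x)$. Fourier transform: $\widehat f(y)=\int_{\mathbb R}f(x)e(-xy)\,dx$, $e(u)=e^{2\pi iu}$, for Schwartz $f$, and $\int\widehat\sigma f\,dx=\int\sigma\widehat f\,dy$ for tempered $\sigma$. If $\sigma$ vanishes to infinite order at $0$, $\widehat\sigma$ extends canonically across $\infty$. Signed Mellin transform. Let $\sigma\in\mathcal S'(\mathbb R)$ vanish to order $k_0\in\mathbb Z\cup\{\infty\}$ at $0$ and have an extension to $\mathbb R\cup\{\infty\}$ vanishing to order $k_\infty\in\mathbb Z\cup\{\infty\}$ at $\infty$, with $k_0+k_\infty\ge1$ (where $k_0+k_\infty=\infty$ if either is $\infty$). For $\operatorname{Re}s>-k_0$ the distribution $(\operatorname{sgn}x)^\delta|x|^{s-1}\sigma(x)$ on $\mathbb R-\{0\}$ has a unique extension across $0$ which depends holomorphically on $s$ (when paired with any test measure) and vanishes at $0$ to order $\ell$ for every integer $\ell$ with $0\le\ell\le\operatorname{Re}s-1+k_0$; likewise, for $\operatorname{Re}s<k_\infty$, $(\operatorname{sgn}x)^\delta|x|^{-s-1}\sigma(1/x)$ has a unique extension across $x=0$ which depends holomorphically on $s$ and vanishes there to order $\ell$ whenever $0\le\ell\le k_\infty-\operatorname{Re}s-1$. With these extensions understood, and with $\phi\in C_c^\infty(\mathbb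 R)$ any function equal to $1$ near $0$, $$M_\delta\sigma(s)=\int_{\mathbb R}(\operatorname{sgn}x)^\delta|x|^{s-1}\phi(x)\sigma(x)\,dx+\int_{\mathbb R}(\operatorname{sgn}x)^\delta|x|^{-s-1}(1-\phi)(1/x)\sigma(1/x)\,dx$$ for $-k_0<\operatorname{Re}s<k_\infty$; this is independent of $\phi$ and holomorphic in that region. Every tempered distribution vanishes to some (possibly negative) order at $0$ and has an extension across $\infty$ vanishing there to some (possibly negative) order. Hence $M_\delta\sigma$ is defined on some left half plane if $\sigma$ vanishes to infinite order at $0$, and on some right half plane if $\sigma$ extends canonically across $\infty$. $G_\delta(s)=\int_{\mathbb R}e(x)(\operatorname{sgn}x)^\delta|x|^{s-1}\,dx$ for $0<\operatorname{Re}s<1$ (conditionally convergent), extended meromorphically to $\mathbb C$ by $G_\delta(s)=2\,i^\delta(2\pi)^{-s}\Gamma(s)\cos(\pi(s-\delta)/2)$, with $\delta\in\{0,1\}$. *)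

theory Defs
  imports "HOL-Complex_Analysis.Complex_Analysis"
begin

section \<open>Smooth functions and test functions\<close>

definition nderiv :: "nat \<Rightarrow> (real \<Rightarrow> complex) \<Rightarrow> real \<Rightarrow> complex" where
  "nderiv n = ((\<lambda>f x. vector_derivative f (at x)) ^^ n)"

definition smooth_on :: "real set \<Rightarrow> (real \<Rightarrow> complex) \<Rightarrow> bool" where
  "smooth_on U f \<longleftrightarrow> (\<forall>n. \<forall>x\<in>U. nderiv n f differentiable (at x))"

definition test_functions :: "real set \<Rightarrow> (real \<Rightarrow> complex) set" where
  "test_functions U = {f. smooth_on UNIV f \<and> compact (closure {x. f x \<noteq> 0}) \<and>
                          closure {x. f x \<noteq> 0} \<subseteq> U}"

definition schwartz :: "(real \<Rightarrow> complex) set" where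
  "schwartz = {f. smooth_on UNIV f \<and>
                  (\<forall>m n. bounded (range (\<lambda>x. of_real x ^ m * nderiv n f x)))}"

section \<open>Distributions\<close>

text \<open>
  A distribution is a total function on \<^typ>\<open>real \<Rightarrow> complex\<close> whose values matter only on
  the relevant space of densities: on an open subset of the line the smooth measure \<open>f(x) dx\<close> is
  represented by its density \<open>f\<close>. Two functionals are the same distribution iff they agree
  on all such densities, so no definition below inspects other values.
\<close>

type_synonym distr = "(real \<Rightarrow> complex) \<Rightarrow> complex"

definition linear_functional_on :: "(real \<Rightarrow> complex) set \<Rightarrow> distr \<Rightarrow> bool" where
  "linear_functional_on S T \<longleftrightarrow>
     (\<forall>f\<in>S. \<forall>g\<in>S. T (\<lambda>x. f x + g x) = T f + T g) \<and>
     (\<forall>f\<in>S. \<forall>c. T (\<lambda>x. c * f x) = c * T f)"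

definition distribution_on :: "real set \<Rightarrow> distr \<Rightarrow> bool" where
  "distribution_on U T \<longleftrightarrow> linear_functional_on (test_functions U) T \<and>
     (\<forall>K. compact K \<and> K \<subseteq> U \<longrightarrow>
        (\<exists>C N. \<forall>f\<in>test_functions U. \<forall>B.
           {x. f x \<noteq> 0} \<subseteq> K \<and> (\<forall>n\<le>N. \<forall>x. norm (nderiv n f x) \<le> B)
             \<longrightarrow> norm (T f) \<le> C * B))"

definition tempered :: "distr \<Rightarrow> bool" where
  "tempered T \<longleftrightarrow> linear_functional_on schwartz T \<and>
     (\<exists>C N. \<forall>f\<in>schwartz. \<forall>B.
        (\<forall>m\<le>N. \<forall>n\<le>N. \<forall>x. norm (of_real x ^ m * nderiv n f x) \<le> B)
          \<longrightarrow> norm (T f) \<le> C * B)"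

definition tempered_parity :: "nat \<Rightarrow> distr \<Rightarrow> bool" where
  "tempered_parity \<delta> \<sigma> \<longleftrightarrow> tempered \<sigma> \<and> (\<forall>f\<in>schwartz. \<sigma> (\<lambda>x. f (- x)) = (- 1) ^ \<delta> * \<sigma> f)"

definition mult_distr :: "(real \<Rightarrow> complex) \<Rightarrow> distr \<Rightarrow> distr" where
  "mult_distr f T = (\<lambda>\<phi>. T (\<lambda>x. f x * \<phi> x))"

definition Linf_loc :: "real set \<Rightarrow> (real \<Rightarrow> complex) \<Rightarrow> bool" where
  "Linf_loc U h \<longleftrightarrow> h \<in> borel_measurable (lebesgue_on U) \<and>
     (\<forall>K. compact K \<and> K \<subseteq> U \<longrightarrow> (\<exists>C. AE x in lebesgue_on K. norm (h x) \<le> C))"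

definition distr_of_fun :: "real set \<Rightarrow> (real \<Rightarrow> complex) \<Rightarrow> distr" where
  "distr_of_fun U h = (\<lambda>\<phi>. integral\<^sup>L (lebesgue_on U) (\<lambda>x. h x * \<phi> x))"

section \<open>Differential operators and order of vanishing\<close>

text \<open>The pair \<open>(m, a)\<close> stands for the operator \<open>D = (\<Sum>i\<le>m. a i * (d/dx)^i)\<close>; on
  distributions it acts through its formal transpose.\<close>

definition diffop_fun :: "nat \<Rightarrow> (nat \<Rightarrow> real \<Rightarrow> complex) \<Rightarrow> (real \<Rightarrow> complex) \<Rightarrow> real \<Rightarrow> complex" where
  "diffop_fun m a f = (\<lambda>x. \<Sum>i\<le>m. a i x * nderiv i f x)"

definition diffop_distr :: "nat \<Rightarrow> (nat \<Rightarrow> real \<Rightarrow> complex) \<Rightarrow> distr \<Rightarrow> distr" where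
  "diffop_distr m a T = (\<lambda>\<phi>. \<Sum>i\<le>m. (- 1) ^ i * T (nderiv i (\<lambda>x. a i x * \<phi> x)))"

definition fun_vanishes :: "(real \<Rightarrow> complex) \<Rightarrow> real \<Rightarrow> nat \<Rightarrow> bool" where
  "fun_vanishes f p k \<longleftrightarrow> (\<forall>i<k. nderiv i f p = 0)"

definition tangential :: "real set \<Rightarrow> real \<Rightarrow> nat \<Rightarrow> (nat \<Rightarrow> real \<Rightarrow> complex) \<Rightarrow> bool" where
  "tangential U p m a \<longleftrightarrow> (\<forall>i\<le>m. smooth_on U (a i)) \<and>
     (\<forall>k f. smooth_on U f \<and> fun_vanishes f p k \<longrightarrow> fun_vanishes (diffop_fun m a f) p k)"

text \<open>The identity \<open>\<sigma> = (\<Sum>j<N. f j * D j (h j))\<close> of distributions on the neighbourhood \<open>U\<close>,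
  with all \<open>f j\<close> vanishing to order \<open>k \<ge> 0\<close> at \<open>p\<close>.\<close>

definition vanishes_nonneg_on :: "real set \<Rightarrow> distr \<Rightarrow> real \<Rightarrow> nat \<Rightarrow> bool" where
  "vanishes_nonneg_on U \<sigma> p k \<longleftrightarrow>
     (\<exists>(N::nat) f m a h.
        (\<forall>j<N. smooth_on U (f j) \<and> fun_vanishes (f j) p k \<and>
               tangential U p (m j) (a j) \<and> Linf_loc U (h j)) \<and>
        (\<forall>\<phi>\<in>test_functions U.
           \<sigma> \<phi> = (\<Sum>j<N. mult_distr (f j) (diffop_distr (m j) (a j) (distr_of_fun U (h j))) \<phi>)))"

definition vanishes_to :: "distr \<Rightarrow> real \<Rightarrow> int \<Rightarrow> bool" where
  "vanishes_to \<sigma> p k \<longleftrightarrow>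
     (if 0 \<le> k then \<exists>U. open U \<and> p \<in> U \<and> vanishes_nonneg_on U \<sigma> p (nat k)
      else \<exists>U z. open U \<and> p \<in> U \<and> smooth_on U z \<and> z p = 0 \<and> nderiv 1 z p \<noteq> 0 \<and>
             vanishes_nonneg_on U (mult_distr (\<lambda>x. z x ^ nat (- k)) \<sigma>) p 0)"

datatype vanishing_order = Finite_Order int | Infinite_Order

primrec order_val :: "vanishing_order \<Rightarrow> ereal" where
  "order_val (Finite_Order k) = ereal (of_int k)"
| "order_val Infinite_Order = \<infinity>"

primrec vanishes :: "distr \<Rightarrow> real \<Rightarrow> vanishing_order \<Rightarrow> bool" where
  "vanishes \<sigma> p (Finite_Order k) = vanishes_to \<sigma> p k"
| "vanishes \<sigma> p Infinite_Order = (\<forall>k. vanishes_to \<sigma> p k)"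

section \<open>Distributions on the projective line\<close>

text \<open>
  A smooth measure on \<open>\<real> \<union> {\<infinity>}\<close> is determined by its density \<open>f\<close> with respect to \<open>dx\<close>; in the
  coordinate \<open>t = 1/x\<close> its density is \<open>f(1/t)/t\<^sup>2\<close>, which has to extend smoothly across \<open>t = 0\<close>.
  The unit intervals in the two coordinates cover the projective line, so the derivatives of both
  densities on them give the topology.
\<close>

definition inv_density :: "(real \<Rightarrow> complex) \<Rightarrow> real \<Rightarrow> complex" where
  "inv_density f = (\<lambda>x. if x = 0 then 0 else f (1 / x) / (of_real x)\<^sup>2)"

definition density_pair :: "(real \<Rightarrow> complex) \<Rightarrow> (real \<Rightarrow> complex) \<Rightarrow> bool" where
  "density_pair f g \<longleftrightarrow> smooth_on UNIV f \<and> smooth_on UNIV g \<and> (\<forall>x. x \<noteq> 0 \<longrightarrow> f x = inv_density g x)"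

definition proj_distribution :: "distr \<Rightarrow> bool" where
  "proj_distribution T \<longleftrightarrow> linear_functional_on {f. \<exists>g. density_pair f g} T \<and>
     (\<exists>C N. \<forall>f g B. density_pair f g \<and>
        (\<forall>n\<le>N. \<forall>x. \<bar>x\<bar> \<le> 1 \<longrightarrow> norm (nderiv n f x) \<le> B \<and> norm (nderiv n g x) \<le> B)
          \<longrightarrow> norm (T f) \<le> C * B)"

text \<open>For \<open>\<sigma>\<close> on the line, \<open>inversion \<sigma>\<close> is the distribution \<open>\<sigma>(1/x)\<close> on \<open>\<real> - {0}\<close>. For \<open>\<tau>\<close> on
  the projective line, \<open>inversion \<tau>\<close> is \<open>\<tau>\<close> in the coordinate \<open>1/x\<close>, a distribution on all of
  \<open>\<real>\<close>, with \<open>\<infinity>\<close> corresponding to the origin.\<close>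

definition inversion :: "distr \<Rightarrow> distr" where
  "inversion T = (\<lambda>\<phi>. T (inv_density \<phi>))"

definition extends_across_infinity :: "distr \<Rightarrow> vanishing_order \<Rightarrow> bool" where
  "extends_across_infinity \<sigma> k \<longleftrightarrow>
     (\<exists>\<tau>. proj_distribution \<tau> \<and> (\<forall>\<phi>\<in>test_functions UNIV. \<tau> \<phi> = \<sigma> \<phi>) \<and> vanishes (inversion \<tau>) 0 k)"

definition extends_canonically_across_infinity :: "distr \<Rightarrow> bool" where
  "extends_canonically_across_infinity \<sigma> \<longleftrightarrow> extends_across_infinity \<sigma> Infinite_Order"

section \<open>Fourier transform\<close>

definition fourier_fun :: "(real \<Rightarrow> complex) \<Rightarrow> real \<Rightarrow> complex" where
  "fourier_fun f y = (LINT x|lborel. f x * exp (2 * of_real pi * \<i> * of_real (- (x * y))))"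

definition fourier :: "distr \<Rightarrow> distr" where
  "fourier \<sigma> = (\<lambda>f. \<sigma> (fourier_fun f))"

section \<open>Signed Mellin transform\<close>

definition signed_power :: "nat \<Rightarrow> complex \<Rightarrow> real \<Rightarrow> complex" where
  "signed_power \<delta> w x = of_real (sgn x) ^ \<delta> * of_real \<bar>x\<bar> powr w"

text \<open>\<open>E s\<close> is the extension across the origin of \<open>(sgn x)^\<delta> |x|^(s-1) \<sigma>(x)\<close>, for \<open>Re s > -k\<close>.\<close>

definition mellin_extension :: "nat \<Rightarrow> vanishing_order \<Rightarrow> distr \<Rightarrow> (complex \<Rightarrow> distr) \<Rightarrow> bool" where
  "mellin_extension \<delta> k \<sigma> E \<longleftrightarrow>
     (\<forall>s. - order_val k < ereal (Re s) \<longrightarrow>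
        distribution_on UNIV (E s) \<and>
        (\<forall>\<phi>\<in>test_functions (- {0}). E s \<phi> = mult_distr (signed_power \<delta> (s - 1)) \<sigma> \<phi>) \<and>
        (\<forall>l::int. 0 \<le> l \<and> ereal (of_int l) \<le> ereal (Re s - 1) + order_val k
                    \<longrightarrow> vanishes_to (E s) 0 l)) \<and>
     (\<forall>\<phi>\<in>test_functions UNIV. (\<lambda>s. E s \<phi>) holomorphic_on {s. - order_val k < ereal (Re s)})"

definition mellin_orders :: "distr \<Rightarrow> vanishing_order \<Rightarrow> vanishing_order \<Rightarrow> bool" where
  "mellin_orders \<sigma> k0 kinf \<longleftrightarrow> tempered \<sigma> \<and> vanishes \<sigma> 0 k0 \<and> extends_across_infinity \<sigma> kinf \<and>
     1 \<le> order_val k0 + order_val kinf"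

definition mellin_domain :: "distr \<Rightarrow> complex set" where
  "mellin_domain \<sigma> = {s. \<exists>k0 kinf. mellin_orders \<sigma> k0 kinf \<and>
                            - order_val k0 < ereal (Re s) \<and> ereal (Re s) < order_val kinf}"

text \<open>
  The condition at infinity on \<open>(sgn x)^\<delta> |x|^(-s-1) \<sigma>(1/x)\<close> is the condition at the origin with
  \<open>\<sigma>(1/x)\<close> in place of \<open>\<sigma>\<close> and \<open>-s\<close> in place of \<open>s\<close>; hence \<open>F (- s)\<close> below. The function
  \<open>(1-\<phi>)(1/x)\<close> equals 1 near \<open>x = 0\<close>, whereas \<open>1 / 0 = 0\<close> in HOL.
\<close>

definition has_mellin :: "nat \<Rightarrow> distr \<Rightarrow> complex \<Rightarrow> complex \<Rightarrow> bool" where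
  "has_mellin \<delta> \<sigma> s v \<longleftrightarrow>
     (\<exists>k0 kinf E F. mellin_orders \<sigma> k0 kinf \<and>
        - order_val k0 < ereal (Re s) \<and> ereal (Re s) < order_val kinf \<and>
        mellin_extension \<delta> k0 \<sigma> E \<and> mellin_extension \<delta> kinf (inversion \<sigma>) F \<and>
        (\<forall>\<phi>\<in>test_functions UNIV. (\<forall>\<^sub>F x in nhds 0. \<phi> x = 1) \<longrightarrow>
           v = E s \<phi> + F (- s) (\<lambda>x. if x = 0 then 1 else 1 - \<phi> (1 / x))))"

definition mellin :: "nat \<Rightarrow> distr \<Rightarrow> complex \<Rightarrow> complex" where
  "mellin \<delta> \<sigma> s = (THE v. has_mellin \<delta> \<sigma> s v)"

section \<open>The factor G\<close>

text \<open>In HOL, \<^const>\<open>Gamma\<close> is 0 at its poles. Some of these poles are cancelled by zeros of the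
  cosine; \<^const>\<open>remove_sings\<close> restores the correct value of the meromorphic function there
  (and yields 0 at the genuine poles).\<close>

definition G_factor :: "nat \<Rightarrow> complex \<Rightarrow> complex" where
  "G_factor \<delta> = remove_sings (\<lambda>s. 2 * \<i> ^ \<delta> * (2 * of_real pi) powr (- s) * Gamma s *
                                    cos (of_real pi * (s - of_nat \<delta>) / 2))"

text \<open>The meromorphic function \<open>G\<^sub>\<delta>(s) M\<^sub>\<delta>\<sigma>(1-s)\<close>, with removable singularities filled in.\<close>

definition G_mellin :: "nat \<Rightarrow> distr \<Rightarrow> complex \<Rightarrow> complex" where
  "G_mellin \<delta> \<sigma> = remove_sings (\<lambda>s. G_factor \<delta> s * mellin \<delta> \<sigma> (1 - s))"

end

theory Submission
  imports Defs "HOL-Probability.Characteristic_Functions"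
begin

text \<open>
 Near a point, vanishing to order \<open>k\<close> means being a finite sum of terms \<open>(x d/dx)\<^sup>i h\<^sub>i\<close> with
 \<open>h\<^sub>i = O(\<bar>x\<bar>\<^sup>k)\<close>, because the operators tangential to \<open>0\<close> are generated by \<open>x d/dx\<close>. The structure theorem
 makes such a representation available globally for a tempered distribution, and against it the
 Mellin transform is an absolutely convergent integral of the \<open>h\<^sub>i\<close> times a polynomial in \<open>s\<close>;
 uniqueness of the extensions identifies it with the abstractly defined one.
 The Fourier transform exchanges \<open>x d/dx\<close> with minus its transpose, and after division by a high
 power of \<open>x\<close> also the orders at \<open>0\<close> and at \<open>\<infinity>\<close>.
 The functional equation comes from pairing with the Gaussians \<open>x\<^sup>d p(t x\<^sup>2) e\<^bsup>-\<pi> t x\<^sup>2\<^esup>\<close>, integrating against a power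
 of \<open>t\<close>, and using Parseval; the polynomial \<open>p\<close> makes the integrals converge in any given half plane.
 In part (b), regularity of the product forces \<open>M \<sigma>\<close> to vanish at the reflected poles of the Gamma factor,
 i.e. all moments of \<open>\<sigma>\<close> vanish; these are the Taylor coefficients of its Fourier transform at \<open>0\<close>.
\<close>

text \<open>The Mellin transform is defined through arbitrary orders and arbitrary extensions. Each
  value of \<open>mellin\<close> therefore needs an extension across infinity that witnesses the
  domain, which is built explicitly, and a proof that every other admissible choice gives the same
  number, which rests on the fact that a distribution supported at 0 and vanishing there to order 0
  is zero. The main obstacle is that the Fourier transform of a distribution flat at 0 may be
  singular at 0: its coefficients grow like a negative power of x, and the integrals converge only
  on Schwartz functions vanishing to some order M at 0. Representations are therefore always
  relative to a space of test functions, and the Gaussians carry a polynomial factor divisible by a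
  high power of t x^2. The Pochhammer symbol that this factor produces on the other side of the
  Fourier transform is exactly the quotient of Gamma values that undoes the shift. Tangentiality
  leads to x d/dx because the coefficient of the i-th derivative must vanish to order i.\<close>

abbreviation "smooth \<equiv> smooth_on UNIV"
abbreviation "TF \<equiv> test_functions"
abbreviation "testR \<equiv> test_functions UNIV"
abbreviation "test0 \<equiv> test_functions (- {0})"
abbreviation "cx \<equiv> complex_of_real"
abbreviation "FT \<equiv> fourier_fun"
abbreviation "sp \<equiv> signed_power"
abbreviation has_vd (infix "has'_vd" 50) where "f has_vd D \<equiv> f has_vector_derivative D"
abbreviation BM :: "(real \<Rightarrow> 'a::topological_space) set" where "BM \<equiv> borel_measurable borel"
abbreviation lb_int :: "(real \<Rightarrow> 'a::{banach, second_countable_topology}) \<Rightarrow> bool" where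
 "lb_int \<equiv> integrable lborel"
abbreviation lb_integral :: "(real \<Rightarrow> 'a::{banach, second_countable_topology}) \<Rightarrow> 'a" (binder "LB " 60) where
 "lb_integral f \<equiv> integral\<^sup>L lborel f"

lemmas norm_nonneg_trans = order_trans[OF norm_ge_zero]
lemmas LB_norm_le = Bochner_Integration.integral_norm_bound_integral
lemmas LB_integral_cong = Bochner_Integration.integral_cong
lemmas LB_integral_diff = Bochner_Integration.integral_diff
lemmas LB_integrable_diff = Bochner_Integration.integrable_diff
lemmas LB_integral_sum = Bochner_Integration.integral_sum
lemmas LB_integrable_bound = Bochner_Integration.integrable_bound
lemmas LB_integrable_sum = Bochner_Integration.integrable_sum
lemmas LB_integrable_add = Bochner_Integration.integrable_add
lemmas LB_integral_add = Bochner_Integration.integral_add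
lemmas hrd_iff_hvd = has_real_derivative_iff_has_vector_derivative

declare One_nat_def [simp del]

section \<open>Calculus of iterated derivatives on open sets\<close>

lemma nderiv_0 [simp]: "nderiv 0 f = f"
 by (simp add: nderiv_def)

lemma nderiv_1: "nderiv 1 f x = vector_derivative f (at x)"
 by (simp add: nderiv_def One_nat_def)

lemma nderiv_Suc: "nderiv (Suc n) f = nderiv n (nderiv 1 f)"
proof -
 have "(D ^^ Suc n) f = (D ^^ n) ((D ^^ 1) f)" for D :: "(real => complex) => _"
  by (simp add: funpow_swap1 One_nat_def)
 thus ?thesis unfolding nderiv_def by blast
qed

lemma nderiv_Suc': "nderiv (Suc n) f x = vector_derivative (nderiv n f) (at x)"
 by (simp add: nderiv_def)

lemma nderiv_nderiv: "nderiv m (nderiv n f) = nderiv (m + n) f"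
 by (simp add: nderiv_def funpow_add)

lemma hvd_cong_open:
 assumes "open U" "x \<in> U" "!!y. y \<in> U ==> f y = g y"
 shows "(f has_vd D) (at x) \<longleftrightarrow> (g has_vd D) (at x)"
 using has_vector_derivative_transform_within_open[OF _ assms(1,2)] assms(3) by metis

lemma nderiv_cong_open:
 assumes "open U" "!!y. y \<in> U ==> f y = g y" "x \<in> U"
 shows "nderiv n f x = nderiv n g x"
 using assms(3)
proof (induction n arbitrary: x)
 case 0
 thus ?case using assms(2) by simp
next
 case (Suc n)
 have "(nderiv n f has_vd D) (at x) \<longleftrightarrow> (nderiv n g has_vd D) (at x)" for D
  by (rule hvd_cong_open[OF assms(1) Suc.prems]) (rule Suc.IH)
 thus ?case
  by (simp add: nderiv_Suc' vector_derivative_def)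
qed

lemma smooth_hvd:
 assumes "smooth_on U f" "x \<in> U"
 shows "(nderiv n f has_vd nderiv (Suc n) f x) (at x)"
 using assms by (auto simp: smooth_on_def nderiv_Suc' vector_derivative_works)

lemma smooth_hvd1:
 assumes "smooth_on U f" "x \<in> U"
 shows "(f has_vd nderiv 1 f x) (at x)"
 using smooth_hvd[OF assms, of 0] by (simp add: One_nat_def)

lemma nderiv_1_eqI:
 assumes "(f has_vd D) (at x)"
 shows "nderiv 1 f x = D"
 using assms by (simp add: nderiv_1 vector_derivative_at)

lemma smooth_nderiv:
 assumes "smooth_on U f" shows "smooth_on U (nderiv n f)"
 using assms by (simp add: smooth_on_def nderiv_nderiv)

lemma smooth_subset: "smooth_on U f ==> V \<subseteq> U ==> smooth_on V f"
 by (auto simp: smooth_on_def)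

lemma smooth_continuous:
 assumes "smooth_on U f" "x \<in> U" shows "isCont (nderiv n f) x"
 using smooth_hvd[OF assms] has_vector_derivative_continuous by blast

lemma smooth_continuous_on:
 assumes "smooth_on U f" shows "continuous_on U (nderiv n f)"
 using smooth_continuous[OF assms] continuous_at_imp_continuous_on by blast

lemma smooth_cong:
 assumes "open U" "smooth_on U f" "!!y. y \<in> U ==> f y = g y"
 shows "smooth_on U g"
 unfolding smooth_on_def
proof (intro allI ballI)
 fix n x assume x: "x \<in> U"
 have "(nderiv n f has_vd nderiv (Suc n) f x) (at x)"
  using assms x by (intro smooth_hvd)
 hence "(nderiv n g has_vd nderiv (Suc n) f x) (at x)"
  using hvd_cong_open[OF assms(1) x, of "nderiv n f" "nderiv n g"]
   nderiv_cong_open[OF assms(1), of f g, OF assms(3)] by metis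
 thus "nderiv n g differentiable at x"
  by (rule differentiableI_vector)
qed

lemma smooth_local:
 assumes "!!x. x \<in> U ==> \<exists>V. open V \<and> x \<in> V \<and> smooth_on V f"
 shows "smooth_on U f"
 using assms unfolding smooth_on_def by blast

text \<open>By induction all iterated derivatives of f agree on \<open>U\<close> with members of the
  class \<open>P\<close>. Smoothness is thus proved by guessing a family closed under
  differentiation, without a formula for the n-th derivative.\<close>

lemma smooth_coinduct:
 assumes "open U" "P f"
  and step: "!!f. P f ==> \<exists>g. P g \<and> (\<forall>x\<in>U. (f has_vd g x) (at x))"
 shows "smooth_on U f"
proof -
 have *: "\<exists>g. P g \<and> (\<forall>x\<in>U. nderiv n f x = g x)" for n
 proof (induction n)
  case 0
  thus ?case using assms(2) by auto
 next
  case (Suc n)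
  then obtain g where g: "P g" "\<forall>x\<in>U. nderiv n f x = g x" by blast
  from step[OF g(1)] obtain h where h: "P h" "\<forall>x\<in>U. (g has_vd h x) (at x)" by blast
  have "nderiv (Suc n) f x = h x" if "x \<in> U" for x
   unfolding nderiv_Suc' using h(2) that g(2)
   by (metis hvd_cong_open[OF assms(1) that] vector_derivative_at)
  thus ?case using h(1) by blast
 qed
 show ?thesis unfolding smooth_on_def
 proof (intro allI ballI)
  fix n x assume x: "x \<in> U"
  obtain g where g: "P g" "\<forall>x\<in>U. nderiv n f x = g x" using * by blast
  from step[OF g(1)] obtain h where h: "\<forall>x\<in>U. (g has_vd h x) (at x)" by blast
  have "(nderiv n f has_vd h x) (at x)"
   using h x g(2) by (metis hvd_cong_open[OF assms(1) x])
  thus "nderiv n f differentiable at x" by (rule differentiableI_vector)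
 qed
qed

lemma smooth_const [intro, simp]: "smooth_on U (\<lambda>x. c)"
proof -
 have "smooth (\<lambda>x. c)"
  by (rule smooth_coinduct[where P="\<lambda>f. \<exists>c. f = (\<lambda>x. c)"]) (auto intro!: derivative_eq_intros)
 thus ?thesis using smooth_subset by blast
qed

lemma smooth_of_real [intro, simp]: "smooth_on U cx"
proof -
 have "smooth cx"
 proof (rule smooth_coinduct[where P="\<lambda>f. f = cx \<or> (\<exists>c. f = (\<lambda>x. c))"])
  fix f :: "real => complex"
  assume "f = cx \<or> (\<exists>c. f = (\<lambda>x. c))"
  thus "\<exists>g. (g = cx \<or> (\<exists>c. g = (\<lambda>x. c))) \<and> (\<forall>x\<in>UNIV. (f has_vd g x) (at x))"
  proof
   assume "f = cx"
   hence "\<forall>x\<in>UNIV. (f has_vd 1) (at x)"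
    by (auto intro!: has_vector_derivative_real_field derivative_eq_intros
      simp: has_vector_derivative_def scaleR_conv_of_real)
   thus ?thesis by (intro exI[of _ "\<lambda>x. 1"]) auto
  next
   assume "\<exists>c. f = (\<lambda>x. c)"
   thus ?thesis by (intro exI[of _ "\<lambda>x. 0"]) (auto intro!: derivative_eq_intros)
  qed
 qed auto
 thus ?thesis using smooth_subset by blast
qed

lemma nderiv_add:
 assumes "open U" "smooth_on U f" "smooth_on U g" "x \<in> U"
 shows "nderiv n (\<lambda>x. f x + g x) x = nderiv n f x + nderiv n g x"
 using assms(4)
proof (induction n arbitrary: x)
 case (Suc n)
 have "((\<lambda>x. nderiv n f x + nderiv n g x) has_vd nderiv (Suc n) f x + nderiv (Suc n) g x) (at x)"
  using assms Suc.prems by (intro has_vector_derivative_add smooth_hvd)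
 hence "(nderiv n (\<lambda>x. f x + g x) has_vd nderiv (Suc n) f x + nderiv (Suc n) g x) (at x)"
  using hvd_cong_open[OF assms(1) Suc.prems] Suc.IH by (metis (no_types, lifting))
 thus ?case by (simp add: nderiv_Suc' vector_derivative_at)
qed auto

lemma smooth_add:
 assumes "open U" "smooth_on U f" "smooth_on U g"
 shows "smooth_on U (\<lambda>x. f x + g x)"
proof (rule smooth_coinduct[where P="\<lambda>h. \<exists>f g. smooth_on U f \<and> smooth_on U g \<and> h = (\<lambda>x. f x + g x)"])
 fix h assume "\<exists>f g. smooth_on U f \<and> smooth_on U g \<and> h = (\<lambda>x. f x + g x)"
 then obtain f g where "smooth_on U f" "smooth_on U g" "h = (\<lambda>x. f x + g x)" by blast
 thus "\<exists>k. (\<exists>f g. smooth_on U f \<and> smooth_on U g \<and> k = (\<lambda>x. f x + g x)) \<and>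
       (\<forall>x\<in>U. (h has_vd k x) (at x))"
  by (intro exI[of _ "\<lambda>x. nderiv 1 f x + nderiv 1 g x"])
    (auto intro!: has_vector_derivative_add smooth_hvd1 smooth_nderiv)
qed (use assms in auto)

lemma nderiv_mult:
 assumes "open U" "smooth_on U f" "smooth_on U g" "x \<in> U"
 shows "nderiv n (\<lambda>x. f x * g x) x = (\<Sum>k\<le>n. of_nat (n choose k) * nderiv k f x * nderiv (n - k) g x)"
  and "nderiv n (\<lambda>x. f x * g x) differentiable (at x)"
proof -
 define L where "L n x = (\<Sum>k\<le>n. of_nat (n choose k) * nderiv k f x * nderiv (n - k) g x)" for n x
 \<comment> \<open>Pascal's rule, once both sums run over the same index.\<close>
 have D: "(L n has_vd L (Suc n) x) (at x)" if "x \<in> U" for n x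
 proof -
  define F where "F k = nderiv k f x" for k
  define G where "G k = nderiv k g x" for k
  have "(L n has_vd (\<Sum>k\<le>n. of_nat (n choose k) * (F k * G (Suc (n - k)) + F (Suc k) * G (n - k)))) (at x)"
   unfolding L_def mult.assoc F_def G_def
   by (intro has_vector_derivative_sum has_vector_derivative_mult has_vector_derivative_mult_right
     smooth_hvd[OF assms(2) that] smooth_hvd[OF assms(3) that])
  also have "(\<Sum>k\<le>n. of_nat (n choose k) * (F k * G (Suc (n - k)) + F (Suc k) * G (n - k)))
    = (\<Sum>k\<le>n. of_nat (n choose k) * F k * G (Suc n - k)) + (\<Sum>k\<le>n. of_nat (n choose k) * F (Suc k) * G (n - k))"
   by (simp add: sum.distrib algebra_simps Suc_diff_le)
  also have "(\<Sum>k\<le>n. of_nat (n choose k) * F k * G (Suc n - k)) = (\<Sum>k\<le>Suc n. of_nat (n choose k) * F k * G (Suc n - k))"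
   by simp
  also have "... = F 0 * G (Suc n) + (\<Sum>k\<le>n. of_nat (n choose Suc k) * F (Suc k) * G (n - k))"
   by (subst sum.atMost_Suc_shift) simp
  also have "... + (\<Sum>k\<le>n. of_nat (n choose k) * F (Suc k) * G (n - k))
    = F 0 * G (Suc n) + (\<Sum>k\<le>n. of_nat (Suc n choose Suc k) * F (Suc k) * G (n - k))"
   by (simp add: sum.distrib[symmetric] algebra_simps)
  also have "... = (\<Sum>k\<le>Suc n. of_nat (Suc n choose k) * F k * G (Suc n - k))"
   by (subst sum.atMost_Suc_shift) simp
  also have "... = L (Suc n) x" by (simp add: L_def F_def G_def)
  finally show ?thesis .
 qed
 have eq: "nderiv n (\<lambda>x. f x * g x) x = L n x" if "x \<in> U" for n x
  using that
 proof (induction n arbitrary: x)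
  case (Suc n)
  have "(nderiv n (\<lambda>x. f x * g x) has_vd L (Suc n) x) (at x)"
   using hvd_cong_open[OF assms(1) Suc.prems] Suc.IH D[OF Suc.prems] by (metis (no_types, lifting))
  thus ?case by (simp add: nderiv_Suc' vector_derivative_at)
 qed (simp add: L_def)
 show "nderiv n (\<lambda>x. f x * g x) x = (\<Sum>k\<le>n. of_nat (n choose k) * nderiv k f x * nderiv (n - k) g x)"
  using eq[OF assms(4)] by (simp add: L_def)
 have "(nderiv n (\<lambda>x. f x * g x) has_vd L (Suc n) x) (at x)"
  using hvd_cong_open[OF assms(1,4)] eq D[OF assms(4)] by (metis (no_types, lifting))
 thus "nderiv n (\<lambda>x. f x * g x) differentiable (at x)" by (rule differentiableI_vector)
qed

lemma smooth_mult:
 assumes "open U" "smooth_on U f" "smooth_on U g"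
 shows "smooth_on U (\<lambda>x. f x * g x)"
 using nderiv_mult(2)[OF assms] by (simp add: smooth_on_def)

lemma smooth_cmult: "open U ==> smooth_on U f ==> smooth_on U (\<lambda>x. c * f x)"
 by (intro smooth_mult) auto

lemma smooth_uminus: "open U ==> smooth_on U f ==> smooth_on U (\<lambda>x. - f x)"
 using smooth_cmult[of U f "-1"] by simp

lemma smooth_diff: "open U ==> smooth_on U f ==> smooth_on U g ==> smooth_on U (\<lambda>x. f x - g x)"
 using smooth_add[of U f "\<lambda>x. - g x"] smooth_uminus by simp

lemma smooth_sum:
 assumes "open U" "!!i. i \<in> A ==> smooth_on U (f i)"
 shows "smooth_on U (\<lambda>x. \<Sum>i\<in>A. f i x)"
 using assms(2) by (induction A rule: infinite_finite_induct) (auto intro!: smooth_add assms(1))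

lemma smooth_power: "open U ==> smooth_on U f ==> smooth_on U (\<lambda>x. f x ^ n)"
 by (induction n) (auto intro!: smooth_mult)

lemma nderiv_const [simp]: "nderiv n (\<lambda>x. c) x = (if n = 0 then c else 0)"
proof (induction n arbitrary: c)
 case (Suc n)
 have "nderiv 1 (\<lambda>x. c) = (\<lambda>x. 0)" by (auto simp: nderiv_1)
 thus ?case using Suc[of 0] by (simp only: nderiv_Suc) auto
qed simp

lemma nderiv_1_of_real: "nderiv 1 cx = (\<lambda>x. 1)"
 by (rule ext, rule nderiv_1_eqI) 
   (auto intro!: derivative_eq_intros simp: has_vector_derivative_def scaleR_conv_of_real)

lemma nderiv_cmult:
 assumes "open U" "smooth_on U f" "x \<in> U"
 shows "nderiv n (\<lambda>x. c * f x) x = c * nderiv n f x"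
 by (subst nderiv_mult(1)[OF assms(1) _ assms(2,3)]) (auto simp: if_distrib if_distribR sum.delta cong: if_cong)

lemma nderiv_sum:
 assumes "open U" "!!i. i \<in> A ==> smooth_on U (f i)" "x \<in> U"
 shows "nderiv n (\<lambda>x. \<Sum>i\<in>A. f i x) x = (\<Sum>i\<in>A. nderiv n (f i) x)"
 using assms(2)
proof (induction A rule: infinite_finite_induct)
 case (insert a A)
 thus ?case
  by (simp add: nderiv_add[OF assms(1) _ _ assms(3)] smooth_sum assms(1))
qed auto

lemma nderiv_of_real_mult:
 assumes "open U" "smooth_on U f" "x \<in> U"
 shows "nderiv (Suc n) (\<lambda>x. cx x * f x) x = cx x * nderiv (Suc n) f x + of_nat (Suc n) * nderiv n f x"
proof -
 have "nderiv 1 (\<lambda>x. cx x * f x) y = f y + cx y * nderiv 1 f y" if "y \<in> U" for y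
  by (rule nderiv_1_eqI) (use has_vector_derivative_mult[OF smooth_hvd1[OF smooth_of_real that]
    smooth_hvd1[OF assms(2) that]] in \<open>simp add: nderiv_1_of_real add.commute\<close>)
 note 1 = this
 show ?thesis using assms(3)
 proof (induction n arbitrary: x)
  case 0
  thus ?case using 1 by (simp add: algebra_simps One_nat_def)
 next
  case (Suc n)
  have "(nderiv (Suc n) (\<lambda>x. cx x * f x) has_vd
    (cx x * nderiv (Suc (Suc n)) f x + nderiv (Suc n) f x) + of_nat (Suc n) * nderiv (Suc n) f x) (at x)"
   apply (subst hvd_cong_open[OF assms(1) Suc.prems Suc.IH], assumption)
   apply (intro has_vector_derivative_add has_vector_derivative_mult_right smooth_hvd[OF assms(2) Suc.prems])
   apply (rule has_vector_derivative_eq_rhs, rule has_vector_derivative_mult)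
    apply (rule smooth_hvd1[OF smooth_of_real Suc.prems])
    apply (rule smooth_hvd[OF assms(2) Suc.prems])
   apply (simp add: nderiv_1_of_real)
   done
  thus ?case by (simp add: nderiv_Suc'[of "Suc n"] vector_derivative_at algebra_simps)
 qed
qed

text \<open>The functions g / f^k with g smooth form a family closed under differentiation.\<close>

lemma smooth_inverse:
 assumes "open U" "smooth_on U f" "!!x. x \<in> U ==> f x ~= 0"
 shows "smooth_on U (\<lambda>x. inverse (f x))"
proof (rule smooth_coinduct[where P="\<lambda>h. \<exists>g k. smooth_on U g \<and> h = (\<lambda>x. g x * inverse (f x) ^ k)"])
 show "\<exists>g k. smooth_on U g \<and> (\<lambda>x. inverse (f x)) = (\<lambda>x. g x * inverse (f x) ^ k)"
  by (rule exI[of _ "\<lambda>x. 1"], rule exI[of _ 1]) auto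
next
 fix h assume "\<exists>g k. smooth_on U g \<and> h = (\<lambda>x. g x * inverse (f x) ^ k)"
 then obtain g k where g: "smooth_on U g" "h = (\<lambda>x. g x * inverse (f x) ^ k)" by blast
 define G where "G = (\<lambda>x. nderiv 1 g x * f x - of_nat k * g x * nderiv 1 f x)"
 have G: "smooth_on U G" unfolding G_def
  by (intro smooth_diff smooth_mult smooth_nderiv assms g) auto
 have "(h has_vd G x * inverse (f x) ^ Suc k) (at x)" if x: "x \<in> U" for x
 proof -
  have a: "(f has_vd nderiv 1 f x) (at x)" by (rule smooth_hvd1[OF assms(2) x])
  have "((\<lambda>z. inverse z ^ k) has_field_derivative (- of_nat k * inverse (f x) ^ Suc k)) (at (f x))"
   using assms(3)[OF x]
   by (auto intro!: derivative_eq_intros simp: field_simps power_Suc[symmetric] simp del: power_Suc)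
    (cases k; simp add: field_simps)
  from field_vector_diff_chain_at[OF a this]
  have b: "((\<lambda>x. inverse (f x) ^ k) has_vd nderiv 1 f x * (- of_nat k * inverse (f x) ^ Suc k)) (at x)"
   by (simp add: o_def)
  have "(h has_vd g x * (nderiv 1 f x * (- of_nat k * inverse (f x) ^ Suc k)) + nderiv 1 g x * inverse (f x) ^ k) (at x)"
   unfolding g(2) by (intro has_vector_derivative_mult b smooth_hvd1[OF g(1) x])
  moreover have "g x * (nderiv 1 f x * (- of_nat k * inverse (f x) ^ Suc k)) + nderiv 1 g x * inverse (f x) ^ k
    = G x * inverse (f x) ^ Suc k"
   using assms(3)[OF x] by (simp add: G_def field_simps)
  ultimately show ?thesis by simp
 qed
 thus "\<exists>ga. (\<exists>g k. smooth_on U g \<and> ga = (\<lambda>x. g x * inverse (f x) ^ k)) \<and> (\<forall>x\<in>U. (h has_vd ga x) (at x))"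
  using G by (intro exI[of _ "\<lambda>x. G x * inverse (f x) ^ Suc k"]) blast
qed (rule assms)

lemma smooth_reciprocal:
 assumes "smooth_on (- {0}) f"
 shows "smooth_on (- {0}) (\<lambda>x. f (1 / x))"
proof (rule smooth_coinduct[where P="\<lambda>h. \<exists>g. smooth_on (- {0}) g \<and> h = (\<lambda>x. g (1 / x))"])
 fix h assume "\<exists>g. smooth_on (- {0}) g \<and> h = (\<lambda>x. g (1 / x))"
 then obtain g where g: "smooth_on (- {0}) g" "h = (\<lambda>x. g (1 / x))" by blast
 define G where "G = (\<lambda>t. - (cx t ^ 2 * nderiv 1 g t))"
 have G: "smooth_on (- {0}) G" unfolding G_def
  by (intro smooth_uminus smooth_mult smooth_nderiv smooth_power g) auto
 have "(h has_vd G (1 / x)) (at x)" if "x ~= 0" for x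
 proof -
  have "((\<lambda>x. 1 / x) has_vd - (1 / x^2)) (at x)"
   using that unfolding hrd_iff_hvd[symmetric]
   by (auto intro!: derivative_eq_intros simp: power2_eq_square)
  moreover have "(g has_vd nderiv 1 g (1 / x)) (at (1 / x))"
   using that by (intro smooth_hvd1[OF g(1)]) auto
  ultimately have "(g \<circ> (\<lambda>x. 1 / x) has_vd - (1 / x^2) *\<^sub>R nderiv 1 g (1 / x)) (at x)"
   by (rule vector_diff_chain_at)
  thus ?thesis by (simp add: g(2) o_def G_def scaleR_conv_of_real power_one_over)
 qed
 thus "\<exists>ga. (\<exists>g. smooth_on (- {0}) g \<and> ga = (\<lambda>x. g (1 / x))) \<and> (\<forall>x\<in>- {0}. (h has_vd ga x) (at x))"
  using G by (intro exI[of _ "\<lambda>x. G (1 / x)"]) blast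
qed (use assms in auto)

lemma smooth_affine:
 assumes "smooth f"
 shows "smooth (\<lambda>x. f (c * x + d))" and "nderiv n (\<lambda>x. f (c * x + d)) x = cx c ^ n * nderiv n f (c * x + d)"
proof -
 have D: "((\<lambda>x. g (c * x + d)) has_vd cx c * nderiv 1 g (c * x + d)) (at x)"
  if g: "smooth g" for g x
 proof -
  have "((\<lambda>x. c * x + d) has_vd c) (at x)"
   unfolding hrd_iff_hvd[symmetric]
   by (auto intro!: derivative_eq_intros)
  moreover have "(g has_vd nderiv 1 g (c * x + d)) (at (c * x + d))"
   by (intro smooth_hvd1[OF g]) auto
  ultimately have "(g \<circ> (\<lambda>x. c * x + d) has_vd c *\<^sub>R nderiv 1 g (c * x + d)) (at x)"
   by (rule vector_diff_chain_at)
  thus ?thesis by (simp add: o_def scaleR_conv_of_real)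
 qed
 show "smooth (\<lambda>x. f (c * x + d))"
 proof (rule smooth_coinduct[where P="\<lambda>h. \<exists>g. smooth g \<and> h = (\<lambda>x. g (c * x + d))"])
  fix h assume "\<exists>g. smooth g \<and> h = (\<lambda>x. g (c * x + d))"
  then obtain g where g: "smooth g" "h = (\<lambda>x. g (c * x + d))" by blast
  have "smooth (\<lambda>x. cx c * nderiv 1 g x)"
   by (intro smooth_cmult smooth_nderiv g) auto
  thus "\<exists>ga. (\<exists>g. smooth g \<and> ga = (\<lambda>x. g (c * x + d))) \<and> (\<forall>x\<in>UNIV. (h has_vd ga x) (at x))"
   using D[OF g(1)] unfolding g(2) 
   by (intro exI[of _ "\<lambda>x. cx c * nderiv 1 g (c * x + d)"]) blast
 qed (use assms in auto)
 show "nderiv n (\<lambda>x. f (c * x + d)) x = cx c ^ n * nderiv n f (c * x + d)"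
 proof (induction n arbitrary: x)
  case (Suc n)
  hence "nderiv n (\<lambda>x. f (c * x + d)) = (\<lambda>x. cx c ^ n * nderiv n f (c * x + d))" by blast
  hence "(nderiv n (\<lambda>x. f (c * x + d)) has_vd cx c ^ n * (cx c * nderiv 1 (nderiv n f) (c * x + d))) (at x)"
   using has_vector_derivative_mult_right[OF D[OF smooth_nderiv[OF assms]]] by metis
  thus ?case by (simp add: nderiv_Suc' vector_derivative_at nderiv_1)
 qed auto
qed

section \<open>Cutoff functions\<close>

definition flat :: "real => real" where
 "flat x = (if x > 0 then exp (- (1 / x)) else 0)"

lemma tendsto_poly_flat: "((\<lambda>x. norm (poly p (cx (1 / x)) :: complex) * exp (- (1 / x))) \<longlongrightarrow> 0) (at_right 0)"
proof -
 have "((\<lambda>u. norm (poly p (cx u) :: complex) * exp (- u)) \<longlongrightarrow> 0) at_top"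
 proof (rule Lim_null_comparison)
  show "\<forall>\<^sub>F u in at_top. norm (norm (poly p (cx u) :: complex) * exp (- u))
    <= (\<Sum>i\<le>degree p. norm (coeff p i) * (u ^ i / exp u))"
   using eventually_ge_at_top[of 0]
  proof eventually_elim
   case (elim u)
   have "norm (poly p (cx u) :: complex) <= (\<Sum>i\<le>degree p. norm (coeff p i) * u ^ i)"
    unfolding poly_altdef using elim
    by (intro order_trans[OF norm_sum] sum_mono) (simp add: norm_mult norm_power)
   hence "norm (poly p (cx u) :: complex) * exp (-u) <= (\<Sum>i\<le>degree p. norm (coeff p i) * u ^ i) * exp (-u)"
    by (rule mult_right_mono) simp
   thus ?case by (simp add: sum_distrib_right exp_minus divide_inverse mult.assoc)
  qed
  have "((\<lambda>u. \<Sum>i\<le>degree p. norm (coeff p i) * (u ^ i / exp u)) \<longlongrightarrow> (\<Sum>i\<le>degree p. norm (coeff p i) * 0)) at_top"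
   by (intro tendsto_sum tendsto_mult tendsto_const tendsto_power_div_exp_0)
  thus "((\<lambda>u. \<Sum>i\<le>degree p. norm (coeff p i) * (u ^ i / exp u)) \<longlongrightarrow> 0) at_top" by simp
 qed
 from filterlim_compose[OF this filterlim_inverse_at_top_right] show ?thesis
  by (simp add: inverse_eq_divide)
qed

lemma smooth_flat: "smooth (\<lambda>x. cx (flat x))"
proof -
 define F :: "complex poly => real => complex" where "F p x = poly p (cx (1 / x)) * cx (flat x)" for p x
 have "smooth (F 1)"
 proof (rule smooth_coinduct[where P="\<lambda>h. \<exists>p. h = F p"])
  fix f assume "\<exists>p. f = F p"
  then obtain p where f: "f = F p" by blast
  \<comment> \<open>With u = 1/x, the x-derivative of p(u) e^(-u) is u^2 (p(u) - p'(u))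
    e^(-u).\<close>
  define q where "q = [:0, 0, 1:] * (p - pderiv p)"
  have "(F p has_vd F q x) (at x)" for x
  proof -
   consider "x > 0" | "x < 0" | "x = 0" by linarith
   thus ?thesis
   proof cases
    case 1
    have "((\<lambda>z. poly p (1 / z) * exp (- (1 / z))) has_field_derivative
      (poly q (1 / cx x) * exp (- (1 / cx x)))) (at (cx x))"
     using 1
     by (auto intro!: derivative_eq_intros DERIV_chain2[OF poly_DERIV] simp: q_def field_simps power2_eq_square)
    from has_vector_derivative_real_field[OF this]
    have "((\<lambda>x. poly p (1 / cx x) * exp (- (1 / cx x))) has_vd
      (poly q (1 / cx x) * exp (- (1 / cx x)))) (at x)"
     by simp
    hence "(F p has_vd (poly q (1 / cx x) * exp (- (1 / cx x)))) (at x)"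
     using 1 by (subst hvd_cong_open[of "{0<..}"])
      (auto simp: F_def flat_def exp_of_real[symmetric])
    thus ?thesis using 1 by (simp add: F_def flat_def exp_of_real[symmetric])
   next
    case 2
    hence "(F p has_vd 0) (at x)"
     by (subst hvd_cong_open[of "{..<0}" _ _ "\<lambda>x. 0"]) (auto simp: F_def flat_def)
    thus ?thesis using 2 by (simp add: F_def flat_def)
   next
    case 3
    \<comment> \<open>The difference quotient at 0 is again a polynomial in 1/h times e^(-1/h), with
      the polynomial multiplied by its variable.\<close>
    have "((\<lambda>h. norm (F p h) / norm h) \<longlongrightarrow> 0) (at 0)"
    proof (rule filterlim_split_at)
     show "((\<lambda>h. norm (F p h) / norm h) \<longlongrightarrow> 0) (at_left 0)"
      by (rule tendsto_eventually) (auto simp: eventually_at_filter F_def flat_def)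
     have "((\<lambda>h. norm (poly ([:0, 1:] * p) (cx (1 / h)) :: complex) * exp (- (1 / h))) \<longlongrightarrow> 0) (at_right 0)"
      by (rule tendsto_poly_flat)
     thus "((\<lambda>h. norm (F p h) / norm h) \<longlongrightarrow> 0) (at_right 0)"
      by (rule Lim_transform_eventually)
       (auto simp: eventually_at_filter F_def flat_def norm_mult norm_divide)
    qed
    hence "(F p has_vd 0) (at 0)"
     by (simp add: has_vector_derivative_def has_derivative_at F_def flat_def)
    thus ?thesis using 3 by (simp add: F_def flat_def)
   qed
  qed
  thus "\<exists>g. (\<exists>p. g = F p) \<and> (\<forall>x\<in>UNIV. (f has_vd g x) (at x))"
   using f by blast
 qed auto
 moreover have "F 1 = (\<lambda>x. cx (flat x))" by (auto simp: F_def)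
 ultimately show ?thesis by simp
qed

definition step :: "real => real" where
 "step x = flat x / (flat x + flat (1 - x))"

lemma flat_nonneg: "flat x >= 0" and flat_pos: "x > 0 ==> flat x > 0" and flat_0: "x <= 0 ==> flat x = 0"
 by (auto simp: flat_def)

lemma flat_sum_pos: "flat x + flat (1 - x) > 0"
 using flat_pos[of x] flat_pos[of "1 - x"] flat_nonneg[of x] flat_nonneg[of "1-x"] 
 by (cases "x > 0") auto

lemma step_0: "x <= 0 ==> step x = 0" and step_1: "x >= 1 ==> step x = 1"
 and step_nonneg: "step x >= 0"
 using flat_sum_pos[of x] flat_nonneg[of x] by (auto simp: step_def flat_0)

lemma smooth_step: "smooth (\<lambda>x. cx (step x))"
proof -
 have "smooth (\<lambda>x. cx (flat x) * inverse (cx (flat x) + cx (flat ((-1) * x + 1))))"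
  by (intro smooth_mult smooth_inverse smooth_add smooth_flat smooth_affine(1)[OF smooth_flat])
    (use flat_sum_pos in \<open>auto simp: of_real_add[symmetric] simp del: of_real_add\<close>, smt (verit) flat_sum_pos)
 thus ?thesis by (simp add: step_def field_simps)
qed

definition cutoff :: "real => complex" where
 "cutoff x = cx (step (2 - x) * step (2 + x))"

lemma smooth_cutoff: "smooth cutoff"
proof -
 have "smooth (\<lambda>x. cx (step ((-1) * x + 2)) * cx (step (1 * x + 2)))"
  by (intro smooth_mult smooth_affine(1)[OF smooth_step]) auto
 thus ?thesis by (simp add: cutoff_def[abs_def] add.commute)
qed

lemma cutoff_1: "abs x <= 1 ==> cutoff x = 1" and cutoff_0: "abs x >= 2 ==> cutoff x = 0"
 by (auto simp: cutoff_def step_1 step_0 abs_if split: if_splits)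

section \<open>Test functions and their supports\<close>

lemma test_iff:
 "f \<in> TF U \<longleftrightarrow> smooth f \<and> (\<exists>K. compact K \<and> K \<subseteq> U \<and> (\<forall>x. x \<notin> K --> f x = 0))"
proof
 assume "f \<in> TF U"
 thus "smooth f \<and> (\<exists>K. compact K \<and> K \<subseteq> U \<and> (\<forall>x. x \<notin> K --> f x = 0))"
  using closure_subset[of "{x. f x ~= 0}"] by (auto simp: test_functions_def intro!: exI[of _ "closure {x. f x ~= 0}"])
next
 assume A: "smooth f \<and> (\<exists>K. compact K \<and> K \<subseteq> U \<and> (\<forall>x. x \<notin> K --> f x = 0))"
 then obtain K where K: "compact K" "K \<subseteq> U" "!!x. x \<notin> K ==> f x = 0" by blast
 have "closure {x. f x ~= 0} \<subseteq> K"
  using K by (intro closure_minimal) (auto simp: compact_imp_closed)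
 thus "f \<in> TF U"
  using A K compact_Int_closed[OF K(1), of "closure {x. f x ~= 0}"]
  by (auto simp: test_functions_def Int_absorb1)
qed

lemma test_functionsI:
 assumes "smooth f" "compact K" "K \<subseteq> U" "!!x. x \<notin> K ==> f x = 0"
 shows "f \<in> TF U"
 using assms test_iff by blast

lemma test_functionsE:
 assumes "f \<in> TF U"
 obtains K where "smooth f" "compact K" "K \<subseteq> U" "!!x. x \<notin> K ==> f x = 0"
 using assms test_iff by metis

lemma test_smooth: "f \<in> TF U ==> smooth f"
 by (simp add: test_iff)

lemma test_mono: "f \<in> TF U ==> U \<subseteq> V ==> f \<in> TF V"
 by (meson order_trans test_iff)

lemma nderiv_zero_outside:
 assumes "closed K" "!!x. x \<notin> K ==> f x = 0" "x \<notin> K"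
 shows "nderiv n f x = 0"
 using nderiv_cong_open[of "- K" f "\<lambda>x. 0" x n] assms by (auto split: if_splits)

lemma test_nderiv: "f \<in> TF U ==> nderiv n f \<in> TF U"
 by (elim test_functionsE, rule test_functionsI)
   (auto intro: smooth_nderiv nderiv_zero_outside compact_imp_closed)

lemma test_add:
 assumes "f \<in> TF U" "g \<in> TF U" shows "(\<lambda>x. f x + g x) \<in> TF U"
proof -
 obtain K where "compact K" "K \<subseteq> U" "!!x. x \<notin> K ==> f x = 0"
  using assms(1) by (rule test_functionsE) blast
 moreover obtain L where "compact L" "L \<subseteq> U" "!!x. x \<notin> L ==> g x = 0"
  using assms(2) by (rule test_functionsE) blast
 ultimately show ?thesis
  using assms by (intro test_functionsI[of _ "K \<union> L"] smooth_add) (auto simp: test_smooth)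
qed

lemma test_mult:
 assumes f: "f \<in> TF U" and g: "smooth_on V g" and "open V" "U \<subseteq> V"
 shows "(\<lambda>x. g x * f x) \<in> TF U"
proof -
 obtain K where K: "smooth f" "compact K" "K \<subseteq> U" "!!x. x \<notin> K ==> f x = 0"
  using f by (rule test_functionsE) blast
 show ?thesis
 proof (rule test_functionsI[OF _ K(2,3)])
  show "smooth (\<lambda>x. g x * f x)"
  proof (rule smooth_local)
   fix x
   show "\<exists>W. open W \<and> x \<in> W \<and> smooth_on W (\<lambda>x. g x * f x)"
   proof (cases "x \<in> K")
    case True
    thus ?thesis using assms K smooth_subset[OF K(1)]
     by (intro exI[of _ V]) (auto intro!: smooth_mult)
   next
    case False
    have "open (- K)" using K(2) by (simp add: compact_imp_closed open_Compl)
    with False show ?thesis using K(4)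
     by (intro exI[of _ "- K"]) (auto intro!: smooth_cong[OF _ smooth_const[of _ 0]])
   qed
  qed
 qed (use K in auto)
qed

lemma test_cmult: "f \<in> TF U ==> (\<lambda>x. c * f x) \<in> TF U"
 using test_mult[of f U UNIV "\<lambda>x. c"] by simp

lemma test_diff: "f \<in> TF U ==> g \<in> TF U ==> (\<lambda>x. f x - g x) \<in> TF U"
 using test_add[OF _ test_cmult[of g U "-1"]] by simp

lemma test_bounded:
 assumes "f \<in> TF U" shows "\<exists>B. \<forall>x. norm (nderiv n f x) <= B"
proof -
 obtain K where K: "smooth f" "compact K" "K \<subseteq> U" "!!x. x \<notin> K ==> f x = 0"
  using assms by (rule test_functionsE) blast
 have "continuous_on K (nderiv n f)"
  using smooth_continuous_on[OF K(1)] continuous_on_subset by blast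
 hence "bounded (nderiv n f ` K)" using K(2) by (intro compact_imp_bounded compact_continuous_image)
 then obtain B where B: "!!x. x \<in> K ==> norm (nderiv n f x) <= B" by (auto simp: bounded_iff)
 have "norm (nderiv n f x) <= abs B" for x
  using B[of x] nderiv_zero_outside[OF compact_imp_closed[OF K(2)] K(4), where x=x and n=n] by (cases "x \<in> K") auto
 thus ?thesis by blast
qed

lemma cutoff_test: "cutoff \<in> testR"
 by (rule test_functionsI[OF smooth_cutoff, of "{-2..2}"]) (auto intro!: cutoff_0)

lemma test_bounded_subset:
 assumes "f \<in> TF U" shows "\<exists>R>0. \<forall>x. abs x >= R --> f x = 0"
proof -
 obtain K where K: "compact K" "!!x. x \<notin> K ==> f x = 0" using assms by (rule test_functionsE) blast
 obtain B where B: "!!x. x \<in> K ==> abs x <= B" using compact_imp_bounded[OF K(1)] by (auto simp: bounded_iff)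
 have "f x = 0" if "abs x >= abs B + 1" for x
  using K(2)[of x] B[of x] that by (cases "x \<in> K") auto
 thus ?thesis by (intro exI[of _ "abs B + 1"]) auto
qed

lemma test_away_0:
 assumes "f \<in> test0" shows "\<exists>r>0. \<forall>x. abs x < r --> f x = 0"
proof -
 obtain K where K: "compact K" "K \<subseteq> - {0}" "!!x. x \<notin> K ==> f x = 0" using assms by (rule test_functionsE) blast
 have "open (- K)" "0 \<in> - K" using K by (auto simp: compact_imp_closed open_Compl)
 then obtain r where "r > 0" "ball 0 r \<subseteq> - K" by (meson openE)
 hence "r > 0 \<and> (\<forall>x. abs x < r --> f x = 0)" using K(3) by auto
 thus ?thesis by blast
qed

lemma test_away_0I:
 assumes "smooth f" "r > 0" "!!x. abs x < r ==> f x = 0" "!!x. abs x > R ==> f x = 0"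
 shows "f \<in> test0"
proof (rule test_functionsI[OF assms(1), of "{-R..-r} \<union> {r..R}"])
 fix x assume "x \<notin> {-R..-r} \<union> {r..R}"
 thus "f x = 0" using assms(3,4)[of x] by (auto simp: abs_if split: if_splits)
qed (use assms(2) in auto)

section \<open>The Euler operator and the Schwartz space\<close>

definition Sz :: "nat => (real => complex) set" where
 "Sz n = {f \<in> schwartz. fun_vanishes f 0 n}"

definition Eop :: "(real => complex) => real => complex" where
 "Eop f = (\<lambda>x. f x + cx x * nderiv 1 f x)"

definition th :: "(real => complex) => real => complex" where
 "th f = (\<lambda>x. cx x * nderiv 1 f x)"

lemma Eop_th: "Eop f = (\<lambda>x. f x + th f x)"
 by (simp add: Eop_def th_def)

lemma smooth_th: "open U ==> smooth_on U f ==> smooth_on U (th f)"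
 unfolding th_def by (intro smooth_mult smooth_nderiv) auto

lemma smooth_Eop: "open U ==> smooth_on U f ==> smooth_on U (Eop f)"
 unfolding Eop_th by (intro smooth_add smooth_th) auto

lemma smooth_Eop_funpow: "open U ==> smooth_on U f ==> smooth_on U ((Eop ^^ j) f)"
 by (induction j) (auto intro: smooth_Eop)

lemma nderiv_th:
 assumes "open U" "smooth_on U f" "x \<in> U"
 shows "nderiv n (th f) x = cx x * nderiv (Suc n) f x + of_nat n * nderiv n f x"
proof (cases n)
 case (Suc m)
 have "nderiv (Suc m) (th f) x = cx x * nderiv (Suc m) (nderiv 1 f) x + of_nat (Suc m) * nderiv m (nderiv 1 f) x"
  unfolding th_def using assms by (intro nderiv_of_real_mult smooth_nderiv)
 thus ?thesis by (simp add: nderiv_nderiv Suc One_nat_def)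
qed (simp add: th_def nderiv_Suc)

lemma nderiv_Eop:
 assumes "open U" "smooth_on U f" "x \<in> U"
 shows "nderiv n (Eop f) x = cx x * nderiv (Suc n) f x + of_nat (Suc n) * nderiv n f x"
 unfolding Eop_th 
 by (subst nderiv_add[OF assms(1,2) smooth_th[OF assms(1,2)] assms(3)])
   (simp add: nderiv_th[OF assms] algebra_simps)

lemma fun_vanishes_Eop:
 assumes "open U" "smooth_on U f" "0 \<in> U" "fun_vanishes f 0 n"
 shows "fun_vanishes (Eop f) 0 n"
 using assms by (auto simp: fun_vanishes_def nderiv_Eop)

lemma test_functions_Eop: "f \<in> TF U ==> Eop f \<in> TF U"
 unfolding Eop_def 
 by (intro test_add test_mult[where V=UNIV] test_nderiv) auto

lemma test_functions_Eop_funpow: "f \<in> TF U ==> (Eop ^^ j) f \<in> TF U"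
 by (induction j) (auto intro: test_functions_Eop)

lemma schwartz_iff: "f \<in> schwartz \<longleftrightarrow> smooth f \<and> (\<forall>m n. \<exists>B. \<forall>x. norm (cx x ^ m * nderiv n f x) <= B)"
 by (auto simp: schwartz_def bounded_iff)

lemma schwartz_smooth: "f \<in> schwartz ==> smooth f"
 by (simp add: schwartz_iff)

lemma schwartz_bound: "f \<in> schwartz ==> \<exists>B. \<forall>x. norm (cx x ^ m * nderiv n f x) <= B"
 by (simp add: schwartz_iff)

lemma test_schwartz: "f \<in> TF U ==> f \<in> schwartz"
proof -
 assume f: "f \<in> TF U"
 have "\<exists>B. \<forall>x. norm (cx x ^ m * nderiv n f x) <= B" for m n
 proof -
  have "(\<lambda>x. cx x ^ m * nderiv n f x) \<in> TF U"
   using f by (intro test_mult[where V=UNIV] test_nderiv smooth_power) auto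
  from test_bounded[OF this, of 0] show ?thesis by simp
 qed
 thus ?thesis using f by (simp add: schwartz_iff test_smooth)
qed

section \<open>Seminorm estimates and continuous operators on the Schwartz space\<close>

definition sbd :: "nat => (real => complex) => real => bool" where
 "sbd N f B \<longleftrightarrow> (\<forall>m\<le>N. \<forall>n\<le>N. \<forall>x. norm (cx x ^ m * nderiv n f x) <= B)"

text \<open>Continuity on the Schwartz space, stated through seminorm estimates; the constant is
  kept nonnegative so that estimates can be composed and added.\<close>

definition tame :: "((real => complex) => real => complex) => bool" where
 "tame L \<longleftrightarrow> (\<forall>f\<in>schwartz. L f \<in> schwartz) \<and>
   (\<forall>N. \<exists>C N'. C >= 0 \<and> (\<forall>f\<in>schwartz. \<forall>B. sbd N' f B --> sbd N (L f) (C * B)))"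

lemma sbd_nonneg: "sbd N f B ==> B >= 0"
 unfolding sbd_def using norm_ge_zero order_trans by blast

lemma sbd_mono: "sbd N f B ==> N' <= N ==> B <= B' ==> sbd N' f B'"
 unfolding sbd_def by (meson order_trans)

lemma sbdD: "sbd N f B ==> m <= N ==> n <= N ==> norm (cx x ^ m * nderiv n f x) <= B"
 unfolding sbd_def by blast

lemma sbd_exists:
 assumes "f \<in> schwartz" shows "\<exists>B. sbd N f B"
proof -
 obtain b where b: "!!m n x. norm (cx x ^ m * nderiv n f x) <= b m n"
  using schwartz_bound[OF assms] by metis
 have "sbd N f (Max ((\<lambda>(m, n). b m n) ` ({..N} \<times> {..N})))"
  unfolding sbd_def
 proof (intro allI impI)
  fix m n x assume "m <= N" "n <= N"
  hence "b m n <= Max ((\<lambda>(m, n). b m n) ` ({..N} \<times> {..N}))"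
   by (intro Max_ge) auto
  thus "norm (cx x ^ m * nderiv n f x) <= Max ((\<lambda>(m, n). b m n) ` ({..N} \<times> {..N}))"
   using b order_trans by blast
 qed
 thus ?thesis by blast
qed

lemma schwartzI_sbd: "smooth f ==> (!!N. \<exists>B. sbd N f B) ==> f \<in> schwartz"
 unfolding schwartz_iff sbd_def by (meson le_cases)

lemma tame_schwartz: "tame L ==> f \<in> schwartz ==> L f \<in> schwartz"
 by (simp add: tame_def)

lemma tameD: "tame L ==> \<exists>C N'. C >= 0 \<and> (\<forall>f\<in>schwartz. \<forall>B. sbd N' f B --> sbd N (L f) (C * B))"
 by (simp add: tame_def)

lemma tameI:
 assumes "!!f. f \<in> schwartz ==> smooth (L f)"
  and "!!N. \<exists>C N'. C >= 0 \<and> (\<forall>f\<in>schwartz. \<forall>B. sbd N' f B --> sbd N (L f) (C * B))"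
 shows "tame L"
proof -
 have "L f \<in> schwartz" if "f \<in> schwartz" for f
  using assms that sbd_exists[OF that] by (intro schwartzI_sbd) meson+
 thus ?thesis using assms by (auto simp: tame_def)
qed

lemma tame_comp:
 assumes "tame L" "tame M" shows "tame (\<lambda>f. L (M f))"
 unfolding tame_def
proof (intro conjI ballI allI)
 fix N
 obtain C N' where C: "C >= 0" "!!f B. f \<in> schwartz ==> sbd N' f B ==> sbd N (L f) (C * B)"
  using tameD[OF assms(1)] by metis
 obtain D N'' where D: "D >= 0" "!!f B. f \<in> schwartz ==> sbd N'' f B ==> sbd N' (M f) (D * B)"
  using tameD[OF assms(2)] by metis
 show "\<exists>C N'. C >= 0 \<and> (\<forall>f\<in>schwartz. \<forall>B. sbd N' f B --> sbd N (L (M f)) (C * B))"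
  using C D tame_schwartz[OF assms(2)]
  by (intro exI[of _ "C * D"] exI[of _ N'']) (auto simp: mult.assoc)
qed (use assms in \<open>auto simp: tame_schwartz\<close>)

lemma tame_id: "tame (\<lambda>f. f)"
proof (rule tameI)
 show "\<exists>C N'. C >= 0 \<and> (\<forall>f\<in>schwartz. \<forall>B. sbd N' f B --> sbd N f (C * B))" for N
  by (intro exI[of _ 1] exI[of _ N]) auto
qed (rule schwartz_smooth)

lemma tame_funpow: "tame L ==> tame (L ^^ n)"
proof (induction n)
 case (Suc n)
 thus ?case using tame_comp[of L "L ^^ n"] by (simp add: o_def)
qed (simp add: tame_id id_def)

lemma tame_nderiv_1: "tame (nderiv 1)"
proof (rule tameI)
 fix N
 have "sbd N (nderiv 1 f) (1 * B)" if "sbd (Suc N) f B" for f B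
  using that unfolding sbd_def by (auto simp: nderiv_nderiv)
 thus "\<exists>C N'. C >= 0 \<and> (\<forall>f\<in>schwartz. \<forall>B. sbd N' f B --> sbd N (nderiv 1 f) (C * B))"
  by (intro exI[of _ 1] exI[of _ "Suc N"]) auto
qed (auto intro: smooth_nderiv simp: schwartz_smooth)

lemma tame_nderiv: "tame (nderiv n)"
proof (induction n)
 case (Suc n)
 have "nderiv (Suc n) = (\<lambda>f. nderiv n (nderiv 1 f))" by (auto simp: nderiv_Suc)
 thus ?case using tame_comp[OF Suc tame_nderiv_1] by simp
next
 case 0
 thus ?case using tame_id by (simp add: nderiv_def id_def)
qed

lemma sbd_add:
 assumes "sbd N f A" "sbd N g B" "smooth f" "smooth g"
 shows "sbd N (\<lambda>x. f x + g x) (A + B)"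
 unfolding sbd_def
proof (intro allI impI)
 fix m n x assume "m <= N" "n <= N"
 hence "norm (cx x ^ m * nderiv n f x) <= A" "norm (cx x ^ m * nderiv n g x) <= B"
  using assms by (auto simp: sbd_def)
 thus "norm (cx x ^ m * nderiv n (\<lambda>x. f x + g x) x) <= A + B"
  by (subst nderiv_add[of UNIV]) (use assms in \<open>auto simp: ring_distribs intro: norm_triangle_mono\<close>)
qed

lemma tame_add:
 assumes "tame L" "tame M" shows "tame (\<lambda>f x. L f x + M f x)"
proof (rule tameI)
 fix N
 obtain C N' where C: "C >= 0" "!!f B. f \<in> schwartz ==> sbd N' f B ==> sbd N (L f) (C * B)"
  using tameD[OF assms(1)] by metis
 obtain D N'' where D: "D >= 0" "!!f B. f \<in> schwartz ==> sbd N'' f B ==> sbd N (M f) (D * B)"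
  using tameD[OF assms(2)] by metis
 have "sbd N (\<lambda>x. L f x + M f x) ((C + D) * B)" if "f \<in> schwartz" "sbd (max N' N'') f B" for f B
  unfolding ring_distribs
  using that schwartz_smooth[OF tame_schwartz[OF assms(1)]] schwartz_smooth[OF tame_schwartz[OF assms(2)]]
  by (intro sbd_add C D) (auto elim: sbd_mono)
 thus "\<exists>C N'. C >= 0 \<and> (\<forall>f\<in>schwartz. \<forall>B. sbd N' f B --> sbd N (\<lambda>x. L f x + M f x) (C * B))"
  using add_nonneg_nonneg[OF C(1) D(1)] by blast
next
 fix f assume "f \<in> schwartz"
 thus "smooth (\<lambda>x. L f x + M f x)"
  using assms by (auto intro!: smooth_add[OF open_UNIV] simp: schwartz_smooth tame_schwartz)
qed

lemma sbd_mult: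
 assumes "sbd N f B" "!!k x. k <= N ==> norm (nderiv k g x) <= G" "smooth f" "smooth g"
 shows "sbd N (\<lambda>x. g x * f x) (2 ^ N * G * B)"
 unfolding sbd_def
proof (intro allI impI)
 fix m n x assume mn: "m <= N" "n <= N"
 have G: "G >= 0" using assms(2)[of 0 0] norm_ge_zero order_trans by blast
 have "norm (cx x ^ m * nderiv n (\<lambda>x. g x * f x) x)
   = norm (\<Sum>k\<le>n. of_nat (n choose k) * nderiv k g x * (cx x ^ m * nderiv (n - k) f x))"
  by (subst nderiv_mult(1)[of UNIV]) (use assms in \<open>auto simp: sum_distrib_left mult_ac\<close>)
 also have "... <= (\<Sum>k\<le>n. of_nat (n choose k) * G * B)"
  using mn assms G by (intro order_trans[OF norm_sum] sum_mono) 
   (auto simp: norm_mult intro!: mult_mono sbdD[OF assms(1), simplified norm_mult])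
 also have "... = 2 ^ n * G * B"
  by (simp add: sum_distrib_right[symmetric] of_nat_sum[symmetric] choose_row_sum del: of_nat_sum)
 also have "... <= 2 ^ N * G * B"
  using mn G sbd_nonneg[OF assms(1)] by (intro mult_right_mono) auto
 finally show "norm (cx x ^ m * nderiv n (\<lambda>x. g x * f x) x) <= 2 ^ N * G * B" .
qed

definition bdd_smooth :: "(real => complex) => bool" where
 "bdd_smooth g \<longleftrightarrow> smooth g \<and> (\<forall>n. \<exists>B. \<forall>x. norm (nderiv n g x) <= B)"

lemma tame_mult:
 assumes "bdd_smooth g" shows "tame (\<lambda>f x. g x * f x)"
proof (rule tameI)
 fix N
 obtain b where b: "!!n x. norm (nderiv n g x) <= b n"
  using assms unfolding bdd_smooth_def by metis
 have G: "norm (nderiv k g x) <= Max (b ` {..N})" if "k <= N" for k x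
  using order_trans[OF b[of k x] Max_ge[of "b ` {..N}" "b k"]] that by auto
 hence "Max (b ` {..N}) >= 0" by (meson norm_ge_zero order_trans le0)
 thus "\<exists>C N'. C >= 0 \<and> (\<forall>f\<in>schwartz. \<forall>B. sbd N' f B --> sbd N (\<lambda>x. g x * f x) (C * B))"
  using G assms by (intro exI[of _ "2 ^ N * Max (b ` {..N})"] exI[of _ N]) 
   (auto intro!: sbd_mult simp: bdd_smooth_def schwartz_smooth)
qed (use assms in \<open>auto intro!: smooth_mult simp: bdd_smooth_def schwartz_smooth\<close>)

lemma bdd_smooth_const: "bdd_smooth (\<lambda>x. c)"
 by (auto simp: bdd_smooth_def)

lemma bdd_smooth_test: "f \<in> TF U ==> bdd_smooth f"
 using test_bounded by (auto simp: bdd_smooth_def test_smooth)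

lemma bdd_smooth_add: 
 assumes "bdd_smooth f" "bdd_smooth g" shows "bdd_smooth (\<lambda>x. f x + g x)"
proof -
 have "\<exists>B. \<forall>x. norm (nderiv n (\<lambda>x. f x + g x) x) <= B" for n
 proof -
  obtain A B where "!!x. norm (nderiv n f x) <= A" "!!x. norm (nderiv n g x) <= B"
   using assms by (meson bdd_smooth_def)
  hence "norm (nderiv n (\<lambda>x. f x + g x) x) <= A + B" for x
   by (subst nderiv_add[of UNIV]) (use assms in \<open>auto simp: bdd_smooth_def intro: norm_triangle_mono\<close>)
  thus ?thesis by blast
 qed
 thus ?thesis using assms smooth_add[OF open_UNIV, of f g] by (auto simp: bdd_smooth_def)
qed

lemma tame_cmult: "tame (\<lambda>f x. c * f x)"
 by (rule tame_mult[OF bdd_smooth_const])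

lemma tame_x: "tame (\<lambda>f x. cx x * f x)"
proof (rule tameI)
 fix N
 have "sbd N (\<lambda>x. cx x * f x) (real (Suc N) * B)" if f: "f \<in> schwartz" and b: "sbd (Suc N) f B" for f B
  unfolding sbd_def
 proof (intro allI impI)
  fix m n x assume mn: "m <= N" "n <= N"
  have B: "B >= 0" using b sbd_nonneg by blast
  show "norm (cx x ^ m * nderiv n (\<lambda>x. cx x * f x) x) <= real (Suc N) * B"
  proof (cases n)
   case 0
   have "norm (cx x ^ Suc m * nderiv 0 f x) <= B" using b mn by (intro sbdD) auto
   also have "B <= real (Suc N) * B" using B by (simp add: field_simps)
   finally show ?thesis using 0 by (simp add: mult_ac)
  next
   case (Suc k)
   have 1: "norm (cx x ^ Suc m * nderiv n f x) <= B" 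
    and 2: "norm (cx x ^ m * nderiv k f x) <= B" 
    using sbdD[OF b, of "Suc m" n x] sbdD[OF b, of m k x] mn Suc by auto
   have "cx x ^ m * nderiv n (\<lambda>x. cx x * f x) x = 
     cx x ^ Suc m * nderiv n f x + of_nat n * (cx x ^ m * nderiv k f x)"
    unfolding Suc by (subst nderiv_of_real_mult[of UNIV]) (use f in \<open>auto simp: schwartz_smooth algebra_simps\<close>)
   also have "norm ... <= B + real n * B"
    using 1 2 by (intro norm_triangle_mono) (auto simp: norm_mult intro!: mult_left_mono)
   also have "... <= real (Suc N) * B" using mn B mult_left_mono[of "real n" "real N" B] by (simp add: algebra_simps)
   finally show ?thesis .
  qed
 qed
 thus "\<exists>C N'. C >= 0 \<and> (\<forall>f\<in>schwartz. \<forall>B. sbd N' f B --> sbd N (\<lambda>x. cx x * f x) (C * B))"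
  by (intro exI[of _ "real (Suc N)"] exI[of _ "Suc N"]) auto
qed (auto intro!: smooth_mult simp: schwartz_smooth)

lemma tame_th: "tame th"
 unfolding th_def by (rule tame_comp[OF tame_x tame_nderiv_1])

lemma tame_Eop: "tame Eop"
 unfolding Eop_th by (rule tame_add[OF tame_id tame_th])

lemma tame_xpow: "tame (\<lambda>f x. cx x ^ n * f x)"
proof (induction n)
 case (Suc n)
 thus ?case using tame_comp[OF tame_x Suc] by (simp add: mult.assoc)
qed (simp add: tame_id)

lemma Sz_Eop: "f \<in> Sz n ==> Eop f \<in> Sz n"
 unfolding Sz_def using fun_vanishes_Eop[of UNIV f n] tame_schwartz[OF tame_Eop]
 by (auto simp: schwartz_smooth)

lemma Sz_schwartz: "f \<in> Sz n ==> f \<in> schwartz" by (simp add: Sz_def)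

lemma Sz_0: "Sz 0 = schwartz" by (auto simp: Sz_def fun_vanishes_def)

lemma fun_vanishes_0I: "r > 0 ==> (!!x. abs x < r ==> f x = 0) ==> fun_vanishes f 0 n"
 unfolding fun_vanishes_def
proof (intro allI impI)
 fix i assume "r > 0" "!!x. abs x < r ==> f x = 0"
 thus "nderiv i f 0 = 0"
  using nderiv_cong_open[of "ball 0 r" f "\<lambda>x. 0" 0 i] by (auto split: if_splits)
qed

lemma test_away_Sz: "f \<in> test0 ==> f \<in> Sz n"
 unfolding Sz_def using test_away_0[of f] fun_vanishes_0I test_schwartz by blast

lemma fun_vanishes_mult:
 assumes "open U" "0 \<in> U" "smooth_on U f" "smooth_on U g" "fun_vanishes f 0 m" "fun_vanishes g 0 n"
 shows "fun_vanishes (\<lambda>x. f x * g x) 0 (m + n)"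
 unfolding fun_vanishes_def
proof (intro allI impI)
 fix i assume i: "i < m + n"
 have "nderiv i (\<lambda>x. f x * g x) 0 = (\<Sum>k\<le>i. of_nat (i choose k) * nderiv k f 0 * nderiv (i - k) g 0)"
  using assms by (intro nderiv_mult(1)) auto
 also have "... = 0"
 proof (rule sum.neutral, rule ballI)
  fix k assume "k \<in> {..i}"
  hence "k < m \<or> i - k < n" using i by auto
  thus "of_nat (i choose k) * nderiv k f 0 * nderiv (i - k) g 0 = 0"
   using assms(5,6) by (auto simp: fun_vanishes_def)
 qed
 finally show "nderiv i (\<lambda>x. f x * g x) 0 = 0" .
qed

lemma fun_vanishes_mult_right:
 assumes "open U" "0 \<in> U" "smooth_on U f" "smooth_on U g" "fun_vanishes g 0 n"
 shows "fun_vanishes (\<lambda>x. f x * g x) 0 n"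
 using fun_vanishes_mult[OF assms(1-4) _ assms(5), of 0] by (simp add: fun_vanishes_def)

lemma fun_vanishes_xpow: "fun_vanishes (\<lambda>x. cx x ^ n) 0 n"
proof (induction n)
 case (Suc n)
 have "fun_vanishes (\<lambda>x. cx x) 0 1" by (auto simp: fun_vanishes_def)
 from fun_vanishes_mult[OF _ _ _ _ this Suc, of UNIV] show ?case by (simp add: smooth_power del: One_nat_def) (simp add: One_nat_def)
qed (simp add: fun_vanishes_def)

lemma Sz_mult: "f \<in> Sz n ==> bdd_smooth g ==> (\<lambda>x. g x * f x) \<in> Sz n"
 using tame_schwartz[OF tame_mult, of g f] fun_vanishes_mult_right[of UNIV g f n]
 by (auto simp: Sz_def bdd_smooth_def schwartz_smooth)

lemma Sz_xpow: "f \<in> schwartz ==> (\<lambda>x. cx x ^ n * f x) \<in> Sz n"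
 using tame_schwartz[OF tame_xpow, of f] fun_vanishes_mult[OF _ _ _ _ fun_vanishes_xpow, where U=UNIV and g=f and n=0]
 by (auto simp: Sz_def schwartz_smooth smooth_power fun_vanishes_def)

lemma Sz_mono: "f \<in> Sz n ==> m <= n ==> f \<in> Sz m"
 by (auto simp: Sz_def fun_vanishes_def)

text \<open>One mean value estimate per order, applied to the derivative, which vanishes to one
  order less. The factor 1/k! of Taylor's formula is given up.\<close>

lemma vanishing_bound:
 assumes "smooth_on U f" "{-r..r} \<subseteq> U" "fun_vanishes f 0 k"
  and "!!x. abs x <= r ==> norm (nderiv k f x) <= B" and "abs x <= r"
 shows "norm (f x) <= B * abs x ^ k"
 using assms
proof (induction k arbitrary: f x)
 case 0
 thus ?case by simp
next
 case (Suc k)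
 have IH: "norm (nderiv 1 f y) <= B * abs y ^ k" if "abs y <= r" for y
 proof (rule Suc.IH)
  show "fun_vanishes (nderiv 1 f) 0 k"
   using Suc.prems(3) by (auto simp: fun_vanishes_def nderiv_nderiv)
 qed (use Suc.prems that in \<open>auto simp: smooth_nderiv nderiv_nderiv One_nat_def\<close>)
 have B: "B >= 0" using Suc.prems(4)[OF Suc.prems(5)] norm_ge_zero order_trans by blast
 have "norm (f x - f 0) <= (B * abs x ^ k) * norm (x - 0)"
 proof (rule differentiable_bound[where f'="\<lambda>y h. h *\<^sub>R nderiv 1 f y" and S="{-abs x..abs x}"])
  fix y assume y: "y \<in> {-abs x..abs x}"
  hence yr: "abs y <= r" using Suc.prems(5) by auto
  hence "y \<in> U" using Suc.prems(2) by (auto simp: subset_iff abs_le_iff)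
  from smooth_hvd1[OF Suc.prems(1) this]
  show "(f has_derivative (\<lambda>h. h *\<^sub>R nderiv 1 f y)) (at y within {-abs x..abs x})"
   by (simp add: has_vector_derivative_def has_derivative_at_withinI)
  have "onorm (\<lambda>h. h *\<^sub>R nderiv 1 f y) <= norm (nderiv 1 f y)"
   by (rule onorm_bound) (auto simp: mult.commute)
  also have "... <= B * abs y ^ k" by (rule IH[OF yr])
  also have "... <= B * abs x ^ k" using y B by (intro mult_left_mono power_mono) auto
  finally show "onorm (\<lambda>h. h *\<^sub>R nderiv 1 f y) <= B * abs x ^ k" .
 qed auto
 moreover have "f 0 = 0" using Suc.prems(3) by (auto simp: fun_vanishes_def)
 ultimately show ?case by (simp add: mult_ac)
qed

lemma Sz_bound_near:
 assumes "f \<in> Sz n" shows "\<exists>C. \<forall>x. abs x <= 1 --> norm (f x) <= C * abs x ^ n"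
proof -
 obtain B where "!!x. norm (cx x ^ 0 * nderiv n f x) <= B"
  using schwartz_bound[of f 0 n] assms by (auto simp: Sz_def)
 thus ?thesis using assms vanishing_bound[of UNIV f 1 n B]
  by (auto simp: Sz_def schwartz_smooth)
qed

lemma schwartz_bound_far:
 assumes "f \<in> schwartz" shows "\<exists>C. \<forall>x. abs x >= 1 --> norm (f x) <= C * abs x powr (- K)"
proof -
 define k where "k = nat \<lceil>K\<rceil>"
 obtain B where B: "!!x. norm (cx x ^ k * nderiv 0 f x) <= B"
  using schwartz_bound[of f k 0] assms by auto
 have "norm (f x) <= B * abs x powr (- K)" if "abs x >= 1" for x
 proof -
  have "norm (f x) * abs x powr K <= norm (f x) * abs x powr (real k)"
   using that unfolding k_def by (intro mult_left_mono powr_mono) (linarith | simp)+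
  also have "... = norm (cx x ^ k * nderiv 0 f x)"
   using that by (simp add: powr_realpow norm_mult norm_power)
  also have "... <= B" by (rule B)
  finally show ?thesis using that by (simp add: powr_minus field_simps)
 qed
 thus ?thesis by blast
qed

section \<open>Weighted forms in the Euler operator\<close>

text \<open>The exponents at 0 and at infinity are kept separate because cutoffs, inversion and the
  Fourier transform treat the two ends differently. Since \<open>0 powr a = 0\<close>, the value at
  the origin is meaningless, hence the proviso \<open>x ~= 0\<close> in all bounds by
  \<open>wt\<close>.\<close>

definition wt :: "real => real => real => real" where
 "wt a b x = (if abs x <= 1 then abs x powr a else abs x powr b)"

lemma wt_nonneg [simp]: "wt a b x >= 0"
 by (simp add: wt_def)

lemma wt_1 [simp]: "wt a b 1 = 1"
 by (simp add: wt_def)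

lemma wt_mult: "wt a b x * wt c d x = wt (a + c) (b + d) x"
 by (simp add: wt_def powr_add)

lemma wt_measurable [measurable]: "wt a b \<in> BM"
 unfolding wt_def[abs_def] by measurable

lemma wt_mono:
 assumes "a' <= a" "b <= b'" "x ~= 0" shows "wt a b x <= wt a' b' x"
 using assms by (auto simp: wt_def intro: powr_mono powr_mono')

lemma integrable_wt:
 assumes "a > -1" "b < -1" shows "lb_int (wt a b)"
proof -
 have fin: "(\<integral>\<^sup>+x. ennreal (wt a b x) * indicator {0..} x \<partial>lborel) < \<infinity>"
 proof -
  have "((\<lambda>x. x powr a) has_integral (1 powr (a+1) / (a+1))) {0..1}"
   using has_integral_powr_from_0[of a 1] assms by simp
  from nn_integral_has_integral_lebesgue'[OF _ this]
  have 1: "(\<integral>\<^sup>+x. ennreal (x powr a) * indicator {0..1} x \<partial>lborel) < \<infinity>" by simp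
  have "((\<lambda>x. x powr b) has_integral (-(1 powr (b+1)) / (b+1))) {1..}"
   using has_integral_powr_to_inf[of b 1] assms by simp
  from nn_integral_has_integral_lebesgue'[OF _ this]
  have 2: "(\<integral>\<^sup>+x. ennreal (x powr b) * indicator {1..} x \<partial>lborel) < \<infinity>" by simp
  have "(\<integral>\<^sup>+x. ennreal (wt a b x) * indicator {0..} x \<partial>lborel) <=
    (\<integral>\<^sup>+x. ennreal (x powr a) * indicator {0..1} x + ennreal (x powr b) * indicator {1..} x \<partial>lborel)"
   by (intro nn_integral_mono) (auto simp: wt_def indicator_def)
  also have "... = (\<integral>\<^sup>+x. ennreal (x powr a) * indicator {0..1} x \<partial>lborel) + (\<integral>\<^sup>+x. ennreal (x powr b) * indicator {1..} x \<partial>lborel)"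
   by (intro nn_integral_add) auto
  also have "... < \<infinity>" using 1 2 by simp
  finally show ?thesis .
 qed
 have "(\<integral>\<^sup>+x. ennreal (wt a b x) \<partial>lborel) <= (\<integral>\<^sup>+x. ennreal (wt a b x) * indicator {0..} x + ennreal (wt a b x) * indicator {..0} x \<partial>lborel)"
  by (intro nn_integral_mono) (auto simp: indicator_def)
 also have "... = (\<integral>\<^sup>+x. ennreal (wt a b x) * indicator {0..} x \<partial>lborel) + (\<integral>\<^sup>+x. ennreal (wt a b x) * indicator {..0} x \<partial>lborel)"
  by (intro nn_integral_add) auto
 also have "(\<integral>\<^sup>+x. ennreal (wt a b x) * indicator {..0} x \<partial>lborel) = (\<integral>\<^sup>+x. ennreal (wt a b x) * indicator {0..} x \<partial>lborel)"
  by (subst nn_integral_real_affine[where c="-1" and t=0])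
    (auto intro!: nn_integral_cong simp: wt_def indicator_def)
 also have "... + ... < \<infinity>" using fin by simp
 finally have "(\<integral>\<^sup>+x. ennreal (wt a b x) \<partial>lborel) < \<infinity>" by simp
 thus ?thesis by (intro integrableI_nonneg) auto
qed

definition wbd :: "real => real => (real => complex) => bool" where
 "wbd a b h \<longleftrightarrow> h \<in> BM \<and> (\<exists>C. \<forall>x. x ~= 0 --> norm (h x) <= C * wt a b x)"

lemma wbdI: "h \<in> BM ==> (!!x. x ~= 0 ==> norm (h x) <= C * wt a b x) ==> wbd a b h"
 by (auto simp: wbd_def)

lemma wbd_measurable: "wbd a b h ==> h \<in> BM"
 by (simp add: wbd_def)

lemma wbdE:
 assumes "wbd a b h" obtains C where "C >= 0" "!!x. x ~= 0 ==> norm (h x) <= C * wt a b x"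
proof -
 obtain C where C: "!!x. x ~= 0 ==> norm (h x) <= C * wt a b x" using assms by (auto simp: wbd_def)
 have "C >= 0" using norm_nonneg_trans[OF C[of 1]] by simp
 with C that show ?thesis by blast
qed

lemma wbd_zero [simp]: "wbd a b (\<lambda>x. 0)"
 by (rule wbdI[of _ 0]) auto

lemma wbd_add:
 assumes "wbd a b f" "wbd a b g" shows "wbd a b (\<lambda>x. f x + g x)"
proof -
 obtain C D where C: "!!x. x ~= 0 ==> norm (f x) <= C * wt a b x" and D: "!!x. x ~= 0 ==> norm (g x) <= D * wt a b x"
  using assms by (auto simp: wbd_def)
 show ?thesis
  by (rule wbdI[of _ "C + D"]) 
   (use assms in \<open>auto simp: wbd_measurable ring_distribs intro!: norm_triangle_mono C D borel_measurable_add\<close>)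
qed

lemma wbd_mult:
 assumes "wbd a b f" "wbd c d g" shows "wbd (a + c) (b + d) (\<lambda>x. f x * g x)"
proof -
 obtain C where C: "C >= 0" "!!x. x ~= 0 ==> norm (f x) <= C * wt a b x" using assms(1) by (rule wbdE) blast
 obtain D where D: "D >= 0" "!!x. x ~= 0 ==> norm (g x) <= D * wt c d x" using assms(2) by (rule wbdE) blast
 show ?thesis
 proof (rule wbdI[of _ "C * D"])
  fix x :: real assume "x ~= 0"
  hence "norm (f x * g x) <= (C * wt a b x) * (D * wt c d x)"
   unfolding norm_mult using C D by (intro mult_mono) auto
  thus "norm (f x * g x) <= C * D * wt (a + c) (b + d) x" by (simp add: wt_mult[symmetric] mult_ac)
 qed (use assms in \<open>auto simp: wbd_measurable intro!: borel_measurable_times\<close>)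
qed

lemma wbd_bounded: "h \<in> BM ==> (!!x. norm (h x) <= C) ==> wbd 0 0 h"
 by (rule wbdI[of _ C]) (auto simp: wt_def)

lemma wbd_cmult: "wbd a b f ==> wbd a b (\<lambda>x. c * f x)"
 using wbd_mult[OF wbd_bounded[of "\<lambda>x. c" "norm c"], of a b f] by simp

lemma wbd_mono:
 assumes "wbd a b h" "a' <= a" "b <= b'" shows "wbd a' b' h"
proof -
 obtain C where C: "C >= 0" "!!x. x ~= 0 ==> norm (h x) <= C * wt a b x" using assms(1) by (rule wbdE) blast
 show ?thesis using assms C
  by (intro wbdI[of _ C]) (auto simp: wbd_measurable intro: order_trans[OF C(2)] mult_left_mono wt_mono)
qed

lemma wbd_far:
 assumes "wbd a b h" "!!x. abs x > R ==> h x = 0" shows "wbd a b' h"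
proof -
 obtain C where C: "C >= 0" "!!x. x ~= 0 ==> norm (h x) <= C * wt a b x" using assms(1) by (rule wbdE) blast
 define R' where "R' = max R 1"
 \<comment> \<open>\<open>K\<close> bounds |x|^(b - b') on 1 < |x| <= R', the only range where the
   two weights differ and h may be nonzero.\<close>
 define K where "K = R' powr (abs (b - b'))"
 have K: "K >= 1" unfolding K_def R'_def by (auto simp: ge_one_powr_ge_zero)
 show ?thesis
 proof (rule wbdI[of _ "C * K"])
  fix x :: real assume x: "x ~= 0"
  consider "abs x <= 1" | "abs x > R'" | "abs x > 1" "abs x <= R'" by linarith
  thus "norm (h x) <= C * K * wt a b' x"
  proof cases
   case 1
   hence "norm (h x) <= C * wt a b' x" using C(2)[OF x] by (simp add: wt_def)
   also have "... <= C * wt a b' x * K"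
    using C(1) K by (intro mult_left_mono[of 1 K "C * wt a b' x", simplified]) auto
   finally show ?thesis by (simp add: mult_ac)
  next
   case 2
   thus ?thesis using assms(2)[of x] C K by (simp add: R'_def)
  next
   case 3
   have "abs x powr b = abs x powr (b - b') * abs x powr b'" by (simp add: powr_add[symmetric])
   also have "abs x powr (b - b') <= abs x powr (abs (b - b'))" using 3 by (intro powr_mono) auto
   also have "... <= K" unfolding K_def using 3 by (intro powr_mono2) auto
   finally have "abs x powr b <= K * abs x powr b'" by (simp add: mult_right_mono)
   thus ?thesis using C(2)[OF x] 3 C(1) 
    by (simp add: wt_def mult.assoc) (meson mult_left_mono order_trans)
  qed
 qed (use assms in \<open>auto simp: wbd_measurable\<close>)
qed

lemma wbd_recip:
 assumes "wbd a b h" shows "wbd (-b) (-a) (\<lambda>x. h (1 / x))"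
proof -
 obtain C where C: "C >= 0" "!!x. x ~= 0 ==> norm (h x) <= C * wt a b x" using assms(1) by (rule wbdE) blast
 have [measurable]: "h \<in> BM" using assms by (rule wbd_measurable)
 show ?thesis
 proof (rule wbdI[of _ C])
  show "(\<lambda>x. h (1 / x)) \<in> BM" by measurable
  fix x :: real assume x: "x ~= 0"
  have "wt a b (1 / x) = wt (-b) (-a) x"
  proof -
   have "abs (1 / x) powr c = abs x powr (-c)" for c
    by (simp add: abs_divide powr_divide powr_minus_divide)
   moreover have "abs (1 / x) <= 1 \<longleftrightarrow> abs x >= 1" using x by (simp add: abs_divide field_simps)
   ultimately show ?thesis by (cases "abs x = 1") (auto simp: wt_def)
  qed
  thus "norm (h (1 / x)) <= C * wt (-b) (-a) x" using C(2)[of "1 / x"] x by simp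
 qed
qed

text \<open>The substitution x -> 1/x exchanges the two ends and reduces this to
  \<open>wbd_far\<close>.\<close>

lemma wbd_near:
 assumes "wbd a b h" "r > 0" "!!x. abs x < r ==> h x = 0" shows "wbd a' b h"
proof -
 define g where "g = (\<lambda>x. if x = 0 then 0 else h (1 / x))"
 have [measurable]: "h \<in> BM" using assms by (auto simp: wbd_measurable)
 have "wbd (-b) (-a) (\<lambda>x. h (1 / x))" by (rule wbd_recip[OF assms(1)])
 hence "wbd (-b) (-a) g" unfolding wbd_def g_def by auto
 moreover have "g x = 0" if "abs x > 1 / r" for x
  using assms(3)[of "1 / x"] that assms(2) by (auto simp: g_def field_simps)
 ultimately have "wbd (-b) (-a') g" by (rule wbd_far)
 from wbd_recip[OF this] have "wbd a' b (\<lambda>x. g (1 / x))" by simp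
 moreover have "h x = g (1 / x)" if "x ~= 0" for x using that by (simp add: g_def)
 ultimately show ?thesis unfolding wbd_def by auto
qed

lemma wbd_xpow: "wbd k k (\<lambda>x. cx x ^ k)" for k :: nat
 by (rule wbdI[of _ 1]) (auto simp: norm_power wt_def powr_realpow)

lemma wbd_xpow_inverse: "wbd (- k) (- k) (\<lambda>x. inverse (cx x ^ k))" for k :: nat
 by (rule wbdI[of _ 1]) (auto simp: norm_power norm_inverse wt_def powr_realpow powr_minus)

lemma smooth_measurable: "smooth f ==> f \<in> BM"
 using smooth_continuous_on[of UNIV f 0] by (intro borel_measurable_continuous_onI) simp

lemma schwartz_measurable: "f \<in> schwartz ==> f \<in> BM"
 by (intro smooth_measurable schwartz_smooth)

lemma Sz_wbd:
 assumes "f \<in> Sz n" shows "wbd n (- K) f"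
proof -
 obtain C where C: "!!x. abs x <= 1 ==> norm (f x) <= C * abs x ^ n" using Sz_bound_near[OF assms] by blast
 obtain D where D: "!!x. abs x >= 1 ==> norm (f x) <= D * abs x powr (- K)" 
  using schwartz_bound_far Sz_schwartz assms by blast
 show ?thesis
 proof (rule wbdI[of _ "max C D"])
  fix x :: real assume "x ~= 0"
  thus "norm (f x) <= max C D * wt n (- K) x"
   using C[of x] D[of x] 
   by (auto simp: wt_def powr_realpow max_mult_distrib_right)
 qed (use assms in \<open>auto simp: Sz_schwartz schwartz_measurable\<close>)
qed

text \<open>One constant serves all f at once; this is the form in which continuity of the
  functional f -> integral of h f is needed later.\<close>

lemma wbd_pairing:
 assumes h: "wbd a b h" and ab: "a + c > -1" "b + d < -1"
 shows "\<exists>C\<ge>0. \<forall>f B. f \<in> BM \<and> (\<forall>x. x ~= 0 --> norm (f x) <= B * wt c d x) -->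
   lb_int (\<lambda>x. h x * f x) \<and> norm (LB x. h x * f x) <= C * B"
proof -
 obtain C where C: "C >= 0" "!!x. x ~= 0 ==> norm (h x) <= C * wt a b x" using h by (rule wbdE) blast
 have int: "lb_int (wt (a + c) (b + d))" by (rule integrable_wt) (use ab in auto)
 define K where "K = (LB x. wt (a + c) (b + d) x)"
 have K: "K >= 0" unfolding K_def by simp
 have AE0: "AE x in lborel. x ~= (0::real)" by (rule AE_lborel_singleton)
 show ?thesis
 proof (intro exI[of _ "C * K"] conjI allI impI)
  fix f :: "real => complex" and B
  assume f: "f \<in> BM \<and> (\<forall>x. x ~= 0 --> norm (f x) <= B * wt c d x)"
  have meas: "(\<lambda>x. h x * f x) \<in> borel_measurable lborel"
   using f wbd_measurable[OF h] by auto
  have bd: "norm (h x * f x) <= C * B * wt (a + c) (b + d) x" if "x ~= 0" for x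
  proof -
   have "norm (h x * f x) <= (C * wt a b x) * (B * wt c d x)"
    unfolding norm_mult using C f that by (intro mult_mono) auto
   thus ?thesis by (simp add: wt_mult[symmetric] mult_ac)
  qed
  have AEb: "AE x in lborel. norm (h x * f x) <= C * B * wt (a + c) (b + d) x"
   using AE0 by eventually_elim (rule bd)
  have ig: "lb_int (\<lambda>x. C * B * wt (a + c) (b + d) x)"
   by (intro integrable_mult_right int)
  show 1: "lb_int (\<lambda>x. h x * f x)"
   by (rule LB_integrable_bound[OF ig meas]) (use AEb in \<open>auto elim!: eventually_mono\<close>)
  have "norm (LB x. h x * f x) <= (LB x. norm (h x * f x))"
   by (rule integral_norm_bound)
  also have "... <= (LB x. C * B * wt (a + c) (b + d) x)"
   by (rule integral_mono_AE) (use 1 ig AEb in auto)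
  also have "... = C * K * B" by (simp add: K_def)
  finally show "norm (LB x. h x * f x) <= C * K * B" .
 qed (use C K in auto)
qed

lemma wbd_integrable_mult:
 assumes "wbd a b h" "wbd c d f" "a + c > -1" "b + d < -1"
 shows "lb_int (\<lambda>x. h x * f x)"
proof -
 obtain C where C: "!!x. x ~= 0 ==> norm (f x) <= C * wt c d x" using assms(2) by (auto simp: wbd_def)
 show ?thesis using wbd_pairing[OF assms(1,3,4)] C wbd_measurable[OF assms(2)] by blast
qed

lemma wbd_integrable_Sz:
 assumes "wbd a b h" "f \<in> Sz n" "a + n > -1"
 shows "lb_int (\<lambda>x. h x * f x)"
 using wbd_integrable_mult[OF assms(1) Sz_wbd[OF assms(2), of "b + 2"] assms(3)] by simp

lemma wbd_tempered:
 assumes h: "wbd a b h" and a: "a > -1"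
 shows "\<exists>C N. C >= 0 \<and> (\<forall>f\<in>schwartz. \<forall>B. sbd N f B --> norm (LB x. h x * f x) <= C * B)"
proof -
 \<comment> \<open>N >= b + 2 makes |x|^(b - N) integrable at infinity.\<close>
 define N where "N = nat \<lceil>b + 2\<rceil>"
 have N: "real N >= b + 2" unfolding N_def by linarith
 obtain C where C: "C >= 0" "!!f B. f \<in> BM ==> (!!x. x ~= 0 ==> norm (f x) <= B * wt 0 (- real N) x) ==>
   norm (LB x. h x * f x) <= C * B"
  using wbd_pairing[OF h, of 0 "- real N"] a N by auto
 have "norm (LB x. h x * f x) <= C * B" if f: "f \<in> schwartz" "sbd N f B" for f B
 proof (rule C(2))
  fix x :: real assume "x ~= 0"
  have 0: "norm (f x) <= B" using sbdD[OF f(2), of 0 0 x] by simp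
  have "norm (f x) * abs x ^ N <= B" using sbdD[OF f(2), of N 0 x] by (simp add: norm_mult norm_power mult.commute)
  thus "norm (f x) <= B * wt 0 (- real N) x"
   using 0 \<open>x ~= 0\<close> by (auto simp: wt_def powr_minus powr_realpow field_simps)
 qed (use f in \<open>auto intro: schwartz_measurable\<close>)
 thus ?thesis using C(1) by blast
qed

text \<open>In \<open>rep S a b T\<close> the exponents \<open>a\<close> and \<open>b\<close> bound the growth of the coefficients at \<open>0\<close> and at
 \<open>\<infinity>\<close>: \<open>T\<close> vanishes to order \<open>a\<close> at \<open>0\<close> and, in the coordinate \<open>1/x\<close>, to order \<open>- b\<close> at \<open>\<infinity>\<close>.
 The operator \<open>Eop\<close> is minus the transpose of \<open>x d/dx\<close>.\<close>

definition euler_form :: "nat => (nat => real => complex) => distr" where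
 "euler_form m h f = (\<Sum>i\<le>m. LB x. h i x * (Eop ^^ i) f x)"

definition rep :: "(real => complex) set => real => real => distr => bool" where
 "rep S a b T \<longleftrightarrow> (\<exists>m h. (\<forall>i. wbd a b (h i)) \<and> (\<forall>f\<in>S. T f = euler_form m h f))"

text \<open>Domains for forms: on \<open>Sz n\<close> a coefficient of size |x|^a near 0 gives a
  convergent integral as soon as a + n > -1, and stability under \<open>Eop\<close> allows forms to
  be rewritten without leaving the domain.\<close>

definition adm :: "nat => (real => complex) set => bool" where
 "adm n S \<longleftrightarrow> S \<subseteq> Sz n \<and> (\<forall>f\<in>S. Eop f \<in> S)"

lemma adm_Sz: "m >= n ==> adm n (Sz m)"
 by (auto simp: adm_def Sz_Eop intro: Sz_mono)

lemma adm_test: "adm 0 (TF U)"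
 by (auto simp: adm_def test_functions_Eop Sz_0 test_schwartz)

lemma adm_test_away: "adm n (test0)"
 by (auto simp: adm_def test_functions_Eop test_away_Sz)

lemma admD: "adm n S ==> f \<in> S ==> f \<in> Sz n" and adm_Eop: "adm n S ==> f \<in> S ==> Eop f \<in> S"
 by (auto simp: adm_def)

lemma adm_funpow: "adm n S ==> f \<in> S ==> (Eop ^^ i) f \<in> S"
 by (induction i) (auto intro: adm_Eop)

lemma adm_smooth: "adm n S ==> f \<in> S ==> smooth f"
 using admD Sz_schwartz schwartz_smooth by blast

lemma adm_integrable:
 "adm n S ==> a + n > -1 ==> wbd a b h ==> f \<in> S ==> lb_int (\<lambda>x. h x * f x)"
 using wbd_integrable_Sz admD by blast

lemma repI: "(!!i. wbd a b (h i)) ==> (!!f. f \<in> S ==> T f = euler_form m h f) ==> rep S a b T"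
 unfolding rep_def by blast

text \<open>Padding with zero coefficients makes every sufficiently large degree available, so that
  two forms can be added term by term.\<close>

lemma rep_normal:
 assumes "rep S a b T"
 obtains m h where "!!i. wbd a b (h i)" "!!f M. f \<in> S ==> M >= m ==> T f = euler_form M h f"
proof -
 obtain m h where h: "!!i. wbd a b (h i)" "!!f. f \<in> S ==> T f = euler_form m h f"
  using assms unfolding rep_def by blast
 define h' where "h' i = (if i <= m then h i else (\<lambda>x. 0))" for i
 show ?thesis
 proof (rule that[of h' m])
  show "wbd a b (h' i)" for i using h(1) by (simp add: h'_def)
  fix f M assume f: "f \<in> S" "M >= m"
  have "euler_form M h' f = (\<Sum>i\<le>m. LB x. h' i x * (Eop ^^ i) f x)"
   unfolding euler_form_def using f(2) by (intro sum.mono_neutral_right) (auto simp: h'_def)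
  also have "... = T f" unfolding h(2)[OF f(1)] euler_form_def by (intro sum.cong) (auto simp: h'_def)
  finally show "T f = euler_form M h' f" by simp
 qed
qed

lemma rep_cong: "rep S a b T ==> (!!f. f \<in> S ==> T f = T' f) ==> rep S a b T'"
 unfolding rep_def by (metis (no_types, lifting))

lemma rep_mono: "rep S a b T ==> S' \<subseteq> S ==> a' <= a ==> b <= b' ==> rep S' a' b' T"
 unfolding rep_def by (meson wbd_mono subset_iff)

lemma rep_int: "wbd a b h ==> rep S a b (\<lambda>f. LB x. h x * f x)"
 by (rule repI[of _ _ "\<lambda>i. h" _ _ 0]) (auto simp: euler_form_def)

lemma rep_zero: "rep S a b (\<lambda>f. 0)"
 by (rule repI[of _ _ "\<lambda>i x. 0" _ _ 0]) (auto simp: euler_form_def)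

lemma rep_add:
 assumes S: "adm n S" "a + n > -1" and "rep S a b T" "rep S a b T'"
 shows "rep S a b (\<lambda>f. T f + T' f)"
proof -
 obtain m h where h: "!!i. wbd a b (h i)" "!!f M. f \<in> S ==> M >= m ==> T f = euler_form M h f"
  using rep_normal[OF assms(3)] by metis
 obtain m' h' where h': "!!i. wbd a b (h' i)" "!!f M. f \<in> S ==> M >= m' ==> T' f = euler_form M h' f"
  using rep_normal[OF assms(4)] by metis
 show ?thesis
 proof (rule repI[of _ _ "\<lambda>i x. h i x + h' i x" _ _ "max m m'"])
  show "wbd a b (\<lambda>x. h i x + h' i x)" for i by (intro wbd_add h h')
  fix f assume f: "f \<in> S"
  have "T f + T' f = euler_form (max m m') h f + euler_form (max m m') h' f"
   using h(2)[OF f, of "max m m'"] h'(2)[OF f, of "max m m'"] by simp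
  also have "... = euler_form (max m m') (\<lambda>i x. h i x + h' i x) f"
   unfolding euler_form_def sum.distrib[symmetric] ring_distribs
   by (intro sum.cong refl LB_integral_add[symmetric] adm_integrable[OF S h(1)] adm_integrable[OF S h'(1)] adm_funpow[OF S(1) f])
  finally show "T f + T' f = euler_form (max m m') (\<lambda>i x. h i x + h' i x) f" .
 qed
qed

lemma rep_cmult:
 assumes "rep S a b T" shows "rep S a b (\<lambda>f. c * T f)"
proof -
 obtain m h where h: "!!i. wbd a b (h i)" "!!f. f \<in> S ==> T f = euler_form m h f"
  using assms unfolding rep_def by blast
 show ?thesis
  by (rule repI[of _ _ "\<lambda>i x. c * h i x" _ _ m])
    (auto simp: h euler_form_def sum_distrib_left mult.assoc intro: wbd_cmult)
qed

lemma rep_diff: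
 assumes S: "adm n S" "a + n > -1" and "rep S a b T" "rep S a b T'"
 shows "rep S a b (\<lambda>f. T f - T' f)"
 using rep_add[OF S assms(3) rep_cmult[OF assms(4), of "-1"]] by simp

lemma rep_sum:
 assumes S: "adm n S" "a + n > -1" and "!!i. i \<in> A ==> rep S a b (T i)"
 shows "rep S a b (\<lambda>f. \<Sum>i\<in>A. T i f)"
 using assms(3) by (induction A rule: infinite_finite_induct) (auto intro: rep_add[OF S] rep_zero)

lemma rep_Eop:
 assumes S: "!!f. f \<in> S' ==> Eop f \<in> S" and "rep S a b T" shows "rep S' a b (\<lambda>f. T (Eop f))"
proof -
 obtain m h where h: "!!i. wbd a b (h i)" "!!f. f \<in> S ==> T f = euler_form m h f"
  using assms unfolding rep_def by blast
 define h' where "h' i = (case i of 0 => (\<lambda>x. 0) | Suc j => h j)" for i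
 show ?thesis
 proof (rule repI[of _ _ h' _ _ "Suc m"])
  show "wbd a b (h' i)" for i using h by (cases i) (auto simp: h'_def)
  fix f assume f: "f \<in> S'"
  have "euler_form (Suc m) h' f = (\<Sum>i\<le>m. LB x. h i x * (Eop ^^ Suc i) f x)"
   unfolding euler_form_def by (subst sum.atMost_Suc_shift) (simp add: h'_def)
  also have "... = T (Eop f)" using h(2)[OF S[OF f]] by (simp add: euler_form_def funpow_swap1)
  finally show "T (Eop f) = euler_form (Suc m) h' f" by simp
 qed
qed

lemma Eop_add:
 assumes "smooth f" "smooth g"
 shows "Eop (\<lambda>x. f x + g x) = (\<lambda>x. Eop f x + Eop g x)"
 using nderiv_add[OF open_UNIV assms] by (auto simp: Eop_def algebra_simps)

lemma Eop_cmult: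
 assumes "smooth f" shows "Eop (\<lambda>x. c * f x) = (\<lambda>x. c * Eop f x)"
 using nderiv_cmult[OF open_UNIV assms] by (auto simp: Eop_def algebra_simps)

lemma Eop_funpow_add:
 assumes "smooth f" "smooth g"
 shows "(Eop ^^ n) (\<lambda>x. f x + g x) = (\<lambda>x. (Eop ^^ n) f x + (Eop ^^ n) g x)"
 by (induction n) (auto simp: Eop_add[OF smooth_Eop_funpow smooth_Eop_funpow] assms)

lemma Eop_funpow_cmult:
 assumes "smooth f" shows "(Eop ^^ n) (\<lambda>x. c * f x) = (\<lambda>x. c * (Eop ^^ n) f x)"
 by (induction n) (auto simp: Eop_cmult[OF smooth_Eop_funpow] assms)

lemma th_cmult:
 assumes "smooth f" shows "th (\<lambda>x. c * f x) = (\<lambda>x. c * th f x)"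
 using nderiv_cmult[OF open_UNIV assms] by (auto simp: th_def algebra_simps)

lemma nderiv_1_mult:
 assumes "open U" "smooth_on U f" "smooth_on U g" "x \<in> U"
 shows "nderiv 1 (\<lambda>x. f x * g x) x = f x * nderiv 1 g x + nderiv 1 f x * g x"
 by (rule nderiv_1_eqI) (intro has_vector_derivative_mult smooth_hvd1[OF assms(2,4)]
   smooth_hvd1[OF assms(3,4)])

lemma Eop_mult:
 assumes "open U" "smooth_on U f" "smooth_on U g" "x \<in> U"
 shows "Eop (\<lambda>x. g x * f x) x = g x * Eop f x + th g x * f x"
 unfolding Eop_def th_def nderiv_1_mult[OF assms(1,3,2,4)] by (simp add: algebra_simps)

lemma Eop_mult':
 assumes "smooth f" "smooth g"
 shows "Eop (\<lambda>x. g x * f x) = (\<lambda>x. g x * Eop f x + th g x * f x)"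
 using Eop_mult[OF open_UNIV assms] by auto

text \<open>The product rule \<open>Eop (g f) = g Eop f + th g f\<close> moves g past one factor
  \<open>Eop\<close> at a time. It is proved for all g together because \<open>th g\<close> replaces
  g, which is why the bounds are demanded of all \<open>(th ^^ k) g\<close>, as for a
  symbol.\<close>

lemma rep_mult_aux:
 assumes S: "adm n S" "a + c + n > -1" and h: "wbd a b h"
  and "smooth g" "!!k. wbd c d ((th ^^ k) g)"
 shows "(\<forall>f\<in>S. lb_int (\<lambda>x. h x * (Eop ^^ j) (\<lambda>x. g x * f x) x)) \<and>
   rep S (a + c) (b + d) (\<lambda>f. LB x. h x * (Eop ^^ j) (\<lambda>x. g x * f x) x)"
 using assms(4,5)
proof (induction j arbitrary: g)
 case 0
 have "wbd (a + c) (b + d) (\<lambda>x. h x * g x)" using 0(2)[of 0] by (auto intro: wbd_mult h)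
 from rep_int[OF this, of S] adm_integrable[OF S(1) _ this] show ?case using S(2)
  by (simp add: mult.assoc)
next
 case (Suc j)
 have 1: "\<forall>f\<in>S. lb_int (\<lambda>x. h x * (Eop ^^ j) (\<lambda>x. g x * f x) x)"
   "rep S (a + c) (b + d) (\<lambda>f. LB x. h x * (Eop ^^ j) (\<lambda>x. g x * f x) x)"
  using Suc.IH[of g] Suc.prems by auto
 have t: "smooth (th g)" "!!k. wbd c d ((th ^^ k) (th g))"
  using Suc.prems(2)[of "Suc k" for k] Suc.prems(1) by (auto simp: funpow_swap1 smooth_th)
 have 2: "\<forall>f\<in>S. lb_int (\<lambda>x. h x * (Eop ^^ j) (\<lambda>x. th g x * f x) x)"
   "rep S (a + c) (b + d) (\<lambda>f. LB x. h x * (Eop ^^ j) (\<lambda>x. th g x * f x) x)"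
  using Suc.IH[of "th g"] t by auto
 have eq: "h x * (Eop ^^ Suc j) (\<lambda>x. g x * f x) x =
   h x * (Eop ^^ j) (\<lambda>x. g x * Eop f x) x + h x * (Eop ^^ j) (\<lambda>x. th g x * f x) x" if f: "f \<in> S" for f x
 proof -
  have sf: "smooth f" using adm_smooth[OF S(1) f] .
  have "(Eop ^^ Suc j) (\<lambda>x. g x * f x) = (Eop ^^ j) (\<lambda>x. g x * Eop f x + th g x * f x)"
   by (simp add: funpow_swap1 Eop_mult'[OF sf Suc.prems(1)])
  also have "... = (\<lambda>x. (Eop ^^ j) (\<lambda>x. g x * Eop f x) x + (Eop ^^ j) (\<lambda>x. th g x * f x) x)"
   using sf Suc.prems(1) by (intro Eop_funpow_add smooth_mult smooth_Eop smooth_th) auto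
  finally show ?thesis by (simp add: algebra_simps)
 qed
 have "rep S (a + c) (b + d) (\<lambda>f. (LB x. h x * (Eop ^^ j) (\<lambda>x. g x * Eop f x) x) + (LB x. h x * (Eop ^^ j) (\<lambda>x. th g x * f x) x))"
  by (rule rep_add[OF S(1) _ rep_Eop[OF adm_Eop[OF S(1)] 1(2)] 2(2)]) (use S in auto)
 moreover have "(LB x. h x * (Eop ^^ j) (\<lambda>x. g x * Eop f x) x) + (LB x. h x * (Eop ^^ j) (\<lambda>x. th g x * f x) x)
   = (LB x. h x * (Eop ^^ Suc j) (\<lambda>x. g x * f x) x)" if f: "f \<in> S" for f
  unfolding eq[OF f] by (rule LB_integral_add[symmetric]) (use 1 2 f adm_Eop[OF S(1) f] in auto)
 ultimately have "rep S (a + c) (b + d) (\<lambda>f. LB x. h x * (Eop ^^ Suc j) (\<lambda>x. g x * f x) x)"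
  by (rule rep_cong)
 moreover have "lb_int (\<lambda>x. h x * (Eop ^^ Suc j) (\<lambda>x. g x * f x) x)" if f: "f \<in> S" for f
  unfolding eq[OF f] by (rule LB_integrable_add) (use 1 2 f adm_Eop[OF S(1) f] in auto)
 ultimately show ?case by blast
qed

lemma rep_mult:
 assumes S: "adm n S" "a + c + n > -1" and "rep S0 a b T"
  and g: "smooth g" "!!k. wbd c d ((th ^^ k) g)" "!!f. f \<in> S ==> (\<lambda>x. g x * f x) \<in> S0"
 shows "rep S (a + c) (b + d) (\<lambda>f. T (\<lambda>x. g x * f x))"
proof -
 obtain m h where h: "!!i. wbd a b (h i)" "!!f. f \<in> S0 ==> T f = euler_form m h f"
  using assms(3) unfolding rep_def by blast
 have "rep S (a + c) (b + d) (\<lambda>f. \<Sum>i\<le>m. LB x. h i x * (Eop ^^ i) (\<lambda>x. g x * f x) x)"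
  by (rule rep_sum[OF S(1)]) (use S rep_mult_aux[OF S h(1) g(1,2)] in auto)
 thus ?thesis by (rule rep_cong) (simp add: h(2)[OF g(3)] euler_form_def)
qed

lemma th_test:
 assumes "f \<in> TF U" shows "th f \<in> TF U"
 unfolding th_def using assms by (intro test_mult[where V=UNIV] test_nderiv) auto

lemma th_funpow_test: "f \<in> TF U ==> (th ^^ k) f \<in> TF U"
 by (induction k) (auto intro: th_test)

lemma test_wbd: "f \<in> TF U ==> wbd 0 d f"
 using Sz_wbd[of f 0 "-d"] test_schwartz by (simp add: Sz_0)

lemma test_away_wbd: 
 assumes "f \<in> test0" shows "wbd c d f"
proof -
 obtain r where r: "r > 0" "!!x. abs x < r ==> f x = 0" using test_away_0[OF assms] by blast
 show ?thesis by (rule wbd_near[OF test_wbd[OF assms] r])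
qed

text \<open>A compactly supported factor makes the exponent at infinity arbitrary.\<close>

lemma rep_cutoff:
 assumes S: "adm n S" "a + n > -1" and "rep S0 a b T" and g: "g \<in> testR"
  "!!f. f \<in> S ==> (\<lambda>x. g x * f x) \<in> S0"
 shows "rep S a b' (\<lambda>f. T (\<lambda>x. g x * f x))"
proof -
 have "rep S (a + 0) (b + (b' - b)) (\<lambda>f. T (\<lambda>x. g x * f x))"
  by (rule rep_mult[OF S(1) _ assms(3)])
    (use S(2) g test_wbd[OF th_funpow_test[OF g(1)]] in \<open>auto simp: test_smooth\<close>)
 thus ?thesis by simp
qed

text \<open>A factor vanishing near 0 makes the exponent at 0 arbitrary, within the range where the
  integrals converge on the domain. The function 1 - g is only bounded at infinity, but applying
  \<open>th\<close> once turns it into a test function supported away from 0.\<close>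

lemma rep_cutoff_compl:
 assumes S: "adm n S" "a' + n > -1" and "rep S0 a b T" and g: "g \<in> testR" "r > 0" "!!x. abs x < r ==> g x = 1"
  "!!f. f \<in> S ==> (\<lambda>x. (1 - g x) * f x) \<in> S0"
 shows "rep S a' b (\<lambda>f. T (\<lambda>x. (1 - g x) * f x))"
proof -
 have sg: "smooth (\<lambda>x. 1 - g x)" by (intro smooth_diff test_smooth[OF g(1)]) auto
 have th1: "th (\<lambda>x. 1 - g x) \<in> test0"
 proof -
  have "nderiv 1 (\<lambda>x. 1 - g x) x = - nderiv 1 g x" for x
   using nderiv_add[OF open_UNIV _ smooth_cmult[OF open_UNIV test_smooth[OF g(1)], of "-1"], of "\<lambda>x. 1" x 1]
     nderiv_cmult[OF open_UNIV test_smooth[OF g(1)], of x 1 "-1"] by simp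
  hence eq: "th (\<lambda>x. 1 - g x) = (\<lambda>x. (-1) * th g x)" by (simp add: th_def)
  obtain R where R: "!!x. abs x >= R ==> th g x = 0" using test_bounded_subset[OF th_test[OF g(1)]] by blast
  have z: "th g x = 0" if "abs x < r" for x
  proof -
   have "nderiv 1 g x = nderiv 1 (\<lambda>x. 1) x"
    by (rule nderiv_cong_open[of "{-r<..<r}"]) (use g(3) that in auto)
   thus ?thesis by (simp add: th_def)
  qed
  have "th g \<in> test0"
   by (rule test_away_0I[of _ r R]) (use g R z in \<open>auto intro: smooth_th test_smooth\<close>)
  thus ?thesis unfolding eq by (rule test_cmult)
 qed
 have w: "wbd (a' - a) 0 ((th ^^ k) (\<lambda>x. 1 - g x))" for k
 proof (cases k)
  case 0
  obtain B where B: "!!x. norm (nderiv 0 g x) <= B" using test_bounded[OF g(1)] by metis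
  have "wbd 0 0 (\<lambda>x. 1 - g x)"
   by (rule wbd_bounded[of _ "1 + B"])
     (use B in \<open>auto intro: smooth_measurable[OF sg] order_trans[OF norm_triangle_ineq4]\<close>)
  from wbd_near[OF this g(2)] g(3) 0 show ?thesis by simp
 next
  case (Suc j)
  thus ?thesis using test_away_wbd[OF th_funpow_test[OF th1]] by (simp add: funpow_swap1)
 qed
 have "rep S (a + (a' - a)) (b + 0) (\<lambda>f. T (\<lambda>x. (1 - g x) * f x))"
  by (rule rep_mult[OF S(1) _ assms(3) sg w g(4)]) (use S(2) in auto)
 thus ?thesis by simp
qed

lemma th_xpow: "th (\<lambda>x. cx x ^ n) = (\<lambda>x. of_nat n * cx x ^ n)"
proof (cases n)
 case (Suc m)
 have "nderiv 1 (\<lambda>x. cx x ^ n) x = of_nat n * cx x ^ m" for x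
 proof (rule nderiv_1_eqI)
  have "((\<lambda>z::complex. z ^ n) has_field_derivative of_nat n * cx x ^ m) (at (cx x))"
   using DERIV_power_Suc[OF DERIV_ident, of m "cx x :: complex"] Suc by simp
  thus "((\<lambda>x. cx x ^ n) has_vd (of_nat n * cx x ^ m)) (at x)"
   by (rule has_vector_derivative_real_field)
 qed
 thus ?thesis using Suc by (auto simp: th_def)
qed (simp add: th_def)

lemma th_funpow_xpow: "(th ^^ k) (\<lambda>x. cx x ^ n) = (\<lambda>x. of_nat n ^ k * cx x ^ n)"
proof (induction k)
 case (Suc k)
 thus ?case by (simp add: th_cmult[OF smooth_power[OF open_UNIV smooth_of_real]] th_xpow mult_ac)
qed simp

lemma rep_xpow:
 assumes S: "adm n S" "a + k + n > -1" and "rep S0 a b T"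
  "!!f. f \<in> S ==> (\<lambda>x. cx x ^ k * f x) \<in> S0"
 shows "rep S (a + k) (b + k) (\<lambda>f. T (\<lambda>x. cx x ^ k * f x))"
 by (rule rep_mult[OF S assms(3) _ _ assms(4)])
   (auto simp: th_funpow_xpow smooth_power intro: wbd_cmult wbd_xpow)

text \<open>The operators x^j D^j are polynomials in the Euler operator: x^(j+1) D^(j+1) f = x^j D^j
  (Eop f) - (j+1) x^j D^j f.\<close>

lemma rep_nderiv_aux:
 assumes S: "adm n S" "a + n > -1" and h: "wbd a b h"
 shows "(\<forall>f\<in>S. lb_int (\<lambda>x. h x * (cx x ^ j * nderiv j f x))) \<and>
   rep S a b (\<lambda>f. LB x. h x * (cx x ^ j * nderiv j f x))"
proof (induction j)
 case 0
 thus ?case using rep_int[OF h] adm_integrable[OF S h] by simp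
next
 case (Suc j)
 have eq: "h x * (cx x ^ Suc j * nderiv (Suc j) f x) = 
   h x * (cx x ^ j * nderiv j (Eop f) x) - of_nat (Suc j) * (h x * (cx x ^ j * nderiv j f x))" if "f \<in> S" for f x
  using nderiv_Eop[OF open_UNIV adm_smooth[OF S(1) that], of x j] by (simp add: algebra_simps)
 have "rep S a b (\<lambda>f. (LB x. h x * (cx x ^ j * nderiv j (Eop f) x)) - of_nat (Suc j) * (LB x. h x * (cx x ^ j * nderiv j f x)))"
  using Suc by (intro rep_diff[OF S] rep_cmult rep_Eop[OF adm_Eop[OF S(1)]]) auto
 moreover have "(LB x. h x * (cx x ^ j * nderiv j (Eop f) x)) - of_nat (Suc j) * (LB x. h x * (cx x ^ j * nderiv j f x))
   = (LB x. h x * (cx x ^ Suc j * nderiv (Suc j) f x))" if f: "f \<in> S" for f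
  unfolding eq[OF f] using Suc f adm_Eop[OF S(1) f]
  by (subst LB_integral_diff) auto
 ultimately have "rep S a b (\<lambda>f. LB x. h x * (cx x ^ Suc j * nderiv (Suc j) f x))"
  by (rule rep_cong)
 moreover have "lb_int (\<lambda>x. h x * (cx x ^ Suc j * nderiv (Suc j) f x))" if f: "f \<in> S" for f
  unfolding eq[OF f] using Suc f adm_Eop[OF S(1) f]
  by (intro LB_integrable_diff integrable_mult_right) auto
 ultimately show ?case by blast
qed

lemma rep_nderiv:
 assumes S: "adm n S" "a + n > -1" and h: "wbd a b h"
 shows "rep S a b (\<lambda>f. LB x. h x * (cx x ^ j * nderiv j f x))"
 using rep_nderiv_aux[OF assms] by blast

lemma euler_form_tempered:
 assumes h: "!!i. wbd a b (h i)" and a: "a > -1"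
 shows "\<exists>C N. C >= 0 \<and> (\<forall>f\<in>schwartz. \<forall>B. sbd N f B --> norm (euler_form m h f) <= C * B)"
proof (induction m)
 have *: "\<exists>C N. C >= 0 \<and> (\<forall>f\<in>schwartz. \<forall>B. sbd N f B --> norm (LB x. h i x * (Eop ^^ i) f x) <= C * B)" for i
 proof -
  obtain C N where C: "C >= 0" "!!f B. f \<in> schwartz ==> sbd N f B ==> norm (LB x. h i x * f x) <= C * B"
   using wbd_tempered[OF h a] by metis
  obtain D M where D: "D >= 0" "!!f B. f \<in> schwartz ==> sbd M f B ==> sbd N ((Eop ^^ i) f) (D * B)"
   using tameD[OF tame_funpow[OF tame_Eop]] by metis
  show ?thesis
   using C D tame_schwartz[OF tame_funpow[OF tame_Eop]]
   by (intro exI[of _ "C * D"] exI[of _ M]) (auto simp: mult.assoc)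
 qed
 case 0
 show ?case using *[of 0] by (simp add: euler_form_def)
 case (Suc m)
 obtain C N where C: "C >= 0" "!!f B. f \<in> schwartz ==> sbd N f B ==> norm (euler_form m h f) <= C * B"
  using Suc by metis
 obtain D M where D: "D >= 0" "!!f B. f \<in> schwartz ==> sbd M f B ==> norm (LB x. h (Suc m) x * (Eop ^^ Suc m) f x) <= D * B"
  using *[of "Suc m"] by metis
 have "norm (euler_form (Suc m) h f) <= (C + D) * B" if "f \<in> schwartz" "sbd (max N M) f B" for f B
 proof -
  have "euler_form (Suc m) h f = euler_form m h f + (LB x. h (Suc m) x * (Eop ^^ Suc m) f x)"
   by (simp add: euler_form_def)
  also have "norm ... <= C * B + D * B"
   using that by (intro norm_triangle_mono C D) (auto elim: sbd_mono)
  finally show ?thesis by (simp add: ring_distribs)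
 qed
 thus ?case using add_nonneg_nonneg[OF C(1) D(1)] by blast
qed

section \<open>The substitution x -> 1/x in integrals\<close>

lemma AE_lborel_not_0: "AE x in lborel. x ~= (0::real)"
 by (rule AE_lborel_singleton)

lemma reciprocal_substitution_real:
 fixes f :: "real => real"
 assumes [measurable]: "f \<in> BM"
 shows "lb_int (\<lambda>x. f (1 / x) / x^2) \<longleftrightarrow> lb_int f"
  and "(LB x. f (1 / x) / x^2) = (LB x. f x)"
proof -
 \<comment> \<open>The change of variables is available for absolute integrability on the set - {0};
   removing a null set identifies this with integrability on the line.\<close>
 have conv: "(g absolutely_integrable_on (- {0}) \<longleftrightarrow> lb_int g) \<and>
   (lb_int g --> integral (- {0}) g = (LB x. g x))" if [measurable]: "g \<in> BM" for g :: "real => real"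
 proof -
  have "set_integrable lebesgue (- {0}) g \<longleftrightarrow> lb_int (\<lambda>x. indicator (- {0}) x *\<^sub>R g x)"
   unfolding set_integrable_def by (rule integrable_completion) measurable
  also have "... \<longleftrightarrow> lb_int g"
   by (rule integrable_cong_AE) (use AE_lborel_not_0 in \<open>auto elim!: eventually_mono\<close>)
  finally have 1: "set_integrable lebesgue (- {0}) g \<longleftrightarrow> lb_int g" .
  moreover have "integral (- {0}) g = (LB x. g x)" if "lb_int g"
  proof -
   have "integral (- {0}) g = set_lebesgue_integral lebesgue (- {0}) g"
    using set_lebesgue_integral_eq_integral(2)[of "- {0}" g] 1 that by simp
   also have "... = (LB x. indicator (- {0}) x *\<^sub>R g x)"
    unfolding set_lebesgue_integral_def by (rule integral_completion) measurable
   also have "... = (LB x. g x)"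
    by (rule integral_cong_AE) (use AE_lborel_not_0 in \<open>auto elim!: eventually_mono\<close>)
   finally show ?thesis .
  qed
  ultimately show ?thesis by blast
 qed
 have img: "(\<lambda>x. 1 / x) ` (- {0}) = - {0::real}"
 proof -
  have "x \<in> (\<lambda>x. 1 / x) ` (- {0})" if "x ~= 0" for x :: real
   using that by (intro image_eqI[of _ _ "1 / x"]) auto
  thus ?thesis by auto
 qed
 have cv: "(\<lambda>x. abs (- (1 / x^2)) * f (1 / x)) absolutely_integrable_on (- {0}) \<and>
   integral (- {0}) (\<lambda>x. abs (- (1 / x^2)) * f (1 / x)) = b
   \<longleftrightarrow> f absolutely_integrable_on ((\<lambda>x. 1 / x) ` (- {0})) \<and> integral ((\<lambda>x. 1 / x) ` (- {0})) f = b" for b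
 proof (rule has_absolute_integral_change_of_variables_1')
  fix x :: real assume "x \<in> - {0}"
  thus "((\<lambda>x. 1 / x) has_real_derivative - (1 / x^2)) (at x within - {0})"
   by (auto intro!: derivative_eq_intros simp: power2_eq_square)
 qed (auto simp: inj_on_def)
 have eq: "(\<lambda>x. abs (- (1 / x^2)) * f (1 / x)) = (\<lambda>x. f (1 / x) / x^2)" by (auto simp: fun_eq_iff)
 have [measurable]: "(\<lambda>x. f (1 / x) / x^2) \<in> BM" by measurable
 define g where "g = (\<lambda>x. f (1 / x) / x^2)"
 have g[measurable]: "g \<in> BM" unfolding g_def by measurable
 have cv': "g absolutely_integrable_on (- {0}) \<and> integral (- {0}) g = b
   \<longleftrightarrow> f absolutely_integrable_on (- {0}) \<and> integral (- {0}) f = b" for b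
  using cv[of b] unfolding eq img g_def .
 have iff: "g absolutely_integrable_on (- {0}) \<longleftrightarrow> f absolutely_integrable_on (- {0})"
  using cv'[of "integral (- {0}) g"] cv'[of "integral (- {0}) f"] by blast
 have 1: "lb_int g \<longleftrightarrow> lb_int f"
  using iff conv[OF g] conv[OF assms] by blast
 thus "lb_int (\<lambda>x. f (1 / x) / x^2) \<longleftrightarrow> lb_int f"
  unfolding g_def .
 have "(LB x. g x) = (LB x. f x)"
 proof (cases "lb_int f")
  case True
  have "integral (- {0}) g = integral (- {0}) f"
   using cv'[of "integral (- {0}) f"] True conv[OF assms] by blast
  thus ?thesis using True 1 conv[OF g] conv[OF assms] by simp
 next
  \<comment> \<open>Both integrals are 0 by the convention for nonintegrable functions, so the
    equation holds for every Borel function.\<close>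
  case False
  thus ?thesis using 1 by (simp add: not_integrable_integral_eq)
 qed
 thus "(LB x. f (1 / x) / x^2) = (LB x. f x)" unfolding g_def .
qed

lemma complex_integrable_iff_Re_Im:
 "integrable M g \<longleftrightarrow> integrable M (\<lambda>x. Re (g x)) \<and> integrable M (\<lambda>x. Im (g x))"
proof safe
 assume "integrable M (\<lambda>x. Re (g x))" "integrable M (\<lambda>x. Im (g x))"
 hence "integrable M (\<lambda>x. cx (Re (g x)) + \<i> * cx (Im (g x)))"
  by (intro LB_integrable_add integrable_mult_right integrable_of_real)
 thus "integrable M g" by (simp add: complex_eq[symmetric])
qed auto

lemma reciprocal_substitution:
 fixes f :: "real => complex"
 assumes [measurable]: "f \<in> BM"
 shows "lb_int (\<lambda>x. f (1 / x) / cx x ^ 2) \<longleftrightarrow> lb_int f"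
  and "(LB x. f (1 / x) / cx x ^ 2) = (LB x. f x)"
proof -
 have re: "Re (f (1 / x) / cx x ^ 2) = Re (f (1 / x)) / x^2" 
  and im: "Im (f (1 / x) / cx x ^ 2) = Im (f (1 / x)) / x^2" for x
  by (simp_all add: of_real_power[symmetric] del: of_real_power)
 have c: "lb_int g \<longleftrightarrow> lb_int (\<lambda>x. Re (g x)) \<and> lb_int (\<lambda>x. Im (g x))" for g :: "real => complex"
  by (rule complex_integrable_iff_Re_Im)
 show 1: "lb_int (\<lambda>x. f (1 / x) / cx x ^ 2) \<longleftrightarrow> lb_int f"
  unfolding c re im using reciprocal_substitution_real(1)[of "\<lambda>x. Re (f x)"] reciprocal_substitution_real(1)[of "\<lambda>x. Im (f x)"]
  by simp
 show "(LB x. f (1 / x) / cx x ^ 2) = (LB x. f x)"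
 proof (cases "lb_int f")
  case True
  show ?thesis
  proof (rule complex_eqI)
   show "Re (LB x. f (1 / x) / cx x ^ 2) = Re (LB x. f x)"
    using True 1 reciprocal_substitution_real(2)[of "\<lambda>x. Re (f x)"] by (subst (1 2) integral_Re[symmetric]) (simp_all only: re, simp_all)
   show "Im (LB x. f (1 / x) / cx x ^ 2) = Im (LB x. f x)"
    using True 1 reciprocal_substitution_real(2)[of "\<lambda>x. Im (f x)"] by (subst (1 2) integral_Im[symmetric]) (simp_all only: im, simp_all)
  qed
 next
  case False
  thus ?thesis using 1 by (simp add: not_integrable_integral_eq)
 qed
qed

text \<open>Subtraction is truncated: for l > n the product contains the factor i = n, which is 0,
  so the formula holds for every l.\<close>

lemma nderiv_xpow:
 "nderiv l (\<lambda>x. cx x ^ n) = (\<lambda>x. (\<Prod>i<l. of_nat (n - i)) * cx x ^ (n - l))"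
proof (induction l)
 case (Suc l)
 have "nderiv (Suc l) (\<lambda>x. cx x ^ n) x = (\<Prod>i<Suc l. of_nat (n - i)) * cx x ^ (n - Suc l)" for x
 proof -
  have "((\<lambda>z::complex. z ^ (n - l)) has_field_derivative of_nat (n - l) * cx x ^ (n - l - 1)) (at (cx x))"
   by (auto intro!: derivative_eq_intros simp: One_nat_def)
  hence "((\<lambda>x. cx x ^ (n - l)) has_vd (of_nat (n - l) * cx x ^ (n - l - 1) :: complex)) (at x)"
   by (rule has_vector_derivative_real_field)
  from has_vector_derivative_mult_right[OF this, of "\<Prod>i<l. of_nat (n - i)"]
  have "(nderiv l (\<lambda>x. cx x ^ n) has_vd
    (\<Prod>i<l. of_nat (n - i)) * (of_nat (n - l) * cx x ^ (n - l - 1))) (at x)"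
   unfolding Suc .
  thus ?thesis by (simp add: nderiv_Suc' vector_derivative_at mult.assoc One_nat_def)
 qed
 thus ?case by blast
qed simp

section \<open>Order of vanishing and representation by Euler forms\<close>

lemma fun_vanishes_add:
 assumes "open U" "0 \<in> U" "smooth_on U f" "smooth_on U g" "fun_vanishes f 0 n" "fun_vanishes g 0 n"
 shows "fun_vanishes (\<lambda>x. f x + g x) 0 n"
 using assms nderiv_add[OF assms(1,3,4,2)] by (simp add: fun_vanishes_def)

lemma fun_vanishes_cmult:
 assumes "open U" "0 \<in> U" "smooth_on U f" "fun_vanishes f 0 n"
 shows "fun_vanishes (\<lambda>x. c * f x) 0 n"
 using assms nderiv_cmult[OF assms(1,3,2)] by (simp add: fun_vanishes_def)

lemma fun_vanishes_sum:
 assumes "open U" "0 \<in> U" "!!i. i \<in> A ==> smooth_on U (f i)" "!!i. i \<in> A ==> fun_vanishes (f i) 0 n"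
 shows "fun_vanishes (\<lambda>x. \<Sum>i\<in>A. f i x) 0 n"
 using assms(4) nderiv_sum[where U=U and A=A and f=f and x=0, OF assms(1,3,2)] by (simp add: fun_vanishes_def)

lemma fun_vanishes_mono: "fun_vanishes f p n ==> m <= n ==> fun_vanishes f p m"
 by (auto simp: fun_vanishes_def)

lemma fun_vanishes_nderiv: "fun_vanishes f p n ==> fun_vanishes (nderiv l f) p (n - l)"
 by (auto simp: fun_vanishes_def nderiv_nderiv)

text \<open>The operator is tested on the monomials \<open>x\<^sup>i\<close>.\<close>

lemma tangential_coeff:
 assumes t: "tangential U 0 m a" and U: "open U" "0 \<in> U" and "i <= m"
 shows "fun_vanishes (a i) 0 i"
 using assms(4)
proof (induction i rule: less_induct)
 case (less i)
 define c where "c l = (\<Prod>k<l. of_nat (i - k) :: complex)" for l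
 have sa: "smooth_on U (a l)" if "l <= m" for l using t that by (auto simp: tangential_def)
 have sx: "smooth_on U (\<lambda>x. cx x ^ i)" for i by (intro smooth_power U) auto
 have D: "diffop_fun m a (\<lambda>x. cx x ^ i) = (\<lambda>x. (\<Sum>l<i. c l * (cx x ^ (i - l) * a l x)) + c i * a i x)"
 proof
  fix x
  have "diffop_fun m a (\<lambda>x. cx x ^ i) x = (\<Sum>l\<le>m. c l * (cx x ^ (i - l) * a l x))"
   by (simp add: diffop_fun_def nderiv_xpow c_def mult_ac)
  also have "... = (\<Sum>l\<le>i. c l * (cx x ^ (i - l) * a l x))"
   using less.prems by (intro sum.mono_neutral_right) (auto simp: c_def)
  also have "... = (\<Sum>l<i. c l * (cx x ^ (i - l) * a l x)) + c i * a i x"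
   by (simp add: lessThan_Suc_atMost[symmetric])
  finally show "diffop_fun m a (\<lambda>x. cx x ^ i) x = ..." .
 qed
 have v1: "fun_vanishes (diffop_fun m a (\<lambda>x. cx x ^ i)) 0 i"
  using t sx fun_vanishes_xpow by (auto simp: tangential_def)
 have v2: "fun_vanishes (\<lambda>x. \<Sum>l<i. c l * (cx x ^ (i - l) * a l x)) 0 i"
 proof (intro fun_vanishes_sum[OF U] fun_vanishes_cmult[OF U])
  fix l assume l: "l \<in> {..<i}"
  show s: "smooth_on U (\<lambda>x. cx x ^ (i - l) * a l x)"
   using l less.prems by (intro smooth_mult U sx sa) auto
  show "smooth_on U (\<lambda>x. c l * (cx x ^ (i - l) * a l x))" by (rule smooth_cmult[OF U(1) s])
  have "fun_vanishes (\<lambda>x. cx x ^ (i - l) * a l x) 0 (i - l + l)"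
   using l less.prems by (intro fun_vanishes_mult[OF U] sx sa fun_vanishes_xpow less.IH) auto
  thus "fun_vanishes (\<lambda>x. cx x ^ (i - l) * a l x) 0 i" using l by simp
 qed
 have s2: "smooth_on U (\<lambda>x. \<Sum>l<i. c l * (cx x ^ (i - l) * a l x))"
  using less.prems by (intro smooth_sum smooth_cmult smooth_mult U sx sa) auto
 have s1: "smooth_on U (diffop_fun m a (\<lambda>x. cx x ^ i))"
  unfolding D using less.prems by (intro smooth_add smooth_cmult s2 U sa) auto
 \<comment> \<open>The image of x^i vanishes to order i, and so do its terms with l < i by the
   induction hypothesis. What remains is i! times the coefficient sought, and c i = i! is
   nonzero.\<close>
 have "fun_vanishes (\<lambda>x. inverse (c i) * (diffop_fun m a (\<lambda>x. cx x ^ i) x + (-1) * (\<Sum>l<i. c l * (cx x ^ (i - l) * a l x)))) 0 i"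
  by (intro fun_vanishes_cmult[OF U] fun_vanishes_add[OF U] smooth_add smooth_cmult U s1 s2 v1 v2)
 moreover have "(\<lambda>x. inverse (c i) * (diffop_fun m a (\<lambda>x. cx x ^ i) x + (-1) * (\<Sum>l<i. c l * (cx x ^ (i - l) * a l x)))) = a i"
  unfolding D by (auto simp: c_def)
 ultimately show ?case by simp
qed

lemma complex_borel_version:
 fixes f :: "real => complex"
 assumes "f \<in> borel_measurable lebesgue"
 shows "\<exists>g\<in>BM. AE x in lborel. f x = g x"
proof -
 obtain u where u: "u \<in> borel_measurable lborel" "AE x in lborel. Re (f x) = u x"
  using completion_ex_borel_measurable_real[of "\<lambda>x. Re (f x)" lborel] assms by auto
 obtain v where v: "v \<in> borel_measurable lborel" "AE x in lborel. Im (f x) = v x"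
  using completion_ex_borel_measurable_real[of "\<lambda>x. Im (f x)" lborel] assms by auto
 have [measurable]: "u \<in> BM" "v \<in> BM" using u(1) v(1) by auto
 show ?thesis
 proof (intro bexI[of _ "\<lambda>x. Complex (u x) (v x)"])
  show "AE x in lborel. f x = Complex (u x) (v x)"
   using u(2) v(2) by eventually_elim (simp add: complex_eq_iff)
  have "(\<lambda>x. Complex (u x) (v x)) = (\<lambda>x. cx (u x) + \<i> * cx (v x))"
   by (auto simp: fun_eq_iff complex_eq_iff)
  thus "(\<lambda>x. Complex (u x) (v x)) \<in> BM" by simp
 qed
qed

text \<open>Forms use Borel coefficients on the whole line, whereas the definition of vanishing
  provides a Lebesgue measurable, locally essentially bounded function on \<open>U\<close>.
  Truncating a Borel version where it exceeds the essential bound changes it only on a null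
  set.\<close>

lemma Linf_loc_borel:
 assumes h: "Linf_loc U h" and U: "open U" "{-r..r} \<subseteq> U"
 shows "\<exists>h' C. h' \<in> BM \<and> (\<forall>x. norm (h' x) <= C) \<and> (AE x in lborel. x \<in> {-r<..<r} --> h x = h' x)"
proof -
 have Um: "U \<in> sets lebesgue" using U(1) by auto
 have "h \<in> borel_measurable (lebesgue_on U)" using h by (simp add: Linf_loc_def)
 hence "(\<lambda>x. indicator U x *\<^sub>R h x) \<in> borel_measurable lebesgue"
  using borel_measurable_restrict_space_iff[of U lebesgue h] Um by simp
 then obtain g where g: "g \<in> BM" "AE x in lborel. indicator U x *\<^sub>R h x = g x"
  using complex_borel_version by blast
 obtain C where C: "AE x in lebesgue_on {-r..r}. norm (h x) <= C"
  using h U(2) by (auto simp: Linf_loc_def)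
 have C': "AE x in lborel. x \<in> {-r..r} --> norm (h x) <= C"
  using C by (subst (asm) AE_restrict_space_iff) (auto simp: AE_completion_iff)
 have [measurable]: "g \<in> BM" by (rule g)
 show ?thesis
 proof (intro exI conjI)
  show "(\<lambda>x. if norm (g x) <= C then g x else 0) \<in> BM" by measurable
  show "\<forall>x. norm (if norm (g x) <= C then g x else 0) <= abs C" by auto
  show "AE x in lborel. x \<in> {-r<..<r} --> h x = (if norm (g x) <= C then g x else 0)"
   using g(2) C'
  proof eventually_elim
   case (elim x)
   show ?case
   proof
    assume x: "x \<in> {-r<..<r}"
    hence "x \<in> U" using U(2) by (auto simp: subset_iff)
    thus "h x = (if norm (g x) <= C then g x else 0)" using elim x by auto
   qed
  qed
 qed
qed

lemma integral_lebesgue_on_eq: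
 fixes h :: "real => complex"
 assumes U: "open U" and h: "h \<in> borel_measurable (lebesgue_on U)" and K: "K \<subseteq> U"
  and eq: "AE x in lborel. x \<in> K --> h x = h' x" and h': "h' \<in> BM"
  and f: "f \<in> BM" "!!x. x \<notin> K ==> f x = 0"
 shows "integral\<^sup>L (lebesgue_on U) (\<lambda>x. h x * f x) = (LB x. h' x * f x)"
proof -
 have Um: "U \<in> sets lebesgue" using U(1) by auto
 have 1: "(\<lambda>x. indicator U x *\<^sub>R h x) \<in> borel_measurable lebesgue"
  using borel_measurable_restrict_space_iff[of U lebesgue h] Um h by simp
 have fl: "f \<in> borel_measurable lebesgue" using f(1) by (simp add: measurable_completion)
 have hl: "h' \<in> borel_measurable lebesgue" using h' by (simp add: measurable_completion)
 have "integral\<^sup>L (lebesgue_on U) (\<lambda>x. h x * f x) = integral\<^sup>L lebesgue (\<lambda>x. indicator U x *\<^sub>R (h x * f x))"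
  using Um by (intro integral_restrict_space) simp
 also have "... = integral\<^sup>L lebesgue (\<lambda>x. h' x * f x)"
 proof (rule integral_cong_AE)
  have "(\<lambda>x. (indicator U x *\<^sub>R h x) * f x) \<in> borel_measurable lebesgue"
   by (intro borel_measurable_times 1 fl)
  thus "(\<lambda>x. indicator U x *\<^sub>R (h x * f x)) \<in> borel_measurable lebesgue" by simp
  show "(\<lambda>x. h' x * f x) \<in> borel_measurable lebesgue" by (intro borel_measurable_times hl fl)
  show "AE x in lebesgue. indicator U x *\<^sub>R (h x * f x) = h' x * f x"
   unfolding AE_completion_iff using eq
  proof eventually_elim
   case (elim x)
   thus ?case using K f(2)[of x] by (cases "x \<in> K") auto
  qed
 qed
 also have "... = (LB x. h' x * f x)"
  by (rule integral_completion) (use h' f in simp)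
 finally show ?thesis .
qed

lemma nderiv_bound_near:
 assumes U: "open U" "{-r..r} \<subseteq> U" and b: "smooth_on U b" "fun_vanishes b 0 n"
 shows "\<exists>C. \<forall>x. abs x <= r --> norm (nderiv l b x) <= C * abs x ^ (n - l)"
proof -
 have "continuous_on {-r..r} (nderiv (n - l) (nderiv l b))"
  using smooth_continuous_on[OF smooth_nderiv[OF b(1)]] U(2) continuous_on_subset by blast
 hence "bounded (nderiv (n - l) (nderiv l b) ` {-r..r})" by (intro compact_imp_bounded compact_continuous_image) auto
 then obtain B where B: "\<forall>x\<in>{-r..r}. norm (nderiv (n - l) (nderiv l b) x) <= B" unfolding bounded_iff by blast
 have "norm (nderiv l b x) <= B * abs x ^ (n - l)" if "abs x <= r" for x
  using vanishing_bound[OF smooth_nderiv[OF b(1)] U(2) fun_vanishes_nderiv[OF b(2)], where B=B and x=x] B that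
  by (auto simp: abs_le_iff)
 thus ?thesis by blast
qed

text \<open>In the Leibniz expansion of (b f)^(i), the factor b^(i-l) in front of f^(l) is
  O(|x|^(k+l)). Dividing by x^l leaves a coefficient O(|x|^k) in front of x^l f^(l), an Euler
  operator. The exponent c at infinity is free because the coefficients vanish outside the
  interval.\<close>

lemma rep_vanishing_term:
 assumes h: "Linf_loc U h" and U: "open U" "{-r..r} \<subseteq> U" and r: "0 < r" "r <= 1"
  and b: "smooth_on U b" "fun_vanishes b 0 (k + i)"
 shows "rep (TF {-r<..<r}) k c (\<lambda>f. integral\<^sup>L (lebesgue_on U) (\<lambda>x. h x * nderiv i (\<lambda>x. b x * f x) x))"
proof -
 let ?S = "TF {-r<..<r}"
 obtain h' C where h': "h' \<in> BM" "!!x. norm (h' x) <= C" "AE x in lborel. x \<in> {-r<..<r} --> h x = h' x"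
  using Linf_loc_borel[OF h U] by blast
 have C0: "C >= 0" using norm_nonneg_trans[OF h'(2)] .
 define H where "H l x = (if x \<in> {-r<..<r} then of_nat (i choose l) * h' x * nderiv (i - l) b x * inverse (cx x ^ l) else 0)" for l x
 have H: "wbd k c (H l)" if l: "l <= i" for l
 proof -
  obtain D where D: "!!x. abs x <= r ==> norm (nderiv (i - l) b x) <= D * abs x ^ (k + i - (i - l))"
   using nderiv_bound_near[OF U b] by metis
  have D0: "D >= 0" using norm_nonneg_trans[OF D[of r]] zero_less_power[OF r(1)] r by (simp add: zero_le_mult_iff not_le[symmetric])
  have "wbd k k (H l)"
  proof (rule wbdI[of _ "real (i choose l) * C * D"])
   have "continuous_on {-r<..<r} (nderiv (i - l) b)"
    using smooth_continuous_on[OF b(1)] U(2) continuous_on_subset[of U _ "{-r<..<r}"] by (auto simp: subset_iff)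
   hence [measurable]: "(\<lambda>x. indicator {-r<..<r} x *\<^sub>R nderiv (i - l) b x) \<in> BM"
    by (intro borel_measurable_continuous_on_indicator) auto
   have [measurable]: "h' \<in> BM" by (rule h')
   have "H l = (\<lambda>x. of_nat (i choose l) * h' x * (indicator {-r<..<r} x *\<^sub>R nderiv (i - l) b x) * inverse (cx x ^ l))"
    by (auto simp: H_def)
   moreover have "... \<in> BM" by measurable
   ultimately show "H l \<in> BM" by (simp only:)
   fix x :: real assume x: "x ~= 0"
   show "norm (H l x) <= real (i choose l) * C * D * wt k k x"
   proof (cases "x \<in> {-r<..<r}")
    case True
    have e: "k + i - (i - l) = k + l" using l by simp
    have "norm (H l x) = real (i choose l) * norm (h' x) * norm (nderiv (i - l) b x) * inverse (abs x ^ l)"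
     using True by (simp add: H_def norm_mult norm_inverse norm_power)
    also have "... <= real (i choose l) * C * (D * abs x ^ (k + l)) * inverse (abs x ^ l)"
     using True D[of x] h'(2)[of x] C0 D0 unfolding e
     by (intro mult_mono mult_nonneg_nonneg) auto
    also have "... = real (i choose l) * C * D * abs x ^ k" using x by (simp add: power_add)
    finally show ?thesis using x by (simp add: wt_def powr_realpow)
   next
    case False
    hence "H l x = 0" by (auto simp: H_def)
    thus ?thesis using C0 D0 by simp
   qed
  qed
  thus ?thesis
  proof (rule wbd_far[of _ _ _ r])
   fix x assume "abs x > r" thus "H l x = 0" by (auto simp: H_def)
  qed
 qed
 have "rep ?S k c (\<lambda>f. \<Sum>l\<le>i. LB x. H l x * (cx x ^ l * nderiv l f x))"
  by (intro rep_sum[OF adm_test] rep_nderiv[OF adm_test] H) auto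
 thus ?thesis
 proof (rule rep_cong)
  fix f assume f: "f \<in> ?S"
  obtain K where K: "smooth f" "compact K" "K \<subseteq> {-r<..<r}" "!!x. x \<notin> K ==> f x = 0"
   using f by (rule test_functionsE) blast
  have sfU: "smooth_on U f" using K(1) smooth_subset by blast
  define F where "F = nderiv i (\<lambda>x. b x * f x)"
  have bf: "(\<lambda>x. b x * f x) \<in> ?S"
   by (rule test_mult[OF f b(1) U(1)]) (use U(2) in \<open>auto simp: subset_iff\<close>)
  have Fmeas: "F \<in> BM" unfolding F_def
   using test_nderiv[OF bf] test_smooth smooth_measurable by blast
  have F0: "F x = 0" if "x \<notin> {-r<..<r}" for x
  proof -
   have "x \<notin> K" using that K(3) by auto
   thus ?thesis
    unfolding F_def by (intro nderiv_zero_outside[OF compact_imp_closed[OF K(2)]]) (use K(4) in auto)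
  qed
  have Leib: "F x = (\<Sum>l\<le>i. of_nat (i choose l) * nderiv (i - l) b x * nderiv l f x)" if "x \<in> U" for x
   unfolding F_def using nderiv_mult(1)[OF U(1) sfU b(1) that, of i] by (simp add: mult_ac)
  have "integral\<^sup>L (lebesgue_on U) (\<lambda>x. h x * F x) = (LB x. h' x * F x)"
  proof (rule integral_lebesgue_on_eq[OF U(1) _ _ h'(3,1) Fmeas F0])
   show "h \<in> borel_measurable (lebesgue_on U)" using h by (simp add: Linf_loc_def)
   show "{-r<..<r} \<subseteq> U" using U(2) by (auto simp: subset_iff)
  qed
  also have "... = (LB x. (\<Sum>l\<le>i. H l x * (cx x ^ l * nderiv l f x)))"
  proof (rule integral_cong_AE)
   show "(\<lambda>x. h' x * F x) \<in> borel_measurable lborel" using h'(1) Fmeas by simp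
   have "H l \<in> BM" if "l <= i" for l using H[OF that] wbd_measurable by blast
   moreover have "nderiv l f \<in> BM" for l
    using test_nderiv[OF f] test_smooth smooth_measurable by blast
   ultimately show "(\<lambda>x. \<Sum>l\<le>i. H l x * (cx x ^ l * nderiv l f x)) \<in> borel_measurable lborel"
    by (auto intro!: borel_measurable_sum borel_measurable_times)
   show "AE x in lborel. h' x * F x = (\<Sum>l\<le>i. H l x * (cx x ^ l * nderiv l f x))"
    using AE_lborel_not_0
   proof eventually_elim
    case (elim x)
    show ?case
    proof (cases "x \<in> {-r<..<r}")
     case True
     hence "x \<in> U" using U(2) by (auto simp: subset_iff)
     thus ?thesis using True elim by (auto simp: Leib H_def sum_distrib_left field_simps intro!: sum.cong)
    next
     case False
     hence "H l x = 0" for l by (auto simp: H_def)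
     thus ?thesis using F0[OF False] by simp
    qed
   qed
  qed
  also have "... = (\<Sum>l\<le>i. LB x. H l x * (cx x ^ l * nderiv l f x))"
   using rep_nderiv_aux[OF adm_test _ H] f
   by (intro LB_integral_sum) auto
  finally show "(\<Sum>l\<le>i. LB x. H l x * (cx x ^ l * nderiv l f x)) =
    integral\<^sup>L (lebesgue_on U) (\<lambda>x. h x * nderiv i (\<lambda>x. b x * f x) x)" by (simp add: F_def)
 qed
qed

text \<open>Tangentiality makes the i-th coefficient of an operator vanish to order i, and f_j
  contributes k more; together they meet the order k + i required by
  \<open>rep_vanishing_term\<close>.\<close>

lemma vanishes_imp_rep:
 assumes "vanishes_to T 0 k" "k >= 0"
 shows "\<exists>r. 0 < r \<and> r <= 1 \<and> (\<forall>c. rep (TF {-r<..<r}) (of_int k) c T)"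
proof -
 define n where "n = nat k"
 have n: "real_of_int k = real n" using assms(2) by (simp add: n_def)
 obtain U where U: "open U" "0 \<in> U" "vanishes_nonneg_on U T 0 n"
  using assms by (auto simp: vanishes_to_def n_def)
 obtain s where s: "s > 0" "ball 0 s \<subseteq> U" using U by (meson openE)
 define r where "r = min 1 (s / 2)"
 have r: "0 < r" "r <= 1" "{-r..r} \<subseteq> U" using s by (auto simp: r_def subset_iff dist_real_def min_def split: if_splits)
 let ?S = "TF {-r<..<r}"
 have "rep ?S (real n) c T" for c
  using U(3) unfolding vanishes_nonneg_on_def
 proof (elim exE conjE)
  fix N f m a h
  assume F: "\<forall>j<N. smooth_on U (f j) \<and> fun_vanishes (f j) 0 n \<and> tangential U 0 (m j) (a j) \<and> Linf_loc U (h j)"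
   and T: "\<forall>\<phi>\<in>TF U. T \<phi> = (\<Sum>j<N. mult_distr (f j) (diffop_distr (m j) (a j) (distr_of_fun U (h j))) \<phi>)"
  have "rep ?S n c (\<lambda>\<phi>. \<Sum>j<N. \<Sum>i\<le>m j. (-1) ^ i * integral\<^sup>L (lebesgue_on U) (\<lambda>x. h j x * nderiv i (\<lambda>x. (a j i x * f j x) * \<phi> x) x))"
  proof (intro rep_sum[OF adm_test] rep_cmult rep_vanishing_term[OF _ U(1) r(3,1,2)])
   fix j i assume ji: "j \<in> {..<N}" "i \<in> {..m j}"
   have a: "smooth_on U (a j i)" using F ji by (auto simp: tangential_def)
   thus "smooth_on U (\<lambda>x. a j i x * f j x)" using F ji by (intro smooth_mult U) auto
   have "fun_vanishes (\<lambda>x. a j i x * f j x) 0 (i + n)"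
    using F ji a tangential_coeff[OF _ U(1,2), of "m j" "a j" i] by (intro fun_vanishes_mult[OF U(1,2)]) auto
   thus "fun_vanishes (\<lambda>x. a j i x * f j x) 0 (n + i)" by (simp add: add.commute)
  qed (use F in auto)
  thus ?thesis
  proof (rule rep_cong)
   fix \<phi> assume \<phi>: "\<phi> \<in> ?S"
   have "\<phi> \<in> TF U" by (rule test_mono[OF \<phi>]) (use r(3) in \<open>auto simp: subset_iff\<close>)
   from bspec[OF T this] show "(\<Sum>j<N. \<Sum>i\<le>m j. (-1) ^ i * integral\<^sup>L (lebesgue_on U) (\<lambda>x. h j x * nderiv i (\<lambda>x. (a j i x * f j x) * \<phi> x) x)) = T \<phi>"
    by (simp add: mult_distr_def diffop_distr_def distr_of_fun_def mult.assoc)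
  qed
 qed
 thus ?thesis using r n by auto
qed

text \<open>A differential operator acts on distributions through its transpose, where derivatives
  stand outside the coefficients. Hence Eop^j has to be rewritten with all derivatives
  outermost.\<close>

lemma euler_to_divergence:
 "\<exists>c. \<forall>f x. smooth f -->
   cx x ^ k * (Eop ^^ j) f x = (\<Sum>l\<le>j. c l * nderiv l (\<lambda>y. cx y ^ l * (cx y ^ k * f y)) x)"
proof (induction j)
 case 0
 show ?case by (intro exI[of _ "\<lambda>l. 1"]) simp
next
 case (Suc j)
 obtain c where c: "!!f x. smooth f ==>
   cx x ^ k * (Eop ^^ j) f x = (\<Sum>l\<le>j. c l * nderiv l (\<lambda>y. cx y ^ l * (cx y ^ k * f y)) x)"
  using Suc by blast
 define d where "d l = (if l = 0 then 0 else c (l - 1)) - (if l <= j then of_nat (l + k) * c l else 0)" for l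
 show ?case
 proof (intro exI[of _ d] allI impI)
  fix f :: "real => complex" and x
  assume f: "smooth f"
  define D where "D l = nderiv l (\<lambda>y. cx y ^ l * (cx y ^ k * f y)) x" for l
  have s: "smooth (\<lambda>y. cx y ^ l * (cx y ^ k * f y))" for l
   by (intro smooth_mult smooth_power f) auto
  \<comment> \<open>From D(x^(l+k+1) f) = x^(l+k) Eop f + (l+k) x^(l+k) f, differentiated l times;
    this gives the recursion behind \<open>d\<close>.\<close>
  have e: "nderiv l (\<lambda>y. cx y ^ l * (cx y ^ k * Eop f y)) x = D (Suc l) - of_nat (l + k) * D l" for l
  proof -
   have "cx y ^ (l + k) * Eop f y = nderiv 1 (\<lambda>y. cx y ^ Suc l * (cx y ^ k * f y)) y
     + (- of_nat (l + k)) * (cx y ^ l * (cx y ^ k * f y))" for y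
   proof -
    have "nderiv 1 (\<lambda>y. cx y ^ Suc l * (cx y ^ k * f y)) y = nderiv 1 (\<lambda>y. cx y * (cx y ^ (l + k) * f y)) y"
     by (simp add: power_add mult.assoc)
    also have "... = Eop (\<lambda>y. cx y ^ (l + k) * f y) y"
     by (subst nderiv_1_mult[OF open_UNIV]) (auto simp: Eop_def nderiv_1_of_real intro!: smooth_mult smooth_power f)
    also have "... = cx y ^ (l + k) * Eop f y + of_nat (l + k) * (cx y ^ (l + k) * f y)"
     by (subst Eop_mult'[OF f]) (auto simp: th_xpow intro!: smooth_power)
    finally have X: "nderiv 1 (\<lambda>y. cx y ^ Suc l * (cx y ^ k * f y)) y = cx y ^ (l + k) * Eop f y + of_nat (l + k) * (cx y ^ (l + k) * f y)" .
    have e2: "cx y ^ (l + k) * f y = cx y ^ l * (cx y ^ k * f y)" by (simp add: power_add)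
    show ?thesis unfolding X e2 by (simp add: algebra_simps)
   qed
   hence "nderiv l (\<lambda>y. cx y ^ l * (cx y ^ k * Eop f y)) x = nderiv l (\<lambda>y. nderiv 1 (\<lambda>y. cx y ^ Suc l * (cx y ^ k * f y)) y
     + (- of_nat (l + k)) * (cx y ^ l * (cx y ^ k * f y))) x"
    by (simp add: power_add mult.assoc)
   also have "... = nderiv l (nderiv 1 (\<lambda>y. cx y ^ Suc l * (cx y ^ k * f y))) x
     + nderiv l (\<lambda>y. (- of_nat (l + k)) * (cx y ^ l * (cx y ^ k * f y))) x"
    by (rule nderiv_add[OF open_UNIV smooth_nderiv[OF s] smooth_cmult[OF open_UNIV s]]) simp
   also have "... = D (Suc l) - of_nat (l + k) * D l"
    by (subst nderiv_cmult[OF open_UNIV s]) (auto simp: D_def nderiv_nderiv One_nat_def algebra_simps)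
   finally show ?thesis .
  qed
  have "cx x ^ k * (Eop ^^ Suc j) f x = cx x ^ k * (Eop ^^ j) (Eop f) x"
   by (simp add: funpow_swap1)
  also have "... = (\<Sum>l\<le>j. c l * (D (Suc l) - of_nat (l + k) * D l))"
   by (subst c[OF smooth_Eop[OF open_UNIV f]]) (simp add: e)
  also have "... = (\<Sum>l\<le>j. c l * D (Suc l)) - (\<Sum>l\<le>j. of_nat (l + k) * c l * D l)"
   by (simp add: algebra_simps sum_subtractf)
  also have "(\<Sum>l\<le>j. c l * D (Suc l)) = (\<Sum>l\<le>Suc j. (if l = 0 then 0 else c (l - 1)) * D l)"
   by (subst sum.atMost_Suc_shift) simp
  also have "(\<Sum>l\<le>j. of_nat (l + k) * c l * D l) = (\<Sum>l\<le>Suc j. (if l <= j then of_nat (l + k) * c l else 0) * D l)"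
   by (simp)
  also have "(\<Sum>l\<le>Suc j. (if l = 0 then 0 else c (l - 1)) * D l) - ... = (\<Sum>l\<le>Suc j. d l * D l)"
   unfolding sum_subtractf[symmetric] by (intro sum.cong) (auto simp: d_def algebra_simps)
  finally show "cx x ^ k * (Eop ^^ Suc j) f x = (\<Sum>l\<le>Suc j. d l * nderiv l (\<lambda>y. cx y ^ l * (cx y ^ k * f y)) x)"
   by (simp add: D_def)
 qed
qed

lemma tangential_euler:
 assumes U: "open U" "0 \<in> U" shows "tangential U 0 m (\<lambda>l x. c l * cx x ^ l)"
proof -
 have sx: "smooth_on U (\<lambda>x. c l * cx x ^ l)" for l by (intro smooth_cmult smooth_power U) auto
 have "fun_vanishes (diffop_fun m (\<lambda>l x. c l * cx x ^ l) f) 0 k" if f: "smooth_on U f" "fun_vanishes f 0 k" for k f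
  unfolding diffop_fun_def
 proof (intro fun_vanishes_sum[OF U])
  fix l
  show "smooth_on U (\<lambda>x. c l * cx x ^ l * nderiv l f x)"
   by (intro smooth_mult[OF U(1)] sx smooth_nderiv f)
  have "fun_vanishes (\<lambda>x. c l * cx x ^ l * nderiv l f x) 0 (l + (k - l))"
   by (intro fun_vanishes_mult[OF U] sx smooth_nderiv f fun_vanishes_nderiv fun_vanishes_cmult[OF U] fun_vanishes_xpow smooth_power U) auto
  thus "fun_vanishes (\<lambda>x. c l * cx x ^ l * nderiv l f x) 0 k"
   by (rule fun_vanishes_mono) simp
 qed
 thus ?thesis using sx by (auto simp: tangential_def)
qed

lemma rep_imp_vanishes_nonneg:
 assumes rep: "rep (TF {-r<..<r}) a b T" and "r > 0" and k: "real k <= a"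
 shows "vanishes_to T 0 (int k)"
proof -
 \<comment> \<open>Inside the unit interval only the exponent at 0 matters, and the weight is at
   most 1.\<close>
 define s where "s = min r 1"
 have s: "0 < s" "s <= 1" "{-s<..<s} \<subseteq> {-r<..<r}" using assms(2) by (auto simp: s_def)
 define U where "U = {-s<..<s}"
 have U: "open U" "0 \<in> U" using s by (auto simp: U_def)
 obtain m h where h: "!!i. wbd a b (h i)" "!!f. f \<in> TF {-r<..<r} ==> T f = euler_form m h f"
  using rep unfolding rep_def by blast
 \<comment> \<open>The factor x^k is split off as the f_j of the definition; k <= a keeps what is
   left bounded near 0.\<close>
 define H where "H i x = h i x * inverse (cx x ^ k)" for i x
 have H: "wbd (a - k) (b - k) (H i)" for i
  unfolding H_def using wbd_mult[OF h(1) wbd_xpow_inverse] by simp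
 have "\<forall>j. \<exists>c. \<forall>f x. smooth f -->
   cx x ^ k * (Eop ^^ j) f x = (\<Sum>l\<le>j. c l * nderiv l (\<lambda>y. cx y ^ l * (cx y ^ k * f y)) x)"
  by (intro allI euler_to_divergence)
 from choice[OF this] obtain c where "\<forall>j f x. smooth f -->
   cx x ^ k * (Eop ^^ j) f x = (\<Sum>l\<le>j. c j l * nderiv l (\<lambda>y. cx y ^ l * (cx y ^ k * f y)) x)" ..
 note c = this[rule_format]
 have "vanishes_nonneg_on U T 0 k"
  unfolding vanishes_nonneg_on_def
 proof (intro exI conjI allI impI ballI)
  fix j assume "j < Suc m"
  show "smooth_on U (\<lambda>x. cx x ^ k)" by (intro smooth_power U) auto
  show "fun_vanishes (\<lambda>x. cx x ^ k) 0 k" by (rule fun_vanishes_xpow)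
  \<comment> \<open>The sign cancels the (-1)^l that \<open>diffop_distr\<close> introduces.\<close>
  show "tangential U 0 j (\<lambda>l x. ((-1) ^ l * c j l) * cx x ^ l)" by (rule tangential_euler[OF U])
  show "Linf_loc U (H j)"
   unfolding Linf_loc_def
  proof (intro conjI allI impI)
   show "H j \<in> borel_measurable (lebesgue_on U)"
    using wbd_measurable[OF H, of j] by (simp add: measurable_completion measurable_restrict_space1)
   obtain C where C: "C >= 0" "!!x. x ~= 0 ==> norm (H j x) <= C * wt (a - k) (b - k) x" using H by (rule wbdE) blast
   fix K assume K: "compact K \<and> K \<subseteq> U"
   have "norm (H j x) <= C" if "x \<in> K" "x ~= 0" for x
   proof -
    have "abs x <= 1" using that K s(2) by (auto simp: U_def subset_iff abs_le_iff dest!: bspec)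
    hence "wt (a - k) (b - k) x <= 1" using k by (auto simp: wt_def intro: powr_le1)
    thus ?thesis using C(2)[OF that(2)] mult_left_mono[of _ 1 C] C(1) by fastforce
   qed
   hence "AE x in lborel. x \<in> K --> norm (H j x) <= C"
    using AE_lborel_not_0 by (auto elim!: eventually_mono)
   moreover have "K \<in> sets lebesgue" using K by (auto intro!: borel_compact)
   ultimately show "\<exists>C. AE x in lebesgue_on K. norm (H j x) <= C"
    by (subst AE_restrict_space_iff) (auto simp: AE_completion_iff)
  qed
 next
  fix f assume f: "f \<in> TF U"
  have fr: "f \<in> TF {-r<..<r}" by (rule test_mono[OF f]) (use s in \<open>auto simp: U_def\<close>)
  have sf: "smooth f" using f test_smooth by blast
  define D where "D l = nderiv l (\<lambda>y. cx y ^ l * (cx y ^ k * f y))" for l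
  have D: "D l \<in> TF U" for l unfolding D_def
   using f by (intro test_nderiv test_mult[where V=UNIV] smooth_power) auto
  have Dm: "D l \<in> BM" for l using D test_smooth smooth_measurable by blast
  have intD: "lb_int (\<lambda>x. H j x * D l x)" for j l
   by (rule adm_integrable[OF adm_test _ H D]) (use k in auto)
  have one: "integral\<^sup>L (lebesgue_on U) (\<lambda>x. H j x * D l x) = (LB x. H j x * D l x)" for j l
  proof (rule integral_lebesgue_on_eq[OF U(1) _ order_refl _ wbd_measurable[OF H]])
   show "H j \<in> borel_measurable (lebesgue_on U)"
    using wbd_measurable[OF H, of j] by (simp add: measurable_completion measurable_restrict_space1)
   show "D l \<in> BM" using D test_smooth smooth_measurable by blast
   show "D l x = 0" if "x \<notin> U" for x
    using test_functionsE[OF D[of l]] that by (metis subset_iff)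
  qed auto
  have "T f = (\<Sum>j\<le>m. LB x. h j x * (Eop ^^ j) f x)"
   using h(2)[OF fr] by (simp add: euler_form_def)
  also have "... = (\<Sum>j\<le>m. \<Sum>l\<le>j. c j l * (LB x. H j x * D l x))"
  proof (rule sum.cong[OF refl])
   fix j
   have "(LB x. h j x * (Eop ^^ j) f x) = (LB x. (\<Sum>l\<le>j. c j l * (H j x * D l x)))"
   proof (rule integral_cong_AE)
    show "(\<lambda>x. h j x * (Eop ^^ j) f x) \<in> borel_measurable lborel"
     using wbd_measurable[OF h(1)] smooth_measurable[OF smooth_Eop_funpow[OF open_UNIV sf]] by simp
    show "(\<lambda>x. \<Sum>l\<le>j. c j l * (H j x * D l x)) \<in> borel_measurable lborel"
     using wbd_measurable[OF H] Dm by (intro borel_measurable_sum borel_measurable_times) auto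
    show "AE x in lborel. h j x * (Eop ^^ j) f x = (\<Sum>l\<le>j. c j l * (H j x * D l x))"
     using AE_lborel_not_0
    proof eventually_elim
     case (elim x)
     hence "h j x * (Eop ^^ j) f x = H j x * (cx x ^ k * (Eop ^^ j) f x)" by (simp add: H_def)
     also have "... = (\<Sum>l\<le>j. c j l * (H j x * D l x))"
      unfolding c[OF sf] by (simp add: D_def sum_distrib_left mult_ac)
     finally show ?case .
    qed
   qed
   also have "... = (\<Sum>l\<le>j. c j l * (LB x. H j x * D l x))"
    using intD by (subst LB_integral_sum) auto
   finally show "(LB x. h j x * (Eop ^^ j) f x) = (\<Sum>l\<le>j. c j l * (LB x. H j x * D l x))" .
  qed
  also have "... = (\<Sum>j<Suc m. mult_distr (\<lambda>x. cx x ^ k) (diffop_distr j (\<lambda>l x. ((-1) ^ l * c j l) * cx x ^ l) (distr_of_fun U (H j))) f)"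
   unfolding lessThan_Suc_atMost mult_distr_def diffop_distr_def distr_of_fun_def
  proof (intro sum.cong refl)
   fix j l
   have "nderiv l (\<lambda>x. ((-1) ^ l * c j l) * cx x ^ l * (cx x ^ k * f x)) = (\<lambda>x. ((-1) ^ l * c j l) * D l x)"
    unfolding D_def mult.assoc[of "(-1) ^ l * c j l"] using sf
    by (intro ext nderiv_cmult[OF open_UNIV]) (auto intro!: smooth_mult smooth_power)
   hence "(-1) ^ l * integral\<^sup>L (lebesgue_on U) (\<lambda>x. H j x * nderiv l (\<lambda>x. ((-1) ^ l * c j l) * cx x ^ l * (cx x ^ k * f x)) x)
    = (-1) ^ l * integral\<^sup>L (lebesgue_on U) (\<lambda>x. ((-1) ^ l * c j l) * (H j x * D l x))"
    by (simp add: mult_ac)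
   also have "... = (-1) ^ l * (((-1) ^ l * c j l) * integral\<^sup>L (lebesgue_on U) (\<lambda>x. H j x * D l x))"
    by (subst integral_mult_right_zero) simp
   also have "... = c j l * (LB x. H j x * D l x)"
    by (simp add: one power_mult_distrib[symmetric] mult.assoc[symmetric])
   finally show "c j l * (LB x. H j x * D l x) = (-1) ^ l * integral\<^sup>L (lebesgue_on U) (\<lambda>x. H j x * nderiv l (\<lambda>x. ((-1) ^ l * c j l) * cx x ^ l * (cx x ^ k * f x)) x)" by simp
  qed
  finally show "T f = (\<Sum>j<Suc m. mult_distr (\<lambda>x. cx x ^ k) (diffop_distr j (\<lambda>l x. ((-1) ^ l * c j l) * cx x ^ l) (distr_of_fun U (H j))) f)" .
 qed
 thus ?thesis using U by (auto simp: vanishes_to_def)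
qed

lemma rep_imp_vanishes_neg:
 assumes rep: "rep (TF {-r<..<r}) a b (\<lambda>f. T (\<lambda>x. cx x ^ k * f x))" and "r > 0" "a >= 0" "k > 0"
 shows "vanishes_to T 0 (- int k)"
proof -
 have "vanishes_to (\<lambda>f. T (\<lambda>x. cx x ^ k * f x)) 0 (int 0)"
  by (rule rep_imp_vanishes_nonneg[OF rep]) (use assms in auto)
 then obtain U where U: "open U" "0 \<in> U" "vanishes_nonneg_on U (\<lambda>f. T (\<lambda>x. cx x ^ k * f x)) 0 0"
  by (auto simp: vanishes_to_def)
 have 1: "nderiv 1 cx 0 ~= (0::complex)" by (simp add: nderiv_1_of_real)
 have 2: "mult_distr (\<lambda>x. cx x ^ nat (- (- int k))) T = (\<lambda>f. T (\<lambda>x. cx x ^ k * f x))"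
  by (simp add: mult_distr_def)
 have "\<exists>U z. open U \<and> 0 \<in> U \<and> smooth_on U z \<and> z 0 = 0 \<and> nderiv 1 z 0 ~= 0 \<and>
   vanishes_nonneg_on U (mult_distr (\<lambda>x. z x ^ nat (- (- int k))) T) 0 0"
  by (intro exI[of _ U] exI[of _ cx] conjI U 1 smooth_of_real) (use U(3) 2 in simp_all)
 thus ?thesis using assms(4) by (simp add: vanishes_to_def)
qed

lemma test_xpow: "f \<in> TF U ==> (\<lambda>x. cx x ^ n * f x) \<in> TF U"
 by (rule test_mult[OF _ smooth_power[OF open_UNIV smooth_of_real]]) auto

lemma rep_imp_vanishes:
 assumes rep: "rep (TF {-r<..<r}) a b T" and r: "r > 0" and a: "a >= 0" "of_int k <= a"
 shows "vanishes_to T 0 k"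
proof (cases "k >= 0")
 case True
 thus ?thesis using rep_imp_vanishes_nonneg[OF rep r, of "nat k"] a by simp
next
 case False
 define n where "n = nat (- k)"
 have "rep (TF {-r<..<r}) (a + n) (b + n) (\<lambda>f. T (\<lambda>x. cx x ^ n * f x))"
  by (rule rep_xpow[OF adm_test _ rep test_xpow]) (use a in simp)
 from rep_imp_vanishes_neg[OF this r] show ?thesis using a False by (auto simp: n_def)
qed

lemma Eop_funpow_zero:
 assumes "closed K" "!!x. x \<notin> K ==> f x = 0" "x \<notin> K"
 shows "(Eop ^^ j) f x = 0"
 using assms(3)
proof (induction j arbitrary: x)
 case (Suc j)
 have "(Eop ^^ j) f x = 0" "nderiv 1 ((Eop ^^ j) f) x = 0"
  using Suc nderiv_zero_outside[OF assms(1), of "(Eop ^^ j) f" x 1] by auto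
 thus ?case by (simp add: Eop_def[of "(Eop ^^ j) f"])
qed (use assms in auto)

section \<open>Dilations and distributions supported at the origin\<close>

lemma Eop_dilate:
 assumes "smooth f"
 shows "Eop (\<lambda>x. f (c * x)) = (\<lambda>x. Eop f (c * x))" and "th (\<lambda>x. f (c * x)) = (\<lambda>x. th f (c * x))"
 using smooth_affine(2)[OF assms, of 1 c 0] by (auto simp: Eop_def th_def fun_eq_iff)

lemma smooth_dilate: "smooth f ==> smooth (\<lambda>x. f (c * x))"
 using smooth_affine(1)[of f c 0] by simp

lemma Eop_funpow_dilate:
 assumes "smooth f"
 shows "(Eop ^^ j) (\<lambda>x. f (c * x)) = (\<lambda>x. (Eop ^^ j) f (c * x))"
 by (induction j) (auto simp: Eop_dilate[OF smooth_Eop_funpow[OF open_UNIV assms]])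

text \<open>The bound is uniform in the dilation c because the Euler operator commutes with
  dilations: th of g(c x) is (th g)(c x), with no factor c.\<close>

lemma Eop_funpow_cutoff_bound:
 assumes "g \<in> testR" "f \<in> testR"
 shows "\<exists>C. \<forall>c x. norm ((Eop ^^ j) (\<lambda>x. g (c * x) * f x) x) <= C"
 using assms
proof (induction j arbitrary: g f)
 case 0
 obtain A B where AB: "!!x. norm (g x) <= A" "!!x. norm (f x) <= B"
  using test_bounded[OF 0(1), of 0] test_bounded[OF 0(2), of 0] by auto
 have "A >= 0" using norm_nonneg_trans[OF AB(1)] .
 hence "norm (g (c * x) * f x) <= A * B" for c x
  unfolding norm_mult using AB by (intro mult_mono) auto
 thus ?case by auto
next
 case (Suc j)
 obtain C where C: "!!c x. norm ((Eop ^^ j) (\<lambda>x. g (c * x) * Eop f x) x) <= C"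
  using Suc.IH[OF Suc.prems(1) test_functions_Eop[OF Suc.prems(2)]] by blast
 obtain D where D: "!!c x. norm ((Eop ^^ j) (\<lambda>x. th g (c * x) * f x) x) <= D"
  using Suc.IH[OF th_test[OF Suc.prems(1)] Suc.prems(2)] by blast
 have s: "smooth f" "smooth g" using Suc.prems by (auto simp: test_smooth)
 have "norm ((Eop ^^ Suc j) (\<lambda>x. g (c * x) * f x) x) <= C + D" for c x
 proof -
  have "(Eop ^^ Suc j) (\<lambda>x. g (c * x) * f x) = (Eop ^^ j) (\<lambda>x. g (c * x) * Eop f x + th g (c * x) * f x)"
   using Eop_mult'[OF s(1) smooth_dilate[OF s(2)], of c] Eop_dilate(2)[OF s(2), of c]
   by (simp add: funpow_swap1)
  also have "... = (\<lambda>x. (Eop ^^ j) (\<lambda>x. g (c * x) * Eop f x) x + (Eop ^^ j) (\<lambda>x. th g (c * x) * f x) x)"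
   by (intro Eop_funpow_add smooth_mult smooth_dilate smooth_Eop smooth_th s) auto
  finally show ?thesis using C[of c x] D[of c x] by (auto intro: norm_triangle_mono)
 qed
 thus ?case by blast
qed

lemma euler_form_add:
 assumes S: "adm n S" "a + n > -1" and h: "!!i. wbd a b (h i)" and fg: "f \<in> S" "g \<in> S"
 shows "euler_form m h (\<lambda>x. f x + g x) = euler_form m h f + euler_form m h g"
 unfolding euler_form_def sum.distrib[symmetric]
proof (intro sum.cong refl)
 fix i
 have "(Eop ^^ i) (\<lambda>x. f x + g x) = (\<lambda>x. (Eop ^^ i) f x + (Eop ^^ i) g x)"
  by (intro Eop_funpow_add adm_smooth[OF S(1)] fg)
 thus "(LB x. h i x * (Eop ^^ i) (\<lambda>x. f x + g x) x) = (LB x. h i x * (Eop ^^ i) f x) + (LB x. h i x * (Eop ^^ i) g x)"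
  using adm_integrable[OF S h adm_funpow[OF S(1) fg(1)]] adm_integrable[OF S h adm_funpow[OF S(1) fg(2)]]
  by (simp add: ring_distribs)
qed

lemma euler_form_cmult:
 assumes "smooth f" shows "euler_form m h (\<lambda>x. c * f x) = c * euler_form m h f"
 unfolding euler_form_def sum_distrib_left
proof (intro sum.cong refl)
 fix i
 have "(LB x. h i x * (Eop ^^ i) (\<lambda>x. c * f x) x) = (LB x. c * (h i x * (Eop ^^ i) f x))"
  by (simp add: Eop_funpow_cmult[OF assms] mult_ac)
 thus "(LB x. h i x * (Eop ^^ i) (\<lambda>x. c * f x) x) = c * (LB x. h i x * (Eop ^^ i) f x)"
  by simp
qed

text \<open>Replacing f by its part at distance O(1/n) from 0 does not change \<open>T f\<close>. By
  \<open>Eop_funpow_cutoff_bound\<close> the Euler derivatives of these parts stay bounded, and they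
  vanish at each x ~= 0 eventually, so the form tends to 0 by dominated convergence. Delta functions
  and their derivatives are excluded because exponent 0 makes the coefficients bounded near
  0.\<close>

lemma rep_point_support_zero:
 assumes T: "linear_functional_on (testR) T" and rep: "rep (TF {-r<..<r}) 0 b T" and r: "r > 0"
  and z: "!!f. f \<in> test0 ==> T f = 0" and f: "f \<in> testR"
 shows "T f = 0"
proof -
 obtain m h where h: "!!i. wbd 0 b (h i)" "!!f. f \<in> TF {-r<..<r} ==> T f = euler_form m h f"
  using rep unfolding rep_def by blast
 define F where "F n = (\<lambda>x. cutoff (real n * x) * f x)" for n
 have sf: "smooth f" and sc: "smooth (\<lambda>x. cutoff (real n * x))" for n
  by (rule test_smooth[OF f]) (rule smooth_dilate[OF smooth_cutoff])
 have F: "F n \<in> testR" for n unfolding F_def by (rule test_mult[OF f sc]) auto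
 have F0: "F n x = 0" if "abs x >= 2 / n" "n > 0" for n x
  using that cutoff_0[of "real n * x"] by (simp add: F_def abs_mult divide_le_eq mult.commute)
 obtain R where R: "R > 0" "!!x. abs x >= R ==> f x = 0" using test_bounded_subset[OF f] by blast
 have "T f = T (F n)" if "n > 0" for n
 proof -
  have G: "(\<lambda>x. f x - F n x) \<in> test0"
   by (rule test_away_0I[OF smooth_diff[OF open_UNIV sf test_smooth[OF F]], where r = "1 / real n" and R = R])
    (use that R in \<open>auto simp: F_def abs_mult field_simps intro!: cutoff_1\<close>)
  have "T (\<lambda>x. F n x + (f x - F n x)) = T (F n) + T (\<lambda>x. f x - F n x)"
   using T[unfolded linear_functional_on_def, THEN conjunct1, rule_format, OF F test_mono[OF G subset_UNIV]] .
  thus ?thesis using z[OF G] by simp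
 qed
 moreover have "T (F n) = euler_form m h (F n)" if "n > 2 / r" for n
 proof (rule h(2))
  have "real n > 0" using that r by (rule_tac less_trans[of _ "2 / r"]) auto
  hence n: "n > 0" "2 / n < r" using that r by (auto simp: field_simps)
  show "F n \<in> TF {-r<..<r}"
   by (rule test_functionsI[OF test_smooth[OF F], of "{-2/n..2/n}"]) (use n F0 in \<open>auto simp: abs_if not_le\<close>)
 qed
 moreover have "(\<lambda>n. euler_form m h (F n)) \<longlonglongrightarrow> (\<Sum>i\<le>m. (LINT x::real|lborel. 0))"
  unfolding euler_form_def
 proof (intro tendsto_sum)
  fix i
  obtain C where C: "!!c x. norm ((Eop ^^ i) (\<lambda>x. cutoff (c * x) * f x) x) <= C"
   using Eop_funpow_cutoff_bound[OF cutoff_test f, of i] by blast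
  note [measurable] = wbd_measurable[OF h(1)]
  have [measurable]: "(Eop ^^ i) (F n) \<in> BM" for n
   by (intro smooth_measurable smooth_Eop_funpow test_smooth[OF F] open_UNIV)
  show "(\<lambda>n. LB x. h i x * (Eop ^^ i) (F n) x) \<longlonglongrightarrow> (LINT x::real|lborel. 0)"
  proof (rule integral_dominated_convergence[where w = "\<lambda>x. C * norm (h i x * indicator {-R..R} x)"])
   have "wbd 0 (-b - 2) (\<lambda>x. indicator {-R..R} x :: complex)"
    by (rule wbd_far[of 0 0 _ R], rule wbd_bounded[of _ 1]) (auto simp: indicator_def)
   from wbd_integrable_mult[OF h(1) this] show "lb_int (\<lambda>x. C * norm (h i x * indicator {-R..R} x))" by auto
   show "AE x in lborel. (\<lambda>n. h i x * (Eop ^^ i) (F n) x) \<longlonglongrightarrow> 0"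
    using AE_lborel_not_0
   proof eventually_elim
    case (elim x)
    obtain N where N: "real N > 2 / abs x" using reals_Archimedean2 by blast
    have "(Eop ^^ i) (F n) x = 0" if "n >= N" for n
    proof -
     have "real n > 2 / abs x" using N that by linarith
     moreover from this have "n > 0" using elim by (intro Nat.gr0I) auto
     ultimately have n: "n > 0" "abs x > 2 / n" using elim by (auto simp: field_simps)
     thus ?thesis by (intro Eop_funpow_zero[of "{-2/n..2/n}"]) (auto simp: abs_if not_le intro!: F0 split: if_splits)
    qed
    thus ?case by (intro tendsto_eventually eventually_sequentiallyI[of N]) simp
   qed
   show "AE x in lborel. norm (h i x * (Eop ^^ i) (F n) x) <= C * norm (h i x * indicator {-R..R} x)" for n
   proof (intro AE_I2)
    fix x
    have "(Eop ^^ i) (F n) x = 0" if "x \<notin> {-R..R}"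
     by (rule Eop_funpow_zero[OF _ _ that]) (use R in \<open>auto simp: F_def abs_if\<close>)
    thus "norm (h i x * (Eop ^^ i) (F n) x) <= C * norm (h i x * indicator {-R..R} x)"
     using mult_left_mono[OF C[of "real n" x] norm_ge_zero[of "h i x"]]
     by (auto simp: norm_mult F_def indicator_def mult.commute)
   qed
  qed measurable
 qed
 ultimately have "(\<lambda>n. T f) \<longlonglongrightarrow> (\<Sum>i\<le>m. (LINT x::real|lborel. 0))"
 proof (elim Lim_transform_eventually)
  obtain N where N: "real N > 2 / r" using reals_Archimedean2 by blast
  show "\<forall>\<^sub>F n in sequentially. euler_form m h (F n) = T f"
  proof (rule eventually_sequentiallyI[of "Suc N"])
   fix n assume "n >= Suc N"
   hence "n > 0" "real n > 2 / r" using N by auto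
   thus "euler_form m h (F n) = T f" using \<open>!!n. n > 0 ==> T f = T (F n)\<close> \<open>!!n. 2 / r < real n ==> T (F n) = euler_form m h (F n)\<close> by simp
  qed
 qed
 thus ?thesis by (simp add: LIMSEQ_const_iff)
qed

text \<open>Used to differentiate integrals and values of distributions in a parameter: a
  second-order remainder bound passes through the pairing, and the derivative can be read off
  afterwards.\<close>

lemma has_vector_derivative_quadratic:
 fixes F :: "real => complex"
 assumes "d > 0" "!!h. abs h < d ==> norm (F (x + h) - F x - cx h * D) <= K * h^2"
 shows "(F has_vd D) (at x)"
proof -
 have "((\<lambda>h. norm (F (x + h) - F x - h *\<^sub>R D) / norm h) \<longlongrightarrow> 0) (at 0)"
 proof (rule Lim_null_comparison)
  have "eventually (\<lambda>h. abs h < d) (at (0::real))"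
   using assms(1) by (auto simp: eventually_at dist_real_def intro!: exI[of _ d])
  thus "\<forall>\<^sub>F h in at 0. norm (norm (F (x + h) - F x - h *\<^sub>R D) / norm h) <= K * abs h"
   unfolding eventually_at_filter
  proof eventually_elim
   case (elim h)
   show ?case
   proof (intro impI)
    assume "h ~= 0" "h \<in> UNIV"
    thus "norm (norm (F (x + h) - F x - h *\<^sub>R D) / norm h) <= K * abs h"
     using assms(2)[of h] elim by (auto simp: scaleR_conv_of_real divide_le_eq power2_eq_square mult.assoc abs_mult[symmetric])
   qed
  qed
  have "((\<lambda>h. K * abs h) \<longlongrightarrow> K * abs 0) (at 0)" by (intro tendsto_intros)
  thus "((\<lambda>h. K * abs h) \<longlongrightarrow> 0) (at 0)" by simp
 qed
 thus ?thesis
  by (simp add: has_vector_derivative_def has_derivative_at bounded_linear_scaleR_left)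
qed

lemma smooth_lipschitz:
 assumes "smooth f" "!!x. norm (nderiv 1 f x) <= A"
 shows "norm (f u - f v) <= A * abs (u - v)"
proof -
 have "norm (f u - f v) <= A * norm (u - v)"
 proof (rule differentiable_bound[where f'="\<lambda>y h. h *\<^sub>R nderiv 1 f y" and S=UNIV])
  fix y
  show "(f has_derivative (\<lambda>h. h *\<^sub>R nderiv 1 f y)) (at y within UNIV)"
   using smooth_hvd1[OF assms(1), of y] by (simp add: has_vector_derivative_def)
  show "onorm (\<lambda>h. h *\<^sub>R nderiv 1 f y) <= A"
   using assms(2)[of y] by (intro order_trans[OF onorm_bound]) (auto simp: mult.commute)
 qed auto
 thus ?thesis by simp
qed

lemma smooth_taylor1:
 assumes f: "smooth f" and A: "!!x. norm (nderiv 2 f x) <= A"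
 shows "norm (f (u + h) - f u - cx h * nderiv 1 f u) <= A * h^2"
proof -
 define g where "g t = f t - cx t * nderiv 1 f u" for t
 have n2: "nderiv 1 (nderiv 1 f) = nderiv 2 f" by (simp add: nderiv_nderiv)
 have A0: "A >= 0" using norm_nonneg_trans[OF A] .
 have "norm (g (u + h) - g u) <= (A * abs h) * norm ((u + h) - u)"
 proof (rule differentiable_bound[where f'="\<lambda>y k. k *\<^sub>R (nderiv 1 f y - nderiv 1 f u)" and S="cball u (abs h)"])
  fix y assume y: "y \<in> cball u (abs h)"
  have "(cx has_vd (1::complex)) (at y)"
   using smooth_hvd1[OF smooth_of_real, of y UNIV] by (simp add: nderiv_1_of_real)
  note od = has_vector_derivative_at_within[OF this]
  have "(g has_vd nderiv 1 f y - 1 * nderiv 1 f u) (at y within cball u (abs h))"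
   unfolding g_def
   by (intro has_vector_derivative_diff has_vector_derivative_mult_left
     has_vector_derivative_at_within[OF smooth_hvd1[OF f]] od) auto
  thus "(g has_derivative (\<lambda>k. k *\<^sub>R (nderiv 1 f y - nderiv 1 f u))) (at y within cball u (abs h))"
   by (simp add: has_vector_derivative_def)
  have "norm (nderiv 1 f y - nderiv 1 f u) <= A * abs (y - u)"
   by (rule smooth_lipschitz[OF smooth_nderiv[OF f]]) (simp add: n2 A)
  also have "... <= A * abs h" using y A0 by (intro mult_left_mono) (auto simp: dist_real_def)
  finally have "norm (nderiv 1 f y - nderiv 1 f u) <= A * abs h" .
  thus "onorm (\<lambda>k. k *\<^sub>R (nderiv 1 f y - nderiv 1 f u)) <= A * abs h"
   by (intro order_trans[OF onorm_bound]) (auto simp: mult.commute)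
 qed (auto simp: dist_real_def)
 thus ?thesis by (simp add: g_def algebra_simps power2_eq_square abs_mult[symmetric])
qed

section \<open>Density of the test functions in the Schwartz space\<close>

lemma sbd_compact:
 assumes "!!y. abs y > R ==> F y = 0" "!!n y. n <= N ==> norm (nderiv n F y) <= B"
 shows "sbd N F ((max 1 R) ^ N * B)"
 unfolding sbd_def
proof (intro allI impI)
 fix m n x assume mn: "m <= N" "n <= N"
 have B: "B >= 0" using norm_nonneg_trans[OF assms(2)[of 0 0]] by simp
 show "norm (cx x ^ m * nderiv n F x) <= (max 1 R) ^ N * B"
 proof (cases "abs x > R")
  case True
  have "nderiv n F x = 0"
   by (rule nderiv_zero_outside[of "{-R..R}"]) (use assms(1) True in auto)
  thus ?thesis using B by simp
 next
  case False
  have "abs x ^ m <= (max 1 R) ^ m" using False by (intro power_mono) auto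
  also have "... <= (max 1 R) ^ N" using mn by (intro power_increasing) auto
  finally show ?thesis using assms(2)[OF mn(2), of x] B by (auto simp: norm_mult norm_power intro!: mult_mono)
 qed
qed

text \<open>On the support of g one has |x| >= R, so one spare power of x, taken from the next
  seminorm, is worth a factor 1/R.\<close>

lemma sbd_mult_far:
 assumes "sbd (Suc N) f B" "!!k x. k <= N ==> norm (nderiv k g x) <= G" "smooth f" "smooth g"
  "R > 0" "!!x. abs x < R ==> g x = 0"
 shows "sbd N (\<lambda>x. g x * f x) (2 ^ N * G * B / R)"
 unfolding sbd_def
proof (intro allI impI)
 fix m n x assume mn: "m <= N" "n <= N"
 have G: "G >= 0" using norm_nonneg_trans[OF assms(2)[of 0 0]] by simp
 have B: "B >= 0" using sbd_nonneg[OF assms(1)] .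
 have L: "nderiv n (\<lambda>x. g x * f x) x = (\<Sum>k\<le>n. of_nat (n choose k) * nderiv k g x * nderiv (n - k) f x)"
  by (rule nderiv_mult(1)[OF open_UNIV assms(4,3)]) simp
 show "norm (cx x ^ m * nderiv n (\<lambda>x. g x * f x) x) <= 2 ^ N * G * B / R"
 proof (cases "abs x < R")
  case True
  have "nderiv k g x = nderiv k (\<lambda>x. 0) x" for k
   by (rule nderiv_cong_open[of "{-R<..<R}"]) (use assms(6) True in auto)
  hence "nderiv k g x = 0" for k by simp
  thus ?thesis using G B assms(5) by (simp add: L)
 next
  case False
  have row: "(\<Sum>k\<le>n. real (n choose k)) = 2 ^ n"
   by (simp add: of_nat_sum[symmetric] choose_row_sum del: of_nat_sum)
  have "norm (cx x ^ m * nderiv n (\<lambda>x. g x * f x) x)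
    = norm (\<Sum>k\<le>n. of_nat (n choose k) * nderiv k g x * (cx x ^ m * nderiv (n - k) f x))"
   unfolding L by (simp add: sum_distrib_left mult_ac)
  also have "... <= (\<Sum>k\<le>n. of_nat (n choose k) * G * (B / R))"
  proof (intro order_trans[OF norm_sum] sum_mono)
   fix k assume k: "k \<in> {..n}"
   have "R * norm (cx x ^ m * nderiv (n - k) f x) <= abs x * norm (cx x ^ m * nderiv (n - k) f x)"
    using False by (intro mult_right_mono) auto
   also have "... = norm (cx x ^ Suc m * nderiv (n - k) f x)" by (simp add: norm_mult mult.assoc)
   also have "... <= B" using mn by (intro sbdD[OF assms(1)]) auto
   finally have "norm (cx x ^ m * nderiv (n - k) f x) <= B / R" using assms(5) by (simp add: field_simps)
   thus "norm (of_nat (n choose k) * nderiv k g x * (cx x ^ m * nderiv (n - k) f x)) <= of_nat (n choose k) * G * (B / R)"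
    using k mn assms(2)[of k x] G unfolding norm_mult[of "of_nat (n choose k) * nderiv k g x"] norm_mult[of "of_nat (n choose k)"]
    by (intro mult_mono mult_nonneg_nonneg) auto
  qed
  also have "... = 2 ^ n * G * (B / R)" by (simp only: sum_distrib_right[symmetric] row)
  also have "... <= 2 ^ N * G * (B / R)"
   using mn G B assms(5) by (intro mult_right_mono) auto
  finally show ?thesis by simp
 qed
qed

lemma cutoff_dilate_test: "R > 0 ==> (\<lambda>x. cutoff (x / R)) \<in> testR"
proof (rule test_functionsI[of _ "{-2*R..2*R}"])
 show "smooth (\<lambda>x. cutoff (x / R))"
  using smooth_dilate[OF smooth_cutoff, of "1 / R"] by simp
 fix x assume "R > 0" "x \<notin> {-2*R..2*R}"
 thus "cutoff (x / R) = 0" by (intro cutoff_0) (auto simp: abs_divide field_simps abs_if)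
qed auto

lemma cutoff_compl_bound: "\<exists>G. \<forall>R\<ge>1. \<forall>k\<le>N. \<forall>x. norm (nderiv k (\<lambda>x. 1 - cutoff (x / R)) x) <= G"
proof -
 obtain b where b: "!!n x. norm (nderiv n cutoff x) <= b n" using test_bounded[OF cutoff_test] by metis
 have "norm (nderiv k (\<lambda>x. 1 - cutoff (x / R)) x) <= 1 + Max (b ` {..N})" if R: "R >= 1" and k: "k <= N" for R k x
 proof -
  have s: "smooth (\<lambda>x. cutoff (x / R))" using smooth_dilate[OF smooth_cutoff, of "1 / R"] by simp
  have "nderiv k (\<lambda>x. 1 + (-1) * cutoff (x / R)) x = nderiv k (\<lambda>x. 1) x + nderiv k (\<lambda>x. (-1) * cutoff (x / R)) x"
   by (rule nderiv_add[OF open_UNIV _ smooth_cmult[OF open_UNIV s]]) auto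
  also have "nderiv k (\<lambda>x. (-1) * cutoff (x / R)) x = (-1) * nderiv k (\<lambda>x. cutoff (x / R)) x"
   by (rule nderiv_cmult[OF open_UNIV s]) simp
  also have "nderiv k (\<lambda>x. cutoff (x / R)) x = cx (1 / R) ^ k * nderiv k cutoff (x / R)"
   using smooth_affine(2)[OF smooth_cutoff, of k "1 / R" 0 x] by simp
  finally have "norm (nderiv k (\<lambda>x. 1 - cutoff (x / R)) x) <= norm (nderiv k (\<lambda>x. 1::complex) x) + norm (cx (1 / R) ^ k * nderiv k cutoff (x / R))"
   using norm_triangle_ineq4[of "nderiv k (\<lambda>x. 1::complex) x" "cx (1 / R) ^ k * nderiv k cutoff (x / R)"] by simp
  also have "... <= 1 + 1 * b k"
  proof (intro add_mono)
   have "norm (cx (1 / R) ^ k) <= 1" using R by (simp add: norm_power norm_divide power_le_one)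
   thus "norm (cx (1 / R) ^ k * nderiv k cutoff (x / R)) <= 1 * b k"
    unfolding norm_mult using b by (intro mult_mono) auto
  qed auto
  also have "b k <= Max (b ` {..N})" using k by (intro Max_ge) auto
  finally show ?thesis by simp
 qed
 thus ?thesis by blast
qed

text \<open>The tail (1 - cutoff(x/R)) f has seminorms O(1/R), because the derivatives of the
  dilated cutoff are bounded uniformly in R >= 1.\<close>

lemma tempered_zero_on_test:
 assumes add: "!!f g. f \<in> schwartz ==> g \<in> schwartz ==> D (\<lambda>x. f x + g x) = D f + D g"
  and bd: "!!f B. f \<in> schwartz ==> sbd N f B ==> norm (D f) <= C * B"
  and z: "!!f. f \<in> testR ==> D f = (0::complex)"
  and f: "f \<in> schwartz"
 shows "D f = 0"
proof -
 obtain B where B: "sbd (Suc N) f B" using sbd_exists[OF f] by blast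
 obtain G where G: "!!R k x. R >= 1 ==> k <= N ==> norm (nderiv k (\<lambda>x. 1 - cutoff (x / R)) x) <= G"
  using cutoff_compl_bound[of N] by blast
 have sf: "smooth f" using schwartz_smooth[OF f] .
 have bound: "norm (D f) <= C * (2 ^ N * G * B) / R" if R: "R >= 1" for R
 proof -
  have t: "(\<lambda>x. cutoff (x / R)) \<in> testR" using R by (intro cutoff_dilate_test) simp
  have s: "smooth (\<lambda>x. 1 - cutoff (x / R))"
   by (intro smooth_diff test_smooth[OF t] smooth_const open_UNIV)
  have 1: "(\<lambda>x. cutoff (x / R) * f x) \<in> testR"
   using test_mult[OF t sf open_UNIV] by (simp add: mult.commute)
  have bs: "bdd_smooth (\<lambda>x. 1 + (-1) * cutoff (x / R))"
   by (intro bdd_smooth_add bdd_smooth_const bdd_smooth_test[OF test_cmult[OF t]])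
  hence 2: "(\<lambda>x. (1 - cutoff (x / R)) * f x) \<in> schwartz"
   using tame_schwartz[OF tame_mult[OF bs] f] by simp
  have "sbd N (\<lambda>x. (1 - cutoff (x / R)) * f x) (2 ^ N * G * B / R)"
  proof (rule sbd_mult_far[OF B G[OF R] sf s])
   fix x assume "abs x < R"
   thus "1 - cutoff (x / R) = 0" using R by (subst cutoff_1) (auto simp: abs_divide)
  qed (use R in auto)
  from bd[OF 2 this] have "norm (D (\<lambda>x. (1 - cutoff (x / R)) * f x)) <= C * (2 ^ N * G * B) / R" by simp
  moreover have "D f = D (\<lambda>x. cutoff (x / R) * f x) + D (\<lambda>x. (1 - cutoff (x / R)) * f x)"
   using add[OF test_schwartz[OF 1] 2] by (simp add: algebra_simps)
  ultimately show ?thesis using z[OF 1] by simp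
 qed
 have "norm (D f) <= 0"
 proof (rule tendsto_le[of at_top "\<lambda>R. C * (2 ^ N * G * B) / R" 0])
  show "((\<lambda>R. C * (2 ^ N * G * B) / R) \<longlongrightarrow> 0) at_top" by (intro tendsto_divide_0[OF tendsto_const] filterlim_at_top_imp_at_infinity filterlim_ident)
  show "\<forall>\<^sub>F R in at_top. norm (D f) <= C * (2 ^ N * G * B) / R"
   using eventually_ge_at_top[of 1] by eventually_elim (rule bound)
 qed auto
 thus ?thesis by simp
qed

lemma temperedD:
 assumes "tempered T"
 shows "!!f g. f \<in> schwartz ==> g \<in> schwartz ==> T (\<lambda>x. f x + g x) = T f + T g"
  and "!!f c. f \<in> schwartz ==> T (\<lambda>x. c * f x) = c * T f"
  and "\<exists>C N. C >= 0 \<and> (\<forall>f\<in>schwartz. \<forall>B. sbd N f B --> norm (T f) <= C * B)"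
proof -
 show "!!f g. f \<in> schwartz ==> g \<in> schwartz ==> T (\<lambda>x. f x + g x) = T f + T g"
  and "!!f c. f \<in> schwartz ==> T (\<lambda>x. c * f x) = c * T f"
  using assms by (auto simp: tempered_def linear_functional_on_def)
 obtain C N where C: "!!f B. f \<in> schwartz ==> sbd N f B ==> norm (T f) <= C * B"
  using assms unfolding tempered_def sbd_def by blast
 have "norm (T f) <= abs C * B" if "f \<in> schwartz" "sbd N f B" for f B
  using C[OF that] sbd_nonneg[OF that(2)] by (meson abs_ge_self mult_right_mono order_trans)
 thus "\<exists>C N. C >= 0 \<and> (\<forall>f\<in>schwartz. \<forall>B. sbd N f B --> norm (T f) <= C * B)"
  by (intro exI[of _ "abs C"] exI[of _ N]) auto
qed

lemma tempered_diff: 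
 assumes "tempered T" "f \<in> schwartz" "g \<in> schwartz" shows "T (\<lambda>x. f x - g x) = T f - T g"
 using temperedD(1)[OF assms(1,2) tame_schwartz[OF tame_cmult assms(3), of "-1"]] temperedD(2)[OF assms(1,3), of "-1"]
 by simp

text \<open>For a > -1 the form is itself continuous on the Schwartz space, so its difference from T
  falls under \<open>tempered_zero_on_test\<close>.\<close>

lemma rep_test_imp_schwartz:
 assumes T: "tempered T" and h: "!!i. wbd a b (h i)" and a: "a > -1"
  and eq: "!!f. f \<in> testR ==> T f = euler_form m h f"
  and f: "f \<in> schwartz"
 shows "T f = euler_form m h f"
proof -
 obtain C N where C: "C >= 0" "!!f B. f \<in> schwartz ==> sbd N f B ==> norm (T f) <= C * B"
  using temperedD(3)[OF T] by blast
 obtain C' N' where C': "C' >= 0" "!!f B. f \<in> schwartz ==> sbd N' f B ==> norm (euler_form m h f) <= C' * B"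
  using euler_form_tempered[where h=h and m=m, OF h a] by blast
 have "T f - euler_form m h f = 0"
 proof (rule tempered_zero_on_test[where N="max N N'" and C="C + C'", OF _ _ _ f])
  fix f g :: "real => complex" assume "f \<in> schwartz" "g \<in> schwartz"
  thus "T (\<lambda>x. f x + g x) - euler_form m h (\<lambda>x. f x + g x) = T f - euler_form m h f + (T g - euler_form m h g)"
   using temperedD(1)[OF T] euler_form_add[OF adm_Sz[of 0 0] _ h] a by (simp add: Sz_0)
 next
  fix f :: "real => complex" and B assume f: "f \<in> schwartz" "sbd (max N N') f B"
  have "norm (T f - euler_form m h f) <= norm (T f) + norm (euler_form m h f)" by (rule norm_triangle_ineq4)
  also have "... <= C * B + C' * B"
   using f by (intro add_mono C C') (auto elim: sbd_mono)
  finally show "norm (T f - euler_form m h f) <= (C + C') * B" by (simp add: ring_distribs)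
 qed (use eq in auto)
 thus ?thesis by simp
qed

lemma rep_test_schwartz:
 assumes "tempered T" "rep (testR) a b T" "a > -1"
 shows "rep schwartz a b T"
proof -
 obtain m h where h: "!!i. wbd a b (h i)" "!!f. f \<in> testR ==> T f = euler_form m h f"
  using assms(2) unfolding rep_def by blast
 show ?thesis by (rule repI[OF h(1)]) (rule rep_test_imp_schwartz[OF assms(1) h(1) assms(3) h(2)])
qed

section \<open>The structure theorem\<close>

definition conv :: "(real => complex) => (real => complex) => real => complex" where
 "conv f p y = (LB x. f (y - x) * p x)"

lemma test_integrable: "f \<in> TF U ==> lb_int f"
 using wbd_integrable_Sz[of 0 0 "\<lambda>x. 1" f 0] wbd_bounded[of "\<lambda>x. 1" 1] test_schwartz by (auto simp: Sz_0)

lemma conv_integrable: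
 assumes "f \<in> testR" "lb_int p"
 shows "lb_int (\<lambda>x. f (y - x) * p x)"
proof -
 obtain A where A: "!!x. norm (f x) <= A" using test_bounded[OF assms(1), of 0] by auto
 have [measurable]: "f \<in> BM" "p \<in> BM"
  using assms smooth_measurable test_smooth by (auto dest: borel_measurable_integrable)
 show ?thesis
 proof (rule LB_integrable_bound)
  show "lb_int (\<lambda>x. A * norm (p x))" using assms(2) by auto
  show "AE x in lborel. norm (f (y - x) * p x) <= norm (A * norm (p x))"
   using A norm_nonneg_trans[OF A] by (auto simp: norm_mult abs_mult intro!: mult_right_mono)
 qed measurable
qed

lemma conv_has_vector_derivative:
 assumes f: "f \<in> testR" and p: "lb_int p"
 shows "(conv f p has_vd conv (nderiv 1 f) p y) (at y)"
proof -
 obtain A where A: "!!x. norm (nderiv 2 f x) <= A" using test_bounded[OF f] by metis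
 have bound: "norm (conv f p (y + h) - conv f p y - cx h * conv (nderiv 1 f) p y)
   <= (A * (LB x. norm (p x))) * h^2" for h
 proof -
 have i: "lb_int (\<lambda>x. g (y - x) * p x)" if "g \<in> testR" for g y
  by (rule conv_integrable[OF that p])
 have sf: "smooth f" using f test_smooth by blast
 note i0 = i[OF f, of y] and ih = i[OF f, of "y + h"] 
  and i1 = integrable_mult_right[OF i[OF test_nderiv[OF f, of 1], of y], of "cx h"]
 have "conv f p (y + h) - conv f p y - cx h * conv (nderiv 1 f) p y
   = (LB x. f (y + h - x) * p x - f (y - x) * p x - cx h * (nderiv 1 f (y - x) * p x))"
  unfolding conv_def LB_integral_diff[OF LB_integrable_diff[OF ih i0] i1]
   LB_integral_diff[OF ih i0] integral_mult_right_zero ..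
 also have "... = (LB x. (f ((y - x) + h) - f (y - x) - cx h * nderiv 1 f (y - x)) * p x)"
  by (simp add: algebra_simps)
 also have "norm ... <= (LB x. A * h^2 * norm (p x))"
 proof (rule LB_norm_le)
  from LB_integrable_diff[OF LB_integrable_diff[OF ih i0] i1]
   show "lb_int (\<lambda>x. (f ((y - x) + h) - f (y - x) - cx h * nderiv 1 f (y - x)) * p x)"
   by (simp add: algebra_simps)
  show "lb_int (\<lambda>x. A * h^2 * norm (p x))" using p by auto
  show "norm ((f ((y - x) + h) - f (y - x) - cx h * nderiv 1 f (y - x)) * p x) <= A * h^2 * norm (p x)" for x
   unfolding norm_mult by (intro mult_right_mono smooth_taylor1[OF sf A]) auto
 qed
 also have "... = (A * (LB x. norm (p x))) * h^2" by simp
 finally show ?thesis .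
 qed
 show ?thesis by (rule has_vector_derivative_quadratic[of 1]) (simp, rule bound)
qed

text \<open>Smoothness comes from f alone; p is merely integrable since it will also be a test
  function truncated with a jump.\<close>

lemma conv_smooth:
 assumes f: "f \<in> testR" and p: "lb_int p"
 shows "smooth (conv f p)" and "nderiv n (conv f p) = conv (nderiv n f) p"
proof -
 show "smooth (conv f p)"
 proof (rule smooth_coinduct[where P="\<lambda>g. \<exists>f\<in>testR. g = conv f p"])
  fix g assume "\<exists>f\<in>testR. g = conv f p"
  then obtain f where g: "f \<in> testR" "g = conv f p" by blast
  show "\<exists>k. (\<exists>f\<in>testR. k = conv f p) \<and> (\<forall>x\<in>UNIV. (g has_vd k x) (at x))"
   unfolding g(2) using conv_has_vector_derivative[OF g(1) p] test_nderiv[OF g(1), of 1]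
   by (intro exI[of _ "conv (nderiv 1 f) p"]) blast
 qed (use f in auto)
 show "nderiv n (conv f p) = conv (nderiv n f) p"
  using f
 proof (induction n arbitrary: f)
  case (Suc n)
  have "nderiv 1 (conv f p) = conv (nderiv 1 f) p"
   by (intro ext nderiv_1_eqI conv_has_vector_derivative Suc.prems p)
  thus ?case using Suc.IH[OF test_nderiv[OF Suc.prems, of 1]] by (simp add: nderiv_Suc)
 qed simp
qed

lemma conv_support:
 assumes "!!x. abs x > R ==> f x = 0" "!!x. abs x > R' ==> p x = 0" "abs y > R + R'"
 shows "conv f p y = 0"
proof -
 have "(\<lambda>x. f (y - x) * p x) = (\<lambda>x. 0)"
 proof
  fix x
  have "abs x > R' \<or> abs (y - x) > R" using assms(3) by linarith
  thus "f (y - x) * p x = 0" using assms(1,2) by auto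
 qed
 thus ?thesis by (simp add: conv_def)
qed

lemma conv_commute: "conv f p y = conv p f y"
proof -
 have "(LB x. f (y - x) * p x) = abs (-1) *\<^sub>R (LB x. f (y - (y + (-1) * x)) * p (y + (-1) * x))"
  by (rule lborel_integral_real_affine) simp
 thus ?thesis by (simp add: conv_def mult.commute)
qed

lemma conv_test:
 assumes "f \<in> testR" "p \<in> testR"
 shows "conv f p \<in> testR"
proof -
 obtain R where R: "!!x. abs x >= R ==> f x = 0" using test_bounded_subset[OF assms(1)] by blast
 obtain R' where R': "!!x. abs x >= R' ==> p x = 0" using test_bounded_subset[OF assms(2)] by blast
 show ?thesis
 proof (rule test_functionsI[of _ "{-(R + R')..R + R'}"])
  show "smooth (conv f p)" by (rule conv_smooth(1)[OF assms(1) test_integrable[OF assms(2)]])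
  fix x assume "x \<notin> {-(R + R')..R + R'}"
  thus "conv f p x = 0" by (intro conv_support[of R f R' p]) (use R R' in auto)
 qed auto
qed

lemma conv_nderiv_swap:
 assumes "f \<in> testR" "p \<in> testR"
 shows "conv (nderiv n f) p = conv f (nderiv n p)"
proof -
 have c: "conv f p = conv p f" for f p using conv_commute by blast
 have "conv (nderiv n f) p = nderiv n (conv f p)" using conv_smooth(2)[OF assms(1) test_integrable[OF assms(2)]] by simp
 also have "... = nderiv n (conv p f)" by (simp add: c)
 also have "... = conv (nderiv n p) f" using conv_smooth(2)[OF assms(2) test_integrable[OF assms(1)]] by simp
 finally show ?thesis by (simp add: c)
qed

lemma translate_test: "f \<in> testR ==> (\<lambda>y. f (y - x)) \<in> testR"
 and nderiv_translate: "f \<in> testR ==> nderiv n (\<lambda>y. f (y - x)) y = nderiv n f (y - x)"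
proof -
 assume f: "f \<in> testR"
 obtain R where R: "!!x. abs x >= R ==> f x = 0" using test_bounded_subset[OF f] by blast
 have a: "smooth (\<lambda>y. f (y - x))" "nderiv n (\<lambda>y. f (y - x)) y = nderiv n f (y - x)"
  using smooth_affine[OF test_smooth[OF f], where c=1 and d="-x"] by auto
 show "nderiv n (\<lambda>y. f (y - x)) y = nderiv n f (y - x)" by (rule a)
 show "(\<lambda>y. f (y - x)) \<in> testR"
  by (rule test_functionsI[OF a(1), of "{x - R..x + R}"]) (use R in \<open>auto simp: abs_if\<close>)
qed

text \<open>The function \<open>H(z) = \<sigma>(f * (p 1\<^bsub>x \<le> z\<^esub>))\<close> has derivative \<open>\<sigma>(f(\<cdot> - z)) p(z)\<close>.\<close>

lemma tempered_conv:
 assumes T: "tempered T" and f: "f \<in> testR" and p: "p \<in> testR"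
 shows "T (conv f p) = (LB x. T (\<lambda>y. f (y - x)) * p x)"
  and "continuous_on UNIV (\<lambda>x. T (\<lambda>y. f (y - x)) * p x)"
proof -
 obtain C N where C: "C >= 0" "!!f B. f \<in> schwartz ==> sbd N f B ==> norm (T f) <= C * B"
  using temperedD(3)[OF T] by blast
 obtain R1 R2 where R12: "R1 > 0" "R2 > 0" "!!x. abs x >= R1 ==> f x = 0" "!!x. abs x >= R2 ==> p x = 0"
  using test_bounded_subset[OF f] test_bounded_subset[OF p] by blast
 define R where "R = max R1 R2"
 have R: "R > 0" "!!x. abs x > R ==> f x = 0" "!!x. abs x > R ==> p x = 0" using R12 by (auto simp: R_def)
 have ft: "smooth f" "smooth p" using f p test_smooth by auto
 obtain A where A: "!!n x. norm (nderiv n f x) <= A n" using test_bounded[OF f] by metis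
 obtain P where P: "!!n x. norm (nderiv n p x) <= P n" using test_bounded[OF p] by metis
 have A0: "A n >= 0" "P n >= 0" for n using norm_nonneg_trans[OF A] norm_nonneg_trans[OF P] by auto
 \<comment> \<open>A common Lipschitz constant in the translation parameter for the first N
   derivatives of y -> f(y - x) p(x), the ones that the seminorm of T sees.\<close>
 define L where "L = Max ((\<lambda>n. A (Suc n) * P 0 + A n * P 1) ` {..N})"
 have L: "norm (nderiv n f (y - x) * p x - nderiv n f (y - z) * p z) <= L * abs (x - z)" if n: "n <= N" for n x y z
 proof -
  have "nderiv n f (y - x) * p x - nderiv n f (y - z) * p z = (nderiv n f (y - x) - nderiv n f (y - z)) * p x + nderiv n f (y - z) * (p x - p z)"
   by (simp add: algebra_simps)
  also have "norm ... <= (A (Suc n) * abs (x - z)) * P 0 + A n * (P 1 * abs (x - z))"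
  proof (intro norm_triangle_mono)
   have 1: "norm (nderiv n f (y - x) - nderiv n f (y - z)) <= A (Suc n) * abs ((y - x) - (y - z))"
    by (rule smooth_lipschitz[OF smooth_nderiv[OF ft(1)]]) (use A[of "Suc n"] in \<open>simp add: nderiv_nderiv One_nat_def\<close>)
   have 2: "norm (p x - p z) <= P 1 * abs (x - z)" by (rule smooth_lipschitz[OF ft(2) P])
   show "norm ((nderiv n f (y - x) - nderiv n f (y - z)) * p x) <= (A (Suc n) * abs (x - z)) * P 0"
    unfolding norm_mult using 1 P[of 0 x] A0 by (intro mult_mono) (auto simp: abs_minus_commute)
   show "norm (nderiv n f (y - z) * (p x - p z)) <= A n * (P 1 * abs (x - z))"
    unfolding norm_mult using 2 A A0 by (intro mult_mono) auto
  qed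
  also have "... = (A (Suc n) * P 0 + A n * P 1) * abs (x - z)" by (simp add: algebra_simps)
  also have "... <= L * abs (x - z)" unfolding L_def using n by (intro mult_right_mono Max_ge) auto
  finally show ?thesis .
 qed
 define K where "K = (max 1 (2 * R)) ^ N * L"
 define g where "g z = T (\<lambda>y. f (y - z)) * p z" for z
 have gz: "g z = T (\<lambda>y. p z * f (y - z))" for z
  using temperedD(2)[OF T test_schwartz[OF translate_test[OF f, of z]], of "p z"] by (simp add: g_def mult.commute)
 have tz: "(\<lambda>y. c * f (y - z)) \<in> testR" for c z by (intro test_cmult translate_test f)
 have nz: "nderiv n (\<lambda>y. c * f (y - z)) y = c * nderiv n f (y - z)" for n c y z
  using nderiv_cmult[OF open_UNIV test_smooth[OF translate_test[OF f, of z]], of y n c] nderiv_translate[OF f] by simp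
 have sz: "p z * f (y - z) = 0" if "abs y > 2 * R" for y z
 proof -
  have "abs z > R \<or> abs (y - z) > R" using that by linarith
  thus ?thesis using R by auto
 qed
 have glip: "norm (g w - g z) <= C * K * abs (w - z)" for w z
 proof -
  have "g w - g z = T (\<lambda>y. p w * f (y - w) - p z * f (y - z))"
   unfolding gz by (rule tempered_diff[OF T, symmetric]) (intro test_schwartz[OF tz])+
  moreover have "sbd N (\<lambda>y. p w * f (y - w) - p z * f (y - z)) ((max 1 (2 * R)) ^ N * (L * abs (w - z)))"
  proof (rule sbd_compact)
   fix n y assume n: "n <= N"
   have "nderiv n (\<lambda>y. p w * f (y - w) + (- p z) * f (y - z)) y = p w * nderiv n f (y - w) + (- p z) * nderiv n f (y - z)"
    by (subst nderiv_add[OF open_UNIV test_smooth[OF tz] test_smooth[OF tz]]) (simp_all only: nz UNIV_I)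
   thus "norm (nderiv n (\<lambda>y. p w * f (y - w) - p z * f (y - z)) y) <= L * abs (w - z)"
    using L[OF n, of y w z] by (simp add: mult.commute)
  next
   fix y assume "abs y > 2 * R"
   thus "p w * f (y - w) - p z * f (y - z) = 0" by (simp only: sz diff_self)
  qed
  ultimately show ?thesis
   using C(2)[OF test_schwartz[OF test_diff[OF tz[of "p w" w] tz[of "p z" z]]]] by (simp add: K_def mult.assoc)
 qed
 show cont: "continuous_on UNIV (\<lambda>x. T (\<lambda>y. f (y - x)) * p x)"
 proof -
  have "(C * K)-lipschitz_on UNIV g"
  proof (rule lipschitz_onI)
   show "dist (g x) (g y) <= C * K * dist x y" for x y using glip[of x y] by (simp add: dist_norm)
   have "0 <= C * K * abs (1 - 0)" using norm_nonneg_trans[OF glip[of 1 0]] .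
   thus "0 <= C * K" by simp
  qed
  from lipschitz_on_continuous_on[OF this] show ?thesis by (simp add: g_def[abs_def])
 qed
 \<comment> \<open>Truncating p at z makes the convolution an integral with variable upper limit,
   whose z-derivative is the integrand.\<close>
 define q where "q z x = (if x <= z then p x else 0)" for z x
 have pm[measurable]: "p \<in> BM" using smooth_measurable[OF ft(2)] .
 have qi: "lb_int (q z)" for z
 proof (rule LB_integrable_bound[OF test_integrable[OF p]])
  show "q z \<in> borel_measurable lborel" unfolding q_def[abs_def] by measurable
 qed (auto simp: q_def)
 have qs: "q z x = 0" if "abs x > R" for z x using R(3)[OF that] by (simp add: q_def)
 have qt: "conv f (q z) \<in> testR" for z
 proof (rule test_functionsI[OF conv_smooth(1)[OF f qi], of "{-(R+R)..R+R}"])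
  fix y assume "y \<notin> {-(R+R)..R+R}"
  thus "conv f (q z) y = 0" by (intro conv_support[of R f R "q z"]) (use R(2) qs in auto)
 qed auto
 define H where "H z = T (conv f (q z))" for z
 \<comment> \<open>The remainder is an integral over (z, w] of a difference that is itself at most L
   (w - z), hence quadratic in w - z in every seminorm involved.\<close>
 have H: "norm (H w - H z - cx (w - z) * g z) <= C * K * (w - z)\<^sup>2" if zw: "z <= w" for z w
 proof -
  define E where "E = (\<lambda>y. conv f (q w) y - conv f (q z) y - cx (w - z) * (p z * f (y - z)))"
  have st: "(\<lambda>y. cx (w - z) * (p z * f (y - z))) \<in> testR" by (rule test_cmult[OF tz])
  have Et: "E \<in> testR" unfolding E_def by (intro test_diff qt st)
  have "T E = T (\<lambda>y. conv f (q w) y - conv f (q z) y) - T (\<lambda>y. cx (w - z) * (p z * f (y - z)))"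
   unfolding E_def by (rule tempered_diff[OF T test_schwartz[OF test_diff[OF qt qt]] test_schwartz[OF st]])
  also have "T (\<lambda>y. conv f (q w) y - conv f (q z) y) = H w - H z"
   unfolding H_def by (rule tempered_diff[OF T]) (intro test_schwartz[OF qt])+
  also have "T (\<lambda>y. cx (w - z) * (p z * f (y - z))) = cx (w - z) * g z"
   unfolding gz by (rule temperedD(2)[OF T test_schwartz[OF tz]])
  finally have TE: "T E = H w - H z - cx (w - z) * g z" .
  have "sbd N E ((max 1 (2 * R)) ^ N * (L * (w - z)\<^sup>2))"
  proof (rule sbd_compact)
   show "E y = 0" if "abs y > 2 * R" for y
   proof -
    have "conv f (q v) y = 0" for v by (rule conv_support[of R f R "q v"]) (use R(2) qs that in auto)
    thus ?thesis using sz[OF that] by (simp add: E_def)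
   qed
   fix n y assume n: "n <= N"
   define F where "F = nderiv n f"
   have Ft: "F \<in> testR" unfolding F_def by (rule test_nderiv[OF f])
   have "nderiv n (\<lambda>y. conv f (q w) y + ((-1) * conv f (q z) y + (- cx (w - z) * p z) * f (y - z))) y
    = conv F (q w) y + ((-1) * conv F (q z) y + (- cx (w - z) * p z) * F (y - z))"
    unfolding F_def
     nderiv_add[OF open_UNIV conv_smooth(1)[OF f qi] smooth_add[OF open_UNIV smooth_cmult[OF open_UNIV conv_smooth(1)[OF f qi]] test_smooth[OF tz]] UNIV_I]
     nderiv_add[OF open_UNIV smooth_cmult[OF open_UNIV conv_smooth(1)[OF f qi]] test_smooth[OF tz] UNIV_I]
     nderiv_cmult[OF open_UNIV conv_smooth(1)[OF f qi] UNIV_I] nz conv_smooth(2)[OF f qi] ..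
   hence nE: "nderiv n E y = conv F (q w) y - conv F (q z) y - cx (w - z) * (p z * F (y - z))"
    by (simp add: E_def algebra_simps)
   have "conv F (q w) y - conv F (q z) y = (LB x. F (y - x) * q w x - F (y - x) * q z x)"
    unfolding conv_def by (rule LB_integral_diff[symmetric]) (intro conv_integrable[OF Ft qi])+
   also have "... = (LB x. indicator {z<..w} x *\<^sub>R (F (y - x) * p x))"
    by (intro LB_integral_cong) (use zw in \<open>auto simp: q_def indicator_def\<close>)
   finally have i1: "conv F (q w) y - conv F (q z) y = (LB x. indicator {z<..w} x *\<^sub>R (F (y - x) * p x))" .
   have int1: "lb_int (\<lambda>x. indicator {z<..w} x *\<^sub>R (F (y - x) * p x))"
    by (rule integrable_mult_indicator[OF _ conv_integrable[OF Ft test_integrable[OF p]]]) auto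
   have int2: "lb_int (\<lambda>x. indicator {z<..w} x *\<^sub>R (F (y - z) * p z))"
    by (intro integrable_scaleR_left integrable_real_indicator) (use zw in auto)
   have "cx (w - z) * (p z * F (y - z)) = (LB x. indicator {z<..w} x *\<^sub>R (F (y - z) * p z))"
    using zw by (simp add: scaleR_conv_of_real)
   hence "nderiv n E y = (LB x. indicator {z<..w} x *\<^sub>R (F (y - x) * p x) - indicator {z<..w} x *\<^sub>R (F (y - z) * p z))"
    unfolding nE i1 using LB_integral_diff[OF int1 int2] by simp
   also have "norm ... <= (LB x. indicator {z<..w} x * (L * (w - z)))"
   proof (rule LB_norm_le)
    show "lb_int (\<lambda>x. indicator {z<..w} x *\<^sub>R (F (y - x) * p x) - indicator {z<..w} x *\<^sub>R (F (y - z) * p z))"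
     by (rule LB_integrable_diff[OF int1 int2])
    show "lb_int (\<lambda>x. indicator {z<..w} x * (L * (w - z)))"
     by (intro integrable_mult_left integrable_real_indicator) (use zw in auto)
    have "0 <= L * abs (1 - 0)" using norm_nonneg_trans[OF L[of 0 0 1 0]] by simp
    hence L0: "L >= 0" by simp
    show "norm (indicator {z<..w} x *\<^sub>R (F (y - x) * p x) - indicator {z<..w} x *\<^sub>R (F (y - z) * p z)) <= indicator {z<..w} x * (L * (w - z))" for x
    proof (cases "x \<in> {z<..w}")
     case True
     have "norm (F (y - x) * p x - F (y - z) * p z) <= L * abs (x - z)" unfolding F_def by (rule L[OF n])
     also have "... <= L * (w - z)" using True L0 by (intro mult_left_mono) auto
     finally show ?thesis using True by simp
    qed simp
   qed
   also have "... = L * (w - z)\<^sup>2" using zw by (simp add: power2_eq_square)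
   finally show "norm (nderiv n E y) <= L * (w - z)\<^sup>2" .
  qed
  from C(2)[OF test_schwartz[OF Et] this] show ?thesis unfolding TE by (simp add: K_def mult.assoc)
 qed
 \<comment> \<open>The estimate is available for increments to the right; for h < 0 it is applied
   from z + h to z, and the Lipschitz bound of g moves the derivative back to z.\<close>
 have Hd: "(H has_vd g z) (at z)" for z
 proof (rule has_vector_derivative_quadratic[of 1])
  fix h :: real
  show "norm (H (z + h) - H z - cx h * g z) <= (2 * (C * K)) * h^2"
  proof (cases "h >= 0")
   case True
   hence "norm (H (z + h) - H z - cx h * g z) <= C * K * h^2" using H[of z "z + h"] by simp
   also have "... <= (2 * (C * K)) * h^2"
    using norm_nonneg_trans[OF H[of 0 1]] by (intro mult_right_mono) auto
   finally show ?thesis .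
  next
   case False
   have 1: "norm (H z - H (z + h) - cx (- h) * g (z + h)) <= C * K * h^2" using H[of "z + h" z] False by simp
   have "norm (cx h * (g (z + h) - g z)) <= abs h * (C * K * abs h)"
    unfolding norm_mult using glip[of "z + h" z] by (intro mult_mono) auto
   hence 2: "norm (cx h * (g (z + h) - g z)) <= C * K * h^2" by (simp add: power2_eq_square abs_mult[symmetric] mult_ac)
   have "H (z + h) - H z - cx h * g z = - (H z - H (z + h) - cx (- h) * g (z + h)) + cx h * (g (z + h) - g z)"
    by (simp add: algebra_simps)
   also have "norm ... <= C * K * h^2 + C * K * h^2" using 1 2 by (intro norm_triangle_mono) (simp_all only: norm_minus_cancel)
   finally show ?thesis by simp
  qed
 qed simp
 \<comment> \<open>At the left end the truncated p is 0, at the right end it is all of p.\<close>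
 have "(g has_integral (H (R + 1) - H (- R - 1))) {-R - 1..R + 1}"
  by (rule fundamental_theorem_of_calculus) (use R(1) has_vector_derivative_at_within[OF Hd] in auto)
 moreover have "q (- R - 1) = (\<lambda>x. 0)" using R(3) by (force simp: q_def fun_eq_iff)
 hence "conv f (q (- R - 1)) = (\<lambda>x. 0 * f x)" by (auto simp: conv_def)
 hence "H (- R - 1) = 0" using temperedD(2)[OF T test_schwartz[OF f], of 0] by (simp add: H_def)
 moreover have "q (R + 1) = p" using R(3) by (force simp: q_def fun_eq_iff)
 hence "H (R + 1) = T (conv f p)" by (simp add: H_def)
 moreover have g0: "g x = 0" if "x \<notin> {-R - 1..R + 1}" for x
 proof -
  have "abs x > R" using that R(1) by (auto simp: abs_if split: if_splits)
  thus ?thesis using R(3) by (simp add: g_def)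
 qed
 ultimately have I: "(g has_integral T (conv f p)) UNIV"
  using has_integral_on_superset[of g "T (conv f p)" "{-R - 1..R + 1}" UNIV] by simp
 have "lb_int (\<lambda>x. indicator {-R - 1..R + 1} x *\<^sub>R g x)"
  using cont by (intro borel_integrable_compact) (auto simp: g_def intro: continuous_on_subset)
 also have "(\<lambda>x. indicator {-R - 1..R + 1} x *\<^sub>R g x) = g" using g0 by (auto simp: indicator_def fun_eq_iff)
 finally have "(g has_integral (LB x. g x)) UNIV" by (rule has_integral_integral_lborel)
 with I show "T (conv f p) = (LB x. T (\<lambda>y. f (y - x)) * p x)"
  unfolding g_def using has_integral_unique by blast
qed

text \<open>A translate by x is supported in |y| <= 2 + |x|, where the powers of y in the seminorm
  contribute at most (2 + |x|)^N.\<close>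

lemma tempered_translate_bound:
 assumes T: "tempered T" "C >= 0" "!!f B. f \<in> schwartz ==> sbd N f B ==> norm (T f) <= C * B"
  and f: "f \<in> testR" "!!x. abs x > 1 ==> f x = 0" and B: "!!n x. n <= N ==> norm (nderiv n f x) <= B"
 shows "norm (T (\<lambda>y. f (y - x))) <= C * B * (2 + abs x) ^ N"
proof -
 have B0: "B >= 0" using norm_nonneg_trans[OF B[of 0 0]] by simp
 have "sbd N (\<lambda>y. f (y - x)) ((max 1 (2 + abs x)) ^ N * B)"
 proof (rule sbd_compact)
  show "f (y - x) = 0" if "abs y > 2 + abs x" for y by (rule f(2)) (use that in linarith)
 qed (use B in \<open>simp add: nderiv_translate[OF f(1)]\<close>)
 from T(3)[OF test_schwartz[OF translate_test[OF f(1)]] this] show ?thesis by (simp add: max_def mult_ac)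
qed

lemma tempered_translate_measurable:
 assumes T: "tempered T" and f: "f \<in> testR"
 shows "(\<lambda>x. T (\<lambda>y. f (y - x))) \<in> BM"
proof -
 have "isCont (\<lambda>x. T (\<lambda>y. f (y - x))) x" for x
 proof -
  \<comment> \<open>A test function equal to 1 near x reduces continuity at x to the continuity
    statement of \<open>tempered_conv\<close>.\<close>
  define p where "p = (\<lambda>z. cutoff (z / (abs x + 1)))"
  have p: "p \<in> testR" unfolding p_def by (rule cutoff_dilate_test) simp
  have "isCont (\<lambda>x. T (\<lambda>y. f (y - x)) * p x) x"
   using tempered_conv(2)[OF T f p] by (simp add: continuous_on_eq_continuous_at)
  moreover have ev: "\<forall>\<^sub>F z in nhds x. T (\<lambda>y. f (y - z)) * p z = T (\<lambda>y. f (y - z))"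
  proof -
   have "\<forall>\<^sub>F z in nhds x. z \<in> {-abs x - 1<..<abs x + 1}" by (rule eventually_nhds_in_open) auto
   thus ?thesis
   proof eventually_elim
    case (elim z)
    hence "p z = 1" unfolding p_def by (intro cutoff_1) (auto simp: abs_divide)
    thus ?case by simp
   qed
  qed
  ultimately show ?thesis by (simp add: isCont_cong[OF ev])
 qed
 hence "continuous_on UNIV (\<lambda>x. T (\<lambda>y. f (y - x)))" by (simp add: continuous_on_eq_continuous_at)
 thus ?thesis by (rule borel_measurable_continuous_onI)
qed

lemma integral_deriv_compact:
 assumes F: "smooth F" and ab: "a <= b" and z: "!!x. x \<notin> {a..b} ==> nderiv 1 F x = 0"
 shows "(LB x. nderiv 1 F x) = F b - F a"
proof -
 have "(nderiv 1 F has_integral (F b - F a)) {a..b}"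
  by (rule fundamental_theorem_of_calculus[OF ab])
    (rule has_vector_derivative_at_within[OF smooth_hvd1[OF F UNIV_I]])
 hence I: "(nderiv 1 F has_integral (F b - F a)) UNIV"
  by (rule has_integral_on_superset) (use z in auto)
 have "lb_int (\<lambda>x. indicator {a..b} x *\<^sub>R nderiv 1 F x)"
  using continuous_on_subset[OF smooth_continuous_on[OF F]] by (intro borel_integrable_compact) auto
 also have "(\<lambda>x. indicator {a..b} x *\<^sub>R nderiv 1 F x) = nderiv 1 F" using z by (auto simp: indicator_def fun_eq_iff)
 finally have "(nderiv 1 F has_integral (LB x. nderiv 1 F x)) UNIV" by (rule has_integral_integral_lborel)
 with I show ?thesis using has_integral_unique by blast
qed

lemma wbd_poly:
 assumes "h \<in> BM" "!!x. norm (h x) <= C * (2 + abs x) ^ N"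
 shows "wbd 0 N h"
proof (rule wbdI[OF assms(1), of "C * 3 ^ N"])
 have C: "C >= 0" using norm_nonneg_trans[OF assms(2)[of 0]] zero_less_power[of "2::real" N]
  by (simp add: zero_le_mult_iff not_le[symmetric])
 fix x :: real
 have "(2 + abs x) ^ N <= 3 ^ N * wt 0 N x" if "x ~= 0"
 proof (cases "abs x <= 1")
  case True
  thus ?thesis using that by (auto simp: wt_def intro: power_mono)
 next
  case False
  have "(2 + abs x) ^ N <= (3 * abs x) ^ N" using False by (intro power_mono) auto
  thus ?thesis using False by (simp add: wt_def powr_realpow power_mult_distrib)
 qed
 thus "norm (h x) <= C * 3 ^ N * wt 0 N x" if "x ~= 0"
  using assms(2)[of x] mult_left_mono[OF _ C] that by (fastforce simp: mult.assoc)
qed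

text \<open>The kernels of the structure theorem: \<open>r\<close> is the \<open>N+2\<close>-nd derivative of a smoothed
 truncated power \<open>S\<close>; by homogeneity \<open>k(u) = 2\<^bsup>-(N+1)\<^esup> S(2u) - S(u)\<close> has compact support, so successive
 dyadic mollifiers differ by an \<open>N+2\<close>-nd derivative.\<close>

lemma mollifier_exists:
 fixes N :: nat
 obtains r k where "r \<in> testR" "k \<in> testR"
  "!!x. abs x > 1 ==> r x = 0" "!!x. abs x > 1 ==> k x = 0" "(LB x. r x) = 1"
  "!!x. nderiv (N + 2) k x = 2 * r (2 * x) - r x"
proof -
 define S :: "real => complex" where "S u = cx (step u) * (inverse (fact (Suc N)) * cx u ^ Suc N)" for u
 define P :: "real => complex" where "P u = inverse (fact (Suc N)) * cx u ^ Suc N" for u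
 have sP: "smooth P" unfolding P_def by (intro smooth_cmult smooth_power) auto
 have S: "smooth S" unfolding S_def by (intro smooth_mult smooth_step smooth_power) auto
 have S0: "S u = 0" if "u <= 0" for u using that by (simp add: S_def step_0)
 have S1: "S u = P u" if "u >= 1" for u using that by (simp add: S_def P_def step_1)
 have nP: "nderiv n P x = inverse (fact (Suc N)) * ((\<Prod>i<n. of_nat (Suc N - i)) * cx x ^ (Suc N - n))" for n x
  unfolding P_def nderiv_cmult[OF open_UNIV smooth_power[OF open_UNIV smooth_of_real] UNIV_I] nderiv_xpow ..
 have n0: "nderiv n S x = 0" if "x < 0" for n x
  using nderiv_cong_open[of "{..<0}" S "\<lambda>x. 0" x n] S0 that by (auto split: if_splits)
 have n1: "nderiv n S x = nderiv n P x" if "x > 1" for n x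
  using nderiv_cong_open[of "{1<..}" S P x n] S1 that by auto
 define r where "r = nderiv (N + 2) S"
 define k where "k x = cx ((1/2) ^ Suc N) * S (2 * x) - S x" for x
 have sr: "smooth r" unfolding r_def by (rule smooth_nderiv[OF S])
 have sS2: "smooth (\<lambda>x. S (2 * x))" by (rule smooth_dilate[OF S])
 have sk: "smooth k" unfolding k_def[abs_def] by (intro smooth_diff smooth_cmult S sS2) auto
 have zero: "(\<Prod>i<N + 2. of_nat (Suc N - i)) = (0::complex)" by (auto intro!: prod_zero)
 have r0: "r x = 0" if "abs x > 1" for x
 proof (cases "x < 0")
  case False
  hence "r x = nderiv (N + 2) P x" using that by (simp add: r_def n1)
  thus ?thesis unfolding nP zero by simp
 qed (simp add: r_def n0)
 have k0: "k x = 0" if "abs x > 1" for x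
 proof (cases "x < 0")
  case False
  thus ?thesis using that S1[of x] S1[of "2 * x"] by (simp add: k_def P_def power_mult_distrib field_simps)
 qed (simp add: k_def S0)
 have rt: "r \<in> testR" by (rule test_functionsI[OF sr, of "{-1..1}"]) (use r0 in auto)
 have kt: "k \<in> testR" by (rule test_functionsI[OF sk, of "{-1..1}"]) (use k0 in auto)
 have rr: "r = nderiv 1 (nderiv (Suc N) S)" by (simp add: r_def nderiv_nderiv One_nat_def)
 \<comment> \<open>The derivative of order N+1 of \<open>S\<close> is 0 to the left of [0, 1] and 1
   to the right of it, so its derivative r has integral 1.\<close>
 have "(LB x. nderiv 1 (nderiv (Suc N) S) x) = nderiv (Suc N) S 2 - nderiv (Suc N) S (-1)"
  by (rule integral_deriv_compact[OF smooth_nderiv[OF S]]) (use r0 rr in auto)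
 moreover have X: "(\<Prod>i<Suc N. of_nat (Suc N - i)) = (fact (Suc N) :: complex)"
 proof -
  have "(\<Prod>i<n. of_nat (n - i)) = (fact n :: complex)" for n
  proof (induction n)
   case (Suc n)
   thus ?case by (subst prod.lessThan_Suc_shift) simp
  qed simp
  thus ?thesis by blast
 qed
 have "nderiv (Suc N) S 2 = 1" by (subst n1) (simp, simp only: nP X, simp del: fact_Suc)
 ultimately have i: "(LB x. r x) = 1" using n0[of "-1" "Suc N"] rr by simp
 have "nderiv (N + 2) k x = 2 * r (2 * x) - r x" for x
 proof -
  have "nderiv (N + 2) (\<lambda>x. cx ((1/2) ^ Suc N) * S (2 * x) + (-1) * S x) x
    = cx ((1/2) ^ Suc N) * nderiv (N + 2) (\<lambda>x. S (2 * x)) x + (-1) * nderiv (N + 2) S x"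
   by (subst nderiv_add[OF open_UNIV smooth_cmult[OF open_UNIV sS2] smooth_cmult[OF open_UNIV S]])
     (simp_all only: nderiv_cmult[OF open_UNIV sS2] nderiv_cmult[OF open_UNIV S] UNIV_I)
  also have "nderiv (N + 2) (\<lambda>x. S (2 * x)) x = cx 2 ^ (N + 2) * r (2 * x)"
   using smooth_affine(2)[OF S, where c=2 and d=0 and n="N + 2" and x=x] by (simp only: r_def add_0_right)
  finally have "nderiv (N + 2) (\<lambda>x. cx ((1/2) ^ Suc N) * S (2 * x) + (-1) * S x) x
    = cx ((1/2) ^ Suc N) * (cx 2 ^ (N + 2) * r (2 * x)) + (-1) * nderiv (N + 2) S x" .
  moreover have "cx ((1/2) ^ Suc N) * cx 2 ^ (N + 2) = (2::complex)"
   by (simp add: power_one_over field_simps)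
  ultimately show ?thesis unfolding k_def[abs_def] r_def[symmetric] by (simp add: mult.assoc[symmetric] r_def[symmetric] del: of_real_power)
 qed
 thus ?thesis using that[OF rt kt r0 k0 i] by blast
qed

text \<open>T p is the limit of T(r_n * p) along dyadic mollifiers r_n. Successive terms differ by
  T(k_n * D^(N+2) p), which is the integral of G_n D^(N+2) p with G_n(x) = T(k_n(. - x)). As T
  involves only N derivatives, G_n is O(2^(-n) (2 + |x|)^N), and the series of the G_n converges to
  one function of polynomial growth.\<close>

lemma structure_theorem:
 assumes T: "tempered T"
 shows "\<exists>N M G0 G. wbd 0 (real N) G0 \<and> wbd 0 (real N) G \<and>
   (\<forall>p\<in>testR. T p = (LB x. G0 x * p x) + (LB x. G x * nderiv M p x))"
proof -
 obtain C N where C: "C >= 0" "!!f B. f \<in> schwartz ==> sbd N f B ==> norm (T f) <= C * B"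
  using temperedD(3)[OF T] by blast
 obtain r k where rk: "r \<in> testR" "k \<in> testR"
  "!!x. abs x > 1 ==> r x = 0" "!!x. abs x > 1 ==> k x = 0" "(LB x. r x) = 1"
  "!!x. nderiv (N + 2) k x = 2 * r (2 * x) - r x"
  using mollifier_exists[of N] by blast
 define M where "M = N + 2"
 \<comment> \<open>The scaling is chosen so that M = N + 2 derivatives produce exactly the
   mass-preserving factor 2^n of \<open>rn\<close>.\<close>
 define kn where "kn n x = cx ((1/2) ^ (n * Suc N)) * k (2 ^ n * x)" for n x
 define rn where "rn n x = cx (2 ^ n) * r (2 ^ n * x)" for n x
 have dil: "(\<lambda>x. c * f (2 ^ n * x)) \<in> testR" "!!x. abs x > 1 ==> c * f (2 ^ n * x) = 0"
  if f: "f \<in> testR" "!!x. abs x > 1 ==> f x = 0" for f :: "real => complex" and c and n :: nat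
 proof -
  have z: "f (2 ^ n * x) = 0" if "abs x > 1" for x :: real
  proof (rule f(2))
   have "1 * 1 < 2 ^ n * abs x" using that by (intro mult_le_less_imp_less) auto
   thus "1 < abs (2 ^ n * x)" by (simp add: abs_mult)
  qed
  thus "c * f (2 ^ n * x) = 0" if "abs x > 1" for x using that by simp
  show "(\<lambda>x. c * f (2 ^ n * x)) \<in> testR"
  proof (rule test_functionsI[of _ "{-1..1}"])
   show "smooth (\<lambda>x. c * f (2 ^ n * x))"
    by (rule smooth_cmult[OF open_UNIV smooth_dilate[OF test_smooth[OF f(1)]]])
   fix x :: real assume "x \<notin> {-1..1}"
   thus "c * f (2 ^ n * x) = 0" using z[of x] by (auto simp: abs_if split: if_splits)
  qed auto
 qed
 have knt: "kn n \<in> testR" and kn0: "!!x. abs x > 1 ==> kn n x = 0" for n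
  unfolding kn_def[abs_def] by (rule dil(1)[OF rk(2)], rule rk(4), assumption) (rule dil(2)[OF rk(2)], rule rk(4), assumption+)
 have rnt: "rn n \<in> testR" and rn0: "!!x. abs x > 1 ==> rn n x = 0" for n
  unfolding rn_def[abs_def] by (rule dil(1)[OF rk(1)], rule rk(3), assumption) (rule dil(2)[OF rk(1)], rule rk(3), assumption+)
 have nkn: "nderiv j (kn n) x = cx ((1/2) ^ (n * Suc N)) * (cx (2 ^ n) ^ j * nderiv j k (2 ^ n * x))" for j n x
  unfolding kn_def[abs_def] 
  using nderiv_cmult[OF open_UNIV smooth_dilate[OF test_smooth[OF rk(2)], of "2 ^ n"], of x j]
   smooth_affine(2)[OF test_smooth[OF rk(2)], where c="2 ^ n" and d=0 and n=j and x=x] by simp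
 have tele: "rn (Suc n) x - rn n x = nderiv M (kn n) x" for n x
 proof -
  have "cx ((1/2) ^ (n * Suc N)) * cx (2 ^ n) ^ M = (cx (((1/2) ^ n * 2 ^ n) ^ Suc N * 2 ^ n) :: complex)"
   unfolding M_def power_mult by (simp add: power_mult_distrib)
  also have "((1/2) ^ n * 2 ^ n) = (1::real)" by (simp add: power_mult_distrib[symmetric])
  finally have e: "cx ((1/2) ^ (n * Suc N)) * cx (2 ^ n) ^ M = (cx (2 ^ n))" by simp
  have "nderiv M (kn n) x = (cx ((1/2) ^ (n * Suc N)) * cx (2 ^ n) ^ M) * nderiv M k (2 ^ n * x)"
   unfolding nkn by (simp only: mult.assoc)
  also have "... = cx (2 ^ n) * (2 * r (2 * (2 ^ n * x)) - r (2 ^ n * x))"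
   unfolding e unfolding M_def rk(6) ..
  finally show ?thesis by (simp add: rn_def algebra_simps)
 qed
 obtain A where A: "!!n x. norm (nderiv n k x) <= A n" using test_bounded[OF rk(2)] by metis
 define A' where "A' = Max (A ` {..N})"
 have A': "norm (nderiv j k x) <= A'" if "j <= N" for j x
  unfolding A'_def using order_trans[OF A] that by (meson Max_ge atMost_iff finite_atMost finite_imageI imageI)
 have A'0: "A' >= 0" using norm_nonneg_trans[OF A'[of 0 0]] by simp
 define Gk where "Gk n x = T (\<lambda>y. kn n (y - x))" for n x
 have Gk: "norm (Gk n x) <= (1/2) ^ n * (C * A' * (2 + abs x) ^ N)" for n x
 proof -
  \<comment> \<open>Each derivative costs 2^n, so at most N of them leave a factor 2^(-n) of the
    amplitude 2^(-n (N+1)).\<close>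
  have "norm (nderiv j (kn n) y) <= (1/2) ^ n * A'" if j: "j <= N" for j y
  proof -
   have "(2 ^ n) ^ j <= ((2 ^ n) ^ N :: real)" using j by (intro power_increasing) auto
   hence "(1/2) ^ (n * Suc N) * (2 ^ n) ^ j <= ((1/2) ^ (n * Suc N) * (2 ^ n) ^ N :: real)"
    by (intro mult_left_mono) auto
   also have "... = (1/2) ^ n * ((1/2) ^ n * 2 ^ n) ^ N" unfolding power_mult by (simp add: power_mult_distrib)
   also have "((1/2) ^ n * 2 ^ n) = (1::real)" by (simp add: power_mult_distrib[symmetric])
   finally have "(1/2) ^ (n * Suc N) * (2 ^ n) ^ j <= ((1/2) ^ n :: real)" by simp
   hence "((1/2) ^ (n * Suc N) * (2 ^ n) ^ j) * norm (nderiv j k (2 ^ n * y)) <= (1/2) ^ n * A'"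
    using A'[OF j] by (intro mult_mono) auto
   thus ?thesis unfolding nkn by (simp add: norm_mult norm_power mult.assoc norm_divide)
  qed
  from tempered_translate_bound[OF T C knt kn0 this] show ?thesis unfolding Gk_def by (simp add: mult_ac)
 qed
 have Gkm: "Gk n \<in> BM" for n
  unfolding Gk_def[abs_def] by (rule tempered_translate_measurable[OF T knt])
 have sumn: "summable (\<lambda>n. norm (Gk n x))" for x
  by (rule summable_comparison_test'[of "\<lambda>n. (1/2) ^ n * (C * A' * (2 + abs x) ^ N)" 0])
    (use Gk in \<open>auto intro!: summable_mult2 summable_geometric\<close>)
 define G where "G x = (\<Sum>n. Gk n x)" for x
 have Gm: "G \<in> BM" unfolding G_def[abs_def] by (intro borel_measurable_suminf Gkm)
 have Gs: "(\<Sum>n. norm (Gk n x)) <= (2 * C * A') * (2 + abs x) ^ N" for x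
 proof -
  have "(\<Sum>n. norm (Gk n x)) <= (\<Sum>n. (1/2) ^ n * (C * A' * (2 + abs x) ^ N))"
   by (rule suminf_le[OF Gk sumn]) (intro summable_mult2 summable_geometric, simp)
  also have "... = (\<Sum>n. (1/2) ^ n) * (C * A' * (2 + abs x) ^ N)"
   by (rule suminf_mult2[symmetric]) (simp add: summable_geometric)
  also have "(\<Sum>n. (1/2) ^ n) = (2::real)" by (subst suminf_geometric) auto
  finally show ?thesis by (simp add: mult_ac)
 qed
 have "norm (G x) <= (2 * C * A') * (2 + abs x) ^ N" for x
  unfolding G_def by (rule order_trans[OF summable_norm[OF sumn] Gs])
 hence Gw: "wbd 0 N G" by (rule wbd_poly[OF Gm])
 define G0 where "G0 x = T (\<lambda>y. r (y - x))" for x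
 obtain D where D: "!!n x. norm (nderiv n r x) <= D n" using test_bounded[OF rk(1)] by metis
 have D': "norm (nderiv j r x) <= Max (D ` {..N})" if "j <= N" for j x
  using order_trans[OF D] that by (meson Max_ge atMost_iff finite_atMost finite_imageI imageI)
 have "norm (G0 x) <= (C * Max (D ` {..N})) * (2 + abs x) ^ N" for x
  unfolding G0_def by (rule tempered_translate_bound[OF T C rk(1,3) D'])
 moreover have "G0 \<in> BM" unfolding G0_def[abs_def] by (rule tempered_translate_measurable[OF T rk(1)])
 ultimately have G0w: "wbd 0 N G0" by (intro wbd_poly)
 have main: "T p = (LB x. G0 x * p x) + (LB x. G x * nderiv M p x)" if p: "p \<in> testR" for p
 proof -
  define q where "q = nderiv M p"
  have q: "q \<in> testR" unfolding q_def by (rule test_nderiv[OF p])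
  have step: "T (conv (rn n) p) = T (conv (rn 0) p) + (\<Sum>k<n. LB x. Gk k x * q x)" for n
  proof (induction n)
   case (Suc n)
   have "conv (rn (Suc n)) p y = conv (rn n) p y + conv (kn n) q y" for y
   proof -
    have "conv (rn (Suc n)) p y - conv (rn n) p y = (LB x. rn (Suc n) (y - x) * p x - rn n (y - x) * p x)"
     unfolding conv_def by (rule LB_integral_diff[symmetric]) (intro conv_integrable rnt test_integrable[OF p])+
    also have "... = conv (nderiv M (kn n)) p y" unfolding conv_def tele[symmetric] by (simp add: algebra_simps)
    also have "... = conv (kn n) q y" unfolding q_def conv_nderiv_swap[OF knt p] ..
    finally show ?thesis by (simp add: algebra_simps)
   qed
   hence "conv (rn (Suc n)) p = (\<lambda>y. conv (rn n) p y + conv (kn n) q y)" by blast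
   hence "T (conv (rn (Suc n)) p) = T (conv (rn n) p) + T (conv (kn n) q)"
    using temperedD(1)[OF T test_schwartz[OF conv_test[OF rnt p]] test_schwartz[OF conv_test[OF knt q]]] by simp
   thus ?case using Suc tempered_conv(1)[OF T knt q] by (simp add: Gk_def)
  qed simp
  have lim1: "(\<lambda>n. T (conv (rn n) p)) \<longlonglongrightarrow> T p"
  proof -
   obtain P where P: "!!n x. norm (nderiv n p x) <= P n" using test_bounded[OF p] by metis
   define P' where "P' = Max ((\<lambda>n. P (Suc n)) ` {..N})"
   have P': "norm (nderiv (Suc j) p x) <= P'" if "j <= N" for j x
   proof -
    have "P (Suc j) <= P'" unfolding P'_def using that by (intro Max_ge) auto
    thus ?thesis using P order_trans by blast
   qed
   obtain R where R: "R > 0" "!!x. abs x >= R ==> p x = 0" using test_bounded_subset[OF p] by blast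
   define I where "I = (LB u. norm (r u))"
   have ri: "lb_int r" by (rule test_integrable[OF rk(1)])
   \<comment> \<open>The mollifier has integral 1 and width 2^(-n), so convolution with it moves f
     by at most 2^(-n) times its Lipschitz constant and the L^1 norm of r.\<close>
   have est: "norm (conv (rn n) f y - f y) <= B * I * (1/2) ^ n"
    if f: "f \<in> testR" and B: "!!x. norm (nderiv 1 f x) <= B" for f n y B
   proof -
    have B0: "B >= 0" using norm_nonneg_trans[OF B] .
    have "conv (rn n) f y = conv f (rn n) y" by (rule conv_commute)
    also have "... = abs (1 / 2 ^ n) *\<^sub>R (LB u. f (y - (0 + (1 / 2 ^ n) * u)) * rn n (0 + (1 / 2 ^ n) * u))"
     unfolding conv_def by (rule lborel_integral_real_affine) simp
    also have "... = (LB u. (1 / 2 ^ n) *\<^sub>R (f (y - (0 + (1 / 2 ^ n) * u)) * rn n (0 + (1 / 2 ^ n) * u)))"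
     by simp
    also have "... = (LB u. f (y - u / 2 ^ n) * r u)"
     by (intro LB_integral_cong) (auto simp: rn_def scaleR_conv_of_real)
    finally have 1: "conv (rn n) f y = (LB u. f (y - u / 2 ^ n) * r u)" .
    obtain F where F: "!!x. norm (f x) <= F" using test_bounded[OF f, of 0] by auto
    have fm: "f \<in> BM" "r \<in> BM"
     using f rk(1) test_smooth smooth_measurable by blast+
    note [measurable] = fm
    have i1: "lb_int (\<lambda>u. f (y - u / 2 ^ n) * r u)"
    proof (rule LB_integrable_bound)
     show "lb_int (\<lambda>u. F * norm (r u))" using ri by auto
     show "AE u in lborel. norm (f (y - u / 2 ^ n) * r u) <= norm (F * norm (r u))"
      using F norm_nonneg_trans[OF F] by (auto simp: norm_mult abs_mult intro!: mult_right_mono)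
    qed measurable
    have i2: "lb_int (\<lambda>u. f y * r u)" using ri by auto
    have "f y = (LB u. f y * r u)" using rk(5) by simp
    hence "conv (rn n) f y - f y = (LB u. f (y - u / 2 ^ n) * r u - f y * r u)"
     unfolding 1 using LB_integral_diff[OF i1 i2] by simp
    also have "norm ... <= (LB u. B * (1/2) ^ n * norm (r u))"
    proof (rule LB_norm_le[OF LB_integrable_diff[OF i1 i2]])
     show "lb_int (\<lambda>u. B * (1/2) ^ n * norm (r u))" using ri by auto
     fix u
     show "norm (f (y - u / 2 ^ n) * r u - f y * r u) <= B * (1/2) ^ n * norm (r u)"
     proof (cases "abs u > 1")
      case False
      have "norm (f (y - u / 2 ^ n) - f y) <= B * abs ((y - u / 2 ^ n) - y)"
       by (rule smooth_lipschitz[OF test_smooth[OF f] B])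
      also have "... <= B * (1/2) ^ n"
       using False B0 by (intro mult_left_mono) (auto simp: abs_divide power_one_over divide_le_eq)
      finally have "norm (f (y - u / 2 ^ n) - f y) * norm (r u) <= B * (1/2) ^ n * norm (r u)"
       by (rule mult_right_mono) simp
      thus ?thesis by (simp add: norm_mult[symmetric] left_diff_distrib)
     qed (simp add: rk(3))
    qed
    also have "... = B * I * (1/2) ^ n" by (simp add: I_def)
    finally show ?thesis .
   qed
   have bound: "norm (T (conv (rn n) p) - T p) <= (C * ((max 1 (1 + R)) ^ N * (P' * I))) * (1/2) ^ n" for n
   proof -
    have ct: "conv (rn n) p \<in> testR" by (rule conv_test[OF rnt p])
    have "sbd N (\<lambda>y. conv (rn n) p y - p y) ((max 1 (1 + R)) ^ N * (P' * I * (1/2) ^ n))"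
    proof (rule sbd_compact)
     fix y assume y: "abs y > 1 + R"
     have "conv (rn n) p y = 0" by (rule conv_support[of 1 _ R]) (use rn0 R(2) y in auto)
     thus "conv (rn n) p y - p y = 0" using R(2)[of y] R(1) y by simp
    next
     fix j y assume j: "j <= N"
     have "nderiv j (\<lambda>y. conv (rn n) p y + (-1) * p y) y = nderiv j (conv (rn n) p) y + (-1) * nderiv j p y"
      by (subst nderiv_add[OF open_UNIV test_smooth[OF ct] smooth_cmult[OF open_UNIV test_smooth[OF p]]])
        (simp_all only: nderiv_cmult[OF open_UNIV test_smooth[OF p]] UNIV_I)
     also have "nderiv j (conv (rn n) p) = conv (rn n) (nderiv j p)"
      unfolding conv_smooth(2)[OF rnt test_integrable[OF p]] by (rule conv_nderiv_swap[OF rnt p])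
     finally have "nderiv j (\<lambda>y. conv (rn n) p y - p y) y = conv (rn n) (nderiv j p) y - nderiv j p y" by simp
     thus "norm (nderiv j (\<lambda>y. conv (rn n) p y - p y) y) <= P' * I * (1/2) ^ n"
      using est[OF test_nderiv[OF p], of j P' n y] P'[OF j] by (simp add: nderiv_nderiv One_nat_def)
    qed
    from C(2)[OF test_schwartz[OF test_diff[OF ct p]] this]
    show ?thesis unfolding tempered_diff[OF T test_schwartz[OF ct] test_schwartz[OF p]] by (simp add: mult_ac)
   qed
   have l0: "(\<lambda>n. (C * ((max 1 (1 + R)) ^ N * (P' * I))) * (1/2) ^ n) \<longlonglongrightarrow> 0"
    by (rule tendsto_mult_right_zero, rule LIMSEQ_realpow_zero) auto
   have "(\<lambda>n. T (conv (rn n) p) - T p) \<longlonglongrightarrow> 0"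
    by (rule Lim_null_comparison[OF always_eventually l0]) (rule allI, rule bound)
   thus ?thesis using LIM_zero_iff by blast
  qed
  have i: "lb_int (\<lambda>x. Gk n x * q x)" for n
   by (rule wbd_integrable_Sz[of 0 N _ _ 0]) 
     (use Gk Gkm test_schwartz[OF q] in \<open>auto simp: Sz_0 intro!: wbd_poly[where C="(1/2) ^ n * (C * A')"] simp: mult_ac\<close>)
  have nw: "norm (cx ((2 + abs x) ^ N) :: complex) = (2 + abs x) ^ N" for x :: real
   by (simp only: norm_of_real) simp
  have pw: "wbd 0 N (\<lambda>x. cx ((2 + abs x) ^ N) :: complex)"
  proof (rule wbd_poly[of _ 1])
   show "(\<lambda>x. cx ((2 + abs x) ^ N) :: complex) \<in> BM" by measurable
  qed (simp only: nw mult_1_left order_refl)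
  have iw: "lb_int (\<lambda>x. norm (cx ((2 + abs x) ^ N) * q x))"
   by (intro integrable_norm wbd_integrable_Sz[OF pw, of _ 0]) (use test_schwartz[OF q] in \<open>auto simp: Sz_0\<close>)
  have "(\<lambda>n. LB x. (\<Sum>k<n. Gk k x) * q x) \<longlonglongrightarrow> (LB x. G x * q x)"
  proof (rule integral_dominated_convergence[where w = "\<lambda>x. (2 * C * A') * norm (cx ((2 + abs x) ^ N) * q x)"])
   show "AE x in lborel. (\<lambda>n. (\<Sum>k<n. Gk k x) * q x) \<longlonglongrightarrow> G x * q x"
    unfolding G_def by (intro always_eventually allI tendsto_mult tendsto_const summable_LIMSEQ summable_norm_cancel[OF sumn])
   have b: "norm (\<Sum>k<n. Gk k x) <= 2 * C * A' * (2 + abs x) ^ N" for n x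
    by (rule order_trans[OF norm_sum order_trans[OF sum_le_suminf[OF sumn] Gs]]) auto
   show "AE x in lborel. norm ((\<Sum>k<n. Gk k x) * q x) <= (2 * C * A') * norm (cx ((2 + abs x) ^ N) * q x)" for n
    unfolding norm_mult nw mult.assoc[symmetric] by (intro always_eventually allI mult_right_mono b norm_ge_zero)
  qed (use iw Gm Gkm smooth_measurable[OF test_smooth[OF q]] in auto)
  hence "(\<lambda>n. \<Sum>k<n. LB x. Gk k x * q x) \<longlonglongrightarrow> (LB x. G x * q x)"
   unfolding sum_distrib_right LB_integral_sum[OF i] .
  hence "(\<lambda>n. T (conv (rn 0) p) + (\<Sum>k<n. LB x. Gk k x * q x)) \<longlonglongrightarrow> T (conv (rn 0) p) + (LB x. G x * q x)"
   by (intro tendsto_add tendsto_const)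
  hence "(\<lambda>n. T (conv (rn n) p)) \<longlonglongrightarrow> T (conv (rn 0) p) + (LB x. G x * q x)"
   unfolding step[symmetric] .
  hence "T p = T (conv (rn 0) p) + (LB x. G x * q x)" using lim1 LIMSEQ_unique by blast
  moreover have "rn 0 = r" by (auto simp: rn_def)
  ultimately show ?thesis using tempered_conv(1)[OF T rk(1) p] by (simp add: G0_def q_def)
 qed
 show ?thesis using G0w Gw main by blast
qed

text \<open>On functions vanishing near 0, D^M p may be written as x^(-M) (x^M D^M p). This is an
  Euler operator, and the negative power only worsens the exponent at 0.\<close>

lemma rep_away_from_zero:
 assumes T: "tempered T"
 shows "\<exists>N M::nat. rep (test0) (- real M) (real N) T"
proof -
 obtain N M G0 G where G: "wbd 0 (real N) G0" "wbd 0 (real N) G"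
   "!!p. p\<in>testR ==> T p = (LB x. G0 x * p x) + (LB x. G x * nderiv M p x)"
  using structure_theorem[OF T] by blast
 have "rep (test0) (- real M) (real N) (\<lambda>p. (LB x. G0 x * p x) + (LB x. (G x * inverse (cx x ^ M)) * (cx x ^ M * nderiv M p x)))"
 proof (rule rep_add[OF adm_test_away[of M]])
  show "rep (test0) (- real M) (real N) (\<lambda>p. LB x. G0 x * p x)"
   by (rule rep_int[OF wbd_mono[OF G(1)]]) auto
  have "wbd (- real M) (real N) (\<lambda>x. G x * inverse (cx x ^ M))"
   by (rule wbd_mono[OF wbd_mult[OF G(2) wbd_xpow_inverse[of M]]]) auto
  thus "rep (test0) (- real M) (real N) (\<lambda>p. LB x. (G x * inverse (cx x ^ M)) * (cx x ^ M * nderiv M p x))"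
   by (intro rep_nderiv[OF adm_test_away[of M]]) auto
 qed simp
 hence "rep (test0) (- real M) (real N) T"
 proof (rule rep_cong)
  fix p assume p: "p \<in> test0"
  have pU: "p \<in> testR" by (rule test_mono[OF p]) simp
  have m: "G \<in> BM" "nderiv M p \<in> BM"
   using wbd_measurable[OF G(2)] smooth_measurable[OF test_smooth[OF test_nderiv[OF p]]] by auto
  note [measurable] = m
  have "(LB x. (G x * inverse (cx x ^ M)) * (cx x ^ M * nderiv M p x)) = (LB x. G x * nderiv M p x)"
   by (rule integral_cong_AE) (use AE_lborel_not_0 in \<open>auto elim!: eventually_mono\<close>)
  thus "(LB x. G0 x * p x) + (LB x. (G x * inverse (cx x ^ M)) * (cx x ^ M * nderiv M p x)) = T p"
   using G(3)[OF pU] by simp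
 qed
 thus ?thesis by blast
qed

section \<open>Gluing local representations\<close>

lemma bump_exists:
 assumes "r > 0"
 obtains g where "g \<in> testR" "!!x. abs x < r / 3 ==> g x = 1" "!!x. abs x > 2 * r / 3 ==> g x = 0"
proof
 show "(\<lambda>x. cutoff (x / (r / 3))) \<in> testR" using assms by (intro cutoff_dilate_test) simp
 show "cutoff (x / (r / 3)) = 1" if "abs x < r / 3" for x
  using assms that by (intro cutoff_1) (simp add: abs_mult field_simps)
 show "cutoff (x / (r / 3)) = 0" if "abs x > 2 * r / 3" for x
  using assms that by (intro cutoff_0) (simp add: abs_mult field_simps)
qed

text \<open>A partition of unity at 0: one representation supplies the exponent at 0, the other the
  exponent at infinity, and the bad exponent of each is removed by the cutoff in front of
  it.\<close>

lemma rep_combine: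
 assumes S: "adm n S" "a + n > -1" 
  and add: "!!f. f \<in> S ==> T f = T (\<lambda>x. g x * f x) + T (\<lambda>x. (1 - g x) * f x)"
  and r0: "rep S0 a c T" and r1: "rep S1 d b T"
  and g: "g \<in> testR" "r > 0" "!!x. abs x < r ==> g x = 1"
  and m: "!!f. f \<in> S ==> (\<lambda>x. g x * f x) \<in> S0" "!!f. f \<in> S ==> (\<lambda>x. (1 - g x) * f x) \<in> S1"
 shows "rep S a b T"
proof -
 have "rep S a b (\<lambda>f. T (\<lambda>x. g x * f x))" by (rule rep_cutoff[OF S r0 g(1) m(1)])
 moreover have "rep S a b (\<lambda>f. T (\<lambda>x. (1 - g x) * f x))" by (rule rep_cutoff_compl[OF S r1 g m(2)])
 ultimately have "rep S a b (\<lambda>f. T (\<lambda>x. g x * f x) + T (\<lambda>x. (1 - g x) * f x))" by (rule rep_add[OF S])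
 thus ?thesis by (rule rep_cong) (simp add: add)
qed

lemma bdd_smooth_compl: "g \<in> testR ==> bdd_smooth (\<lambda>x. 1 - g x)"
 using bdd_smooth_add[OF bdd_smooth_const[of 1] bdd_smooth_test[OF test_cmult[of g UNIV "-1"]]] by simp

lemma test_mult_smooth: "f \<in> TF U ==> smooth g ==> (\<lambda>x. g x * f x) \<in> TF U"
 by (rule test_mult[where V=UNIV]) auto

lemma tempered_split:
 assumes "tempered T" "f \<in> schwartz" "g \<in> testR"
 shows "T f = T (\<lambda>x. g x * f x) + T (\<lambda>x. (1 - g x) * f x)"
 using temperedD(1)[OF assms(1) tame_schwartz[OF tame_mult[OF bdd_smooth_test[OF assms(3)]] assms(2)]
   tame_schwartz[OF tame_mult[OF bdd_smooth_compl[OF assms(3)]] assms(2)]]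
 by (simp add: algebra_simps)

lemma compl_test_away:
 assumes f: "f \<in> testR" and g: "g \<in> testR" "r > 0" "!!x. abs x < r ==> g x = 1"
 shows "(\<lambda>x. (1 - g x) * f x) \<in> test0"
proof -
 obtain R where R: "!!x. abs x >= R ==> f x = 0" using test_bounded_subset[OF f] by blast
 show ?thesis
 proof (rule test_away_0I[of _ r R])
  show "smooth (\<lambda>x. (1 - g x) * f x)"
   by (intro smooth_mult smooth_diff test_smooth[OF f] test_smooth[OF g(1)]) auto
  show "(1 - g x) * f x = 0" if "abs x > R" for x using R[of x] that by simp
 qed (use g in auto)
qed

text \<open>The local form at 0 given by the order of vanishing is glued to the form valid away from
  0, and density carries the result from test functions to Schwartz functions.\<close>

lemma tempered_vanishing_rep:
 assumes T: "tempered T" and v: "vanishes_to T 0 (int k)" and N: "rep (test0) d b T"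
 shows "rep schwartz k b T"
proof -
 obtain r where r: "0 < r" "r <= 1" "!!c. rep (TF {-r<..<r}) (of_int (int k)) c T"
  using vanishes_imp_rep[OF v] by auto
 obtain g where g: "g \<in> testR" "!!x. abs x < r / 3 ==> g x = 1" "!!x. abs x > 2 * r / 3 ==> g x = 0"
  using bump_exists[OF r(1)] by blast
 have "rep (testR) k b T"
 proof (rule rep_combine[OF adm_test _ _ _ N g(1) _ g(2), where r="r / 3"])
  show "rep (TF {-r<..<r}) k 0 T" using r(3)[of 0] by simp
  fix f assume f: "f \<in> testR"
  show "(\<lambda>x. g x * f x) \<in> TF {-r<..<r}"
  proof (rule test_functionsI[of _ "{-2*r/3..2*r/3}"])
   show "smooth (\<lambda>x. g x * f x)"
    by (intro smooth_mult test_smooth[OF f] test_smooth[OF g(1)]) auto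
   fix x assume "x \<notin> {-2*r/3..2*r/3}"
   hence "g x = 0" by (intro g(3)) (auto simp: abs_if)
   thus "g x * f x = 0" by simp
  qed (use r in auto)
  show "(\<lambda>x. (1 - g x) * f x) \<in> test0"
   by (rule compl_test_away[OF f g(1) _ g(2), where r="r / 3"]) (use r in auto)
  show "T f = T (\<lambda>x. g x * f x) + T (\<lambda>x. (1 - g x) * f x)" by (rule tempered_split[OF T test_schwartz[OF f] g(1)])
 qed (use r in auto)
 thus ?thesis by (rule rep_test_schwartz[OF T]) simp
qed

section \<open>Inversion and behaviour at infinity\<close>

lemma Eop_funpow_cong_open:
 assumes "open U" "!!x. x \<in> U ==> f x = g x" "x \<in> U"
 shows "(Eop ^^ j) f x = (Eop ^^ j) g x"
 using assms(3)
proof (induction j arbitrary: x)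
 case (Suc j)
 have "nderiv 1 ((Eop ^^ j) f) x = nderiv 1 ((Eop ^^ j) g) x"
  by (rule nderiv_cong_open[OF assms(1) Suc.IH Suc.prems])
 thus ?case using Suc by (simp add: Eop_def[of "(Eop ^^ j) f"] Eop_def[of "(Eop ^^ j) g"])
qed (use assms in simp)

lemma inv_density_nz: "x ~= 0 ==> inv_density f x = inverse (cx x) ^ 2 * f (1 / x)"
 by (simp add: inv_density_def field_simps)

lemma smooth_inv_density:
 assumes "smooth_on (- {0}) f" shows "smooth_on (- {0}) (inv_density f)"
proof (rule smooth_cong)
 show "smooth_on (- {0}) (\<lambda>x. inverse (cx x) ^ 2 * f (1 / x))"
  by (intro smooth_mult smooth_power smooth_inverse smooth_reciprocal assms) auto
qed (auto simp: inv_density_nz)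

lemma inv_density_inv_density: "x ~= 0 ==> inv_density (inv_density f) x = f x"
 by (simp add: inv_density_def power_one_over)

text \<open>In the coordinate 1/x the field x d/dx changes sign. The factor 1/x^2 of a density turns
  \<open>Eop\<close>, which is d/dx composed with x, into exactly its negative.\<close>

lemma Eop_inv_density:
 assumes "smooth_on (- {0}) f" "x ~= 0"
 shows "Eop (inv_density f) x = - inv_density (Eop f) x"
proof -
 have "((\<lambda>x. 1 / x) has_vd - (1 / x^2)) (at x)"
  using assms(2) unfolding hrd_iff_hvd[symmetric]
  by (auto intro!: derivative_eq_intros simp: power2_eq_square)
 moreover have "(f has_vd nderiv 1 f (1 / x)) (at (1 / x))"
  using assms(2) by (intro smooth_hvd1[OF assms(1)]) auto
 ultimately have "(f \<circ> (\<lambda>x. 1 / x) has_vd - (1 / x^2) *\<^sub>R nderiv 1 f (1 / x)) (at x)"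
  by (rule vector_diff_chain_at)
 hence 1: "((\<lambda>x. f (1 / x)) has_vd - (1 / x^2) *\<^sub>R nderiv 1 f (1 / x)) (at x)"
  by (simp add: o_def)
 have "((\<lambda>z. inverse z ^ 2) has_field_derivative (- 2 * inverse (cx x) ^ 3)) (at (cx x))"
  using assms(2) by (auto intro!: derivative_eq_intros simp: field_simps power2_eq_square power3_eq_cube)
 hence 2: "((\<lambda>x. inverse (cx x) ^ 2) has_vd (- 2 * inverse (cx x) ^ 3)) (at x)"
  by (rule has_vector_derivative_real_field)
 have "((\<lambda>x. inverse (cx x) ^ 2 * f (1 / x)) has_vd
   inverse (cx x) ^ 2 * (- (1 / x^2) *\<^sub>R nderiv 1 f (1 / x)) + (- 2 * inverse (cx x) ^ 3) * f (1 / x)) (at x)"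
  by (rule has_vector_derivative_mult[OF 2 1])
 hence "(inv_density f has_vd
   inverse (cx x) ^ 2 * (- (1 / x^2) *\<^sub>R nderiv 1 f (1 / x)) + (- 2 * inverse (cx x) ^ 3) * f (1 / x)) (at x)"
  by (subst hvd_cong_open[of "- {0}"]) (use assms(2) in \<open>auto simp: inv_density_nz\<close>)
 hence N: "nderiv 1 (inv_density f) x = inverse (cx x) ^ 2 * (- (1 / x^2) *\<^sub>R nderiv 1 f (1 / x)) + (- 2 * inverse (cx x) ^ 3) * f (1 / x)"
  by (rule nderiv_1_eqI)
 show ?thesis using assms(2) unfolding Eop_def N inv_density_nz[OF assms(2)]
  by (simp add: scaleR_conv_of_real field_simps power2_eq_square power3_eq_cube)
qed

lemma Eop_funpow_inv_density:
 assumes "smooth_on (- {0}) f" "x ~= 0"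
 shows "(Eop ^^ j) (inv_density f) x = (-1) ^ j * inv_density ((Eop ^^ j) f) x"
 using assms(2)
proof (induction j arbitrary: x)
 case (Suc j)
 define g where "g = (Eop ^^ j) f"
 have sg: "smooth_on (- {0}) g" unfolding g_def by (rule smooth_Eop_funpow[OF _ assms(1)]) auto
 have o: "open (- {0::real})" by auto
 have "Eop ((Eop ^^ j) (inv_density f)) x = Eop (\<lambda>x. (-1) ^ j * inv_density g x) x"
  using Eop_funpow_cong_open[of "- {0}" "(Eop ^^ j) (inv_density f)" "\<lambda>x. (-1) ^ j * inv_density g x" x 1, OF o] Suc
  by (simp add: g_def One_nat_def)
 also have "... = (-1) ^ j * Eop (inv_density g) x"
  using nderiv_cmult[OF o smooth_inv_density[OF sg], of x 1 "(-1) ^ j"] Suc.prems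
  by (simp add: Eop_def algebra_simps)
 also have "... = (-1) ^ Suc j * inv_density (Eop g) x" using Eop_inv_density[OF sg Suc.prems] by simp
 finally show ?case by (simp add: g_def)
qed simp

lemma inv_density_test_away:
 assumes f: "f \<in> test0" shows "inv_density f \<in> test0"
proof -
 obtain r where r: "r > 0" "!!x. abs x < r ==> f x = 0" using test_away_0[OF f] by blast
 obtain R where R: "R > 0" "!!x. abs x >= R ==> f x = 0" using test_bounded_subset[OF f] by blast
 have z0: "inv_density f x = 0" if "abs x < 1 / R" for x
  using R(2)[of "1 / x"] that R(1) by (auto simp: inv_density_def abs_divide field_simps)
 have z1: "inv_density f x = 0" if "abs x > 1 / r" for x
  using r(2)[of "1 / x"] that r(1) by (auto simp: inv_density_def abs_divide field_simps)
 have s: "smooth_on (- {0}) (inv_density f)"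
  by (rule smooth_inv_density[OF smooth_subset[OF test_smooth[OF f]]]) simp
 have "smooth (inv_density f)"
 proof (rule smooth_local)
  fix x :: real
  show "\<exists>V. open V \<and> x \<in> V \<and> smooth_on V (inv_density f)"
  proof (cases "x = 0")
   case True
   have "smooth_on {-(1/R)<..<1/R} (inv_density f)"
    by (rule smooth_cong[OF _ smooth_const[of _ 0]]) (use z0 in auto)
   thus ?thesis using True R(1) by (intro exI[of _ "{-(1/R)<..<1/R}"]) auto
  next
   case False
   thus ?thesis using s by (intro exI[of _ "- {0}"]) auto
  qed
 qed
 thus ?thesis by (rule test_away_0I[of _ "1 / R" "1 / r"]) (use R(1) z0 z1 in auto)
qed

lemma integral_inv_density:
 assumes h: "h \<in> BM" and f: "f \<in> BM"
 shows "(LB x. h x * inv_density f x) = (LB x. h (1 / x) * f x)"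
proof -
 note [measurable] = h f
 have "(LB x. h x * inv_density f x) = (LB x. (\<lambda>t. h (1 / t) * f t) (1 / x) / cx x ^ 2)"
  by (intro LB_integral_cong) (auto simp: inv_density_def)
 also have "... = (LB x. h (1 / x) * f x)" by (rule reciprocal_substitution) measurable
 finally show ?thesis .
qed

lemma euler_form_inv_density:
 assumes h: "!!i. h i \<in> BM" and f: "f \<in> test0"
 shows "euler_form m h (inv_density f) = euler_form m (\<lambda>i x. (-1) ^ i * h i (1 / x)) f"
 unfolding euler_form_def
proof (intro sum.cong refl)
 fix i
 note [measurable] = h
 have sf: "smooth f" by (rule test_smooth[OF f])
 have m: "(Eop ^^ i) f \<in> BM" by (rule smooth_measurable[OF smooth_Eop_funpow[OF open_UNIV sf]])
 have m2: "(Eop ^^ i) (inv_density f) \<in> BM"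
  by (rule smooth_measurable[OF smooth_Eop_funpow[OF open_UNIV test_smooth[OF inv_density_test_away[OF f]]]])
 note [measurable] = m m2
 have [measurable]: "inv_density ((Eop ^^ i) f) \<in> BM"
  by (rule smooth_measurable[OF test_smooth[OF inv_density_test_away[OF test_functions_Eop_funpow[OF f]]]])
 have "(LB x. h i x * (Eop ^^ i) (inv_density f) x) = (LB x. (-1) ^ i * (h i x * inv_density ((Eop ^^ i) f) x))"
 proof (rule integral_cong_AE)
  show "AE x in lborel. h i x * (Eop ^^ i) (inv_density f) x = (-1) ^ i * (h i x * inv_density ((Eop ^^ i) f) x)"
   using AE_lborel_not_0
   by eventually_elim (subst Eop_funpow_inv_density[OF smooth_subset[OF sf]], auto)
 qed measurable
 also have "... = (-1) ^ i * (LB x. h i x * inv_density ((Eop ^^ i) f) x)" by simp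
 also have "... = (-1) ^ i * (LB x. h i (1 / x) * (Eop ^^ i) f x)" by (simp only: integral_inv_density[OF h m])
 also have "... = (LB x. (-1) ^ i * h i (1 / x) * (Eop ^^ i) f x)" by (simp only: integral_mult_right_zero[symmetric] mult.assoc)
 finally show "(LB x. h i x * (Eop ^^ i) (inv_density f) x) = (LB x. (-1) ^ i * h i (1 / x) * (Eop ^^ i) f x)" .
qed

lemma rep_inversion:
 assumes T: "rep S a b T" and S': "S' \<subseteq> test0" "!!f. f \<in> S' ==> inv_density f \<in> S"
 shows "rep S' (- b) (- a) (\<lambda>f. T (inv_density f))"
proof -
 obtain m h where h: "!!i. wbd a b (h i)" "!!f. f \<in> S ==> T f = euler_form m h f"
  using T unfolding rep_def by blast
 show ?thesis
 proof (rule repI[of _ _ "\<lambda>i x. (-1) ^ i * h i (1 / x)" _ _ m])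
  show "wbd (- b) (- a) (\<lambda>x. (-1) ^ i * h i (1 / x))" for i by (rule wbd_cmult[OF wbd_recip[OF h(1)]])
  fix f assume f: "f \<in> S'"
  show "T (inv_density f) = euler_form m (\<lambda>i x. (-1) ^ i * h i (1 / x)) f"
   unfolding h(2)[OF S'(2)[OF f]] using f S'(1) by (intro euler_form_inv_density wbd_measurable[OF h(1)]) auto
 qed
qed

text \<open>Vanishing of the extension to order K in the coordinate 1/x is, back in x, the exponent
  -K at infinity. It is obtained for functions supported far out and glued to the given
  form.\<close>

lemma tempered_canonical_rep:
 assumes T: "tempered T" and v: "rep schwartz a b T" "a > -1"
  and e: "extends_canonically_across_infinity T"
 shows "rep schwartz a (- real K) T"
proof -
 obtain \<tau> where \<tau>: "!!f. f \<in> testR ==> \<tau> f = T f" "vanishes_to (inversion \<tau>) 0 (int K)"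
  using e by (auto simp: extends_canonically_across_infinity_def extends_across_infinity_def)
 obtain r where r: "0 < r" "r <= 1" "!!c. rep (TF {-r<..<r}) (of_int (int K)) c (inversion \<tau>)"
  using vanishes_imp_rep[OF \<tau>(2)] by auto
 \<comment> \<open>Vanishing for |x| < 2/r confines the inverted density to |x| <= r/2, inside the
   interval of the local form.\<close>
 define S1 where "S1 = {f \<in> test0. \<forall>x. abs x < 2 / r --> f x = 0}"
 have inv: "inv_density f \<in> TF {-r<..<r}" if f: "f \<in> S1" for f
 proof (rule test_functionsI[of _ "{-r/2..r/2}"])
  show "smooth (inv_density f)" using f inv_density_test_away test_smooth by (auto simp: S1_def)
  fix x assume "x \<notin> {-r/2..r/2}"
  hence "abs x > r / 2" by (auto simp: abs_if)
  hence "abs (1 / x) < 2 / r" using r(1) by (simp add: abs_divide field_simps)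
  thus "inv_density f x = 0" using f by (simp add: S1_def inv_density_def)
 qed (use r in auto)
 \<comment> \<open>Inversion sends the exponents (K, 0) to (0, -K).\<close>
 have "rep S1 (- 0) (- real K) (\<lambda>f. inversion \<tau> (inv_density f))"
  by (rule rep_inversion[of "TF {-r<..<r}"]) (use r(3)[of 0] inv in \<open>auto simp: S1_def\<close>)
 hence "rep S1 0 (- real K) (\<lambda>f. inversion \<tau> (inv_density f))" by simp
 hence R1: "rep S1 0 (- real K) T"
 proof (rule rep_cong)
  fix f assume f: "f \<in> S1"
  have ii: "inv_density (inv_density f) x = f x" for x
   using f r(1) by (cases "x = 0") (auto simp: inv_density_inv_density S1_def, simp add: inv_density_def)
  hence "inversion \<tau> (inv_density f) = \<tau> f" by (simp add: inversion_def ext[of "inv_density (inv_density f)" f, OF ii])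
  also have "... = T f" using f by (intro \<tau>(1)) (auto simp: S1_def intro: test_mono)
  finally show "inversion \<tau> (inv_density f) = T f" .
 qed
 \<comment> \<open>A third of 6/r is 2/r, so the bump equals 1 wherever the functions of
   \<open>S1\<close> must vanish.\<close>
 have "6 / r > 0" using r(1) by simp
 from bump_exists[OF this] obtain g where g': "g \<in> testR" "!!x. abs x < (6 / r) / 3 ==> g x = 1"
  "!!x. abs x > 2 * (6 / r) / 3 ==> g x = 0" by blast
 have g: "g \<in> testR" "!!x. abs x < 2 / r ==> g x = 1" using g' by auto
 have "rep (testR) a (- real K) T"
 proof (rule rep_combine[OF adm_test _ _ v(1) R1 g(1) _ g(2), where r="2 / r"])
  fix f assume f: "f \<in> testR"
  show "(\<lambda>x. g x * f x) \<in> schwartz"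
   by (rule test_schwartz[OF test_mult_smooth[OF f test_smooth[OF g(1)]]])
  show "(\<lambda>x. (1 - g x) * f x) \<in> S1"
   using compl_test_away[OF f g(1) _ g(2), where r="2 / r"] g(2) r(1) by (auto simp: S1_def)
  show "T f = T (\<lambda>x. g x * f x) + T (\<lambda>x. (1 - g x) * f x)" by (rule tempered_split[OF T test_schwartz[OF f] g(1)])
 qed (use r v(2) in auto)
 thus ?thesis by (rule rep_test_schwartz[OF T _ v(2)])
qed

section \<open>The Fourier transform\<close>

definition ek :: "real => real => complex" where
 "ek y x = exp (2 * cx pi * \<i> * cx (- (x * y)))"

lemma ek_iexp: "ek y x = iexp (- (2 * pi * (x * y)))"
 by (simp add: ek_def mult_ac)

lemma norm_ek [simp]: "norm (ek y x) = 1"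
 by (simp add: ek_iexp)

lemma ek_commute: "ek y x = ek x y"
 by (simp add: ek_def mult.commute)

lemma ek_measurable [measurable (raw)]:
 "f \<in> borel_measurable M ==> g \<in> borel_measurable M ==> (\<lambda>p. ek (f p) (g p)) \<in> borel_measurable M"
 unfolding ek_def by measurable

lemma ek_measurable1 [measurable]: "ek y \<in> BM"
 unfolding ek_def[abs_def] by (intro borel_measurable_continuous_onI continuous_intros)

lemma FT_ek: "FT f y = (LB x. f x * ek y x)"
 by (simp add: fourier_fun_def ek_def)

lemma ek_add: "ek (y + h) x = ek y x * ek h x"
 by (simp add: ek_def exp_add[symmetric] algebra_simps)

lemma ek_taylor: "norm (ek h x - (\<Sum>k<n. (- (2 * cx pi * \<i>) * cx x) ^ k / fact k * cx h ^ k)) <= (2 * pi * abs x * abs h) ^ n"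
proof (cases n)
 case (Suc m)
 have "(\<Sum>k<n. (- (2 * cx pi * \<i>) * cx x) ^ k / fact k * cx h ^ k) = (\<Sum>k\<le>m. (\<i> * cx (- (2 * pi * (x * h)))) ^ k / fact k)"
  unfolding Suc lessThan_Suc_atMost
 proof (intro sum.cong refl)
  fix k
  have "\<i> * cx (- (2 * pi * (x * h))) = (- (2 * cx pi * \<i>) * cx x) * cx h" by simp
  thus "(- (2 * cx pi * \<i>) * cx x) ^ k / fact k * cx h ^ k = (\<i> * cx (- (2 * pi * (x * h)))) ^ k / fact k"
   by (simp only: power_mult_distrib[of _ "cx h"]) simp
 qed
 hence "norm (ek h x - (\<Sum>k<n. (- (2 * cx pi * \<i>) * cx x) ^ k / fact k * cx h ^ k)) <= abs (- (2 * pi * (x * h))) ^ Suc m / fact (Suc m)"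
  using iexp_approx1[of "- (2 * pi * (x * h))" m] by (simp only: ek_iexp)
 also have "... <= abs (- (2 * pi * (x * h))) ^ Suc m / 1"
  by (intro divide_left_mono) (use fact_ge_1[of "Suc m", where ?'a=real] in auto)
 also have "... = (2 * pi * abs x * abs h) ^ n" by (simp add: Suc abs_mult mult_ac)
 finally show ?thesis .
qed simp

lemma schwartz_integrable: "f \<in> schwartz ==> lb_int f"
 using wbd_integrable_Sz[of 0 0 "\<lambda>x. 1" f 0] wbd_bounded[of "\<lambda>x. 1" 1] by (auto simp: Sz_0)

lemma ek_mult_integrable:
 assumes "lb_int f" shows "lb_int (\<lambda>x. f x * ek y x)"
proof (rule LB_integrable_bound[OF assms])
 have [measurable]: "f \<in> BM" using assms by auto
 show "(\<lambda>x. f x * ek y x) \<in> borel_measurable lborel" by measurable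
qed (auto simp: norm_mult)

lemma norm_FT_le:
 assumes "lb_int f" shows "norm (FT f y) <= (LB x. norm (f x))"
 unfolding FT_ek
 using integral_norm_bound[of lborel "\<lambda>x. f x * ek y x"] by (simp add: norm_mult)

lemma schwartz_xpow: "f \<in> schwartz ==> (\<lambda>x. cx x ^ n * f x) \<in> schwartz"
 using tame_schwartz[OF tame_xpow] .

lemma schwartz_cmult: "f \<in> schwartz ==> (\<lambda>x. c * f x) \<in> schwartz"
 using tame_schwartz[OF tame_cmult] .

lemma schwartz_x: "f \<in> schwartz ==> (\<lambda>x. cx x * f x) \<in> schwartz"
 using tame_schwartz[OF tame_x] .

lemma schwartz_nderiv: "f \<in> schwartz ==> nderiv n f \<in> schwartz"
 using tame_schwartz[OF tame_nderiv] .

lemma schwartz_add: "f \<in> schwartz ==> g \<in> schwartz ==> (\<lambda>x. f x + g x) \<in> schwartz"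
proof -
 assume fg: "f \<in> schwartz" "g \<in> schwartz"
 show ?thesis
 proof (rule schwartzI_sbd)
  show "smooth (\<lambda>x. f x + g x)" by (intro smooth_add open_UNIV schwartz_smooth fg)
  fix N
  obtain B C where "sbd N f B" "sbd N g C" using sbd_exists fg by blast
  hence "sbd N (\<lambda>x. f x + g x) (B + C)" by (rule sbd_add) (intro schwartz_smooth fg)+
  thus "\<exists>B. sbd N (\<lambda>x. f x + g x) B" by blast
 qed
qed

lemma FT_cmult: "FT (\<lambda>x. c * f x) y = c * FT f y"
 by (simp add: FT_ek mult.assoc)

lemma FT_add:
 "f \<in> schwartz ==> g \<in> schwartz ==> FT (\<lambda>x. f x + g x) y = FT f y + FT g y"
 using ek_mult_integrable[OF schwartz_integrable] by (simp add: FT_ek ring_distribs)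

lemma FT_has_vector_derivative:
 assumes f: "f \<in> schwartz"
 shows "(FT f has_vd FT (\<lambda>x. - (2 * cx pi * \<i>) * (cx x * f x)) y) (at y)"
proof (rule has_vector_derivative_quadratic[of 1])
 fix h :: real
 let ?c = "- (2 * cx pi * \<i>) :: complex"
 have g: "(\<lambda>x. ?c * (cx x * f x)) \<in> schwartz" by (rule schwartz_cmult[OF schwartz_x[OF f]])
 note fi = schwartz_integrable[OF f] and gi = schwartz_integrable[OF g]
 note i0 = ek_mult_integrable[OF fi, of "y + h"] ek_mult_integrable[OF fi, of y]
  integrable_mult_right[OF ek_mult_integrable[OF gi, of y], of "cx h"]
 have x2: "(\<lambda>x. cx x ^ 2 * f x) \<in> schwartz" by (rule schwartz_xpow[OF f])
 have "FT f (y + h) - FT f y - cx h * FT (\<lambda>x. ?c * (cx x * f x)) y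
   = (LB x. f x * ek (y + h) x - f x * ek y x - cx h * (?c * (cx x * f x) * ek y x))"
  unfolding FT_ek LB_integral_diff[OF LB_integrable_diff[OF i0(1,2)] i0(3)]
   LB_integral_diff[OF i0(1,2)] integral_mult_right_zero ..
 also have "norm ... <= (LB x. (2 * pi) ^ 2 * h^2 * norm (cx x ^ 2 * f x))"
 proof (rule LB_norm_le)
  show "lb_int (\<lambda>x. f x * ek (y + h) x - f x * ek y x - cx h * (?c * (cx x * f x) * ek y x))"
   by (intro LB_integrable_diff i0)
  show "lb_int (\<lambda>x. (2 * pi) ^ 2 * h^2 * norm (cx x ^ 2 * f x))"
   using schwartz_integrable[OF x2] by auto
  fix x
  have s: "(\<Sum>k<2. (?c * cx x) ^ k / fact k * cx h ^ k) = 1 + ?c * cx x * cx h"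
   by (simp add: numeral_2_eq_2 One_nat_def)
  have "f x * ek (y + h) x - f x * ek y x - cx h * (?c * (cx x * f x) * ek y x)
    = f x * ek y x * (ek h x - (\<Sum>k<2. (?c * cx x) ^ k / fact k * cx h ^ k))"
   unfolding s ek_add by (simp add: algebra_simps)
  also have "norm ... <= norm (f x) * (2 * pi * abs x * abs h) ^ 2"
   using ek_taylor[of h x 2] by (simp add: norm_mult mult_left_mono)
  finally show "norm (f x * ek (y + h) x - f x * ek y x - cx h * (?c * (cx x * f x) * ek y x)) <= (2 * pi) ^ 2 * h^2 * norm (cx x ^ 2 * f x)"
   by (simp add: norm_mult norm_power power_mult_distrib mult_ac)
 qed
 also have "... = ((2 * pi) ^ 2 * (LB x. norm (cx x ^ 2 * f x))) * h^2" by simp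
 finally show "norm (FT f (y + h) - FT f y - cx h * FT (\<lambda>x. ?c * (cx x * f x)) y)
  <= ((2 * pi) ^ 2 * (LB x. norm (cx x ^ 2 * f x))) * h^2" .
qed simp

lemma nderiv_1_FT:
 "f \<in> schwartz ==> nderiv 1 (FT f) = FT (\<lambda>x. - (2 * cx pi * \<i>) * (cx x * f x))"
 by (intro ext nderiv_1_eqI FT_has_vector_derivative)

lemma smooth_FT:
 assumes "f \<in> schwartz" shows "smooth (FT f)"
proof (rule smooth_coinduct[where P="\<lambda>g. \<exists>f\<in>schwartz. g = FT f"])
 fix g assume "\<exists>f\<in>schwartz. g = FT f"
 then obtain f where f: "f \<in> schwartz" "g = FT f" by blast
 show "\<exists>k. (\<exists>f\<in>schwartz. k = FT f) \<and> (\<forall>x\<in>UNIV. (g has_vd k x) (at x))"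
  unfolding f(2) using FT_has_vector_derivative[OF f(1)] schwartz_cmult[OF schwartz_x[OF f(1)]] by blast
qed (use assms in auto)

text \<open>Obvious for compact support; the integral of the derivative is continuous on the
  Schwartz space, so density finishes.\<close>

lemma integral_nderiv_schwartz:
 assumes "f \<in> schwartz" shows "(LB x. nderiv 1 f x) = 0"
proof -
 obtain C N where C: "C >= 0" "!!f B. f \<in> schwartz ==> sbd N f B ==> norm (LB x. 1 * f x) <= C * B"
  using wbd_tempered[OF wbd_bounded[of "\<lambda>x. 1" 1]] by auto
 obtain D M where D: "D >= 0" "!!f B. f \<in> schwartz ==> sbd M f B ==> sbd N (nderiv 1 f) (D * B)"
  using tameD[OF tame_nderiv_1] by metis
 show ?thesis
 proof (rule tempered_zero_on_test[where N=M and C="C * D", OF _ _ _ assms])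
  fix f g :: "real => complex" assume f: "f \<in> schwartz" "g \<in> schwartz"
  have "nderiv 1 (\<lambda>x. f x + g x) = (\<lambda>x. nderiv 1 f x + nderiv 1 g x)"
   using nderiv_add[OF open_UNIV schwartz_smooth[OF f(1)] schwartz_smooth[OF f(2)]] by auto
  thus "(LB x. nderiv 1 (\<lambda>x. f x + g x) x) = (LB x. nderiv 1 f x) + (LB x. nderiv 1 g x)"
   using schwartz_integrable[OF schwartz_nderiv] f by simp
 next
  fix f :: "real => complex" and B assume f: "f \<in> schwartz" "sbd M f B"
  show "norm (LB x. nderiv 1 f x) <= C * D * B"
   using C(2)[OF schwartz_nderiv[OF f(1)] D(2)[OF f]] by (simp add: mult.assoc)
 next
  fix f assume f: "f \<in> testR"
  obtain R where R: "R > 0" "!!x. abs x >= R ==> f x = 0" using test_bounded_subset[OF f] by blast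
  have "(LB x. nderiv 1 f x) = f R - f (- R)"
  proof (rule integral_deriv_compact[OF test_smooth[OF f]])
   fix x assume "x \<notin> {-R..R}"
   thus "nderiv 1 f x = 0" by (intro nderiv_zero_outside[of "{-R..R}"]) (use R in auto)
  qed (use R in auto)
  thus "(LB x. nderiv 1 f x) = 0" using R by simp
 qed
qed

lemma ek_has_vector_derivative: "(ek y has_vd - (2 * cx pi * \<i>) * cx y * ek y x) (at x)"
proof -
 have "((\<lambda>z. exp (2 * cx pi * \<i> * (- (z * cx y)))) has_field_derivative
   (- (2 * cx pi * \<i>) * cx y * ek y x)) (at (cx x))"
  by (auto intro!: derivative_eq_intros simp: ek_def)
 from has_vector_derivative_real_field[OF this] show ?thesis by (simp add: ek_def[abs_def])
qed

lemma bdd_smooth_ek: "bdd_smooth (ek y)"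
proof -
 let ?a = "- (2 * cx pi * \<i>) * cx y :: complex"
 have D: "((\<lambda>x. c * ek y x) has_vd c * ?a * ek y x) (at x)" for c x
  using has_vector_derivative_mult_right[OF ek_has_vector_derivative, of c y x] by (simp add: mult.assoc)
 have "smooth (ek y)"
 proof (rule smooth_coinduct[where P="\<lambda>g. \<exists>c. g = (\<lambda>x. c * ek y x)"])
  show "\<exists>c. ek y = (\<lambda>x. c * ek y x)" by (rule exI[of _ 1]) simp
  fix f assume "\<exists>c. f = (\<lambda>x. c * ek y x)"
  then obtain c where c: "f = (\<lambda>x. c * ek y x)" by blast
  show "\<exists>g. (\<exists>c. g = (\<lambda>x. c * ek y x)) \<and> (\<forall>x\<in>UNIV. (f has_vd g x) (at x))"
   unfolding c using D by blast
 qed auto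
 moreover have "nderiv n (ek y) = (\<lambda>x. ?a ^ n * ek y x)" for n
 proof (induction n)
  case (Suc n)
  have "nderiv (Suc n) (ek y) x = ?a ^ Suc n * ek y x" for x
   unfolding nderiv_Suc' Suc using vector_derivative_at[OF D[of "?a ^ n" x]] by (simp only: power_Suc2)
  thus ?case by blast
 qed simp
 ultimately show ?thesis
  unfolding bdd_smooth_def by (auto simp: norm_mult norm_power intro!: exI)
qed

lemma FT_nderiv_1:
 assumes f: "f \<in> schwartz"
 shows "FT (nderiv 1 f) y = 2 * cx pi * \<i> * cx y * FT f y"
proof -
 have g: "(\<lambda>x. ek y x * f x) \<in> schwartz" by (rule tame_schwartz[OF tame_mult[OF bdd_smooth_ek] f])
 have se: "smooth (ek y)" using bdd_smooth_ek by (simp add: bdd_smooth_def)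
 have n: "nderiv 1 (\<lambda>x. ek y x * f x) x = nderiv 1 f x * ek y x - (2 * cx pi * \<i> * cx y) * (f x * ek y x)" for x
  by (subst nderiv_1_mult[OF open_UNIV se schwartz_smooth[OF f] UNIV_I])
    (simp add: nderiv_1_eqI[OF ek_has_vector_derivative] algebra_simps)
 have "0 = (LB x. nderiv 1 f x * ek y x - (2 * cx pi * \<i> * cx y) * (f x * ek y x))"
  using integral_nderiv_schwartz[OF g] unfolding n by simp
 also have "... = FT (nderiv 1 f) y - (2 * cx pi * \<i> * cx y) * FT f y"
  unfolding FT_ek
  using ek_mult_integrable[OF schwartz_integrable[OF schwartz_nderiv[OF f, of 1]]] ek_mult_integrable[OF schwartz_integrable[OF f]]
  by (subst LB_integral_diff) auto
 finally show ?thesis by simp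
qed

lemma FT_nderiv:
 assumes f: "f \<in> schwartz"
 shows "FT (nderiv n f) y = (2 * cx pi * \<i> * cx y) ^ n * FT f y"
 using f
proof (induction n arbitrary: f)
 case (Suc n)
 thus ?case using FT_nderiv_1[OF Suc.prems, of y] schwartz_nderiv[of f 1] by (simp add: nderiv_Suc mult_ac)
qed simp

lemma nderiv_FT:
 assumes f: "f \<in> schwartz"
 shows "nderiv n (FT f) = FT (\<lambda>x. (- (2 * cx pi * \<i>)) ^ n * (cx x ^ n * f x))"
 using f
proof (induction n arbitrary: f)
 case (Suc n)
 have g: "(\<lambda>x. - (2 * cx pi * \<i>) * (cx x * f x)) \<in> schwartz" by (rule schwartz_cmult[OF schwartz_x[OF Suc.prems]])
 show ?case unfolding nderiv_Suc nderiv_1_FT[OF Suc.prems] Suc.IH[OF g] by (simp add: mult_ac)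
qed simp

text \<open>Up to powers of 2 pi i, y^m times the n-th derivative of the transform is the transform
  of the m-th derivative of x^n f, and a transform is bounded by the L^1 norm, itself controlled by
  the seminorms up to 2.\<close>

lemma tame_FT: "tame FT"
proof (rule tameI)
 fix N
 obtain C K where C: "C >= 0" "!!f B. f \<in> schwartz ==> sbd K f B ==> (LB x. norm (f x)) <= C * B"
 proof -
  define C where "C = (LB x. 2 * wt 0 (-2) x)"
  have i: "lb_int (\<lambda>x. 2 * wt 0 (-2) x)" by (intro integrable_mult_right integrable_wt) auto
  have "(LB x. norm (f x)) <= C * B" if f: "f \<in> schwartz" "sbd 2 f B" for f B
  proof -
   have "(LB x. norm (f x)) <= (LB x. 2 * wt 0 (-2) x * B)"
   proof (rule integral_mono_AE)
    show "lb_int (\<lambda>x. norm (f x))" using schwartz_integrable[OF f(1)] by auto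
    show "lb_int (\<lambda>x. 2 * wt 0 (-2) x * B)" using i by auto
    show "AE x in lborel. norm (f x) <= 2 * wt 0 (-2) x * B"
     using AE_lborel_not_0
    proof eventually_elim
     case (elim x)
     have 0: "norm (f x) <= B" using sbdD[OF f(2), of 0 0 x] by simp
     have "abs x ^ 2 * norm (f x) <= B" using sbdD[OF f(2), of 2 0 x] by (simp add: norm_mult norm_power)
     hence "norm (f x) <= wt 0 (-2) x * B"
      using 0 elim by (auto simp: wt_def powr_minus powr_realpow[of _ 2, simplified] field_simps)
     moreover have "wt 0 (-2) x * B >= 0" using sbd_nonneg[OF f(2)] by simp
     ultimately show ?case by linarith
    qed
   qed
   thus ?thesis by (simp add: C_def)
  qed
  moreover have "C >= 0" unfolding C_def by simp
  ultimately show ?thesis using that by blast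
 qed
 define L where "L m n f = nderiv m (\<lambda>x. (- (2 * cx pi * \<i>)) ^ n * (cx x ^ n * f x))" for m n and f :: "real => complex"
 have tL: "tame (L m n)" for m n
  unfolding L_def[abs_def] by (rule tame_comp[OF tame_nderiv tame_comp[OF tame_cmult tame_xpow]])
 have "\<forall>m n. \<exists>C N'. C >= 0 \<and> (\<forall>f\<in>schwartz. \<forall>B. sbd N' f B --> sbd K (L m n f) (C * B))"
  using tameD[OF tL] by blast
 then obtain D M where D: "!!m n. D m n >= 0" "!!m n f B. f \<in> schwartz ==> sbd (M m n) f B ==> sbd K (L m n f) (D m n * B)"
  by metis
 define M' where "M' = Max ((\<lambda>(m, n). M m n) ` ({..N} \<times> {..N}))"
 define D' where "D' = (\<Sum>p\<in>{..N} \<times> {..N}. D (fst p) (snd p))"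
 have M': "M m n <= M'" if "m <= N" "n <= N" for m n unfolding M'_def using that by (intro Max_ge) auto
 have D': "D m n <= D'" if "m <= N" "n <= N" for m n
  unfolding D'_def using that member_le_sum[of "(m, n)" "{..N} \<times> {..N}" "\<lambda>p. D (fst p) (snd p)"] D(1) by auto
 have D'0: "D' >= 0" using D(1) by (simp add: D'_def sum_nonneg)
 show "\<exists>C N'. C >= 0 \<and> (\<forall>f\<in>schwartz. \<forall>B. sbd N' f B --> sbd N (FT f) (C * B))"
 proof (intro exI conjI ballI allI impI)
  show "C * D' >= 0" using C(1) D'0 by simp
  fix f :: "real => complex" and B assume f: "f \<in> schwartz" "sbd M' f B"
  show "sbd N (FT f) (C * D' * B)"
   unfolding sbd_def
  proof (intro allI impI)
   fix m n y assume mn: "m <= N" "n <= N"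
   have g: "(\<lambda>x. (- (2 * cx pi * \<i>)) ^ n * (cx x ^ n * f x)) \<in> schwartz"
    by (rule schwartz_cmult[OF schwartz_xpow[OF f(1)]])
   have B0: "B >= 0" using sbd_nonneg[OF f(2)] .
   \<comment> \<open>The factor 2 pi of the differentiation rule exceeds 1 and may be inserted for
     free.\<close>
   have "abs y ^ m * norm (nderiv n (FT f) y) <= (2 * pi * abs y) ^ m * norm (nderiv n (FT f) y)"
    using pi_ge_two by (intro mult_right_mono power_mono) (auto intro!: mult_right_mono[of 1 "2 * pi" "abs y", simplified])
   also have "... = norm (FT (L m n f) y)"
    unfolding L_def FT_nderiv[OF g] nderiv_FT[OF f(1)] by (simp add: norm_mult norm_power power_mult_distrib)
   also have "... <= (LB x. norm (L m n f x))"
    by (rule norm_FT_le[OF schwartz_integrable[OF tame_schwartz[OF tL f(1)]]])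
   also have "... <= C * (D m n * B)"
    by (rule C(2)[OF tame_schwartz[OF tL f(1)] D(2)[OF f(1) sbd_mono[OF f(2) M'[OF mn] order_refl]]])
   also have "... <= C * (D' * B)" using D'[OF mn] C(1) B0 by (intro mult_left_mono mult_right_mono) auto
   finally show "norm (cx y ^ m * nderiv n (FT f) y) <= C * D' * B" by (simp add: norm_mult norm_power mult.assoc)
  qed
 qed
qed (rule smooth_FT)

lemma tempered_fourier:
 assumes T: "tempered T" shows "tempered (fourier T)"
proof -
 obtain C N where C: "C >= 0" "!!f B. f \<in> schwartz ==> sbd N f B ==> norm (T f) <= C * B"
  using temperedD(3)[OF T] by blast
 obtain D M where D: "D >= 0" "!!f B. f \<in> schwartz ==> sbd M f B ==> sbd N (FT f) (D * B)"
  using tameD[OF tame_FT] by metis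
 note F = tame_schwartz[OF tame_FT]
 have "linear_functional_on schwartz (fourier T)"
  unfolding linear_functional_on_def fourier_def
 proof (intro conjI ballI allI)
  fix f g :: "real => complex" assume fg: "f \<in> schwartz" "g \<in> schwartz"
  have "FT (\<lambda>x. f x + g x) = (\<lambda>y. FT f y + FT g y)" using FT_add[OF fg] by blast
  thus "T (FT (\<lambda>x. f x + g x)) = T (FT f) + T (FT g)"
   using temperedD(1)[OF T F[OF fg(1)] F[OF fg(2)]] by simp
 next
  fix f :: "real => complex" and c assume f: "f \<in> schwartz"
  have "FT (\<lambda>x. c * f x) = (\<lambda>y. c * FT f y)" using FT_cmult by blast
  thus "T (FT (\<lambda>x. c * f x)) = c * T (FT f)"
   using temperedD(2)[OF T F[OF f]] by simp
 qed
 moreover have "norm (fourier T f) <= (C * D) * B" if "f \<in> schwartz" "sbd M f B" for f B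
  using C(2)[OF F[OF that(1)] D(2)[OF that]] by (simp add: fourier_def mult.assoc)
 ultimately show ?thesis unfolding tempered_def sbd_def by blast
qed

definition mth :: "(real => complex) => real => complex" where
 "mth f = (\<lambda>x. - th f x)"

lemma mth_eq: "smooth f ==> mth f = (\<lambda>x. f x + (-1) * Eop f x)"
 by (auto simp: mth_def Eop_th)

lemma tame_mth: "tame mth"
 using tame_comp[OF tame_cmult[of "-1"] tame_th] by (simp add: mth_def[abs_def])

lemma schwartz_mth_funpow: "f \<in> schwartz ==> (mth ^^ i) f \<in> schwartz"
 using tame_schwartz[OF tame_funpow[OF tame_mth]] .

lemma Eop_FT:
 assumes f: "f \<in> schwartz" shows "Eop (FT f) = FT (mth f)"
proof
 fix y
 let ?c = "2 * cx pi * \<i> :: complex"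
 have c0: "?c ~= 0" by simp
 have xf: "(\<lambda>x. cx x * f x) \<in> schwartz" by (rule schwartz_x[OF f])
 have tf: "th f \<in> schwartz" by (rule tame_schwartz[OF tame_th f])
 have "nderiv 1 (\<lambda>x. cx x * f x) = (\<lambda>x. f x + th f x)"
  by (rule ext, subst nderiv_1_mult[OF open_UNIV smooth_of_real schwartz_smooth[OF f] UNIV_I])
    (simp add: nderiv_1_of_real th_def)
 hence "FT f y + FT (th f) y = ?c * cx y * FT (\<lambda>x. cx x * f x) y"
  using FT_nderiv_1[OF xf, of y] FT_add[OF f tf, of y] by simp
 moreover have "nderiv 1 (FT f) y = - ?c * FT (\<lambda>x. cx x * f x) y"
  unfolding nderiv_1_FT[OF f] by (rule FT_cmult)
 ultimately show "Eop (FT f) y = FT (mth f) y"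
  using FT_cmult[of "-1" "th f" y] by (simp add: Eop_def mth_def algebra_simps)
qed

lemma Eop_funpow_FT:
 assumes f: "f \<in> schwartz" shows "(Eop ^^ i) (FT f) = FT ((mth ^^ i) f)"
 by (induction i) (auto simp: Eop_FT[OF schwartz_mth_funpow[OF f]])

lemma FT_measurable:
 assumes [measurable]: "u \<in> BM" shows "FT u \<in> BM"
proof -
 have "(\<lambda>y. LB x. u x * ek y x) \<in> BM"
 proof (rule lborel.borel_measurable_lebesgue_integral)
  show "(\<lambda>(y, x). u x * ek y x) \<in> borel_measurable (borel \<Otimes>\<^sub>M lborel)"
   unfolding case_prod_beta' by measurable
 qed
 thus ?thesis by (simp add: FT_ek[abs_def])
qed

lemma parseval:
 assumes u: "lb_int u" and f: "lb_int f"
 shows "(LB x. u x * FT f x) = (LB y. FT u y * f y)"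
proof -
 have m: "u \<in> BM" "f \<in> BM" using u f by auto
 note [measurable] = m
 have "integrable (lborel \<Otimes>\<^sub>M lborel) (\<lambda>(x, y). u x * (f y * ek x y))"
 proof (rule lborel_pair.Fubini_integrable)
  show "(\<lambda>(x, y). u x * (f y * ek x y)) \<in> borel_measurable (lborel \<Otimes>\<^sub>M lborel)"
   unfolding case_prod_beta' by measurable
  have "(LB y. norm (u x * (f y * ek x y))) = norm (u x) * (LB y. norm (f y))" for x
   by (simp add: norm_mult)
  thus "lb_int (\<lambda>x. LB y. norm (case (x, y) of (x, y) => u x * (f y * ek x y)))"
   using u by auto
  show "AE x in lborel. lb_int (\<lambda>y. case (x, y) of (x, y) => u x * (f y * ek x y))"
   using ek_mult_integrable[OF f] by auto
 qed
 from lborel_pair.Fubini_integral[OF this]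
 have A: "(LB y. LB x. u x * (f y * ek x y)) = (LB x. LB y. u x * (f y * ek x y))" .
 have B: "(LB x. u x * (f y * ek x y)) = FT u y * f y" for y
 proof -
  have "(LB x. u x * (f y * ek x y)) = (LB x. (u x * ek y x) * f y)"
   by (simp add: ek_commute[of _ y] mult_ac)
  thus ?thesis by (simp add: FT_ek)
 qed
 have C: "(LB y. u x * (f y * ek x y)) = u x * FT f x" for x
  by (simp add: FT_ek)
 show ?thesis using A unfolding B C by (rule sym)
qed

lemma rep_mth:
 assumes S: "adm n S" "a + n > -1" "!!f. f \<in> S ==> mth f \<in> S" and T: "rep S a b T"
 shows "rep S a b (\<lambda>f. T (mth f))"
proof -
 obtain m h where h: "!!i. wbd a b (h i)" "!!f. f \<in> S ==> T f = euler_form m h f"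
  using T unfolding rep_def by blast
 have ES: "rep (Sz n) a b (euler_form m h)" by (rule repI[OF h(1)]) simp
 have "rep S a b (\<lambda>f. T f + (-1) * T (Eop f))"
  by (intro rep_add[OF S(1,2)] T rep_cmult rep_Eop[OF adm_Eop[OF S(1)]])
 thus ?thesis
 proof (rule rep_cong)
  fix f assume f: "f \<in> S"
  have sf: "smooth f" by (rule adm_smooth[OF S(1) f])
  have e: "Eop f \<in> S" by (rule adm_Eop[OF S(1) f])
  have e1: "(\<lambda>x. (-1) * Eop f x) \<in> Sz n"
   using Sz_mult[OF admD[OF S(1) e] bdd_smooth_const[of "-1"]] .
  have "T (mth f) = euler_form m h (\<lambda>x. f x + (-1) * Eop f x)"
   using h(2)[OF S(3)[OF f]] mth_eq[OF sf] by simp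
  also have "... = euler_form m h f + euler_form m h (\<lambda>x. (-1) * Eop f x)"
   by (rule euler_form_add[OF adm_Sz[OF order_refl] S(2) h(1) admD[OF S(1) f] e1])
  also have "euler_form m h (\<lambda>x. (-1) * Eop f x) = (-1) * euler_form m h (Eop f)"
   by (rule euler_form_cmult[OF smooth_Eop[OF open_UNIV sf]])
  finally show "T f + (-1) * T (Eop f) = T (mth f)" using h(2)[OF f] h(2)[OF e] by simp
 qed
qed

lemma rep_mth_funpow:
 assumes S: "adm n S" "a + n > -1" "!!f. f \<in> S ==> mth f \<in> S" and T: "rep S a b T"
 shows "rep S a b (\<lambda>f. T ((mth ^^ i) f))"
 using T
proof (induction i arbitrary: T)
 case (Suc i)
 show ?case using rep_mth[OF S Suc.IH[OF Suc.prems]] by (simp add: funpow_swap1)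
qed simp

lemma Sz_mth: "f \<in> Sz n ==> mth f \<in> Sz n"
 using tame_schwartz[OF tame_mth] nderiv_th[OF open_UNIV schwartz_smooth]
  nderiv_cmult[OF open_UNIV smooth_th[OF open_UNIV schwartz_smooth], of f 0 _ "-1"]
 by (auto simp: Sz_def fun_vanishes_def mth_def)

text \<open>Dividing by \<open>x\<^bsup>M\<^esup>\<close> before transforming trades growth for derivatives: the transform is a
 combination of \<open>M\<close>-th derivatives of bounded functions.\<close>

lemma rep_fourier:
 assumes T: "rep schwartz a b T" and ab: "a - real M > -1" "b - real M < -1"
 shows "rep (Sz M) (- real M) (- real M) (fourier T)"
proof -
 obtain m h where h: "!!i. wbd a b (h i)" "!!f. f \<in> schwartz ==> T f = euler_form m h f"
  using T unfolding rep_def by blast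
 define v where "v i x = h i x * inverse (cx x ^ M)" for i x
 have vw: "wbd (a - M) (b - M) (v i)" for i
  unfolding v_def using wbd_mult[OF h(1) wbd_xpow_inverse[of M]] by simp
 have vi: "lb_int (v i)" for i
  using wbd_integrable_mult[OF vw wbd_bounded[of "\<lambda>x. 1" 1]] ab by auto
 \<comment> \<open>By Parseval the M derivatives fall on the test function. A second division by x^M
   writes them as x^M D^M, again an Euler operator, at the price of exponent -M at both ends; this
   is why the domain is \<open>Sz M\<close>.\<close>
 define w where "w i x = FT (v i) x * inverse (cx x ^ M)" for i x
 have ub: "wbd 0 0 (FT (v i))" for i
  using norm_FT_le[OF vi] FT_measurable[OF wbd_measurable[OF vw]] by (rule wbd_bounded[rotated])
 have ww: "wbd (- real M) (- real M) (w i)" for i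
  unfolding w_def using wbd_mult[OF ub wbd_xpow_inverse[of M]] by simp
 let ?c = "inverse ((2 * cx pi * \<i>) ^ M) :: complex"
 have S: "adm M (Sz M)" "- real M + real M > -1" by (auto intro: adm_Sz)
 have "rep (Sz M) (- real M) (- real M) (\<lambda>f. \<Sum>i\<le>m. ?c * (LB x. w i x * (cx x ^ M * nderiv M ((mth ^^ i) f) x)))"
  by (intro rep_sum[OF S] rep_cmult rep_mth_funpow[OF S Sz_mth, of _ "\<lambda>f. LB x. w _ x * (cx x ^ M * nderiv M f x)"] rep_nderiv[OF S] ww)
 thus ?thesis
 proof (rule rep_cong)
  fix f assume f: "f \<in> Sz M"
  have fs: "f \<in> schwartz" using Sz_schwartz[OF f] .
  have "(LB x. h i x * (Eop ^^ i) (FT f) x) = ?c * (LB x. w i x * (cx x ^ M * nderiv M ((mth ^^ i) f) x))" for i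
  proof -
   define g where "g = (mth ^^ i) f"
   have g: "g \<in> schwartz" unfolding g_def by (rule schwartz_mth_funpow[OF fs])
   have gM: "nderiv M g \<in> schwartz" by (rule schwartz_nderiv[OF g])
   have m: "FT g \<in> BM" "h i \<in> BM" "v i \<in> BM" "w i \<in> BM"
     "nderiv M g \<in> BM" "FT (nderiv M g) \<in> BM" "FT (v i) \<in> BM"
    using FT_measurable schwartz_measurable[OF g] schwartz_measurable[OF gM] wbd_measurable[OF h(1)] wbd_measurable[OF vw] wbd_measurable[OF ww] by auto
   note [measurable] = m
   have "(LB x. h i x * (Eop ^^ i) (FT f) x) = (LB x. h i x * FT g x)"
    by (simp add: Eop_funpow_FT[OF fs] g_def)
   also have "... = (LB x. ?c * (v i x * FT (nderiv M g) x))"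
   proof (rule integral_cong_AE)
    show "AE x in lborel. h i x * FT g x = ?c * (v i x * FT (nderiv M g) x)"
     using AE_lborel_not_0
    proof eventually_elim
     case (elim x)
     thus ?case by (simp add: FT_nderiv[OF g] v_def power_mult_distrib field_simps)
    qed
   qed measurable
   also have "... = ?c * (LB x. v i x * FT (nderiv M g) x)" by simp
   also have "(LB x. v i x * FT (nderiv M g) x) = (LB x. FT (v i) x * nderiv M g x)"
    by (rule parseval[OF vi schwartz_integrable[OF gM]])
   also have "... = (LB x. w i x * (cx x ^ M * nderiv M g x))"
    by (rule integral_cong_AE) (use AE_lborel_not_0 in \<open>auto simp: w_def elim!: eventually_mono\<close>)
   finally show ?thesis by (simp add: g_def)
  qed
  thus "(\<Sum>i\<le>m. ?c * (LB x. w i x * (cx x ^ M * nderiv M ((mth ^^ i) f) x))) = fourier T f"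
   unfolding fourier_def h(2)[OF tame_schwartz[OF tame_FT fs]] euler_form_def by simp
 qed
qed

text \<open>Multiplication by x^M sends test functions into \<open>Sz M\<close> and raises the
  exponent at 0 from -M to 0, which is the definition of order -M.\<close>

lemma rep_Sz_vanishes:
 assumes T: "rep (Sz M) (- real M) b T" shows "vanishes_to T 0 (- int M)"
proof -
 have "rep (TF {-1<..<1}) (- real M + real M) (b + real M) (\<lambda>f. T (\<lambda>x. cx x ^ M * f x))"
  by (rule rep_xpow[OF adm_test _ T]) (auto intro: Sz_xpow test_schwartz)
 hence r: "rep (TF {-1<..<1}) 0 (b + real M) (\<lambda>f. T (\<lambda>x. cx x ^ M * f x))" by simp
 show ?thesis
 proof (cases "M = 0")
  case True
  thus ?thesis using rep_imp_vanishes_nonneg[of 1 0 _ T 0] r by simp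
 next
  case False
  thus ?thesis using rep_imp_vanishes_neg[OF r] by simp
 qed
qed

section \<open>Gaussians\<close>

text \<open>The polynomial is taken in t x^2, so that t enters only by scaling and the Euler
  operator acts on p through a map independent of t. The power d matches the parity of the Mellin
  kernel.\<close>

definition gauss :: "nat => real => complex poly => real => complex" where
 "gauss d t p x = cx x ^ d * poly p (cx (t * x^2)) * cx (exp (- (pi * t * x^2)))"

definition polygauss :: "real => complex poly => real => complex" where
 "polygauss t q x = poly q (cx x) * cx (exp (- (pi * t * x^2)))"

lemma polygauss_has_vector_derivative:
 "(polygauss t q has_vd polygauss t (pderiv q - smult (2 * cx (pi * t)) (pCons 0 q)) x) (at x)"
proof -
 have "((\<lambda>z. poly q z * exp (- (cx (pi * t) * z^2))) has_field_derivative
   (poly (pderiv q - smult (2 * cx (pi * t)) (pCons 0 q)) (cx x) * exp (- (cx (pi * t) * (cx x)\<^sup>2)))) (at (cx x))"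
  by (auto intro!: derivative_eq_intros simp: algebra_simps)
 from has_vector_derivative_real_field[OF this]
 show ?thesis unfolding polygauss_def[abs_def] by (simp add: exp_of_real[symmetric] mult.assoc)
qed

lemma polygauss_bounded:
 assumes "t > 0" shows "\<exists>B. \<forall>x. norm (polygauss t q x) <= B"
proof -
 have 1: "abs x ^ k * exp (- (pi * t * x^2)) <= 1 + fact k / (pi * t) ^ k" for k and x :: real
 proof -
  have "(pi * t * x^2) ^ k / fact k <= exp (pi * t * x^2)"
   using sum_le_suminf[OF summable_exp_generic[of "pi * t * x^2"], of "{k}"] assms
   by (simp add: exp_def divide_inverse mult.commute)
  hence "(pi * t * x^2) ^ k * exp (- (pi * t * x^2)) <= fact k"
   by (simp add: exp_minus field_simps)
  hence 2: "(x^2) ^ k * exp (- (pi * t * x^2)) <= fact k / (pi * t) ^ k"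
   using assms by (simp add: power_mult_distrib field_simps)
  have "abs x ^ k <= 1 + (x^2) ^ k"
  proof (cases "abs x <= 1")
   case True
   hence "abs x ^ k <= 1" by (simp add: power_le_one)
   thus ?thesis by (simp add: add_increasing2)
  next
   case False
   hence "abs x ^ k <= (abs x ^ 2) ^ k" using mult_left_mono[of 1 "abs x" "abs x"]
    by (intro power_mono) (auto simp: power2_eq_square)
   thus ?thesis by simp
  qed
  hence "abs x ^ k * exp (- (pi * t * x^2)) <= (1 + (x^2) ^ k) * exp (- (pi * t * x^2))"
   by (rule mult_right_mono) simp
  also have "... = exp (- (pi * t * x^2)) + (x^2) ^ k * exp (- (pi * t * x^2))" by (simp add: algebra_simps)
  also have "... <= 1 + fact k / (pi * t) ^ k" using 2 assms by (intro add_mono) auto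
  finally show ?thesis .
 qed
 have "norm (polygauss t q x) <= (\<Sum>k\<le>degree q. norm (coeff q k) * (1 + fact k / (pi * t) ^ k))" for x
 proof -
  have "norm (polygauss t q x) <= (\<Sum>k\<le>degree q. norm (coeff q k) * abs x ^ k) * exp (- (pi * t * x^2))"
   unfolding polygauss_def poly_altdef norm_mult
   by (intro mult_mono order_trans[OF norm_sum] sum_mono sum_nonneg) (auto simp: norm_mult norm_power)
  also have "... = (\<Sum>k\<le>degree q. norm (coeff q k) * (abs x ^ k * exp (- (pi * t * x^2))))"
   by (simp add: sum_distrib_right mult.assoc)
  also have "... <= (\<Sum>k\<le>degree q. norm (coeff q k) * (1 + fact k / (pi * t) ^ k))"
   by (intro sum_mono mult_left_mono 1) auto
  finally show ?thesis .
 qed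
 thus ?thesis by blast
qed

lemma polygauss_schwartz:
 assumes t: "t > 0" shows "polygauss t q \<in> schwartz"
proof -
 have sm: "smooth (polygauss t q)" for q
 proof (rule smooth_coinduct[where P="\<lambda>g. \<exists>q. g = polygauss t q"])
  fix f assume "\<exists>q. f = polygauss t q"
  thus "\<exists>g. (\<exists>q. g = polygauss t q) \<and> (\<forall>x\<in>UNIV. (f has_vd g x) (at x))"
   using polygauss_has_vector_derivative by blast
 qed auto
 have n: "\<exists>r. nderiv n (polygauss t q) = polygauss t r" for n q
 proof (induction n arbitrary: q)
  case (Suc n)
  have "nderiv 1 (polygauss t q) = polygauss t (pderiv q - smult (2 * cx (pi * t)) (pCons 0 q))"
   by (intro ext nderiv_1_eqI polygauss_has_vector_derivative)
  thus ?case using Suc by (simp only: nderiv_Suc)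
 qed auto
 show ?thesis unfolding schwartz_iff
 proof (intro conjI allI sm)
  fix m n
  obtain r where r: "nderiv n (polygauss t q) = polygauss t r" using n by blast
  obtain B where B: "!!x. norm (polygauss t (monom 1 m * r) x) <= B" using polygauss_bounded[OF t] by blast
  have "cx x ^ m * nderiv n (polygauss t q) x = polygauss t (monom 1 m * r) x" for x
   by (simp add: r polygauss_def poly_monom mult.assoc)
  thus "\<exists>B. \<forall>x. norm (cx x ^ m * nderiv n (polygauss t q) x) <= B" using B by auto
 qed
qed

lemma gauss_polygauss: "gauss d t p = polygauss t (monom 1 d * pcompose p [:0, 0, cx t:])"
 by (auto simp: gauss_def polygauss_def poly_monom poly_pcompose power2_eq_square algebra_simps)

lemma gauss_schwartz: "t > 0 ==> gauss d t p \<in> schwartz"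
 unfolding gauss_polygauss by (rule polygauss_schwartz)

text \<open>The action of \<open>Eop\<close> on p in the variable tau = t x^2: there x d/dx is 2 tau
  d/dtau, the prefactor x^d adds d, and the exponential e^(-pi tau) subtracts 2 pi tau.\<close>

definition Apoly :: "nat => complex poly => complex poly" where
 "Apoly d p = smult (1 + of_nat d) p + smult 2 (pCons 0 (pderiv p - smult (cx pi) p))"

lemma Eop_gauss: "Eop (gauss d t p) = gauss d t (Apoly d p)"
proof
 fix x
 define z where "z = (cx x)"
 define T where "T = (cx t)"
 define D where "D = (of_nat d * z ^ (d - 1) * poly p (T * z^2) + z ^ d * (poly (pderiv p) (T * z^2) * (T * (2 * z)))
   - z ^ d * poly p (T * z^2) * (cx pi * T * (2 * z))) * exp (- (cx pi * T * z^2))"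
 have "((\<lambda>z. z ^ d * poly p (T * z^2) * exp (- (cx pi * T * z^2))) has_field_derivative D) (at (cx x))"
  unfolding D_def z_def
  by (auto intro!: derivative_eq_intros DERIV_chain2[OF poly_DERIV] simp: algebra_simps One_nat_def power2_eq_square)
 from has_vector_derivative_real_field[OF this]
 have "(gauss d t p has_vd D) (at x)"
  unfolding gauss_def[abs_def] by (simp add: T_def exp_of_real[symmetric])
 hence 1: "nderiv 1 (gauss d t p) x = D" by (rule nderiv_1_eqI)
 have zd: "z * (of_nat d * z ^ (d - 1)) = of_nat d * z ^ d" by (cases d) (auto simp: One_nat_def)
 have g: "gauss d t q x = z ^ d * poly q (T * z^2) * exp (- (cx pi * T * z^2))" for q
  unfolding gauss_def by (simp add: T_def z_def exp_of_real[symmetric])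
 have "z * D = (z * (of_nat d * z ^ (d - 1)) * poly p (T * z^2) + z ^ d * (poly (pderiv p) (T * z^2) * (2 * (T * z^2)))
   - z ^ d * poly p (T * z^2) * (cx pi * (2 * (T * z^2)))) * exp (- (cx pi * T * z^2))"
  by (simp add: D_def algebra_simps power2_eq_square)
 thus "Eop (gauss d t p) x = gauss d t (Apoly d p) x"
  unfolding Eop_def 1 g z_def[symmetric] zd by (simp add: Apoly_def algebra_simps)
qed

lemma fourier_gauss_0:
 assumes t: "t > 0"
 shows "FT (gauss 0 t 1) y = cx (t powr (-1/2)) * gauss 0 (1 / t) 1 y"
proof -
 \<comment> \<open>Rescaling by c turns the standard normal density into e^(-pi t x^2) up to
   1/sqrt(2 pi), so its characteristic function gives the transform.\<close>
 define c where "c = sqrt (2 * pi * t)"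
 have c: "c > 0" using t by (simp add: c_def)
 have c2: "c\<^sup>2 = 2 * pi * t" using t by (simp add: c_def)
 define s where "s = - (2 * pi * y) / c"
 have "char std_normal_distribution s = (LB x. std_normal_density x *\<^sub>R iexp (s * x))"
  unfolding char_def by (subst integral_density) auto
 also have "... = abs c *\<^sub>R (LB x. std_normal_density (0 + c * x) *\<^sub>R iexp (s * (0 + c * x)))"
  by (rule lborel_integral_real_affine) (use c in simp)
 also have "(LB x. std_normal_density (0 + c * x) *\<^sub>R iexp (s * (0 + c * x))) = (LB x. cx (1 / sqrt (2 * pi)) * (gauss 0 t 1 x * ek y x))"
 proof (intro LB_integral_cong refl)
  fix x
  have e: "s * (c * x) = - (2 * pi * (x * y))" using c by (simp add: s_def)
  have "(c * x)\<^sup>2 / 2 = pi * t * x^2" by (simp add: power_mult_distrib c2)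
  hence "std_normal_density (c * x) = 1 / sqrt (2 * pi) * exp (- (pi * t * x^2))"
   by (simp add: std_normal_density_def)
  moreover have "iexp (s * (0 + c * x)) = ek y x" unfolding add_0_left e ek_iexp ..
  ultimately show "std_normal_density (0 + c * x) *\<^sub>R iexp (s * (0 + c * x)) = cx (1 / sqrt (2 * pi)) * (gauss 0 t 1 x * ek y x)"
   by (simp only: add_0_left) (simp add: gauss_def scaleR_conv_of_real)
 qed
 also have "... = cx (1 / sqrt (2 * pi)) * FT (gauss 0 t 1) y" by (simp add: FT_ek)
 also have "abs c *\<^sub>R ... = cx (c / sqrt (2 * pi)) * FT (gauss 0 t 1) y"
  using c by (simp add: scaleR_conv_of_real)
 also have "c / sqrt (2 * pi) = sqrt t" by (simp add: c_def real_sqrt_mult)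
 finally have 1: "cx (sqrt t) * FT (gauss 0 t 1) y = cx (exp (- (s^2) / 2))"
  by (simp add: char_std_normal_distribution)
 have "s\<^sup>2 / 2 = pi * (1 / t) * y^2"
  using t by (simp add: s_def power_divide c2) (simp add: field_simps power2_eq_square)
 hence 2: "cx (exp (- (s^2) / 2)) = gauss 0 (1 / t) 1 y" by (simp add: gauss_def)
 have "t powr (-1/2) = 1 / sqrt t" using t by (simp add: powr_minus_divide powr_half_sqrt)
 hence 3: "cx (t powr (-1/2)) * cx (sqrt t) = (1::complex)" using t
  by (simp flip: of_real_mult)
 show ?thesis unfolding 2[symmetric] 1[symmetric] using 3 by (simp only: mult.assoc[symmetric] mult_1_left)
qed

text \<open>The odd case follows by differentiating the even one in y, which multiplies by -2 pi i x
  under the integral.\<close>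

lemma fourier_gauss:
 assumes t: "t > 0" and d: "d \<in> {0, 1}"
 shows "FT (gauss d t 1) = (\<lambda>y. (- \<i>) ^ d * cx (t powr (- 1/2 - real d)) * gauss d (1 / t) 1 y)"
proof (cases "d = 0")
 case True
 thus ?thesis using fourier_gauss_0[OF t] by auto
next
 case False
 hence d1: "d = 1" using d by auto
 have g0: "gauss 0 t 1 \<in> schwartz" by (rule gauss_schwartz[OF t])
 have x: "(\<lambda>x. cx x * gauss 0 t 1 x) = gauss 1 t 1" by (auto simp: gauss_def)
 show ?thesis
 proof
  fix y
  have "((\<lambda>y. cx (t powr (-1/2)) * gauss 0 (1 / t) 1 y) has_vd
    cx (t powr (-1/2)) * (- 2 * cx pi * cx (1 / t) * gauss 1 (1 / t) 1 y)) (at y)"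
  proof (rule has_vector_derivative_mult_right)
   have "(polygauss (1 / t) 1 has_vd polygauss (1 / t) (pderiv 1 - smult (2 * cx (pi * (1 / t))) (pCons 0 1)) y) (at y)"
    by (rule polygauss_has_vector_derivative)
   moreover have "polygauss (1 / t) 1 = gauss 0 (1 / t) 1" by (auto simp: polygauss_def gauss_def)
   ultimately show "(gauss 0 (1 / t) 1 has_vd - 2 * cx pi * cx (1 / t) * gauss 1 (1 / t) 1 y) (at y)"
    by (simp add: polygauss_def gauss_def mult_ac)
  qed
  hence "nderiv 1 (FT (gauss 0 t 1)) y = cx (t powr (-1/2)) * (- 2 * cx pi * cx (1 / t) * gauss 1 (1 / t) 1 y)"
   unfolding fourier_gauss_0[OF t, abs_def] by (rule nderiv_1_eqI)
  moreover have "nderiv 1 (FT (gauss 0 t 1)) y = - (2 * cx pi * \<i>) * FT (gauss 1 t 1) y"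
   unfolding nderiv_1_FT[OF g0] FT_cmult x ..
  ultimately have "(2 * cx pi) * (\<i> * FT (gauss 1 t 1) y) = (2 * cx pi) * (cx (t powr (-1/2)) * cx (1 / t) * gauss 1 (1 / t) 1 y)"
   by (simp add: mult_ac)
  hence "\<i> * FT (gauss 1 t 1) y = cx (t powr (-1/2)) * cx (1 / t) * gauss 1 (1 / t) 1 y"
   by (subst (asm) mult_left_cancel) auto
  hence "- \<i> * (\<i> * FT (gauss 1 t 1) y) = - \<i> * (cx (t powr (-1/2)) * cx (1 / t) * gauss 1 (1 / t) 1 y)"
   by (simp only:)
  hence "FT (gauss 1 t 1) y = - \<i> * (cx (t powr (-1/2)) * cx (1 / t) * gauss 1 (1 / t) 1 y)"
   by (simp add: mult.assoc[symmetric] del: of_real_divide)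
  moreover have "t powr (- 1/2 - real d) = t powr (-1/2) * (1 / t)"
   using powr_diff[of t "-1/2" 1] powr_one[of t] t d1 by simp
  ultimately show "FT (gauss d t 1) y = (- \<i>) ^ d * cx (t powr (- 1/2 - real d)) * gauss d (1 / t) 1 y"
   using d1 by (simp add: mult_ac)
 qed
qed

section \<open>Signed powers\<close>

lemma sp_exp: "x ~= 0 ==> sp \<delta> w x = cx (sgn x) ^ \<delta> * exp (w * cx (ln (abs x)))"
 by (simp add: signed_power_def powr_def Ln_of_real)

lemma sp_0 [simp]: "sp \<delta> w 0 = 0"
 by (simp add: signed_power_def)

lemma norm_sp: "x ~= 0 ==> norm (sp \<delta> w x) = abs x powr Re w"
 by (simp add: signed_power_def norm_mult norm_power norm_powr_real_powr abs_sgn_eq)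

lemma sp_measurable [measurable]: "sp \<delta> w \<in> BM"
proof -
 have "sp \<delta> w = (\<lambda>x. if x = 0 then 0 else cx (sgn x) ^ \<delta> * exp (w * cx (ln (abs x))))"
  by (auto simp: sp_exp)
 moreover have "(\<lambda>x::real. if x = 0 then 0 else cx (sgn x) ^ \<delta> * exp (w * cx (ln (abs x)))) \<in> BM"
  by measurable
 ultimately show ?thesis by simp
qed

lemma wbd_sp: "wbd (Re w) (Re w) (sp \<delta> w)"
 by (rule wbdI[of _ 1]) (auto simp: norm_sp wt_def)

lemma sp_has_vector_derivative:
 assumes "x ~= 0"
 shows "(sp \<delta> w has_vd w * sp (Suc \<delta>) (w - 1) x) (at x)"
proof -
 \<comment> \<open>On the half line containing x the absolute value is the linear function y -> sgn
   x * y.\<close>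
 define S where "S = {y::real. sgn y = sgn x}"
 have "S = {0<..} \<or> S = {..<0}" using assms by (auto simp: S_def sgn_real_def split: if_splits)
 hence "open S" by (metis open_greaterThan open_lessThan)
 moreover have "x \<in> S" by (simp add: S_def)
 ultimately have S: "open S" "x \<in> S" .
 have n0: "y ~= 0" if "y \<in> S" for y using that assms by (auto simp: S_def sgn_real_def split: if_splits)
 have a: "sgn x * y = abs y" if "y \<in> S" for y using that by (simp add: S_def abs_sgn mult.commute)
 have "((\<lambda>y. ln (sgn x * y)) has_real_derivative 1 / x) (at x)"
  using assms a[of x] S by (auto intro!: derivative_eq_intros simp: divide_simps sgn_real_def)
 hence l: "((\<lambda>y. cx (ln (sgn x * y))) has_vd cx (1 / x)) (at x)"
  by (intro has_vector_derivative_of_real) (simp add: hrd_iff_hvd)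
 have "((\<lambda>y. cx (sgn x) ^ \<delta> * exp (w * cx (ln (sgn x * y)))) has_vd
   cx (sgn x) ^ \<delta> * ((w * cx (1 / x)) * exp (w * cx (ln (sgn x * x))))) (at x)"
  using field_vector_diff_chain_at[OF has_vector_derivative_mult_right[OF l, of w] DERIV_exp]
  by (intro has_vector_derivative_mult_right) (simp add: o_def)
 also have "sgn x * x = abs x" using a S by simp
 also have "cx (sgn x) ^ \<delta> * ((w * cx (1 / x)) * exp (w * cx (ln (abs x)))) = w * sp (Suc \<delta>) (w - 1) x"
 proof -
  have "exp (- cx (ln (abs x))) = cx (1 / abs x)" 
   using assms by (simp add: exp_minus exp_of_real inverse_eq_divide)
  moreover have "cx (1 / x) = cx (sgn x) * cx (1 / abs x)"
   using assms by (simp add: sgn_real_def flip: of_real_mult)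
  moreover have "(w - 1) * cx (ln (abs x)) = w * cx (ln (abs x)) + - cx (ln (abs x))" by (simp add: algebra_simps)
  ultimately show ?thesis using assms by (simp only: sp_exp[OF assms] exp_add power_Suc mult_ac)
 qed
 finally show ?thesis
 proof (rule has_vector_derivative_transform_within_open[OF _ S])
  fix y assume "y \<in> S"
  thus "cx (sgn x) ^ \<delta> * exp (w * cx (ln (sgn x * y))) = sp \<delta> w y"
   using n0[of y] a[of y] by (simp add: sp_exp S_def)
 qed
qed

lemma smooth_sp: "smooth_on (- {0}) (sp \<delta> w)"
proof (rule smooth_coinduct[where P = "\<lambda>f. \<exists>c \<delta> w. f = (\<lambda>x. c * sp \<delta> w x)"])
 show "open (- {0::real})" by auto
 show "\<exists>c \<delta>' w'. sp \<delta> w = (\<lambda>x. c * sp \<delta>' w' x)"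
  by (intro exI[of _ 1] exI[of _ \<delta>] exI[of _ w]) simp
next
 fix f :: "real => complex" assume "\<exists>c \<delta> w. f = (\<lambda>x. c * sp \<delta> w x)"
 then obtain c \<delta> w where f: "f = (\<lambda>x. c * sp \<delta> w x)" by blast
 show "\<exists>g. (\<exists>c \<delta> w. g = (\<lambda>x. c * sp \<delta> w x)) \<and> (\<forall>x\<in>- {0}. (f has_vd g x) (at x))"
 proof (intro exI conjI ballI)
  show "(\<lambda>x. (c * w) * sp (Suc \<delta>) (w - 1) x) = (\<lambda>x. (c * w) * sp (Suc \<delta>) (w - 1) x)" ..
  fix x :: real assume "x \<in> - {0}"
  thus "(f has_vd (c * w) * sp (Suc \<delta>) (w - 1) x) (at x)"
   using has_vector_derivative_mult_right[OF sp_has_vector_derivative, of x c \<delta> w] by (simp add: f mult.assoc)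
 qed
qed

lemma th_sp:
 assumes "x ~= 0" shows "th (sp \<delta> w) x = w * sp \<delta> w x"
proof -
 define S X where "S = cx (sgn x)" and "X = cx (ln (abs x))"
 have 1: "cx x = S * exp X"
  using assms by (simp add: S_def X_def exp_of_real sgn_real_def flip: of_real_mult)
 have 2: "S * S = 1" using assms by (simp add: S_def sgn_real_def)
 have 3: "w * X = X + (w - 1) * X" by (simp add: algebra_simps)
 have "cx x * sp (Suc \<delta>) (w - 1) x = (S * S) * (S ^ \<delta> * (exp X * exp ((w - 1) * X)))"
  unfolding sp_exp[OF assms] S_def[symmetric] X_def[symmetric] 1 by (simp only: power_Suc mult_ac)
 also have "... = sp \<delta> w x"
  unfolding sp_exp[OF assms] S_def[symmetric] X_def[symmetric] 2 3 exp_add by simp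
 finally show ?thesis
  unfolding th_def nderiv_1_eqI[OF sp_has_vector_derivative[OF assms]]
  by (simp add: mult.left_commute[of _ w])
qed

section \<open>The Mellin transform\<close>

text \<open>\<open>Ec w\<close> is \<open>Eop\<close> conjugated by the signed power of exponent w,
  as \<open>Eop_funpow_sp\<close> shows.\<close>

definition Ec :: "complex => (real => complex) => real => complex" where
 "Ec c f = (\<lambda>x. Eop f x + c * f x)"

lemma tame_Ec: "tame (Ec c)"
 unfolding Ec_def[abs_def] by (intro tame_add tame_Eop tame_cmult)

lemma Ec_schwartz: "f \<in> schwartz ==> (Ec c ^^ i) f \<in> schwartz"
 by (rule tame_schwartz[OF tame_funpow[OF tame_Ec]])

lemma smooth_Ec: "open U ==> smooth_on U f ==> smooth_on U (Ec c f)"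
 unfolding Ec_def by (intro smooth_add smooth_cmult smooth_Eop)

lemma smooth_Ec_funpow: "open U ==> smooth_on U f ==> smooth_on U ((Ec c ^^ i) f)"
 by (induction i) (simp_all add: smooth_Ec)

lemma Ec_add: "smooth f ==> smooth g ==> Ec c (\<lambda>x. f x + g x) = (\<lambda>x. Ec c f x + Ec c g x)"
 by (auto simp: Ec_def Eop_add algebra_simps)

lemma Ec_cmult: "smooth f ==> Ec c (\<lambda>x. b * f x) = (\<lambda>x. b * Ec c f x)"
 by (auto simp: Ec_def Eop_cmult algebra_simps)

lemma Ec_funpow_add: 
 "smooth f ==> smooth g ==> (Ec c ^^ i) (\<lambda>x. f x + g x) = (\<lambda>x. (Ec c ^^ i) f x + (Ec c ^^ i) g x)"
 by (induction i) (simp_all add: Ec_add smooth_Ec_funpow)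

lemma Ec_funpow_cmult: "smooth f ==> (Ec c ^^ i) (\<lambda>x. b * f x) = (\<lambda>x. b * (Ec c ^^ i) f x)"
 by (induction i) (simp_all add: Ec_cmult smooth_Ec_funpow)

lemma Ec_funpow_Suc:
 assumes "smooth f"
 shows "(Ec c ^^ Suc i) f = (\<lambda>x. (Ec c ^^ i) (Eop f) x + c * (Ec c ^^ i) f x)"
proof -
 have "(Ec c ^^ Suc i) f = (Ec c ^^ i) (\<lambda>x. Eop f x + c * f x)" by (simp add: funpow_swap1 Ec_def)
 thus ?thesis
  using assms by (simp add: Ec_funpow_add Ec_funpow_cmult smooth_Eop smooth_cmult)
qed

lemma Ec_cong_open:
 assumes "open U" "!!x. x \<in> U ==> f x = g x" "x \<in> U" shows "Ec c f x = Ec c g x"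
 using Eop_funpow_cong_open[OF assms, where j = 1] assms(2,3) by (simp add: Ec_def One_nat_def)

lemma Eop_funpow_sp:
 assumes f: "smooth_on (- {0}) f" and "x ~= 0"
 shows "(Eop ^^ i) (\<lambda>x. sp \<delta> w x * f x) x = sp \<delta> w x * (Ec w ^^ i) f x"
 using assms(2)
proof (induction i arbitrary: x)
 case (Suc i)
 have "(Eop ^^ Suc i) (\<lambda>x. sp \<delta> w x * f x) x = Eop (\<lambda>x. sp \<delta> w x * (Ec w ^^ i) f x) x"
  using Eop_funpow_cong_open[of "- {0}" "(Eop ^^ i) (\<lambda>x. sp \<delta> w x * f x)" "\<lambda>x. sp \<delta> w x * (Ec w ^^ i) f x" x 1] Suc
  by (simp add: One_nat_def open_Compl)
 also have "... = sp \<delta> w x * Eop ((Ec w ^^ i) f) x + th (sp \<delta> w) x * (Ec w ^^ i) f x"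
  by (rule Eop_mult[where U = "- {0}"]) (use Suc f smooth_sp smooth_Ec_funpow[of "- {0}" f] in \<open>auto simp: open_Compl\<close>)
 also have "... = sp \<delta> w x * (Ec w ^^ Suc i) f x"
  using th_sp[OF Suc.prems] by (simp add: Ec_def algebra_simps)
 finally show ?case .
qed simp

lemma sp_test_away:
 assumes "f \<in> test0"
 shows "(\<lambda>x. sp \<delta> w x * f x) \<in> test0"
 by (rule test_mult[OF assms smooth_sp]) auto

text \<open>The explicit extension across 0. Away from 0 it is T applied to the signed power times
  f, with the operators moved past the power; in this shape the integrals converge for every
  Schwartz f once a + Re s > 0.\<close>

definition mellin_form :: "nat => nat => (nat => real => complex) => complex => distr" where
 "mellin_form \<delta> m h s f = (\<Sum>i\<le>m. LB x. (h i x * sp \<delta> (s - 1) x) * (Ec (s - 1) ^^ i) f x)"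

lemma mellin_form_away:
 assumes f: "f \<in> test0"
 shows "mellin_form \<delta> m h s f = euler_form m h (\<lambda>x. sp \<delta> (s - 1) x * f x)"
 unfolding mellin_form_def euler_form_def
proof (intro sum.cong refl)
 fix i
 have sf: "smooth_on (- {0}) f" using smooth_subset[OF test_smooth[OF f]] by auto
 have "h i x * sp \<delta> (s - 1) x * (Ec (s - 1) ^^ i) f x = h i x * (Eop ^^ i) (\<lambda>x. sp \<delta> (s - 1) x * f x) x" for x
 proof (cases "x = 0")
  case True
  obtain r where "r > 0" "!!x. abs x < r ==> f x = 0" using test_away_0[OF f] by blast
  hence "(Eop ^^ i) (\<lambda>x. sp \<delta> (s - 1) x * f x) 0 = 0"
   by (intro Eop_funpow_zero[of "- {-r<..<r}"]) (auto simp: abs_less_iff)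
  thus ?thesis using True by simp
 qed (use Eop_funpow_sp[OF sf] in simp)
 thus "(LB x. h i x * sp \<delta> (s - 1) x * (Ec (s - 1) ^^ i) f x)
  = (LB x. h i x * (Eop ^^ i) (\<lambda>x. sp \<delta> (s - 1) x * f x) x)" by (simp only:)
qed

lemma rep_Ec:
 assumes q: "wbd a b q" and a: "a > -1"
 shows "rep schwartz a b (\<lambda>f. LB x. q x * (Ec c ^^ i) f x)"
proof (induction i)
 case 0
 show ?case using rep_int[OF q] by simp
next
 case (Suc i)
 have S: "adm 0 schwartz" using adm_Sz[of 0 0] by (simp add: Sz_0)
 have "rep schwartz a b (\<lambda>f. (LB x. q x * (Ec c ^^ i) (Eop f) x) + c * (LB x. q x * (Ec c ^^ i) f x))"
  by (rule rep_add[OF S]) (use a in \<open>auto intro!: rep_Eop[OF _ Suc] rep_cmult Suc adm_Eop[OF S]\<close>)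
 thus ?case
 proof (rule rep_cong)
  fix f assume f: "f \<in> schwartz"
  have i: "lb_int (\<lambda>x. q x * (Ec c ^^ i) g x)" if "g \<in> schwartz" for g
   by (rule wbd_integrable_Sz[OF q, where n = 0]) (use a Ec_schwartz[OF that] in \<open>auto simp: Sz_0\<close>)
  show "(LB x. q x * (Ec c ^^ i) (Eop f) x) + c * (LB x. q x * (Ec c ^^ i) f x) = (LB x. q x * (Ec c ^^ Suc i) f x)"
   unfolding Ec_funpow_Suc[OF schwartz_smooth[OF f]]
   using i[OF f] i[OF adm_Eop[OF S f]] by (simp add: distrib_left mult.left_commute[of _ c])
 qed
qed

lemma rep_mellin_form:
 assumes h: "!!i. wbd a b (h i)" and s: "a + Re s > 0"
 shows "rep schwartz (a + Re s - 1) (b + Re s - 1) (mellin_form \<delta> m h s)"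
proof -
 have S: "adm 0 schwartz" using adm_Sz[of 0 0] by (simp add: Sz_0)
 have "wbd (a + Re s - 1) (b + Re s - 1) (\<lambda>x. h i x * sp \<delta> (s - 1) x)" for i
  using wbd_mult[OF h[of i] wbd_sp[of "s - 1" \<delta>]] by (simp add: algebra_simps)
 thus ?thesis unfolding mellin_form_def[abs_def]
  by (intro rep_sum[OF S] rep_Ec) (use s in auto)
qed

lemma abs_ln_le_wt:
 assumes "e > 0" "x ~= 0"
 shows "abs (ln (abs x)) <= (1 / e) * wt (- e) e x" and "exp (e * abs (ln (abs x))) = wt (- e) e x"
proof -
 show *: "exp (e * abs (ln (abs x))) = wt (- e) e x"
  using assms by (auto simp: wt_def powr_def abs_if)
 have "e * abs (ln (abs x)) <= exp (e * abs (ln (abs x)))" using exp_ge_add_one_self[of "e * abs (ln (abs x))"] by linarith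
 thus "abs (ln (abs x)) <= (1 / e) * wt (- e) e x" using assms * by (simp add: field_simps)
qed

text \<open>The second-order remainder of \<open>\<bar>x\<bar>\<^sup>z\<close> in \<open>z\<close> costs only arbitrarily small powers of \<open>\<bar>x\<bar>\<close>.\<close>

lemma mellin_integral_holomorphic:
 assumes h: "wbd a b h" and f: "f \<in> schwartz"
 shows "(\<lambda>s. LB x. (h x * sp \<delta> (s - 1) x) * f x) holomorphic_on {s. - a < Re s}"
proof (rule holomorphic_onI)
 fix s assume "s \<in> {s. - a < Re s}"
 hence s: "a + Re s > 0" by simp
 \<comment> \<open>A quarter of the margin: the second-order remainder loses 2 e in the exponent at
   0, which still leaves it above -1, and |z| < e keeps s + z in the half plane.\<close>
 define e where "e = (a + Re s) / 4"
 have e: "e > 0" using s by (simp add: e_def)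
 define F where "F = (\<lambda>s. LB x. (h x * sp \<delta> (s - 1) x) * f x)"
 define g where "g = (\<lambda>x. h x * sp \<delta> (s - 1) x)"
 have g: "wbd (a + Re s - 1) (b + Re s - 1) g"
  unfolding g_def using wbd_mult[OF h wbd_sp[of "s - 1" \<delta>]] by (simp add: algebra_simps)
 have lw: "wbd (- e) e (\<lambda>x. cx (ln (abs x)))"
  by (rule wbdI[of _ "1 / e"]) (use abs_ln_le_wt[OF e] in auto)
 have ww: "wbd (- (2 * e)) (2 * e) (\<lambda>x. cx (wt (- (2 * e)) (2 * e) x))"
  by (rule wbdI[of _ 1]) auto
 have gl: "wbd (a + Re s - 1 + - e) (b + Re s - 1 + e) (\<lambda>x. g x * cx (ln (abs x)))" by (rule wbd_mult[OF g lw])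
 have gw: "wbd (a + Re s - 1 + - (2 * e)) (b + Re s - 1 + 2 * e) (\<lambda>x. g x * cx (wt (- (2 * e)) (2 * e) x))" by (rule wbd_mult[OF g ww])
 have f0: "f \<in> Sz 0" using f by (simp add: Sz_0)
 have i1: "lb_int (\<lambda>x. (g x * cx (ln (abs x))) * f x)"
  by (rule wbd_integrable_Sz[OF gl f0]) (use e s in \<open>simp add: e_def field_simps\<close>)
 have i2: "lb_int (\<lambda>x. (g x * cx (wt (- (2 * e)) (2 * e) x)) * f x)"
  by (rule wbd_integrable_Sz[OF gw f0]) (use e s in \<open>simp add: e_def field_simps\<close>)
 have i3: "lb_int (\<lambda>x. (h x * sp \<delta> (s' - 1) x) * f x)" if "a + Re s' > 0" for s'
  by (rule wbd_integrable_Sz[OF wbd_mult[OF h wbd_sp[of "s' - 1" \<delta>]] f0]) (use that in simp)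
 define D where "D = (LB x. (g x * cx (ln (abs x))) * f x)"
 define K where "K = (2 / e^2) * (LB x. norm ((g x * cx (wt (- (2 * e)) (2 * e) x)) * f x))"
 have pt: "norm (exp (z * cx L) - 1 - z * cx L) <= (norm z)\<^sup>2 * (2 / e^2 * exp (2 * e * abs L))" if z: "norm z < e" for z :: complex and L :: real
 proof -
  have "norm (exp (z * cx L) - 1 - z * cx L) <= exp (norm (z * cx L)) * (norm (z * cx L))\<^sup>2"
   using Taylor_exp_field[of "z * cx L" 1] by (simp add: One_nat_def numeral_2_eq_2 algebra_simps)
  also have "... = (norm z)\<^sup>2 * (exp (norm z * abs L) * L^2)" by (simp add: norm_mult power_mult_distrib mult_ac)
  also have "exp (norm z * abs L) * L^2 <= exp (e * abs L) * (2 / e^2 * exp (e * abs L))"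
  proof (intro mult_mono)
   show "exp (norm z * abs L) <= exp (e * abs L)" using z by (simp add: mult_right_mono)
   have "(e * abs L)\<^sup>2 / 2 <= exp (e * abs L)" using exp_lower_Taylor_quadratic[of "e * abs L"] e mult_nonneg_nonneg[of e "abs L"] by linarith
   thus "L\<^sup>2 <= 2 / e^2 * exp (e * abs L)" using e by (simp add: power_mult_distrib field_simps)
  qed auto
  also have "exp (e * abs L) * (2 / e^2 * exp (e * abs L)) = 2 / e^2 * exp (2 * e * abs L)"
   by (simp add: exp_add[symmetric])
  finally show ?thesis by (simp add: mult_left_mono)
 qed
 have bound: "norm (F (s + z) - F s - z * D) <= K * (norm z)\<^sup>2" if z: "norm z < e" for z :: complex
 proof -
  have "abs (Re z) < e" using abs_Re_le_cmod[of z] z by linarith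
  hence sz: "a + Re (s + z) > 0" using s e by (simp add: e_def abs_if split: if_splits)
  have Fd: "F (s + z) - F s - z * D = (LB x. ((h x * sp \<delta> (s + z - 1) x) * f x - (h x * sp \<delta> (s - 1) x) * f x) - z * ((g x * cx (ln (abs x))) * f x))"
   unfolding F_def D_def using i3[OF sz] i3[OF s] i1 by simp
  have "norm (F (s + z) - F s - z * D) <= (LB x. ((norm z)\<^sup>2 * (2 / e^2)) * norm ((g x * cx (wt (- (2 * e)) (2 * e) x)) * f x))"
   unfolding Fd
  proof (rule LB_norm_le)
   fix x
   show "norm (((h x * sp \<delta> (s + z - 1) x) * f x - (h x * sp \<delta> (s - 1) x) * f x) - z * ((g x * cx (ln (abs x))) * f x))
    <= ((norm z)\<^sup>2 * (2 / e^2)) * norm ((g x * cx (wt (- (2 * e)) (2 * e) x)) * f x)"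
   proof (cases "x = 0")
    case True thus ?thesis by (simp add: g_def)
   next
    case False
    have "(s + z - 1) * cx (ln (abs x)) = (s - 1) * cx (ln (abs x)) + z * cx (ln (abs x))" by (simp add: algebra_simps)
    hence "sp \<delta> (s + z - 1) x = sp \<delta> (s - 1) x * exp (z * cx (ln (abs x)))"
     by (simp only: sp_exp[OF False] exp_add mult_ac)
    hence "((h x * sp \<delta> (s + z - 1) x) * f x - (h x * sp \<delta> (s - 1) x) * f x) - z * ((g x * cx (ln (abs x))) * f x)
     = (g x * f x) * (exp (z * cx (ln (abs x))) - 1 - z * cx (ln (abs x)))"
     by (simp add: g_def algebra_simps)
    also have "norm ... <= norm (g x * f x) * ((norm z)\<^sup>2 * (2 / e^2 * exp (2 * e * abs (ln (abs x)))))"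
     unfolding norm_mult[of "g x * f x"] by (intro mult_left_mono pt z) simp
    also have "... = ((norm z)\<^sup>2 * (2 / e^2)) * norm ((g x * cx (wt (- (2 * e)) (2 * e) x)) * f x)"
     using abs_ln_le_wt(2)[of "2 * e" x] e False by (simp add: norm_mult mult_ac)
    finally show ?thesis .
   qed
  qed (use i1 i2 i3[OF s] i3[OF sz] in auto)
  also have "... = K * (norm z)\<^sup>2" unfolding K_def integral_mult_right_zero by (simp only: mult_ac)
  finally show ?thesis .
 qed
 have "(\<lambda>z. (F (s + z) - F s) / z - D) \<midarrow>0\<rightarrow> 0"
 proof (rule Lim_null_comparison)
  have "\<forall>\<^sub>F z in at 0. norm z < e"
   using e by (auto simp: eventually_at dist_norm intro!: exI[of _ e])
  moreover have "\<forall>\<^sub>F z in at (0::complex). z ~= 0" by (simp add: eventually_at_filter)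
  ultimately show "\<forall>\<^sub>F z in at 0. norm ((F (s + z) - F s) / z - D) <= K * norm z"
  proof eventually_elim
   case (elim z)
   hence "norm ((F (s + z) - F s) / z - D) = norm (F (s + z) - F s - z * D) / norm z"
    by (simp add: divide_simps mult.commute flip: norm_divide)
   also have "... <= K * (norm z)\<^sup>2 / norm z" using bound[of z] elim by (intro divide_right_mono) auto
   finally show ?case using elim by (simp add: power2_eq_square)
  qed
  show "(\<lambda>z::complex. K * norm z) \<midarrow>0\<rightarrow> 0" by (auto intro!: tendsto_eq_intros)
 qed
 hence "DERIV F s :> D" unfolding DERIV_def by (simp add: LIM_zero_iff)
 thus "(\<lambda>s. LB x. (h x * sp \<delta> (s - 1) x) * f x) field_differentiable (at s within {s. - a < Re s})"
  unfolding F_def[symmetric] by (meson field_differentiable_at_within field_differentiable_def)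
qed

lemma mellin_form_holomorphic:
 assumes h: "!!i. wbd a b (h i)" and f: "f \<in> schwartz"
 shows "(\<lambda>s. mellin_form \<delta> m h s f) holomorphic_on {s. - a < Re s}"
proof -
 have S: "adm 0 schwartz" using adm_Sz[of 0 0] by (simp add: Sz_0)
 have "(\<lambda>s. LB x. (q x * sp \<delta> (s - 1) x) * (Ec (s - 1) ^^ i) f x) holomorphic_on {s. - a < Re s}"
  if q: "wbd a b q" for q i
  using f
 proof (induction i arbitrary: f)
  case 0
  thus ?case using mellin_integral_holomorphic[OF q] by simp
 next
  case (Suc i)
  have e: "Eop f \<in> schwartz" using adm_Eop[OF S Suc.prems] .
  have "(\<lambda>s. (LB x. (q x * sp \<delta> (s - 1) x) * (Ec (s - 1) ^^ i) (Eop f) x) +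
    (s - 1) * (LB x. (q x * sp \<delta> (s - 1) x) * (Ec (s - 1) ^^ i) f x)) holomorphic_on {s. - a < Re s}"
   by (intro holomorphic_intros Suc.IH e Suc.prems)
  thus ?case
  proof (rule holomorphic_transform)
   fix s assume "s \<in> {s. - a < Re s}"
   hence s: "a + Re s > 0" by simp
   have i: "lb_int (\<lambda>x. (q x * sp \<delta> (s - 1) x) * (Ec (s - 1) ^^ i) g x)" if "g \<in> schwartz" for g
    by (rule wbd_integrable_Sz[OF wbd_mult[OF q wbd_sp], where n = 0]) (use s Ec_schwartz[OF that] in \<open>auto simp: Sz_0\<close>)
   show "(LB x. (q x * sp \<delta> (s - 1) x) * (Ec (s - 1) ^^ i) (Eop f) x) +
    (s - 1) * (LB x. (q x * sp \<delta> (s - 1) x) * (Ec (s - 1) ^^ i) f x)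
    = (LB x. (q x * sp \<delta> (s - 1) x) * (Ec (s - 1) ^^ Suc i) f x)"
    unfolding Ec_funpow_Suc[OF schwartz_smooth[OF Suc.prems]]
    using i[OF e] i[OF Suc.prems] by (simp add: distrib_left mult.left_commute[of _ "s - 1"])
  qed
 qed
 thus ?thesis unfolding mellin_form_def using h by (intro holomorphic_intros) auto
qed

lemma rep_schwartz_linear:
 assumes T: "rep schwartz a b T" and a: "a > -1"
 shows "linear_functional_on (TF U) T"
proof -
 have S: "adm 0 schwartz" using adm_Sz[of 0 0] by (simp add: Sz_0)
 obtain m h where h: "!!i. wbd a b (h i)" "!!f. f \<in> schwartz ==> T f = euler_form m h f"
  using T unfolding rep_def by blast
 show ?thesis unfolding linear_functional_on_def
 proof (intro conjI ballI allI)
  fix f g assume "f \<in> TF U" "g \<in> TF U"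
  hence "f \<in> schwartz" "g \<in> schwartz" by (auto intro: test_schwartz)
  thus "T (\<lambda>x. f x + g x) = T f + T g"
   using euler_form_add[OF S _ h(1), of f g] a by (simp add: h(2) schwartz_add)
 next
  fix f c assume "f \<in> TF U"
  hence "f \<in> schwartz" by (auto intro: test_schwartz)
  thus "T (\<lambda>x. c * f x) = c * T f"
   using euler_form_cmult[of f m h c] by (simp add: h(2) schwartz_cmult schwartz_smooth)
 qed
qed

lemma rep_schwartz_distribution:
 assumes T: "rep schwartz a b T" and a: "a > -1"
 shows "distribution_on U T"
proof -
 obtain m h where h: "!!i. wbd a b (h i)" "!!f. f \<in> schwartz ==> T f = euler_form m h f"
  using T unfolding rep_def by blast
 obtain C N where CN: "C >= 0" "!!f B. f \<in> schwartz ==> sbd N f B ==> norm (euler_form m h f) <= C * B"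
  using euler_form_tempered[where h = h and m = m, OF h(1) a] by blast
 show ?thesis unfolding distribution_on_def
 proof (intro conjI rep_schwartz_linear[OF assms] allI impI)
  fix K :: "real set" assume "compact K \<and> K \<subseteq> U"
  then obtain R where R: "R > 0" "!!x. x \<in> K ==> norm x <= R" using compact_imp_bounded bounded_pos by metis
  show "\<exists>C N. \<forall>f\<in>TF U. \<forall>B. {x. f x ~= 0} \<subseteq> K \<and> (\<forall>n\<le>N. \<forall>x. norm (nderiv n f x) <= B) --> norm (T f) <= C * B"
  proof (intro exI[of _ "C * (max 1 R) ^ N"] exI[of _ N] ballI allI impI)
   fix f B assume f: "f \<in> TF U" and B: "{x. f x ~= 0} \<subseteq> K \<and> (\<forall>n\<le>N. \<forall>x. norm (nderiv n f x) <= B)"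
   have "f y = 0" if "abs y > R" for y using R(2)[of y] B that by fastforce
   hence "sbd N f ((max 1 R) ^ N * B)" using B by (intro sbd_compact) auto
   thus "norm (T f) <= C * (max 1 R) ^ N * B"
    using CN(2)[OF test_schwartz[OF f]] h(2)[OF test_schwartz[OF f]] by (simp add: mult.assoc)
  qed
 qed
qed

text \<open>The coefficients of \<open>mellin_form\<close> have exponent k + Re s - 1 at 0, which is
  both more than -1 throughout the half plane and the bound on the orders l demanded of the
  extension.\<close>

lemma mellin_extension_form:
 assumes h: "!!i. wbd (of_int k) b (h i)"
  and T: "!!f. f \<in> test0 ==> T f = euler_form m h f"
 shows "mellin_extension \<delta> (Finite_Order k) T (mellin_form \<delta> m h)"
 unfolding mellin_extension_def
proof (intro conjI allI impI ballI)
 fix s assume "- order_val (Finite_Order k) < ereal (Re s)"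
 hence s: "of_int k + Re s > 0" by simp
 have r: "rep schwartz (of_int k + Re s - 1) (b + Re s - 1) (mellin_form \<delta> m h s)" by (rule rep_mellin_form[OF h s])
 show "distribution_on UNIV (mellin_form \<delta> m h s)"
  by (rule rep_schwartz_distribution[OF r]) (use s in simp)
 show "mellin_form \<delta> m h s f = mult_distr (sp \<delta> (s - 1)) T f" if f: "f \<in> test0" for f
  unfolding mult_distr_def by (simp add: mellin_form_away[OF f] T[OF sp_test_away[OF f]])
 fix l :: int assume l: "0 <= l \<and> ereal (of_int l) <= ereal (Re s - 1) + order_val (Finite_Order k)"
 hence l': "0 <= l" "of_int l <= of_int k + Re s - 1" by auto
 show "vanishes_to (mellin_form \<delta> m h s) 0 l"
 proof (rule rep_imp_vanishes)
  show "rep (TF {-1<..<1}) (of_int k + Re s - 1) (b + Re s - 1) (mellin_form \<delta> m h s)"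
   by (rule rep_mono[OF r]) (auto intro: test_schwartz)
 qed (use l' in auto)
next
 fix f assume "f \<in> testR"
 hence "(\<lambda>s. mellin_form \<delta> m h s f) holomorphic_on {s. - of_int k < Re s}"
  by (intro mellin_form_holomorphic[OF h]) (rule test_schwartz)
 thus "(\<lambda>s. mellin_form \<delta> m h s f) holomorphic_on {s. - order_val (Finite_Order k) < ereal (Re s)}" by simp
qed

text \<open>The difference is supported at 0 and has exponent 0 there, so
  \<open>rep_point_support_zero\<close> applies.\<close>

lemma vanishing_extension_unique:
 assumes T: "linear_functional_on (testR) T" "vanishes_to T 0 0"
  and T': "linear_functional_on (testR) T'" "vanishes_to T' 0 0"
  and eq: "!!f. f \<in> test0 ==> T f = T' f" and f: "f \<in> testR"
 shows "T f = T' f"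
proof -
 obtain r where r: "0 < r" "r <= 1" "!!c. rep (TF {-r<..<r}) (of_int 0) c T"
  using vanishes_imp_rep[OF T(2)] by auto
 obtain r' where r': "0 < r'" "r' <= 1" "!!c. rep (TF {-r'<..<r'}) (of_int 0) c T'"
  using vanishes_imp_rep[OF T'(2)] by auto
 define u where "u = min r r'"
 have u: "u > 0" using r r' by (simp add: u_def)
 have m: "TF {-u<..<u} \<subseteq> TF {-r<..<r}" "TF {-u<..<u} \<subseteq> TF {-r'<..<r'}"
  unfolding u_def by (auto elim!: test_mono)
 have R: "rep (TF {-u<..<u}) 0 0 (\<lambda>f. T f - T' f)"
  by (rule rep_diff[OF adm_test]) (use rep_mono[OF r(3) m(1), of 0 0 0] rep_mono[OF r'(3) m(2), of 0 0 0] in auto)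
 have "T f - T' f = 0"
  by (rule rep_point_support_zero[OF _ R u _ f]) (use T(1) T'(1) eq in \<open>auto simp: linear_functional_on_def algebra_simps\<close>)
 thus ?thesis by simp
qed

lemma order_halfplane:
 obtains X where "!!s. X < Re s ==> - order_val k < ereal (Re s) \<and> ereal 0 <= ereal (Re s - 1) + order_val k"
proof (cases k)
 case (Finite_Order n)
 show ?thesis by (rule that[of "1 - of_int n"]) (auto simp: Finite_Order)
next
 case Infinite_Order
 show ?thesis by (rule that[of 0]) (auto simp: Infinite_Order)
qed

lemma order_halfplane_open: "open {s. - order_val k < ereal (Re s)}"
 and order_halfplane_convex: "convex {s. - order_val k < ereal (Re s)}"
 by (cases k; simp add: open_halfspace_Re_gt convex_halfspace_Re_gt)+

text \<open>Extensions for different orders k and k' are compared: far to the right in s both vanish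
  to order 0 and so agree, and the identity theorem carries the equality over the common half
  plane.\<close>

lemma mellin_extension_unique:
 assumes E: "mellin_extension \<delta> k T E" and E': "mellin_extension \<delta> k' T E'"
  and s: "- order_val k < ereal (Re s)" "- order_val k' < ereal (Re s)"
  and f: "f \<in> testR"
 shows "E s f = E' s f"
proof -
 obtain X where X: "!!s. X < Re s ==> - order_val k < ereal (Re s) \<and> ereal 0 <= ereal (Re s - 1) + order_val k"
  by (rule order_halfplane[of k]) blast
 obtain X' where X': "!!s. X' < Re s ==> - order_val k' < ereal (Re s) \<and> ereal 0 <= ereal (Re s - 1) + order_val k'"
  by (rule order_halfplane[of k']) blast
 define H where "H = {s. - order_val k < ereal (Re s)} \<inter> {s. - order_val k' < ereal (Re s)}"
 define Y where "Y = max X X'"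
 show ?thesis
 proof (rule analytic_continuation_open[where s = "{s. Y < Re s}" and s' = H and f = "\<lambda>s. E s f" and g = "\<lambda>s. E' s f" and z = s])
  show "open {s. Y < Re s}" by (rule open_halfspace_Re_gt)
  show "open H" unfolding H_def by (intro open_Int order_halfplane_open)
  have "cx (Y + 1) \<in> {s. Y < Re s}" by simp
  thus "{s. Y < Re s} ~= {}" by blast
  show "connected H" unfolding H_def by (intro convex_connected convex_Int order_halfplane_convex)
  show "{s. Y < Re s} \<subseteq> H" using X X' by (auto simp: Y_def H_def)
  show "(\<lambda>s. E s f) holomorphic_on H" "(\<lambda>s. E' s f) holomorphic_on H"
   using E E' f unfolding mellin_extension_def H_def by (auto intro: holomorphic_on_subset)
  show "s \<in> H" using s by (simp add: H_def)
  show "E z f = E' z f" if "z \<in> {s. Y < Re s}" for z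
  proof (rule vanishing_extension_unique[OF _ _ _ _ _ f])
   have z: "- order_val k < ereal (Re z) \<and> ereal 0 <= ereal (Re z - 1) + order_val k"
    "- order_val k' < ereal (Re z) \<and> ereal 0 <= ereal (Re z - 1) + order_val k'"
    using X[of z] X'[of z] that by (auto simp: Y_def)
   have e: "distribution_on UNIV (E z)" "!!\<phi>. \<phi> \<in> test0 ==> E z \<phi> = mult_distr (sp \<delta> (z - 1)) T \<phi>"
    "!!l. 0 <= l ==> ereal (of_int l) <= ereal (Re z - 1) + order_val k ==> vanishes_to (E z) 0 l"
    using E z(1) unfolding mellin_extension_def by auto
   have e': "distribution_on UNIV (E' z)" "!!\<phi>. \<phi> \<in> test0 ==> E' z \<phi> = mult_distr (sp \<delta> (z - 1)) T \<phi>"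
    "!!l. 0 <= l ==> ereal (of_int l) <= ereal (Re z - 1) + order_val k' ==> vanishes_to (E' z) 0 l"
    using E' z(2) unfolding mellin_extension_def by auto
   show "linear_functional_on (testR) (E z)" "linear_functional_on (testR) (E' z)"
    using e(1) e'(1) by (auto simp: distribution_on_def)
   show "vanishes_to (E z) 0 0" "vanishes_to (E' z) 0 0"
    using e(3)[of 0] e'(3)[of 0] z by auto
   show "E z g = E' z g" if "g \<in> test0" for g
    using e(2)[OF that] e'(2)[OF that] by simp
  qed
 qed
qed

section \<open>Mellin integrals in the coordinate 1/x\<close>

lemma Ec_funpow_cong_open:
 assumes "open U" "!!x. x \<in> U ==> f x = g x" "x \<in> U" shows "(Ec c ^^ i) f x = (Ec c ^^ i) g x"
 using assms(3)
proof (induction i arbitrary: x)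
 case (Suc i)
 thus ?case using Ec_cong_open[OF assms(1), of "(Ec c ^^ i) f" "(Ec c ^^ i) g" x c] by simp
qed (simp add: assms)

lemma smooth_recip:
 assumes "smooth_on (- {0}) g" shows "smooth_on (- {0}) (\<lambda>x. g (1 / x))"
proof (rule smooth_cong)
 have [simp]: "open (- {0::real})" by auto
 show "smooth_on (- {0}) (\<lambda>x. cx x ^ 2 * inv_density g x)"
  by (intro smooth_mult smooth_inv_density assms smooth_power) (auto intro: smooth_subset[OF smooth_of_real])
 show "cx y ^ 2 * inv_density g y = g (1 / y)" if "y \<in> - {0}" for y
  using that by (simp add: inv_density_def)
qed auto

lemma Ec_recip:
 assumes g: "smooth_on (- {0}) g" and x: "x ~= 0"
 shows "Ec (- s - 1) (\<lambda>x. g (1 / x)) x = - Ec (s - 1) g (1 / x)"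
proof -
 have "(g has_vd nderiv 1 g (1 / x)) (at (1 / x))"
  by (rule smooth_hvd1[OF g]) (use x in auto)
 moreover have "((\<lambda>x. 1 / x) has_real_derivative - (1 / x^2)) (at x)"
  using x by (auto intro!: derivative_eq_intros simp: power2_eq_square)
 ultimately have "((\<lambda>x. g (1 / x)) has_vd - (1 / x^2) *\<^sub>R nderiv 1 g (1 / x)) (at x)"
  using vector_diff_chain_at[of "\<lambda>x. 1 / x" "- (1 / x^2)" x g] by (simp add: o_def hrd_iff_hvd)
 hence "nderiv 1 (\<lambda>x. g (1 / x)) x = - (1 / x^2) *\<^sub>R nderiv 1 g (1 / x)" by (rule nderiv_1_eqI)
 thus ?thesis using x
  by (simp add: Ec_def Eop_def scaleR_conv_of_real field_simps power2_eq_square)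
qed

lemma Ec_funpow_recip:
 assumes g: "smooth_on (- {0}) g" and x: "x ~= 0"
 shows "(Ec (- s - 1) ^^ i) (\<lambda>x. g (1 / x)) x = (-1) ^ i * (Ec (s - 1) ^^ i) g (1 / x)"
 using x
proof (induction i arbitrary: x)
 case (Suc i)
 have o: "open (- {0::real})" by auto
 define G where "G = (Ec (s - 1) ^^ i) g"
 have G: "smooth_on (- {0}) G" unfolding G_def by (rule smooth_Ec_funpow[OF o g])
 have "Ec (- s - 1) ((Ec (- s - 1) ^^ i) (\<lambda>x. g (1 / x))) x = Ec (- s - 1) (\<lambda>x. (\<lambda>y. (-1) ^ i * G y) (1 / x)) x"
  by (rule Ec_cong_open[OF o]) (use Suc in \<open>auto simp: G_def\<close>)
 also have "... = - Ec (s - 1) (\<lambda>y. (-1) ^ i * G y) (1 / x)"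
  by (rule Ec_recip[OF smooth_cmult[OF o G] Suc.prems])
 also have "Ec (s - 1) (\<lambda>y. (-1) ^ i * G y) (1 / x) = (-1) ^ i * Ec (s - 1) G (1 / x)"
  using nderiv_cmult[OF o G, of "1 / x" 1 "(-1) ^ i"] Suc.prems by (simp add: Ec_def Eop_def algebra_simps)
 finally show ?case by (simp add: G_def)
qed simp

lemma Ec_funpow_one: "(Ec (s - 1) ^^ i) (\<lambda>x. 1) = (\<lambda>x. s ^ i)"
proof (induction i)
 case (Suc i)
 have "nderiv 1 (\<lambda>x. s ^ i) x = 0" for x by (rule nderiv_1_eqI) simp
 thus ?case using Suc by (auto simp: Ec_def Eop_def algebra_simps)
qed simp

lemma recip_cutoff_test:
 assumes \<phi>: "\<phi> \<in> testR" and 1: "\<forall>\<^sub>F x in nhds 0. \<phi> x = 1"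
 shows "(\<lambda>x. if x = 0 then 1 else 1 - \<phi> (1 / x)) \<in> testR" (is "?g \<in> _")
proof -
 obtain d where d: "d > 0" "!!x. abs x < d ==> \<phi> x = 1"
  using 1 by (auto simp: eventually_nhds_metric dist_norm)
 obtain R where R: "R > 0" "!!x. abs x >= R ==> \<phi> x = 0" using test_bounded_subset[OF \<phi>] by blast
 have o: "open (- {0::real})" by auto
 have s: "smooth_on (- {0}) \<phi>" using smooth_subset[OF test_smooth[OF \<phi>]] by auto
 have s1: "smooth_on (- {0}) ?g"
  by (rule smooth_cong[OF o smooth_diff[OF o _ smooth_recip[OF s]]]) auto
 have s2: "smooth_on {- (1 / R)<..<1 / R} ?g"
 proof (rule smooth_cong[of _ "\<lambda>x. 1"])
  fix y assume "y \<in> {- (1 / R)<..<1 / R}"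
  hence "abs (1 / y) >= R" if "y ~= 0" using R that by (auto simp: field_simps abs_if split: if_splits)
  thus "1 = ?g y" using R(2) by auto
 qed auto
 show ?thesis
 proof (rule test_functionsI[of _ "{- (1 / d)..1 / d}"])
  show "smooth ?g"
  proof (rule smooth_local)
   fix x :: real
   show "\<exists>V. open V \<and> x \<in> V \<and> smooth_on V ?g"
   proof (cases "x = 0")
    case True thus ?thesis using s2 R by (intro exI[of _ "{- (1 / R)<..<1 / R}"]) auto
   next
    case False thus ?thesis using s1 by (intro exI[of _ "- {0}"]) auto
   qed
  qed
  fix x assume "x \<notin> {- (1 / d)..1 / d}"
  hence "abs x > 1 / d" by (auto simp: abs_if)
  moreover have "1 / d > 0" using d by simp
  ultimately have "x ~= 0" "abs (1 / x) < d" using d less_divide_eq_1_pos[of "1 / d" "abs x"]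
   by (auto simp: divide_simps mult.commute split: if_splits)
  thus "?g x = 0" using d(2) by simp
 qed auto
qed

lemma sp_recip:
 assumes "x ~= 0" shows "sp \<delta> (- s - 1) (1 / x) / cx x ^ 2 = sp \<delta> (s - 1) x"
proof -
 have "cx x ^ 2 = exp (2 * cx (ln (abs x)))"
  using assms by (simp add: exp_double exp_of_real flip: of_real_power)
 moreover have "(- s - 1) * - cx (ln (abs x)) = (s - 1) * cx (ln (abs x)) + 2 * cx (ln (abs x))" by (simp add: algebra_simps)
 moreover have "sgn (1 / x) = sgn x" by (simp add: sgn_real_def)
 ultimately show ?thesis
  using assms by (simp add: sp_exp ln_div exp_add del: minus_mult_minus mult_minus_left mult_minus_right)
qed

text \<open>The substitution x -> 1/x turns the second form into the first one with 1 - phi in place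
  of phi, the signs of the inverted operators cancelling those of the inverted coefficients. The
  cutoffs add up to 1, and \<open>Ec (s - 1)\<close> multiplies the constant 1 by s.\<close>

lemma mellin_form_sum:
 assumes h: "!!i. wbd a b (h i)" and s: "- a < Re s" "Re s < - b"
  and \<phi>: "\<phi> \<in> testR" "\<forall>\<^sub>F x in nhds 0. \<phi> x = 1"
 shows "mellin_form \<delta> m h s \<phi> + mellin_form \<delta> m (\<lambda>i x. (-1) ^ i * h i (1 / x)) (- s) (\<lambda>x. if x = 0 then 1 else 1 - \<phi> (1 / x))
  = (\<Sum>i\<le>m. s ^ i * (LB x. h i x * sp \<delta> (s - 1) x))"
 unfolding mellin_form_def sum.distrib[symmetric]
proof (intro sum.cong refl)
 fix i
 note [measurable] = wbd_measurable[OF h]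
 define \<psi> where "\<psi> = (\<lambda>x. if x = 0 then 1 else 1 - \<phi> (1 / x))"
 have \<psi>: "\<psi> \<in> schwartz" unfolding \<psi>_def by (rule test_schwartz[OF recip_cutoff_test[OF \<phi>]])
 have \<phi>s: "\<phi> \<in> schwartz" by (rule test_schwartz[OF \<phi>(1)])
 have \<phi>c: "smooth (\<lambda>x. 1 - \<phi> x)" by (rule smooth_diff[OF open_UNIV smooth_const schwartz_smooth[OF \<phi>s]])
 define q where "q = (\<lambda>x. h i x * sp \<delta> (s - 1) x)"
 have q: "wbd (a + Re s - 1) (b + Re s - 1) q"
  using wbd_mult[OF h[of i] wbd_sp[of "s - 1" \<delta>]] by (simp add: q_def algebra_simps)
 have i1: "lb_int (\<lambda>x. q x * (Ec (s - 1) ^^ i) \<phi> x)"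
  by (rule wbd_integrable_Sz[OF q, where n = 0]) (use s Ec_schwartz[OF \<phi>s] in \<open>auto simp: Sz_0\<close>)
 define F where "F = (\<lambda>x. ((-1) ^ i * h i (1 / x) * sp \<delta> (- s - 1) x) * (Ec (- s - 1) ^^ i) \<psi> x)"
 have \<psi>m: "(Ec (- s - 1) ^^ i) \<psi> \<in> BM" by (rule schwartz_measurable[OF Ec_schwartz[OF \<psi>]])
 have Fm: "F \<in> BM" unfolding F_def using \<psi>m by measurable
 have "wbd (- b + (- Re s - 1)) (- a + (- Re s - 1)) (\<lambda>x. (-1) ^ i * h i (1 / x) * sp \<delta> (- s - 1) x)"
  using wbd_mult[OF wbd_cmult[OF wbd_recip[OF h[of i]]] wbd_sp[of "- s - 1" \<delta>]] by simp
 hence Fi: "lb_int F" unfolding F_def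
  by (rule wbd_integrable_Sz[where n = 0]) (use s Ec_schwartz[OF \<psi>] in \<open>auto simp: Sz_0\<close>)
 have Fe: "F (1 / x) / cx x ^ 2 = q x * (Ec (s - 1) ^^ i) (\<lambda>x. 1 - \<phi> x) x" for x
 proof (cases "x = 0")
  case False
  have "(Ec (- s - 1) ^^ i) \<psi> (1 / x) = (Ec (- s - 1) ^^ i) (\<lambda>x. (\<lambda>y. 1 - \<phi> y) (1 / x)) (1 / x)"
   by (rule Ec_funpow_cong_open[of "- {0}"]) (use False in \<open>auto simp: \<psi>_def\<close>)
  also have "... = (-1) ^ i * (Ec (s - 1) ^^ i) (\<lambda>y. 1 - \<phi> y) (1 / (1 / x))"
   by (rule Ec_funpow_recip) (use False smooth_subset[OF \<phi>c] in auto)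
  finally have 1: "(Ec (- s - 1) ^^ i) \<psi> (1 / x) = (-1) ^ i * (Ec (s - 1) ^^ i) (\<lambda>y. 1 - \<phi> y) x" by simp
  have "F (1 / x) / cx x ^ 2 = ((-1) ^ i * (-1) ^ i) * (h i x * (sp \<delta> (- s - 1) (1 / x) / cx x ^ 2) * (Ec (s - 1) ^^ i) (\<lambda>y. 1 - \<phi> y) x)"
   unfolding F_def 1 by simp
  thus ?thesis unfolding sp_recip[OF False] by (simp add: q_def flip: power_mult_distrib)
 qed (simp add: q_def)
 have i2: "lb_int (\<lambda>x. q x * (Ec (s - 1) ^^ i) (\<lambda>x. 1 - \<phi> x) x)"
  using reciprocal_substitution(1)[OF Fm] Fi unfolding Fe by simp
 have "(LB x. F x) = (LB x. q x * (Ec (s - 1) ^^ i) (\<lambda>x. 1 - \<phi> x) x)"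
  using reciprocal_substitution(2)[OF Fm] unfolding Fe by simp
 hence "(LB x. q x * (Ec (s - 1) ^^ i) \<phi> x) + (LB x. F x)
   = (LB x. q x * (Ec (s - 1) ^^ i) \<phi> x + q x * (Ec (s - 1) ^^ i) (\<lambda>x. 1 - \<phi> x) x)"
  using i1 i2 by simp
 also have "... = (LB x. s ^ i * q x)"
 proof (intro LB_integral_cong refl)
  fix x
  have "(Ec (s - 1) ^^ i) \<phi> x + (Ec (s - 1) ^^ i) (\<lambda>x. 1 - \<phi> x) x = s ^ i"
   using fun_cong[OF Ec_funpow_add[OF schwartz_smooth[OF \<phi>s] \<phi>c, where c = "s - 1" and i = i], of x] by (simp add: Ec_funpow_one)
  thus "q x * (Ec (s - 1) ^^ i) \<phi> x + q x * (Ec (s - 1) ^^ i) (\<lambda>x. 1 - \<phi> x) x = s ^ i * q x"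
   by (simp flip: distrib_left)
 qed
 finally show "(LB x. h i x * sp \<delta> (s - 1) x * (Ec (s - 1) ^^ i) \<phi> x) +
   (LB x. (-1) ^ i * h i (1 / x) * sp \<delta> (- s - 1) x * (Ec (- s - 1) ^^ i) (\<lambda>x. if x = 0 then 1 else 1 - \<phi> (1 / x)) x)
   = s ^ i * (LB x. h i x * sp \<delta> (s - 1) x)"
  unfolding F_def \<psi>_def q_def by simp
qed

lemma mellin_eq_aux:
 fixes a b :: int
 assumes T: "tempered T" "vanishes_to T 0 a" "extends_across_infinity T (Finite_Order (- b))"
  and h: "!!i. wbd (of_int a) (of_int b) (h i)" "!!f. f \<in> test0 ==> T f = euler_form m h f"
  and s: "- of_int a < Re s" "Re s < - of_int b"
 shows "s \<in> mellin_domain T" and "mellin \<delta> T s = (\<Sum>i\<le>m. s ^ i * (LB x. h i x * sp \<delta> (s - 1) x))"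
proof -
 \<comment> \<open>The strip is nonempty and the orders are integers, so they leave the gap of at
   least 1 that \<open>mellin_orders\<close> demands.\<close>
 have "of_int b < (of_int a :: real)" using s by linarith
 hence "b < a" by simp
 hence o: "mellin_orders T (Finite_Order a) (Finite_Order (- b))"
  using T by (simp add: mellin_orders_def one_ereal_def flip: of_int_minus of_int_add)
 thus "s \<in> mellin_domain T"
  unfolding mellin_domain_def mem_Collect_eq using s
  by (intro exI[of _ "Finite_Order a"] exI[of _ "Finite_Order (- b)"]) auto
 define h' where "h' = (\<lambda>i x. (-1) ^ i * h i (1 / x))"
 have h': "wbd (of_int (- b)) (- of_int a) (h' i)" for i
  unfolding h'_def using wbd_cmult[OF wbd_recip[OF h(1)[of i]], of "(-1) ^ i"] by simp
 have E: "mellin_extension \<delta> (Finite_Order a) T (mellin_form \<delta> m h)" by (rule mellin_extension_form[OF h])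
 have F: "mellin_extension \<delta> (Finite_Order (- b)) (inversion T) (mellin_form \<delta> m h')"
 proof (rule mellin_extension_form[OF h'])
  fix f assume f: "f \<in> test0"
  show "inversion T f = euler_form m h' f"
   unfolding inversion_def h(2)[OF inv_density_test_away[OF f]] h'_def
   by (rule euler_form_inv_density[OF wbd_measurable[OF h(1)] f])
 qed
 let ?v = "\<Sum>i\<le>m. s ^ i * (LB x. h i x * sp \<delta> (s - 1) x)"
 have v: "?v = mellin_form \<delta> m h s \<phi> + mellin_form \<delta> m h' (- s) (\<lambda>x. if x = 0 then 1 else 1 - \<phi> (1 / x))"
  if "\<phi> \<in> testR" "\<forall>\<^sub>F x in nhds 0. \<phi> x = 1" for \<phi>
  unfolding h'_def by (rule mellin_form_sum[OF h(1) s that, symmetric])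
 show "mellin \<delta> T s = ?v"
  unfolding mellin_def
 proof (rule the_equality)
  show "has_mellin \<delta> T s ?v"
   unfolding has_mellin_def using o E F v s
   by (intro exI[of _ "Finite_Order a"] exI[of _ "Finite_Order (- b)"] exI[of _ "mellin_form \<delta> m h"] exI[of _ "mellin_form \<delta> m h'"]) auto
  fix w assume "has_mellin \<delta> T s w"
  then obtain k0 kinf E' F' where w: "- order_val k0 < ereal (Re s)" "ereal (Re s) < order_val kinf"
    "mellin_extension \<delta> k0 T E'" "mellin_extension \<delta> kinf (inversion T) F'"
   and w': "!!\<phi>. \<phi> \<in> testR ==> (\<forall>\<^sub>F x in nhds 0. \<phi> x = 1) ==>
      w = E' s \<phi> + F' (- s) (\<lambda>x. if x = 0 then 1 else 1 - \<phi> (1 / x))"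
   unfolding has_mellin_def by blast
  have c: "\<forall>\<^sub>F x in nhds 0. cutoff x = 1"
   by (auto simp: eventually_nhds_metric dist_norm cutoff_1 intro!: exI[of _ 1])
  have "mellin_form \<delta> m h s cutoff = E' s cutoff"
   by (rule mellin_extension_unique[OF E w(3) _ w(1) cutoff_test]) (use s in simp)
  moreover have "mellin_form \<delta> m h' (- s) (\<lambda>x. if x = 0 then 1 else 1 - cutoff (1 / x)) = F' (- s) (\<lambda>x. if x = 0 then 1 else 1 - cutoff (1 / x))"
  proof (rule mellin_extension_unique[OF F w(4) _ _ recip_cutoff_test[OF cutoff_test c]])
   show "- order_val kinf < ereal (Re (- s))" using w(2) by (cases kinf) auto
  qed (use s in simp)
  ultimately show "w = ?v" using w'[OF cutoff_test c] v[OF cutoff_test c] by simp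
 qed
qed

section \<open>Extension across infinity\<close>

definition taylor_rest :: "nat => (real => complex) => real => complex" where
 "taylor_rest K g = (\<lambda>t. g t - (\<Sum>l<K. nderiv l g 0 / fact l * cx t ^ l))"

lemma smooth_xpow: "smooth (\<lambda>t. cx t ^ l)"
 by (rule smooth_power) (auto intro: smooth_of_real)

lemma smooth_poly_sum: "smooth (\<lambda>t. \<Sum>l<K. c l * cx t ^ l)"
 by (intro smooth_sum smooth_cmult smooth_xpow open_UNIV)

lemma smooth_taylor_rest: "smooth g ==> smooth (taylor_rest K g)"
 unfolding taylor_rest_def by (intro smooth_diff smooth_poly_sum open_UNIV)

lemma nderiv_diff:
 assumes "smooth f" "smooth g"
 shows "nderiv n (\<lambda>x. f x - g x) x = nderiv n f x - nderiv n g x"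
 using nderiv_add[OF open_UNIV assms(1) smooth_uminus[OF open_UNIV assms(2)], of x n]
  nderiv_cmult[OF open_UNIV assms(2), of x n "-1"] by simp

lemma nderiv_poly_sum: "nderiv n (\<lambda>t. \<Sum>l<K. c l * cx t ^ l) x = (\<Sum>l<K. c l * nderiv n (\<lambda>t. cx t ^ l) x)"
 by (subst nderiv_sum[OF open_UNIV])
  (auto intro!: smooth_cmult smooth_xpow sum.cong nderiv_cmult[OF open_UNIV])

lemma nderiv_xpow_0: "nderiv n (\<lambda>t. cx t ^ l) 0 = (if n = l then fact l else 0)"
proof -
 consider "n < l" | "n = l" | "n > l" by linarith
 thus ?thesis
 proof cases
  case 2
  have "(\<Prod>i<l. of_nat (l - i)) = (fact l :: complex)"
  proof -
   have "(\<Prod>i<l. l - i) = fact l" unfolding fact_prod_rev by (simp add: lessThan_atLeast0)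
   hence "of_nat (\<Prod>i<l. l - i) = (of_nat (fact l) :: complex)" by simp
   thus ?thesis by (simp only: of_nat_prod of_nat_fact)
  qed
  thus ?thesis using 2 by (simp add: nderiv_xpow)
 next
  case 3
  hence "(\<Prod>i<n. of_nat (l - i)) = (0::complex)" by (intro prod_zero) auto
  thus ?thesis using 3 by (simp add: nderiv_xpow)
 qed (simp add: nderiv_xpow)
qed

lemma fun_vanishes_taylor_rest:
 assumes "smooth g" shows "fun_vanishes (taylor_rest K g) 0 K"
 unfolding fun_vanishes_def taylor_rest_def nderiv_diff[OF assms smooth_poly_sum] nderiv_poly_sum nderiv_xpow_0
 by (auto simp: if_distrib sum.delta cong: if_cong)

lemma taylor_rest_vanishing: "fun_vanishes g 0 K ==> taylor_rest K g = g"
 by (auto simp: taylor_rest_def fun_vanishes_def)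

lemma taylor_rest_add:
 assumes "smooth f" "smooth g"
 shows "taylor_rest K (\<lambda>x. f x + g x) = (\<lambda>x. taylor_rest K f x + taylor_rest K g x)"
 by (auto simp: taylor_rest_def nderiv_add[OF open_UNIV assms] add_divide_distrib distrib_right sum.distrib)

lemma taylor_rest_cmult:
 assumes "smooth f" shows "taylor_rest K (\<lambda>x. c * f x) = (\<lambda>x. c * taylor_rest K f x)"
 by (auto simp: taylor_rest_def nderiv_cmult[OF open_UNIV assms] right_diff_distrib sum_distrib_left mult.assoc)

lemma Eop_funpow_nderiv_bound:
 "\<exists>C\<ge>0. \<forall>f x B. smooth f \<and> abs x <= 1 \<and> (\<forall>n\<le>N + i. norm (nderiv n f x) <= B) -->
   (\<forall>n\<le>N. norm (nderiv n ((Eop ^^ i) f) x) <= C * B)"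
proof (induction i arbitrary: N)
 case 0
 show ?case by (intro exI[of _ 1]) auto
next
 case (Suc i)
 obtain C where C: "C >= 0" "!!f x B. smooth f ==> abs x <= 1 ==> (!!n. n <= Suc N + i ==> norm (nderiv n f x) <= B) ==>
   (\<forall>n\<le>Suc N. norm (nderiv n ((Eop ^^ i) f) x) <= C * B)"
  using Suc[of "Suc N"] by blast
 show ?case
 proof (intro exI[of _ "(2 + real N) * C"] conjI allI impI)
  show "(2 + real N) * C >= 0" using C by simp
  fix f x B n
  assume f: "smooth f \<and> abs x <= 1 \<and> (\<forall>n\<le>N + Suc i. norm (nderiv n f x) <= B)" and n: "n <= N"
  have b: "norm (nderiv n ((Eop ^^ i) f) x) <= C * B" if "n <= Suc N" for n using C(2)[of f x B] f that by auto
  have "norm (nderiv n ((Eop ^^ Suc i) f) x) = norm (cx x * nderiv (Suc n) ((Eop ^^ i) f) x + of_nat (Suc n) * nderiv n ((Eop ^^ i) f) x)"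
   using f by (simp add: nderiv_Eop[OF open_UNIV smooth_Eop_funpow[OF open_UNIV]])
  also have "... <= abs x * norm (nderiv (Suc n) ((Eop ^^ i) f) x) + real (Suc n) * norm (nderiv n ((Eop ^^ i) f) x)"
   by (rule order_trans[OF norm_triangle_ineq]) (simp add: norm_mult del: of_nat_Suc)
  also have "... <= 1 * (C * B) + (1 + real N) * (C * B)"
   using f n b[of n] b[of "Suc n"] norm_nonneg_trans[OF b[of n]] by (intro add_mono mult_mono) auto
  finally show "norm (nderiv n ((Eop ^^ Suc i) f) x) <= (2 + real N) * C * B" by (simp add: algebra_simps)
 qed
qed

lemma Eop_funpow_mult_bound:
 assumes g: "smooth g" "!!k. \<exists>A. \<forall>x. norm ((th ^^ k) g x) <= A"
 shows "\<exists>C\<ge>0. \<forall>f x B. smooth f \<and> (\<forall>j\<le>i. norm ((Eop ^^ j) f x) <= B) --> norm ((Eop ^^ i) (\<lambda>x. g x * f x) x) <= C * B"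
 using g
proof (induction i arbitrary: g)
 case 0
 then obtain A where A: "!!x. norm ((th ^^ 0) g x) <= A" by blast
 hence "A >= 0" using norm_nonneg_trans by blast
 thus ?case using A by (intro exI[of _ A]) (auto simp: norm_mult intro!: mult_mono)
next
 case (Suc i)
 obtain C where C: "C >= 0" "!!f x B. smooth f ==> (!!j. j <= i ==> norm ((Eop ^^ j) f x) <= B) ==> norm ((Eop ^^ i) (\<lambda>x. g x * f x) x) <= C * B"
  using Suc.IH[OF Suc.prems] by blast
 have "\<exists>A. \<forall>x. norm ((th ^^ k) (th g) x) <= A" for k using Suc.prems(2)[of "Suc k"] by (simp add: funpow_swap1)
 from Suc.IH[OF smooth_th[OF open_UNIV Suc.prems(1)] this]
 obtain D where D: "D >= 0" "!!f x B. smooth f ==> (!!j. j <= i ==> norm ((Eop ^^ j) f x) <= B) ==> norm ((Eop ^^ i) (\<lambda>x. th g x * f x) x) <= D * B"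
  by blast
 show ?case
 proof (intro exI[of _ "C + D"] conjI allI impI)
  show "C + D >= 0" using C D by simp
  fix f x B assume f: "smooth f \<and> (\<forall>j\<le>Suc i. norm ((Eop ^^ j) f x) <= B)"
  have sf: "smooth f" using f by simp
  have "(Eop ^^ Suc i) (\<lambda>x. g x * f x) x = (Eop ^^ i) (\<lambda>x. g x * Eop f x + th g x * f x) x"
   by (simp add: funpow_swap1 Eop_mult'[OF sf Suc.prems(1)])
  also have "... = (Eop ^^ i) (\<lambda>x. g x * Eop f x) x + (Eop ^^ i) (\<lambda>x. th g x * f x) x"
   by (subst Eop_funpow_add) (auto intro!: smooth_mult smooth_Eop smooth_th sf Suc.prems)
  also have "norm ... <= C * B + D * B"
  proof (rule norm_triangle_le[OF add_mono])
   show "norm ((Eop ^^ i) (\<lambda>x. g x * Eop f x) x) <= C * B"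
   proof (rule C(2)[OF smooth_Eop[OF open_UNIV sf]])
    fix j assume "j <= i" thus "norm ((Eop ^^ j) (Eop f) x) <= B"
     using f[THEN conjunct2, rule_format, of "Suc j"] by (simp add: funpow_swap1)
   qed
   show "norm ((Eop ^^ i) (\<lambda>x. th g x * f x) x) <= D * B" by (rule D(2)[OF sf]) (use f in auto)
  qed
  finally show "norm ((Eop ^^ Suc i) (\<lambda>x. g x * f x) x) <= (C + D) * B" by (simp add: algebra_simps)
 qed
qed

lemma th_funpow_test_bounded: "f \<in> TF U ==> \<exists>A. \<forall>x. norm ((th ^^ k) f x) <= A"
 using test_bounded[OF th_funpow_test, of f U 0 k] by (simp add: nderiv_0)

lemma density_pair_swap: "density_pair f g ==> density_pair g f"
 unfolding density_pair_def
proof (intro conjI allI impI)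
 fix x :: real assume a: "smooth f \<and> smooth g \<and> (\<forall>x. x ~= 0 --> f x = inv_density g x)" "x ~= 0"
 hence "f (1 / x) = inv_density g (1 / x)" by simp
 thus "g x = inv_density f x" using a(2) by (simp add: inv_density_def power_divide)
qed auto

lemma density_pair_unique:
 assumes "density_pair f g" "density_pair f g'" shows "g = g'"
proof -
 have e: "g x = g' x" if "x ~= 0" for x
  using density_pair_swap[OF assms(1)] density_pair_swap[OF assms(2)] that by (simp add: density_pair_def)
 have "g \<midarrow>0\<rightarrow> g 0" "g' \<midarrow>0\<rightarrow> g' 0"
  using assms smooth_continuous[of UNIV _ 0 0] by (auto simp: density_pair_def isCont_def nderiv_0)
 moreover have "g \<midarrow>0\<rightarrow> l \<longleftrightarrow> g' \<midarrow>0\<rightarrow> l" for l by (rule LIM_equal) (use e in auto)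
 ultimately have "g 0 = g' 0" using LIM_unique by blast
 thus ?thesis using e by (intro ext) metis
qed

lemma density_pair_test:
 assumes f: "f \<in> testR" shows "density_pair f (inv_density f)"
proof -
 obtain R where R: "R > 0" "!!x. abs x >= R ==> f x = 0" using test_bounded_subset[OF f] by blast
 have s1: "smooth_on (- {0}) (inv_density f)"
  by (rule smooth_inv_density) (use smooth_subset[OF test_smooth[OF f]] in auto)
 have s2: "smooth_on {- (1 / R)<..<1 / R} (inv_density f)"
 proof (rule smooth_cong[of _ "\<lambda>x. 0"])
  fix y assume "y \<in> {- (1 / R)<..<1 / R}"
  hence "abs (1 / y) >= R" if "y ~= 0" using R that by (auto simp: field_simps abs_if split: if_splits)
  thus "0 = inv_density f y" using R(2) by (auto simp: inv_density_def)
 qed auto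
 have "smooth (inv_density f)"
 proof (rule smooth_local)
  fix x :: real
  show "\<exists>V. open V \<and> x \<in> V \<and> smooth_on V (inv_density f)"
  proof (cases "x = 0")
   case True thus ?thesis using s2 R by (intro exI[of _ "{- (1 / R)<..<1 / R}"]) auto
  next
   case False thus ?thesis using s1 by (intro exI[of _ "- {0}"]) auto
  qed
 qed
 thus ?thesis
  using test_smooth[OF f] by (simp add: density_pair_def inv_density_inv_density)
qed

text \<open>Near \<open>\<infinity>\<close> the extension is the Hadamard finite part: the form is applied to the density in the
 coordinate \<open>1/x\<close> minus its Taylor polynomial at \<open>0\<close>.\<close>

context
 fixes T :: distr and m :: nat and h :: "nat => real => complex" and a :: real and b :: int
 assumes T: "tempered T" and h: "!!i. wbd a (of_int b) (h i)"
  and eq: "!!f. f \<in> test0 ==> T f = euler_form m h f"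
begin

text \<open>The cutoffs match the seminorms of the projective line, which see only the unit interval
  in each coordinate: \<open>inner_cut\<close> is 1 for |x| <= 1/2 and 0 for |x| >= 1, and
  \<open>outer_cut\<close>, in the coordinate 1/x, is 1 for |x| <= 1 and 0 for |x| >= 2. The sign in
  \<open>coform\<close> is that of \<open>Eop\<close> under inversion.\<close>

definition "inner_cut x = cutoff (2 * x)"
definition "outer_cut x = (if x = 0 then 1 else 1 - inner_cut (1 / x))"
definition "coform i x = (-1) ^ i * h i (1 / x)"
definition "far_part g = (\<lambda>x. outer_cut x * taylor_rest (nat b) g x)"
definition "inf_ext f = T (\<lambda>x. inner_cut x * f x) + euler_form m coform (far_part (THE g. density_pair f g))"

lemma inner_cut_test: "inner_cut \<in> testR"
 unfolding inner_cut_def[abs_def] using cutoff_dilate_test[of "1/2"] by (simp add: mult.commute)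

lemma inner_cut_near: "\<forall>\<^sub>F x in nhds 0. inner_cut x = 1"
 by (auto simp: eventually_nhds_metric dist_norm inner_cut_def cutoff_1 intro!: exI[of _ "1/2"])

lemma outer_cut_test: "outer_cut \<in> testR"
 unfolding outer_cut_def[abs_def] by (rule recip_cutoff_test[OF inner_cut_test inner_cut_near])

lemma outer_cut_1: "abs x <= 1 ==> outer_cut x = 1" and outer_cut_0: "abs x >= 2 ==> outer_cut x = 0"
 by (auto simp: outer_cut_def inner_cut_def abs_mult divide_simps intro!: cutoff_0 cutoff_1)

lemma inf_ext_pair:
 "density_pair f g ==> inf_ext f = T (\<lambda>x. inner_cut x * f x) + euler_form m coform (far_part g)"
 unfolding inf_ext_def using density_pair_unique by (subst the_equality[of _ g]) auto

lemma coform: "wbd (- of_int b) (- a) (coform i)"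
 unfolding coform_def[abs_def] by (rule wbd_cmult[OF wbd_recip[OF h]])

lemma inner_part_schwartz: "smooth f ==> (\<lambda>x. inner_cut x * f x) \<in> schwartz"
 using test_schwartz[OF test_mult_smooth[OF inner_cut_test, of f]] by (simp add: mult.commute[of "inner_cut _"])

lemma far_part_Sz:
 assumes g: "smooth g" shows "far_part g \<in> Sz (nat b)"
proof -
 have "far_part g \<in> schwartz"
  unfolding far_part_def using test_schwartz[OF test_mult_smooth[OF outer_cut_test smooth_taylor_rest[OF g]]]
  by (simp add: mult.commute[of "outer_cut _"])
 moreover have "fun_vanishes (far_part g) 0 (nat b)" unfolding far_part_def
  by (rule fun_vanishes_mult_right[OF open_UNIV _ test_smooth[OF outer_cut_test] smooth_taylor_rest[OF g] fun_vanishes_taylor_rest[OF g]]) simp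
 ultimately show ?thesis by (simp add: Sz_def)
qed

lemma coform_order: "- of_int b + real (nat b) > -1"
 by simp

lemma inf_ext_linear: "linear_functional_on {f. \<exists>g. density_pair f g} inf_ext"
 unfolding linear_functional_on_def
proof (intro conjI ballI allI)
 fix f1 f2 assume "f1 \<in> {f. \<exists>g. density_pair f g}" "f2 \<in> {f. \<exists>g. density_pair f g}"
 then obtain g1 g2 where p: "density_pair f1 g1" "density_pair f2 g2" by blast
 hence s: "smooth f1" "smooth f2" "smooth g1" "smooth g2" by (auto simp: density_pair_def)
 have p': "density_pair (\<lambda>x. f1 x + f2 x) (\<lambda>x. g1 x + g2 x)"
  using p s by (auto simp: density_pair_def inv_density_def add_divide_distrib intro!: smooth_add)
 have "far_part (\<lambda>x. g1 x + g2 x) = (\<lambda>x. far_part g1 x + far_part g2 x)"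
  by (auto simp: far_part_def taylor_rest_add[OF s(3,4)] distrib_left)
 hence "euler_form m coform (far_part (\<lambda>x. g1 x + g2 x)) = euler_form m coform (far_part g1) + euler_form m coform (far_part g2)"
  using euler_form_add[OF adm_Sz[OF order_refl] coform_order coform far_part_Sz[OF s(3)] far_part_Sz[OF s(4)]] by simp
 moreover have "T (\<lambda>x. inner_cut x * (f1 x + f2 x)) = T (\<lambda>x. inner_cut x * f1 x) + T (\<lambda>x. inner_cut x * f2 x)"
  using temperedD(1)[OF T inner_part_schwartz[OF s(1)] inner_part_schwartz[OF s(2)]] by (simp add: distrib_left)
 ultimately show "inf_ext (\<lambda>x. f1 x + f2 x) = inf_ext f1 + inf_ext f2"
  using inf_ext_pair[OF p'] inf_ext_pair[OF p(1)] inf_ext_pair[OF p(2)] by simp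
next
 fix f c assume "f \<in> {f. \<exists>g. density_pair f g}"
 then obtain g where p: "density_pair f g" by blast
 hence s: "smooth f" "smooth g" by (auto simp: density_pair_def)
 have p': "density_pair (\<lambda>x. c * f x) (\<lambda>x. c * g x)"
  using p s by (auto simp: density_pair_def inv_density_def intro!: smooth_cmult)
 have "far_part (\<lambda>x. c * g x) = (\<lambda>x. c * far_part g x)"
  by (auto simp: far_part_def taylor_rest_cmult[OF s(2)])
 hence "euler_form m coform (far_part (\<lambda>x. c * g x)) = c * euler_form m coform (far_part g)"
  using euler_form_cmult[OF schwartz_smooth[OF Sz_schwartz[OF far_part_Sz[OF s(2)]]]] by simp
 moreover have "T (\<lambda>x. inner_cut x * (c * f x)) = c * T (\<lambda>x. inner_cut x * f x)"
  using temperedD(2)[OF T inner_part_schwartz[OF s(1)], of c] by (simp add: mult.left_commute)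
 ultimately show "inf_ext (\<lambda>x. c * f x) = c * inf_ext f"
  using inf_ext_pair[OF p'] inf_ext_pair[OF p] by (simp add: distrib_left)
qed

text \<open>The inverted density of a test function vanishes near 0, so its Taylor polynomial is
  zero and the two pieces are the parts of f cut out by the partition of unity.\<close>

lemma inf_ext_test:
 assumes f: "f \<in> testR" shows "inf_ext f = T f"
proof -
 have p: "density_pair f (inv_density f)" by (rule density_pair_test[OF f])
 obtain R where R: "R > 0" "!!x. abs x >= R ==> f x = 0" using test_bounded_subset[OF f] by blast
 have z: "inv_density f x = 0" if "abs x < 1 / R" for x
  using R that by (auto simp: inv_density_def field_simps abs_mult)
 have t: "taylor_rest (nat b) (inv_density f) = inv_density f"
  by (rule taylor_rest_vanishing[OF fun_vanishes_0I[of "1 / R"]]) (use R z in auto)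
 have si: "smooth (inv_density f)" using p by (simp add: density_pair_def)
 have fp: "far_part (inv_density f) \<in> test0" unfolding far_part_def t
 proof (rule test_away_0I[of _ "1 / R" 2])
  show "smooth (\<lambda>x. outer_cut x * inv_density f x)"
   by (intro smooth_mult si test_smooth[OF outer_cut_test] open_UNIV)
 qed (use R z outer_cut_0 in auto)
 have d: "inv_density (far_part (inv_density f)) x = (1 - inner_cut x) * f x" for x
 proof (cases "x = 0")
  case False
  have "inv_density (far_part (inv_density f)) x = outer_cut (1 / x) * (inv_density f (1 / x) / cx x ^ 2)"
   unfolding far_part_def t using False by (simp add: inv_density_def[of "\<lambda>x. _ x * _ x"])
  also have "inv_density f (1 / x) / cx x ^ 2 = f x"
   using inv_density_inv_density[OF False, of f] False by (simp add: inv_density_def)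
  finally show ?thesis using False by (simp add: outer_cut_def)
 qed (simp add: inv_density_def inner_cut_def cutoff_1)
 have "euler_form m coform (far_part (inv_density f)) = euler_form m h (inv_density (far_part (inv_density f)))"
  unfolding coform_def[abs_def] by (rule euler_form_inv_density[OF wbd_measurable[OF h] fp, symmetric])
 also have "... = T (\<lambda>x. (1 - inner_cut x) * f x)"
  using eq[OF inv_density_test_away[OF fp]] unfolding d[abs_def] by simp
 finally show ?thesis
  using inf_ext_pair[OF p] tempered_split[OF T test_schwartz[OF f] inner_cut_test] by simp
qed

text \<open>For |x| <= 1 the remainder vanishes to order K and \<open>vanishing_bound\<close> gives
  |x|^K. For 1 < |x| <= 2 the bounds on g say nothing directly, and g is expressed through f at 1/x,
  which lies in the unit interval again; the Taylor polynomial is estimated by its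
  coefficients.\<close>

lemma far_part_bound:
 "\<exists>C N. C >= 0 \<and> (\<forall>f g B. \<forall>x::real. density_pair f g \<and> (\<forall>n\<le>N. \<forall>x. abs x <= 1 --> norm (nderiv n f x) <= B \<and> norm (nderiv n g x) <= B)
   \<and> abs x <= 2 --> norm ((Eop ^^ i) (taylor_rest (nat b) g) x) <= C * B * (if abs x <= 1 then abs x ^ nat b else 1))"
proof -
 define K where "K = nat b"
 obtain C1 where C1: "C1 >= 0" "!!f x B. smooth f ==> abs x <= 1 ==> (!!n. n <= K + i ==> norm (nderiv n f x) <= B) ==>
   norm (nderiv K ((Eop ^^ i) f) x) <= C1 * B"
  using Eop_funpow_nderiv_bound[of K i] by blast
 obtain C2 where C2: "C2 >= 0" "!!f x B. smooth f ==> abs x <= 1 ==> (!!n. n <= i ==> norm (nderiv n f x) <= B) ==>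
   norm ((Eop ^^ i) f x) <= C2 * B"
  using Eop_funpow_nderiv_bound[of 0 i] by (auto simp: nderiv_0)
 define P where "P = (\<Sum>n\<le>K + i. \<Sum>l<K. \<Prod>j<n. real (l - j))"
 have P: "P >= 0" unfolding P_def by (intro sum_nonneg prod_nonneg) auto
 define C where "C = C1 * (1 + P) + C2 + (\<Sum>l<K. (1 + real l) ^ i * 2 ^ l)"
 have C: "C >= 0" unfolding C_def using C1 C2 P by (intro add_nonneg_nonneg mult_nonneg_nonneg sum_nonneg) auto
 show ?thesis
 proof (intro exI[of _ C] exI[of _ "K + i"] conjI allI impI C)
  fix f g :: "real => complex" and B x :: real
  assume A: "density_pair f g \<and> (\<forall>n\<le>K + i. \<forall>x. abs x <= 1 --> norm (nderiv n f x) <= B \<and> norm (nderiv n g x) <= B) \<and> abs x <= 2"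
  hence p: "density_pair f g" and fb: "!!n x. n <= K + i ==> abs x <= 1 ==> norm (nderiv n f x) <= B"
   and gb: "!!n x. n <= K + i ==> abs x <= 1 ==> norm (nderiv n g x) <= B" and x2: "abs x <= 2" by auto
  have sf: "smooth f" and sg: "smooth g" using p by (auto simp: density_pair_def)
  have B: "B >= 0" using norm_nonneg_trans[OF fb[of 0 0]] by simp
  define c where "c = (\<lambda>l. nderiv l g 0 / fact l)"
  have c: "norm (c l) <= B" if "l < K" for l
  proof -
   have "norm (c l) = norm (nderiv l g 0) / fact l" by (simp add: c_def norm_divide)
   also have "... <= norm (nderiv l g 0) / 1" by (intro divide_left_mono) (auto simp: fact_ge_1)
   finally show ?thesis using gb[of l 0] that by simp
  qed
  have u: "taylor_rest K g = (\<lambda>t. g t - (\<Sum>l<K. c l * cx t ^ l))" by (simp add: taylor_rest_def c_def)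
  show "norm ((Eop ^^ i) (taylor_rest (nat b) g) x) <= C * B * (if abs x <= 1 then abs x ^ nat b else 1)"
  proof (cases "abs x <= 1")
   case True
   have nb: "norm (nderiv n (taylor_rest K g) y) <= (1 + P) * B" if "n <= K + i" "abs y <= 1" for n y
   proof -
    have "norm (nderiv n (taylor_rest K g) y) <= norm (nderiv n g y) + norm (\<Sum>l<K. c l * nderiv n (\<lambda>t. cx t ^ l) y)"
     unfolding u nderiv_diff[OF sg smooth_poly_sum] nderiv_poly_sum by (rule norm_triangle_ineq4)
    also have "norm (\<Sum>l<K. c l * nderiv n (\<lambda>t. cx t ^ l) y) <= (\<Sum>l<K. B * (\<Prod>j<n. real (l - j)))"
    proof (rule sum_norm_le)
     fix l assume "l \<in> {..<K}"
     hence "l < K" by simp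
     have "norm (nderiv n (\<lambda>t. cx t ^ l) y) = (\<Prod>j<n. real (l - j)) * abs y ^ (l - n)"
      by (simp add: nderiv_xpow norm_mult norm_power flip: prod_norm)
     also have "... <= (\<Prod>j<n. real (l - j)) * 1"
      using that by (intro mult_left_mono power_le_one prod_nonneg) auto
     finally show "norm (c l * nderiv n (\<lambda>t. cx t ^ l) y) <= B * (\<Prod>j<n. real (l - j))"
      unfolding norm_mult using c[OF \<open>l < K\<close>] B by (intro mult_mono) auto
    qed
    also have "... = B * (\<Sum>l<K. \<Prod>j<n. real (l - j))" by (simp add: sum_distrib_left)
    also have "... <= B * P" unfolding P_def
     using that by (intro mult_left_mono B member_le_sum[of n "{..K + i}" "\<lambda>n. \<Sum>l<K. \<Prod>j<n. real (l - j)"] sum_nonneg prod_nonneg) auto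
    finally show ?thesis using gb[OF that] by (simp add: algebra_simps)
   qed
   have "norm ((Eop ^^ i) (taylor_rest K g) x) <= C1 * ((1 + P) * B) * abs x ^ K"
   proof (rule vanishing_bound[where U = UNIV and r = 1])
    show "smooth ((Eop ^^ i) (taylor_rest K g))" by (intro smooth_Eop_funpow smooth_taylor_rest sg open_UNIV)
    show "fun_vanishes ((Eop ^^ i) (taylor_rest K g)) 0 K"
     by (induction i) (auto intro!: fun_vanishes_taylor_rest sg fun_vanishes_Eop[OF open_UNIV] smooth_Eop_funpow smooth_taylor_rest)
    show "norm (nderiv K ((Eop ^^ i) (taylor_rest K g)) y) <= C1 * ((1 + P) * B)" if "abs y <= 1" for y
     by (rule C1(2)[OF smooth_taylor_rest[OF sg] that nb[OF _ that]])
   qed (use True in auto)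
   also have "... <= C * B * abs x ^ K"
   proof (rule mult_right_mono)
    have "C1 * (1 + P) <= C" unfolding C_def using C2 by (auto intro!: add_increasing2 add_nonneg_nonneg sum_nonneg)
    thus "C1 * ((1 + P) * B) <= C * B" using mult_right_mono[OF _ B] by (simp add: mult.assoc[symmetric])
   qed simp
   finally show ?thesis using True by (simp add: K_def)
  next
   case False
   hence x: "x ~= 0" "abs (1 / x) <= 1" by (auto simp: divide_simps)
   \<comment> \<open>The passage to the other coordinate; the factor 1/x^2 is at most 1
     here.\<close>
   have "(Eop ^^ i) g x = (Eop ^^ i) (inv_density f) x"
    by (rule Eop_funpow_cong_open[of "- {0}"]) (use x density_pair_swap[OF p] in \<open>auto simp: density_pair_def\<close>)
   also have "... = (-1) ^ i * inv_density ((Eop ^^ i) f) x"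
    by (rule Eop_funpow_inv_density[OF smooth_subset[OF sf] x(1)]) auto
   finally have "norm ((Eop ^^ i) g x) = norm ((Eop ^^ i) f (1 / x)) / x^2"
    using x by (simp add: inv_density_def norm_mult norm_divide norm_power)
   also have "... <= norm ((Eop ^^ i) f (1 / x)) / 1"
    using False by (intro divide_left_mono) (auto simp: abs_square_le_1[symmetric] intro: less_imp_le simp flip: abs_square_less_1 not_le)
   also have "... <= C2 * B" using C2(2)[OF sf x(2) fb[OF _ x(2)]] by simp
   finally have 1: "norm ((Eop ^^ i) g x) <= C2 * B" .
   have e: "(Eop ^^ i) (\<lambda>t. cx t ^ l) = (\<lambda>t. (1 + of_nat l) ^ i * cx t ^ l)" for l
   proof (induction i)
    case (Suc i)
    have "Eop (\<lambda>t. cx t ^ l) = (\<lambda>t. (1 + of_nat l) * cx t ^ l)" by (auto simp: Eop_th th_xpow algebra_simps)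
    thus ?case unfolding funpow.simps comp_apply Suc Eop_cmult[OF smooth_xpow] by (simp add: mult_ac)
   qed simp
   have es: "(Eop ^^ i) (\<lambda>t. \<Sum>l<K. c l * cx t ^ l) = (\<lambda>t. \<Sum>l<K. c l * ((1 + of_nat l) ^ i * cx t ^ l))" for K
   proof (induction K)
    case (Suc K)
    have "(Eop ^^ i) (\<lambda>t. (\<Sum>l<K. c l * cx t ^ l) + c K * cx t ^ K)
      = (\<lambda>t. (Eop ^^ i) (\<lambda>t. \<Sum>l<K. c l * cx t ^ l) t + c K * (Eop ^^ i) (\<lambda>t. cx t ^ K) t)"
     by (simp add: Eop_funpow_add[OF smooth_poly_sum smooth_cmult[OF open_UNIV smooth_xpow]] Eop_funpow_cmult[OF smooth_xpow])
    thus ?case by (simp add: Suc e)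
   next
    case 0
    have "(Eop ^^ i) (\<lambda>t. 0) = (\<lambda>t. 0)" using Eop_funpow_cmult[OF smooth_const, of i 0 0] by simp
    thus ?case by simp
   qed
   have 2: "norm (\<Sum>l<K. c l * ((1 + of_nat l) ^ i * cx x ^ l)) <= (\<Sum>l<K. B * ((1 + real l) ^ i * 2 ^ l))"
   proof (rule sum_norm_le)
    fix l assume "l \<in> {..<K}"
    have "norm (1 + of_nat l :: complex) = 1 + real l" by (metis norm_of_nat of_nat_Suc)
    thus "norm (c l * ((1 + of_nat l) ^ i * cx x ^ l)) <= B * ((1 + real l) ^ i * 2 ^ l)"
     unfolding norm_mult norm_power using c[of l] B x2 \<open>l \<in> {..<K}\<close> by (intro mult_mono power_mono) auto
   qed
   have "(Eop ^^ i) (taylor_rest K g) x = (Eop ^^ i) g x - (Eop ^^ i) (\<lambda>t. \<Sum>l<K. c l * cx t ^ l) x"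
    using fun_cong[OF Eop_funpow_add[OF sg smooth_cmult[OF open_UNIV smooth_poly_sum[where K = K and c = c], where c = "-1"], where n = i], of x]
    unfolding u Eop_funpow_cmult[OF smooth_poly_sum[where K = K and c = c], where n = i and c = "-1"] by simp
   hence "norm ((Eop ^^ i) (taylor_rest K g) x) <= C2 * B + (\<Sum>l<K. B * ((1 + real l) ^ i * 2 ^ l))"
    unfolding es using norm_triangle_ineq4 add_mono[OF 1 2] order_trans by fastforce
   also have "... = (C2 + (\<Sum>l<K. (1 + real l) ^ i * 2 ^ l)) * B" by (simp add: algebra_simps sum_distrib_left)
   also have "... <= C * B" unfolding C_def using C1 P B by (intro mult_right_mono) auto
   finally show ?thesis using False by (simp add: K_def)
  qed
 qed
qed

lemma inf_ext_bound:
 "\<exists>C N. \<forall>f g B. density_pair f g \<and>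
   (\<forall>n\<le>N. \<forall>x. abs x <= 1 --> norm (nderiv n f x) <= B \<and> norm (nderiv n g x) <= B) --> norm (inf_ext f) <= C * B"
proof -
 define K where "K = nat b"
 obtain CT NT where CT: "CT >= 0" "!!f B. f \<in> schwartz ==> sbd NT f B ==> norm (T f) <= CT * B"
  using temperedD(3)[OF T] by blast
 obtain G where G: "!!k x. k <= NT ==> norm (nderiv k inner_cut x) <= G k"
  using test_bounded[OF inner_cut_test] by metis
 define G' where "G' = (\<Sum>k\<le>NT. abs (G k))"
 have G': "norm (nderiv k inner_cut x) <= G'" if "k <= NT" for k x
  using G[OF that, of x] member_le_sum[of k "{..NT}" "\<lambda>k. abs (G k)"] that by (auto simp: G'_def)
 have "\<exists>P. \<forall>i. fst (P i) >= (0::real) \<and> (\<forall>f g B. \<forall>x::real. density_pair f g \<and> (\<forall>n\<le>snd (P i). \<forall>x. abs x <= 1 --> norm (nderiv n f x) <= B \<and> norm (nderiv n g x) <= B)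
   \<and> abs x <= 2 --> norm ((Eop ^^ i) (taylor_rest K g) x) <= fst (P i) * B * (if abs x <= 1 then abs x ^ K else 1))"
  unfolding K_def using far_part_bound by (intro choice allI) (metis fst_conv snd_conv)
 then obtain P where P: "!!i. fst (P i) >= (0::real)" "!!i f g B x. density_pair f g ==>
   (\<forall>n\<le>snd (P i). \<forall>x. abs x <= 1 --> norm (nderiv n f x) <= B \<and> norm (nderiv n g x) <= B) ==> abs x <= 2 ==>
   norm ((Eop ^^ i) (taylor_rest K g) x) <= fst (P i) * B * (if abs x <= 1 then abs x ^ K else 1)"
  by blast
 define D where "D = (\<lambda>i. fst (P i))"
 define N where "N = (\<lambda>i. snd (P i))"
 have D: "D i >= 0" for i using P(1) by (simp add: D_def)
 have DN: "norm ((Eop ^^ i) (taylor_rest K g) x) <= D i * B * (if abs x <= 1 then abs x ^ K else 1)"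
  if "density_pair f g" "!!n x. n <= N i ==> abs x <= 1 ==> norm (nderiv n f x) <= B \<and> norm (nderiv n g x) <= B" "abs x <= 2" for i f g B x
  unfolding D_def by (rule P(2)[OF that(1) _ that(3)]) (use that(2) in \<open>auto simp: N_def\<close>)
 have "\<exists>M\<ge>0. \<forall>f x B. smooth f \<and> (\<forall>j\<le>i. norm ((Eop ^^ j) f x) <= B) --> norm ((Eop ^^ i) (\<lambda>x. outer_cut x * f x) x) <= M * B" for i
  by (rule Eop_funpow_mult_bound[OF test_smooth[OF outer_cut_test] th_funpow_test_bounded[OF outer_cut_test]])
 then obtain M where M: "!!i. M i >= (0::real)" "!!i f x B. smooth f ==> (!!j. j <= i ==> norm ((Eop ^^ j) f x) <= B) ==>
   norm ((Eop ^^ i) (\<lambda>x. outer_cut x * f x) x) <= M i * B"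
  by metis
 \<comment> \<open>Any exponent at infinity is allowed for a function supported in |x| <= 2; this
   one makes the pairing with \<open>coform\<close>, of exponent -a there, converge. The constant
   \<open>2 powr (- d)\<close> compares the weight with 1 on 1 < |x| <= 2.\<close>
 define d where "d = - (abs a + 2)"
 have "\<exists>L\<ge>0. \<forall>f B. f \<in> BM \<and> (\<forall>x. x ~= 0 --> norm (f x) <= B * wt (real K) d x) -->
   lb_int (\<lambda>x. coform i x * f x) \<and> norm (LB x. coform i x * f x) <= L * B" for i
  by (rule wbd_pairing[OF coform]) (auto simp: K_def d_def)
 then obtain L where L: "!!i. L i >= (0::real)" "!!i f B. f \<in> BM ==> (!!x. x ~= 0 ==> norm (f x) <= B * wt (real K) d x) ==>
   norm (LB x. coform i x * f x) <= L i * B"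
  by metis
 define DD where "DD = (\<Sum>i\<le>m. D i)"
 have DD: "D j <= DD" if "j <= m" for j unfolding DD_def using that D by (intro member_le_sum) auto
 have DD0: "DD >= 0" unfolding DD_def by (intro sum_nonneg D)
 define N' where "N' = NT + (\<Sum>i\<le>m. N i)"
 have N': "N j <= N'" if "j <= m" for j unfolding N'_def using member_le_sum[of j "{..m}" N] that by auto
 define C where "C = CT * (2 ^ NT * G') + (\<Sum>i\<le>m. L i * (M i * DD * 2 powr (- d)))"
 show ?thesis
 proof (intro exI[of _ C] exI[of _ N'] allI impI)
  fix f g B
  assume A: "density_pair f g \<and> (\<forall>n\<le>N'. \<forall>x. abs x <= 1 --> norm (nderiv n f x) <= B \<and> norm (nderiv n g x) <= B)"
  hence p: "density_pair f g" and b: "!!n x. n <= N' ==> abs x <= 1 ==> norm (nderiv n f x) <= B \<and> norm (nderiv n g x) <= B" by auto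
  have sf: "smooth f" and sg: "smooth g" using p by (auto simp: density_pair_def)
  have B: "B >= 0" using norm_nonneg_trans[OF conjunct1[OF b[of 0 0]]] by simp
  have "norm (nderiv n (\<lambda>x. inner_cut x * f x) x) <= 2 ^ NT * G' * B" if n: "n <= NT" for n x
  proof (cases "abs x <= 1")
   case True
   have "norm (nderiv n (\<lambda>x. inner_cut x * f x) x) <= (\<Sum>k\<le>n. real (n choose k) * (G' * B))"
    unfolding nderiv_mult(1)[OF open_UNIV test_smooth[OF inner_cut_test] sf UNIV_I]
    using n True G' b[of _ x] 
    by (intro sum_norm_le) (auto simp: norm_mult mult.assoc N'_def intro!: mult_left_mono mult_mono norm_nonneg_trans[OF G'])
   also have "... = (\<Sum>k\<le>n. real (n choose k)) * (G' * B)" by (simp add: sum_distrib_right)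
   also have "(\<Sum>k\<le>n. real (n choose k)) = 2 ^ n" using choose_row_sum[of n] by (simp flip: of_nat_sum)
   also have "2 ^ n * (G' * B) <= 2 ^ NT * (G' * B)"
    using n B norm_nonneg_trans[OF G'[of 0]] by (intro mult_right_mono power_increasing) auto
   finally show ?thesis by (simp add: mult.assoc)
  next
   case False
   have "nderiv n (\<lambda>x. inner_cut x * f x) x = 0"
    by (rule nderiv_zero_outside[of "{-1..1}"]) (use False in \<open>auto simp: inner_cut_def cutoff_0 abs_if split: if_splits intro!: disjI1 cutoff_0\<close>)
   thus ?thesis using B norm_nonneg_trans[OF G'[of 0]] by simp
  qed
  hence "sbd NT (\<lambda>x. inner_cut x * f x) ((max 1 1) ^ NT * (2 ^ NT * G' * B))"
   by (intro sbd_compact) (auto simp: inner_cut_def cutoff_0)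
  hence 1: "norm (T (\<lambda>x. inner_cut x * f x)) <= CT * (2 ^ NT * G' * B)"
   using CT(2)[OF inner_part_schwartz[OF sf]] by simp
  have "norm (LB x. coform i x * (Eop ^^ i) (far_part g) x) <= L i * (M i * DD * 2 powr (- d) * B)" if i: "i <= m" for i
  proof (rule L(2))
   have st: "smooth (taylor_rest K g)" by (rule smooth_taylor_rest[OF sg])
   show "(Eop ^^ i) (far_part g) \<in> BM"
    by (intro smooth_measurable smooth_Eop_funpow schwartz_smooth Sz_schwartz[OF far_part_Sz] sg open_UNIV)
   fix x :: real assume x: "x ~= 0"
   show "norm ((Eop ^^ i) (far_part g) x) <= M i * DD * 2 powr (- d) * B * wt (real K) d x"
   proof (cases "abs x <= 2")
    case True
    define w where "w = (if abs x <= 1 then abs x ^ K else 1)"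
    have "norm ((Eop ^^ j) (taylor_rest K g) x) <= DD * B * w" if "j <= i" for j
    proof -
     have "norm ((Eop ^^ j) (taylor_rest K g) x) <= D j * B * w"
      unfolding w_def by (rule DN[OF p b True]) (use N'[of j] that i in auto)
     also have "... <= DD * B * w" using DD[of j] that i B by (intro mult_right_mono) (auto simp: w_def)
     finally show ?thesis .
    qed
    hence "norm ((Eop ^^ i) (far_part g) x) <= M i * (DD * B * w)"
     unfolding far_part_def K_def[symmetric] by (intro M(2) st) 
    also have "w <= 2 powr (- d) * wt (real K) d x"
    proof (cases "abs x <= 1")
     case True
     have "1 * abs x ^ K <= 2 powr (- d) * abs x ^ K" by (intro mult_right_mono ge_one_powr_ge_zero) (auto simp: d_def)
     thus ?thesis using True x by (simp add: w_def wt_def powr_realpow)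
    next
     case False
     have "2 powr d <= abs x powr d" using False True by (intro powr_mono2') (auto simp: d_def)
     hence "2 powr (- d) * 2 powr d <= 2 powr (- d) * abs x powr d" by (intro mult_left_mono) auto
     thus ?thesis using False by (simp add: w_def wt_def flip: powr_add)
    qed
    hence "M i * (DD * B * w) <= M i * (DD * B * (2 powr (- d) * wt (real K) d x))"
     using M(1) DD0 B by (intro mult_left_mono) auto
    finally show ?thesis by (simp add: mult_ac)
   next
    case False
    have "(Eop ^^ i) (far_part g) x = 0"
     by (rule Eop_funpow_zero[of "{-2..2}"]) (use False in \<open>auto simp: far_part_def abs_if split: if_splits intro!: outer_cut_0\<close>)
    thus ?thesis using M(1) DD0 B by simp
   qed
  qed
  hence 2: "norm (euler_form m coform (far_part g)) <= (\<Sum>i\<le>m. L i * (M i * DD * 2 powr (- d) * B))"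
   unfolding euler_form_def by (intro sum_norm_le) auto
  have "norm (inf_ext f) <= CT * (2 ^ NT * G' * B) + (\<Sum>i\<le>m. L i * (M i * DD * 2 powr (- d) * B))"
   unfolding inf_ext_pair[OF p] by (rule norm_triangle_le[OF add_mono[OF 1 2]])
  also have "... = C * B" by (simp add: C_def algebra_simps sum_distrib_left)
  finally show "norm (inf_ext f) <= C * B" .
 qed
qed

lemma inf_ext_inversion:
 assumes f: "f \<in> TF {-1<..<1}" and v: "fun_vanishes f 0 (nat b)"
 shows "inversion inf_ext f = euler_form m coform f"
proof -
 have z: "f x = 0" if "abs x >= 1" for x using f that by (force simp: test_iff)
 have p: "density_pair (inv_density f) f"
  by (rule density_pair_swap[OF density_pair_test[OF test_mono[OF f subset_UNIV]]])
 have e: "inner_cut x * inv_density f x = 0" for x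
 proof (cases "abs x >= 1")
  case True thus ?thesis by (simp add: inner_cut_def cutoff_0)
 next
  case False thus ?thesis by (auto simp: inv_density_def divide_simps intro!: z)
 qed
 have "T (\<lambda>x. inner_cut x * inv_density f x) = T (\<lambda>x. 0 * f x)" unfolding e by simp
 also have "... = 0" using temperedD(2)[OF T test_schwartz[OF f], of 0] by simp
 finally have 1: "T (\<lambda>x. inner_cut x * inv_density f x) = 0" .
 have "far_part f x = f x" for x
  by (cases "abs x <= 1") (auto simp: far_part_def taylor_rest_vanishing[OF v] outer_cut_1 z)
 hence 2: "far_part f = f" by auto
 show ?thesis unfolding inversion_def inf_ext_pair[OF p] 1 2 by simp
qed

text \<open>For b > 0 the factor x^b makes the Taylor polynomial of the test function vanish, and
  the finite part becomes an honest form with exponent 0.\<close>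

lemma inf_ext_vanishes: "vanishes_to (inversion inf_ext) 0 (- b)"
proof (cases "b <= 0")
 case True
 have "rep (TF {-1<..<1}) (- of_int b) (- a) (inversion inf_ext)"
  by (rule repI[OF coform inf_ext_inversion]) (use True in \<open>auto simp: fun_vanishes_def\<close>)
 hence "vanishes_to (inversion inf_ext) 0 (int (nat (- b)))"
  by (rule rep_imp_vanishes_nonneg) (use True in auto)
 thus ?thesis using True by simp
next
 case False
 define K where "K = nat b"
 have S: "adm 0 (TF {-1<..<1})" by (rule adm_test)
 have R: "rep (Sz K) (- of_int b) (- a) (euler_form m coform)" by (rule repI[OF coform]) simp
 have "rep (TF {-1<..<1}) (- of_int b + real K) (- a + real K) (\<lambda>f. euler_form m coform (\<lambda>x. cx x ^ K * f x))"
  by (rule rep_xpow[OF S _ R]) (use Sz_xpow[OF test_schwartz] K_def in auto)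
 hence "rep (TF {-1<..<1}) (- of_int b + real K) (- a + real K) (\<lambda>f. inversion inf_ext (\<lambda>x. cx x ^ K * f x))"
 proof (rule rep_cong)
  fix f assume f: "f \<in> TF {-1<..<1}"
  have "fun_vanishes (\<lambda>x. cx x ^ K * f x) 0 (nat b)"
   using Sz_xpow[OF test_schwartz[OF f], of K] by (simp add: Sz_def K_def)
  thus "euler_form m coform (\<lambda>x. cx x ^ K * f x) = inversion inf_ext (\<lambda>x. cx x ^ K * f x)"
   by (rule inf_ext_inversion[OF test_xpow[OF f], symmetric])
 qed
 hence "rep (TF {-1<..<1}) 0 (- a + real K) (\<lambda>f. inversion inf_ext (\<lambda>x. cx x ^ K * f x))"
  using False by (simp add: K_def)
 hence "vanishes_to (inversion inf_ext) 0 (- int K)"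
  by (rule rep_imp_vanishes_neg) (use False in \<open>auto simp: K_def\<close>)
 thus ?thesis using False by (simp add: K_def)
qed

end

lemma extends_across_infinity_form:
 assumes T: "tempered T" and r: "rep (test0) a (of_int b) T"
 shows "extends_across_infinity T (Finite_Order (- b))"
proof -
 obtain m h where h: "!!i. wbd a (of_int b) (h i)" "!!f. f \<in> test0 ==> T f = euler_form m h f"
  using r unfolding rep_def by blast
 note c = T h
 show ?thesis unfolding extends_across_infinity_def proj_distribution_def
  using inf_ext_linear[OF c] inf_ext_bound[OF c] inf_ext_test[OF c] inf_ext_vanishes[OF c]
  by (intro exI[of _ "inf_ext T m h b"]) simp
qed

text \<open>The order at infinity is supplied by the finite part extension of the form itself, which
  leaves only the order at 0 to be assumed.\<close>

lemma mellin_eq: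
 fixes a b :: int
 assumes T: "tempered T" "vanishes_to T 0 a"
  and h: "!!i. wbd (of_int a) (of_int b) (h i)" "!!f. f \<in> test0 ==> T f = euler_form m h f"
  and s: "- of_int a < Re s" "Re s < - of_int b"
 shows "s \<in> mellin_domain T" and "mellin \<delta> T s = (\<Sum>i\<le>m. s ^ i * (LB x. h i x * sp \<delta> (s - 1) x))"
 using mellin_eq_aux[OF T extends_across_infinity_form[OF T(1) repI[OF h]] h s] by auto

section \<open>The functional equation\<close>

text \<open>The integrand of Euler's integral for Gamma(z) c^(-z).\<close>

definition gker :: "complex => real => real => complex" where
 "gker z c t = (if t > 0 then exp ((z - 1) * cx (ln t)) * cx (exp (- (c * t))) else 0)"

lemma gker_measurable [measurable (raw)]:
 assumes [measurable]: "f \<in> borel_measurable M" "g \<in> borel_measurable M"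
 shows "(\<lambda>p. gker z (f p) (g p)) \<in> borel_measurable M"
 unfolding gker_def by measurable

lemma gker_has_integral:
 assumes z: "Re z > 0"
 shows "lb_int (gker z 1)" and "(LB t. gker z 1 t) = Gamma z"
proof -
 have m: "gker z 1 \<in> BM" by (rule gker_measurable) auto
 have e: "indicator {0<..} t *\<^sub>R (cx t powr (z - 1) / cx (exp t)) = gker z 1 t" for t
 proof (cases "t > 0")
  case True
  have "cx (exp (- (1 * t))) = 1 / cx (exp t)" by (simp add: exp_minus inverse_eq_divide)
  thus ?thesis using True by (simp add: gker_def powr_def Ln_of_real)
 qed (simp add: gker_def)
 have "integrable lebesgue (\<lambda>t. indicator {0<..} t *\<^sub>R (cx t powr (z - 1) / cx (exp t)))"
  using absolutely_integrable_Gamma_integral'[OF z] by (simp only: set_integrable_def)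
 hence i: "integrable lebesgue (gker z 1)" unfolding e .
 thus "lb_int (gker z 1)" using m by (simp add: integrable_completion)
 have "(LINT t:{0<..}|lebesgue. cx t powr (z - 1) / cx (exp t)) = integral {0<..} (\<lambda>t. cx t powr (z - 1) / cx (exp t))"
  by (rule set_lebesgue_integral_eq_integral(2)[OF absolutely_integrable_Gamma_integral'[OF z]])
 also have "... = Gamma z" by (rule integral_unique[OF Gamma_integral_complex'[OF z]])
 finally have "(LINT t|lebesgue. gker z 1 t) = Gamma z" unfolding set_lebesgue_integral_def e .
 thus "(LB t. gker z 1 t) = Gamma z" using m by (simp add: integral_completion)
qed

lemma gker_scale: "c > 0 ==> gker z 1 (c * t) = exp ((z - 1) * cx (ln c)) * gker z c t"
 by (auto simp: gker_def ln_mult distrib_left exp_add zero_less_mult_iff)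

lemma gker_scaled:
 assumes z: "Re z > 0" and c: "c > 0"
 shows "lb_int (gker z c)" and "(LB t. gker z c t) = Gamma z * exp (- (z * cx (ln c)))"
  and "(LB t. norm (gker z c t)) = (LB t. norm (gker z 1 t)) * c powr (- Re z)"
proof -
 note g = gker_has_integral[OF z]
 have "lb_int (\<lambda>t. gker z 1 (0 + c * t))"
  by (rule lborel_integrable_real_affine[OF g(1)]) (use c in simp)
 hence "lb_int (\<lambda>t. exp (- ((z - 1) * cx (ln c))) * (exp ((z - 1) * cx (ln c)) * gker z c t))"
  unfolding add_0_left gker_scale[OF c] by (rule integrable_mult_right)
 thus "lb_int (gker z c)" by (simp only: mult.assoc[symmetric] exp_add[symmetric]) simp
 have cc: "exp (cx (ln c)) = cx c" using c by (simp add: exp_of_real)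
 have "Gamma z = abs c *\<^sub>R (LB t. gker z 1 (0 + c * t))"
  unfolding g(2)[symmetric] by (rule lborel_integral_real_affine) (use c in simp)
 also have "... = exp (cx (ln c)) * (exp ((z - 1) * cx (ln c)) * (LB t. gker z c t))"
  using c by (simp add: gker_scale scaleR_conv_of_real cc)
 also have "... = exp (z * cx (ln c)) * (LB t. gker z c t)"
  by (simp add: mult.assoc[symmetric] left_diff_distrib flip: exp_add)
 finally show "(LB t. gker z c t) = Gamma z * exp (- (z * cx (ln c)))"
  by (simp add: exp_minus field_simps)
 have "(LB t. norm (gker z 1 t)) = abs c *\<^sub>R (LB t. norm (gker z 1 (0 + c * t)))"
  by (rule lborel_integral_real_affine) (use c in simp)
 also have "... = exp (ln c) * (exp ((Re z - 1) * ln c) * (LB t. norm (gker z c t)))"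
  using c by (simp add: gker_scale norm_mult)
 also have "... = c powr Re z * (LB t. norm (gker z c t))"
  using c by (simp add: left_diff_distrib powr_def exp_diff)
 finally show "(LB t. norm (gker z c t)) = (LB t. norm (gker z 1 t)) * c powr (- Re z)"
  using c by (simp add: powr_minus field_simps)
qed

text \<open>The Mellin transform at w of p(tau) e^(-pi tau), evaluated termwise by Gamma
  values.\<close>

definition gauss_moment :: "complex => complex poly => complex" where
 "gauss_moment w p = (\<Sum>k\<le>degree p. coeff p k * (Gamma (w + of_nat k) * exp (- ((w + of_nat k) * cx (ln pi)))))"

lemma gauss_moment_le:
 "degree p <= N ==> gauss_moment w p = (\<Sum>k\<le>N. coeff p k * (Gamma (w + of_nat k) * exp (- ((w + of_nat k) * cx (ln pi)))))"
 unfolding gauss_moment_def by (rule sum.mono_neutral_left) (auto simp: coeff_eq_0)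

text \<open>Convergence of the Gamma integral of each monomial that occurs. For a monomial of high
  degree this allows w far to the left.\<close>

definition regular_at :: "complex => complex poly => bool" where
 "regular_at w p \<longleftrightarrow> (\<forall>k. coeff p k ~= 0 --> Re w + real k > 0)"

lemma coeff_Apoly: "coeff (Apoly d p) k = (1 + of_nat d + 2 * of_nat k) * coeff p k - (if k = 0 then 0 else 2 * cx pi * coeff p (k - 1))"
 by (cases k) (auto simp: Apoly_def coeff_pCons coeff_pderiv algebra_simps)

lemma regular_at_Apoly: "regular_at w p ==> regular_at w (Apoly d p)"
 unfolding regular_at_def
proof (intro allI impI)
 fix k assume p: "\<forall>k. coeff p k ~= 0 --> Re w + real k > 0" and k: "coeff (Apoly d p) k ~= 0"
 from k have "coeff p k ~= 0 \<or> k ~= 0 \<and> coeff p (k - 1) ~= 0" by (auto simp: coeff_Apoly split: if_splits)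
 thus "Re w + real k > 0"
 proof
  assume "k ~= 0 \<and> coeff p (k - 1) ~= 0"
  hence "Re w + real (k - 1) > 0" using p by blast
  moreover have "real (k - 1) <= real k" by simp
  ultimately show ?thesis by linarith
 qed (use p in blast)
qed

lemma degree_Apoly: "degree (Apoly d p) <= Suc (degree p)"
 by (rule degree_le) (auto simp: coeff_Apoly coeff_eq_0)

lemma exp_ln_pi: "exp (- ((w + 1) * cx (ln pi))) = exp (- (w * cx (ln pi))) / cx pi"
proof -
 have "exp (cx (ln pi)) = cx pi" by (simp add: exp_of_real)
 moreover have "- ((w + 1) * cx (ln pi)) = - (w * cx (ln pi)) - cx (ln pi)" by (simp add: algebra_simps)
 ultimately show ?thesis by (simp add: exp_diff)
qed

text \<open>This is integration by parts in tau, carried out on coefficients through Gamma(z + 1) =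
  z Gamma(z).\<close>

lemma gauss_moment_Apoly:
 assumes p: "regular_at w p"
 shows "gauss_moment w (Apoly d p) = (1 + of_nat d - 2 * w) * gauss_moment w p"
proof -
 define g where "g k = Gamma (w + of_nat k) * exp (- ((w + of_nat k) * cx (ln pi)))" for k
 define n where "n = degree p"
 have gs: "2 * cx pi * coeff p k * g (Suc k) = 2 * (w + of_nat k) * coeff p k * g k" for k
 proof (cases "coeff p k = 0")
  case False
  hence "Re (w + of_nat k) > 0" using p by (simp add: regular_at_def)
  hence "w + of_nat k \<notin> \<int>\<^sub>\<le>\<^sub>0" by (auto elim!: nonpos_Ints_cases simp: complex_eq_iff)
  hence G: "Gamma (w + of_nat k + 1) = (w + of_nat k) * Gamma (w + of_nat k)"
   by (rule Gamma_plus1)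
  have "w + of_nat (Suc k) = w + of_nat k + 1" by simp
  hence "g (Suc k) = (w + of_nat k) * g k / cx pi"
   unfolding g_def by (simp only: G exp_ln_pi) simp
  thus ?thesis by simp
 qed simp
 have "gauss_moment w (Apoly d p) = (\<Sum>k\<le>Suc n. coeff (Apoly d p) k * g k)"
  unfolding g_def by (rule gauss_moment_le) (simp add: n_def degree_Apoly)
 also have "... = (\<Sum>k\<le>Suc n. (1 + of_nat d + 2 * of_nat k) * coeff p k * g k) - (\<Sum>k\<le>Suc n. (if k = 0 then 0 else 2 * cx pi * coeff p (k - 1)) * g k)"
  by (simp only: coeff_Apoly left_diff_distrib sum_subtractf)
 also have "(\<Sum>k\<le>Suc n. (if k = 0 then 0 else 2 * cx pi * coeff p (k - 1)) * g k) = (\<Sum>k\<le>n. 2 * (w + of_nat k) * coeff p k * g k)"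
  unfolding sum.atMost_Suc_shift by (simp add: gs)
 also have "(\<Sum>k\<le>Suc n. (1 + of_nat d + 2 * of_nat k) * coeff p k * g k) = (\<Sum>k\<le>n. (1 + of_nat d + 2 * of_nat k) * coeff p k * g k)"
  by (simp add: n_def coeff_eq_0)
 also have "... - (\<Sum>k\<le>n. 2 * (w + of_nat k) * coeff p k * g k) = (\<Sum>k\<le>n. (1 + of_nat d - 2 * w) * (coeff p k * g k))"
  by (simp add: sum_subtractf[symmetric] algebra_simps)
 also have "... = (1 + of_nat d - 2 * w) * gauss_moment w p"
  by (simp add: gauss_moment_def g_def n_def sum_distrib_left)
 finally show ?thesis .
qed

lemma gauss_moment_cmult: "gauss_moment w (smult c p) = c * gauss_moment w p"
 by (subst (1 2) gauss_moment_le[of _ "degree p"]) (auto simp: degree_smult_le sum_distrib_left mult.assoc)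

lemma gauss_moment_add: "gauss_moment w (p + q) = gauss_moment w p + gauss_moment w q"
 by (subst (1 2 3) gauss_moment_le[of _ "max (degree p) (degree q)"]) (auto simp: degree_add_le sum.distrib distrib_right)

definition tpow :: "complex => real => complex" where
 "tpow w t = (if t > 0 then exp (w * cx (ln t)) else 0)"

lemma tpow_measurable [measurable]: "tpow w \<in> BM"
 unfolding tpow_def[abs_def] by measurable

text \<open>Integrating a Gaussian against \<open>t\<^sup>w\<^sup>-\<^sup>1 dt\<close> before pairing it with \<open>h\<close> produces the power
 \<open>\<bar>x\<bar>\<^sup>-\<^sup>2\<^sup>w\<close> of the Mellin kernel.\<close>

lemma gauss_integral_swap:
 assumes h: "wbd a b h" and s: "- a < Re s" "Re s < - b" and p: "regular_at w p" and w: "w = (1 + of_nat d - s) / 2"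
 shows "lb_int (\<lambda>t. tpow (w - 1) t * (LB x. h x * gauss d t p x))"
  and "(LB t. tpow (w - 1) t * (LB x. h x * gauss d t p x)) = gauss_moment w p * (LB x. h x * sp d (s - 1) x)"
proof -
 note [measurable] = wbd_measurable[OF h]
 define H where "H k x = h x * cx x ^ d * (cx (x^2)) ^ k" for k x
 define f where "f k = (\<lambda>(x, t). coeff p k * (H k x * gker (w + of_nat k) (pi * x^2) t))" for k
 define F where "F = (\<lambda>q. \<Sum>k\<le>degree p. f k q)"
 have hs: "lb_int (\<lambda>x. h x * sp d (s - 1) x)"
  by (rule wbd_integrable_mult[OF h wbd_sp]) (use s in auto)
 \<comment> \<open>The choice of w makes the k-dependence cancel: the exponent of |x| is d + 2 k - 2
   (w + k) = s - 1 for every monomial.\<close>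
 have key: "cx x ^ d * (cx (x^2)) ^ k * exp (- ((w + of_nat k) * cx (ln (pi * x^2))))
   = sp d (s - 1) x * exp (- ((w + of_nat k) * cx (ln pi)))" if x: "x ~= 0" for x k
 proof -
  have 1: "cx x = cx (sgn x) * exp (cx (ln (abs x)))"
   using x by (simp add: exp_of_real sgn_real_def flip: of_real_mult)
  have 2: "cx (x^2) = exp (2 * cx (ln (abs x)))"
   using x by (simp add: exp_double exp_of_real flip: of_real_power)
  have 3: "cx (ln (pi * x^2)) = cx (ln pi) + 2 * cx (ln (abs x))"
   using x ln_realpow[of "abs x" 2] by (simp add: ln_mult)
  have "cx x ^ d * (cx (x^2)) ^ k * exp (- ((w + of_nat k) * cx (ln (pi * x^2))))
   = cx (sgn x) ^ d * exp (of_nat d * cx (ln (abs x)) + of_nat k * (2 * cx (ln (abs x))) + - ((w + of_nat k) * (cx (ln pi) + 2 * cx (ln (abs x)))))"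
   unfolding 2 3 by (subst 1) (simp only: power_mult_distrib exp_of_nat_mult exp_add mult_ac)
  also have "of_nat d * cx (ln (abs x)) + of_nat k * (2 * cx (ln (abs x))) + - ((w + of_nat k) * (cx (ln pi) + 2 * cx (ln (abs x))))
    = (s - 1) * cx (ln (abs x)) + - ((w + of_nat k) * cx (ln pi))"
   unfolding w by (simp add: field_simps)
  finally show ?thesis unfolding sp_exp[OF x] exp_add by (simp only: mult.assoc)
 qed
 have keyn: "norm (cx x ^ d * (cx (x^2)) ^ k) * (pi * x^2) powr (- Re (w + of_nat k)) = norm (sp d (s - 1) x * exp (- ((w + of_nat k) * cx (ln pi))))"
  if x: "x ~= 0" for x k
  using x by (simp only: key[OF x, symmetric] norm_mult) (simp add: powr_def algebra_simps)
 have fi: "integrable (lborel \<Otimes>\<^sub>M lborel) (f k)" for k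
 proof (cases "coeff p k = 0")
  case True thus ?thesis by (simp add: f_def case_prod_beta')
 next
  case False
  hence k: "Re (w + of_nat k) > 0" using p by (simp add: regular_at_def)
  show ?thesis
  proof (rule lborel_pair.Fubini_integrable)
   show "f k \<in> borel_measurable (lborel \<Otimes>\<^sub>M lborel)"
    unfolding f_def H_def case_prod_beta' by measurable
   have "lb_int (\<lambda>x. (norm (coeff p k) * norm (exp (- ((w + of_nat k) * cx (ln pi)))) * (LB t. norm (gker (w + of_nat k) 1 t))) * norm (h x * sp d (s - 1) x))"
    using hs by auto
   thus "lb_int (\<lambda>x. LB t. norm (f k (x, t)))"
   proof (rule integrable_cong_AE_imp)
    show "(\<lambda>x. LB t. norm (f k (x, t))) \<in> borel_measurable lborel"
     unfolding f_def H_def by measurable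
    show "AE x in lborel. (norm (coeff p k) * norm (exp (- ((w + of_nat k) * cx (ln pi)))) * (LB t. norm (gker (w + of_nat k) 1 t))) * norm (h x * sp d (s - 1) x) = (LB t. norm (f k (x, t)))"
     using AE_lborel_not_0
    proof eventually_elim
     case (elim x)
     have "(LB t. norm (f k (x, t))) = norm (coeff p k) * (norm (H k x) * ((LB t. norm (gker (w + of_nat k) 1 t)) * (pi * x^2) powr (- Re (w + of_nat k))))"
      using gker_scaled(3)[OF k, of "pi * x^2"] elim by (simp add: f_def norm_mult)
     also have "... = norm (coeff p k) * norm (h x) * (LB t. norm (gker (w + of_nat k) 1 t)) * (norm (cx x ^ d * (cx (x^2)) ^ k) * (pi * x^2) powr (- Re (w + of_nat k)))"
      unfolding H_def norm_mult by (simp only: mult_ac)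
     also have "... = (norm (coeff p k) * norm (exp (- ((w + of_nat k) * cx (ln pi)))) * (LB t. norm (gker (w + of_nat k) 1 t))) * norm (h x * sp d (s - 1) x)"
      by (simp only: keyn[OF elim]) (simp only: norm_mult mult_ac)
     finally show ?case ..
    qed
   qed
   show "AE x in lborel. lb_int (\<lambda>t. f k (x, t))"
    using AE_lborel_not_0
   proof eventually_elim
    case (elim x)
    show ?case using gker_scaled(1)[OF k, of "pi * x^2"] elim by (simp add: f_def)
   qed
  qed
 qed
 hence Fi: "integrable (lborel \<Otimes>\<^sub>M lborel) (case_prod (\<lambda>x t. F (x, t)))" unfolding F_def by (auto simp: case_prod_beta')
 have Fe: "F (x, t) = tpow (w - 1) t * (h x * gauss d t p x)" for x t
 proof (cases "t > 0")
  case False thus ?thesis by (simp add: F_def f_def gker_def tpow_def)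
 next
  case True
  have "gker (w + of_nat k) (pi * x^2) t = tpow (w - 1) t * cx t ^ k * cx (exp (- (pi * t * x^2)))" for k
  proof -
   have "(w + of_nat k - 1) * cx (ln t) = (w - 1) * cx (ln t) + of_nat k * cx (ln t)" by (simp add: algebra_simps)
   moreover have "exp (of_nat k * cx (ln t)) = cx t ^ k" using True by (simp add: exp_of_nat_mult exp_of_real)
   ultimately show ?thesis using True by (simp add: gker_def tpow_def exp_add mult_ac)
  qed
  hence "f k (x, t) = tpow (w - 1) t * (h x * cx x ^ d * cx (exp (- (pi * t * x^2)))) * (coeff p k * (cx (t * x^2)) ^ k)" for k
   by (simp add: f_def H_def power_mult_distrib mult_ac)
  thus ?thesis
   by (simp add: F_def gauss_def poly_altdef sum_distrib_left mult_ac)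
 qed
 have "(LB x. F (x, t)) = tpow (w - 1) t * (LB x. h x * gauss d t p x)" for t
  unfolding Fe by simp
 note inner = this
 show "lb_int (\<lambda>t. tpow (w - 1) t * (LB x. h x * gauss d t p x))"
  using lborel_pair.integrable_snd[OF Fi] unfolding inner .
 have "(LB t. LB x. F (x, t)) = (LB x. LB t. F (x, t))"
  using lborel_pair.Fubini_integral[OF Fi] by simp
 also have "... = (LB x. gauss_moment w p * (h x * sp d (s - 1) x))"
 proof (rule integral_cong_AE)
  have "F \<in> borel_measurable (lborel \<Otimes>\<^sub>M lborel)" using Fi by (auto simp: case_prod_beta')
  thus "(\<lambda>x. LB t. F (x, t)) \<in> borel_measurable lborel" by measurable
  show "AE x in lborel. (LB t. F (x, t)) = gauss_moment w p * (h x * sp d (s - 1) x)"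
   using AE_lborel_not_0
  proof eventually_elim
   case (elim x)
   have 1: "lb_int (\<lambda>t. f k (x, t)) \<and> (LB t. f k (x, t)) = coeff p k * (Gamma (w + of_nat k) * exp (- ((w + of_nat k) * cx (ln pi)))) * (h x * sp d (s - 1) x)" for k
   proof (cases "coeff p k = 0")
    case False
    hence k: "Re (w + of_nat k) > 0" using p by (simp add: regular_at_def)
    have i: "lb_int (gker (w + of_nat k) (pi * x^2))" using gker_scaled(1)[OF k] elim by simp
    have "(LB t. f k (x, t)) = coeff p k * (H k x * (Gamma (w + of_nat k) * exp (- ((w + of_nat k) * cx (ln (pi * x^2))))))"
     using gker_scaled(2)[OF k, of "pi * x^2"] elim by (simp add: f_def)
    also have "... = coeff p k * (Gamma (w + of_nat k) * (h x * (cx x ^ d * (cx (x^2)) ^ k * exp (- ((w + of_nat k) * cx (ln (pi * x^2)))))))"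
     unfolding H_def by (simp only: mult_ac)
    also have "... = coeff p k * (Gamma (w + of_nat k) * exp (- ((w + of_nat k) * cx (ln pi)))) * (h x * sp d (s - 1) x)"
     unfolding key[OF elim] by (simp only: mult_ac)
    finally show ?thesis using i by (simp add: f_def)
   qed (simp add: f_def)
   thus ?case unfolding F_def gauss_moment_def by (simp add: sum_distrib_right)
  qed
 qed measurable
 finally show "(LB t. tpow (w - 1) t * (LB x. h x * gauss d t p x)) = gauss_moment w p * (LB x. h x * sp d (s - 1) x)"
  unfolding inner by simp
qed

text \<open>Each \<open>Eop\<close> on the Gaussian becomes \<open>Apoly d\<close> on the
  polynomial, and each \<open>Apoly d\<close> multiplies the moment by 1 + d - 2 w = s. This
  reproduces the factor s^i of the Mellin transform of a form.\<close>

lemma theta_integral: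
 assumes h: "!!i. wbd a b (h i)" and s: "- a < Re s" "Re s < - b" and p: "regular_at w p" and w: "w = (1 + of_nat d - s) / 2"
 shows "lb_int (\<lambda>t. tpow (w - 1) t * euler_form m h (gauss d t p))"
  and "(LB t. tpow (w - 1) t * euler_form m h (gauss d t p)) = gauss_moment w p * (\<Sum>i\<le>m. s ^ i * (LB x. h i x * sp d (s - 1) x))"
proof -
 have E: "(Eop ^^ i) (gauss d t p) = gauss d t ((Apoly d ^^ i) p)" for i t
  by (induction i) (simp_all add: Eop_gauss)
 have r: "regular_at w ((Apoly d ^^ i) p)" for i
  by (induction i) (simp_all add: p regular_at_Apoly)
 have g: "gauss_moment w ((Apoly d ^^ i) p) = s ^ i * gauss_moment w p" for i
 proof (induction i)
  case (Suc i)
  have "1 + of_nat d - 2 * w = s" by (simp add: w field_simps)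
  thus ?case using Suc by (simp add: gauss_moment_Apoly[OF r])
 qed simp
 note sw = gauss_integral_swap[OF h s r w]
 have e: "tpow (w - 1) t * euler_form m h (gauss d t p) = (\<Sum>i\<le>m. tpow (w - 1) t * (LB x. h i x * gauss d t ((Apoly d ^^ i) p) x))" for t
  unfolding euler_form_def E by (simp add: sum_distrib_left)
 show "lb_int (\<lambda>t. tpow (w - 1) t * euler_form m h (gauss d t p))"
  unfolding e by (rule LB_integrable_sum) (rule sw(1))
 have "(LB t. tpow (w - 1) t * euler_form m h (gauss d t p)) = (\<Sum>i\<le>m. (LB t. tpow (w - 1) t * (LB x. h i x * gauss d t ((Apoly d ^^ i) p) x)))"
  unfolding e by (rule LB_integral_sum) (rule sw(1))
 thus "(LB t. tpow (w - 1) t * euler_form m h (gauss d t p)) = gauss_moment w p * (\<Sum>i\<le>m. s ^ i * (LB x. h i x * sp d (s - 1) x))"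
  unfolding sw(2) g by (simp add: sum_distrib_left mult_ac)
qed

text \<open>Up to a power of \<open>t\<close>, \<open>gauss d (1/t) (dual_poly d k)\<close> is the Fourier transform of
 \<open>gauss d t ((-2 \<pi> \<tau>)\<^sup>k)\<close>.\<close>

primrec dual_poly :: "nat => nat => complex poly" where
 "dual_poly d 0 = 1"
| "dual_poly d (Suc k) = smult (-1) (Apoly d (dual_poly d k) + smult (of_nat (d + 2 * k)) (dual_poly d k))"

definition mono_poly :: "nat => complex poly" where
 "mono_poly k = monom ((- 2 * cx pi) ^ k) k"

text \<open>\<open>Apoly d\<close> sends tau^k to (1 + d + 2 k) tau^k - 2 pi tau^(k+1); the
  normalisation by powers of -2 pi absorbs the last constant.\<close>

lemma mono_poly_Suc: "mono_poly (Suc k) = Apoly d (mono_poly k) + smult (- (1 + of_nat d + 2 * of_nat k)) (mono_poly k)"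
 by (rule poly_eqI) (auto simp: mono_poly_def coeff_Apoly algebra_simps)

lemma gauss_add: "gauss d t (p + q) = (\<lambda>x. gauss d t p x + gauss d t q x)"
 and gauss_smult: "gauss d t (smult c p) = (\<lambda>x. c * gauss d t p x)"
 by (auto simp: gauss_def algebra_simps)

lemma fourier_Eop:
 assumes "f \<in> schwartz" shows "FT (Eop f) y = FT f y - Eop (FT f) y"
proof -
 have e: "Eop f \<in> schwartz" using assms by (rule tame_schwartz[OF tame_Eop])
 have "Eop (FT f) y = FT (\<lambda>x. f x + (-1) * Eop f x) y"
  unfolding Eop_FT[OF assms] mth_eq[OF schwartz_smooth[OF assms]] ..
 also have "... = FT f y + (-1) * FT (Eop f) y"
  unfolding FT_add[OF assms schwartz_cmult[OF e]] FT_cmult ..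
 finally show ?thesis by simp
qed

text \<open>The Fourier transform turns \<open>Eop\<close> into 1 - \<open>Eop\<close>, so the
  recursion of \<open>mono_poly\<close> becomes that of \<open>dual_poly\<close>. The common factor
  in t is the one of the plain Gaussian.\<close>

lemma fourier_gauss_mono_poly:
 assumes t: "t > 0" and d: "d \<in> {0, 1}"
 shows "FT (gauss d t (mono_poly k)) = (\<lambda>y. ((- \<i>) ^ d * cx (t powr (- 1/2 - real d))) * gauss d (1 / t) (dual_poly d k) y)"
proof (induction k)
 case 0
 thus ?case using fourier_gauss[OF t d] by (simp add: mono_poly_def monom_0 one_pCons[symmetric])
next
 case (Suc k)
 define g where "g = gauss d t (mono_poly k)"
 define c where "c = (- \<i>) ^ d * cx (t powr (- 1/2 - real d))"
 have g: "g \<in> schwartz" unfolding g_def by (rule gauss_schwartz[OF t])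
 have e: "Eop g \<in> schwartz" using g by (rule tame_schwartz[OF tame_Eop])
 have F: "FT g = (\<lambda>y. c * gauss d (1 / t) (dual_poly d k) y)" using Suc by (simp add: g_def c_def)
 have "gauss d t (mono_poly (Suc k)) = (\<lambda>x. Eop g x + (- (1 + of_nat d + 2 * of_nat k)) * g x)"
  unfolding mono_poly_Suc[of k d] gauss_add gauss_smult g_def Eop_gauss ..
 hence "FT (gauss d t (mono_poly (Suc k))) y = FT (Eop g) y + (- (1 + of_nat d + 2 * of_nat k)) * FT g y" for y
  by (simp only: FT_add[OF e schwartz_cmult[OF g]] FT_cmult)
 hence 1: "FT (gauss d t (mono_poly (Suc k))) y = FT g y - Eop (FT g) y + (- (1 + of_nat d + 2 * of_nat k)) * FT g y" for y
  by (simp only: fourier_Eop[OF g])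
 have 2: "Eop (FT g) y = c * gauss d (1 / t) (Apoly d (dual_poly d k)) y" for y
 proof -
  have "1 / t > 0" using t by simp
  from Eop_cmult[OF schwartz_smooth[OF gauss_schwartz[OF this]], where c = c]
  show ?thesis unfolding F Eop_gauss by (rule fun_cong)
 qed
 have "FT (gauss d t (mono_poly (Suc k))) y = c * gauss d (1 / t) (dual_poly d (Suc k)) y" for y
  unfolding 1 2 dual_poly.simps gauss_smult gauss_add unfolding F by (simp add: algebra_simps)
 thus ?case unfolding c_def by blast
qed

text \<open>The Fourier transform of T is known as a form only on functions vanishing at 0 to high
  order; the monomial factor puts the Gaussian into that domain.\<close>

lemma gauss_mono_poly_Sz:
 assumes "t > 0" shows "gauss d t (mono_poly n) \<in> Sz n"
proof -
 have "(\<lambda>x. cx x ^ n * (cx x ^ n * (((- 2 * cx pi) ^ n * cx t ^ n) * gauss d t 1 x))) \<in> Sz n"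
  by (intro Sz_xpow schwartz_xpow schwartz_cmult gauss_schwartz assms)
 moreover have "(\<lambda>x. cx x ^ n * (cx x ^ n * (((- 2 * cx pi) ^ n * cx t ^ n) * gauss d t 1 x))) = gauss d t (mono_poly n)"
 proof
  fix x
  have "(cx (t * x^2)) ^ n = cx t ^ n * (cx x ^ n * cx x ^ n)"
   by (simp add: power_mult_distrib power2_eq_square)
  thus "cx x ^ n * (cx x ^ n * (((- 2 * cx pi) ^ n * cx t ^ n) * gauss d t 1 x)) = gauss d t (mono_poly n) x"
   by (simp only: gauss_def mono_poly_def poly_monom poly_1 mult_1_left mult_1_right mult_ac)
 qed
 ultimately show ?thesis by simp
qed

lemma gauss_moment_mono_poly:
 "gauss_moment w (mono_poly n) = (- 2) ^ n * (Gamma (w + of_nat n) * exp (- (w * cx (ln pi))))"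
proof -
 have "exp (- (of_nat n * cx (ln pi))) = 1 / cx pi ^ n"
  by (simp add: exp_minus exp_of_nat_mult exp_of_real inverse_eq_divide)
 moreover have "- ((w + of_nat n) * cx (ln pi)) = - (w * cx (ln pi)) + - (of_nat n * cx (ln pi))" by (simp add: algebra_simps)
 ultimately have "exp (- ((w + of_nat n) * cx (ln pi))) = exp (- (w * cx (ln pi))) / cx pi ^ n"
  by (simp only: exp_add) simp
 moreover have "gauss_moment w (mono_poly n) = (\<Sum>k\<le>n. coeff (mono_poly n) k * (Gamma (w + of_nat k) * exp (- ((w + of_nat k) * cx (ln pi)))))"
  by (rule gauss_moment_le) (simp add: mono_poly_def degree_monom_le)
 hence "gauss_moment w (mono_poly n) = (- 2 * cx pi) ^ n * (Gamma (w + of_nat n) * exp (- ((w + of_nat n) * cx (ln pi))))"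
  by (simp add: mono_poly_def if_distrib if_distribR sum.delta cong: if_cong)
 ultimately show ?thesis unfolding power_mult_distrib by simp
qed

text \<open>With w' = 1/2 + d - w the Pochhammer symbol is Gamma(w' + n) / Gamma(w'), which offsets
  the shifted Gamma value in the moment of \<open>mono_poly n\<close> at w'.\<close>

lemma gauss_moment_dual_poly:
 assumes w: "Re w > 0"
 shows "gauss_moment w (dual_poly d n) = (- 2) ^ n * pochhammer (1/2 + of_nat d - w) n * (Gamma w * exp (- (w * cx (ln pi))))"
proof (induction n)
 case 0
 show ?case by (simp add: gauss_moment_def)
next
 case (Suc n)
 have r: "regular_at w p" for p using w by (simp add: regular_at_def add_pos_nonneg)
 have "gauss_moment w (dual_poly d (Suc n)) = (- 1) * ((1 + of_nat d - 2 * w) + of_nat (d + 2 * n)) * gauss_moment w (dual_poly d n)"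
  by (simp only: dual_poly.simps gauss_moment_cmult gauss_moment_add gauss_moment_Apoly[OF r]) (simp add: algebra_simps)
 also have "(- 1) * ((1 + of_nat d - 2 * w) + of_nat (d + 2 * n)) = (- 2) * (1/2 + of_nat d - w + of_nat n)" by (simp add: algebra_simps)
 also have "... * gauss_moment w (dual_poly d n) = (- 2) ^ Suc n * pochhammer (1/2 + of_nat d - w) (Suc n) * (Gamma w * exp (- (w * cx (ln pi))))"
  unfolding Suc pochhammer_Suc power_Suc by (simp only: mult_ac)
 finally show ?case .
qed

text \<open>Pairing the transform with the Gaussian of parameter t equals, up to a power of t,
  pairing T with a Gaussian of parameter 1/t. Integrating both against a power of t gives the two
  Mellin transforms times Gaussian moments, whose quotient is the Gamma factor.\<close>

lemma functional_equation:
 assumes d: "d \<in> {0, 1}"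
  and T: "!!i. wbd a b (h i)" "!!f. f \<in> schwartz ==> T f = euler_form m h f"
  and T': "!!i. wbd a' b' (h' i)" "!!f. f \<in> Sz M ==> fourier T f = euler_form m' h' f"
  and s: "- a' < Re s" "Re s < - b'" "- a < 1 - Re s" "1 - Re s < - b" "0 < Re s"
 shows "(\<Sum>i\<le>m'. s ^ i * (LB x. h' i x * sp d (s - 1) x)) =
  (- \<i>) ^ d * exp ((1/2 - s) * cx (ln pi)) * Gamma ((s + of_nat d) / 2) * rGamma ((1 + of_nat d - s) / 2) *
  (\<Sum>i\<le>m. (1 - s) ^ i * (LB x. h i x * sp d ((1 - s) - 1) x))" (is "?S' = _ * ?S")
proof -
 define w where "w = (1 + of_nat d - (1 - s)) / 2"
 define w' where "w' = (1 + of_nat d - s) / 2"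
 have ww: "w' = 1/2 + of_nat d - w" by (simp add: w_def w'_def field_simps)
 have Rw: "Re w > 0" using s by (simp add: w_def add_nonneg_pos)
 \<comment> \<open>Large enough to put the Gaussian into \<open>Sz M\<close> and to make the Gamma
   integral at w' + n converge.\<close>
 define n where "n = max M (nat \<lceil>abs (Re w')\<rceil> + 1)"
 have nM: "n >= M" and nw: "Re w' + real n > 0" unfolding n_def by linarith+
 define \<Phi> where "\<Phi> = (\<lambda>u. tpow (w - 1) u * euler_form m h (gauss d u (dual_poly d n)))"
 have r: "regular_at w (dual_poly d n)" using Rw by (simp add: regular_at_def add_pos_nonneg)
 have r': "regular_at w' (mono_poly n)" using nw by (auto simp: regular_at_def mono_poly_def)
 have th: "lb_int \<Phi>" "(LB u. \<Phi> u) = gauss_moment w (dual_poly d n) * ?S"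
  unfolding \<Phi>_def using theta_integral[where h = h and m = m and s = "1 - s", OF T(1) _ _ r w_def] s by auto
 \<comment> \<open>The powers of t match because w' - 1 - 1/2 - d = -(w - 1) - 2; the extra t^(-2)
   is the Jacobian of t -> 1/t.\<close>
 have e: "tpow (w' - 1) t * euler_form m' h' (gauss d t (mono_poly n)) = (- \<i>) ^ d * (\<Phi> (1 / t) / cx t ^ 2)" for t
 proof (cases "t > 0")
  case True
  have g: "gauss d (1 / t) (dual_poly d n) \<in> schwartz" using True by (intro gauss_schwartz) simp
  have "euler_form m' h' (gauss d t (mono_poly n)) = fourier T (gauss d t (mono_poly n))"
   using T'(2)[OF Sz_mono[OF gauss_mono_poly_Sz[OF True] nM]] by simp
  also have "... = ((- \<i>) ^ d * cx (t powr (- 1/2 - real d))) * euler_form m h (gauss d (1 / t) (dual_poly d n))"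
   unfolding fourier_def fourier_gauss_mono_poly[OF True d] T(2)[OF schwartz_cmult[OF g]] by (rule euler_form_cmult[OF schwartz_smooth[OF g]])
  finally have 1: "euler_form m' h' (gauss d t (mono_poly n)) = ((- \<i>) ^ d * cx (t powr (- 1/2 - real d))) * euler_form m h (gauss d (1 / t) (dual_poly d n))" .
  have p: "cx (t powr (- 1/2 - real d)) = exp ((- 1/2 - of_nat d) * cx (ln t))"
   using True by (simp add: powr_def flip: exp_of_real)
  have q: "cx t ^ 2 = exp (2 * cx (ln t))" using True by (simp add: exp_double exp_of_real)
  have K: "exp ((w' - 1) * cx (ln t)) * exp ((- 1/2 - of_nat d) * cx (ln t)) = exp ((w - 1) * cx (ln (1 / t))) / exp (2 * cx (ln t))"
   unfolding exp_add[symmetric] exp_diff[symmetric] using True by (simp add: ww ln_div algebra_simps)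
  have L: "tpow (w' - 1) t = exp ((w' - 1) * cx (ln t))" "tpow (w - 1) (1 / t) = exp ((w - 1) * cx (ln (1 / t)))"
   using True by (simp_all add: tpow_def)
  have "tpow (w' - 1) t * euler_form m' h' (gauss d t (mono_poly n))
   = (- \<i>) ^ d * ((exp ((w' - 1) * cx (ln t)) * exp ((- 1/2 - of_nat d) * cx (ln t))) * euler_form m h (gauss d (1 / t) (dual_poly d n)))"
   unfolding 1 p L by (simp only: mult_ac)
  thus ?thesis unfolding K \<Phi>_def L q by simp
 qed (simp add: tpow_def \<Phi>_def)
 have "gauss_moment w' (mono_poly n) * ?S' = (- \<i>) ^ d * (LB t. \<Phi> (1 / t) / cx t ^ 2)"
  using theta_integral(2)[where h = h' and m = m' and s = s, OF T'(1) s(1,2) r' w'_def]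
  unfolding e integral_mult_right_zero by (rule sym)
 also have "(LB t. \<Phi> (1 / t) / cx t ^ 2) = gauss_moment w (dual_poly d n) * ?S"
  using reciprocal_substitution(2)[of \<Phi>] th by (auto dest: borel_measurable_integrable)
 finally have "(- 2) ^ n * (Gamma (w' + of_nat n) * exp (- (w' * cx (ln pi))) * ?S') = (- 2) ^ n * ((- \<i>) ^ d * (pochhammer w' n * (Gamma w * exp (- (w * cx (ln pi)))) * ?S))"
  unfolding gauss_moment_mono_poly gauss_moment_dual_poly[OF Rw] ww[symmetric] by (simp only: mult_ac)
 hence "Gamma (w' + of_nat n) * exp (- (w' * cx (ln pi))) * ?S' = (- \<i>) ^ d * (pochhammer w' n * (Gamma w * exp (- (w * cx (ln pi)))) * ?S)"
  by (subst (asm) mult_left_cancel) auto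
 \<comment> \<open>Multiplying by the reciprocal of Gamma(w' + n) turns the Pochhammer symbol into
   \<open>rGamma w'\<close>, and n disappears.\<close>
 from arg_cong[OF this, of "\<lambda>v. (rGamma (w' + of_nat n) * exp (w' * cx (ln pi))) * v"]
 have "(rGamma (w' + of_nat n) * Gamma (w' + of_nat n)) * (exp (w' * cx (ln pi)) * exp (- (w' * cx (ln pi)))) * ?S'
  = (- \<i>) ^ d * ((pochhammer w' n * rGamma (w' + of_nat n)) * (Gamma w * (exp (w' * cx (ln pi)) * exp (- (w * cx (ln pi))))) * ?S)"
  by (simp only: mult_ac)
 moreover have "rGamma (w' + of_nat n) * Gamma (w' + of_nat n) = 1"
 proof -
  have "w' + of_nat n \<notin> \<int>\<^sub>\<le>\<^sub>0" using nw by (auto elim!: nonpos_Ints_cases simp: complex_eq_iff)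
  thus ?thesis by (simp add: rGamma_inverse_Gamma Gamma_eq_zero_iff)
 qed
 moreover have "exp (w' * cx (ln pi)) * exp (- (w * cx (ln pi))) = exp ((1/2 - s) * cx (ln pi))"
 proof -
  have "w' * cx (ln pi) + - (w * cx (ln pi)) = (w' - w) * cx (ln pi)" by (simp add: algebra_simps)
  also have "w' - w = 1/2 - s" by (simp add: w_def w'_def field_simps)
  finally show ?thesis by (simp only: exp_add[symmetric])
 qed
 moreover have "exp (w' * cx (ln pi)) * exp (- (w' * cx (ln pi))) = 1"
  unfolding exp_add[symmetric] by simp
 ultimately have "?S' = (- \<i>) ^ d * (rGamma w' * (Gamma w * exp ((1/2 - s) * cx (ln pi))) * ?S)"
  unfolding pochhammer_rGamma[of w' n, symmetric] by simp
 moreover have "w = (s + of_nat d) / 2" by (simp add: w_def)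
 ultimately show ?thesis unfolding w'_def by (simp only: mult_ac)
qed

section \<open>The Gamma factor\<close>

definition gamma_factor :: "nat => complex => complex" where
 "gamma_factor d s = \<i> ^ d * exp ((1/2 - s) * cx (ln pi)) * Gamma ((s + of_nat d) / 2) * rGamma ((1 + of_nat d - s) / 2)"

text \<open>Up to the power of i, \<open>gamma_factor\<close> is the quotient at s and 1 - s of the
  real factors pi^(-z/2) Gamma(z/2) with z shifted by d. The duplication formula splits Gamma(s),
  and the reflection formula for the cosine cancels one half and inverts the other. This shape shows
  the actual poles, since \<open>rGamma\<close> is entire.\<close>

lemma gamma_factor_nonint:
 assumes d: "d \<in> {0, 1}" and s: "s \<notin> \<int>"
 shows "2 * \<i> ^ d * (2 * cx pi) powr (- s) * Gamma s * cos (cx pi * (s - of_nat d) / 2) = gamma_factor d s"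
proof -
 have ni: "z \<notin> \<int>\<^sub>\<le>\<^sub>0" if "2 * z - s \<in> \<int>" for z
 proof
  assume "z \<in> \<int>\<^sub>\<le>\<^sub>0"
  hence "2 * z \<in> \<int>" using nonpos_Ints_subset_Ints by (auto intro: Ints_mult)
  hence "2 * z - (2 * z - s) \<in> \<int>" using that by (rule Ints_diff)
  thus False using s by simp
 qed
 have n1: "s / 2 \<notin> \<int>\<^sub>\<le>\<^sub>0" by (rule ni) simp
 have n2: "s / 2 + 1 / 2 \<notin> \<int>\<^sub>\<le>\<^sub>0" by (rule ni) (simp add: distrib_left)
 have pw: "(2 * cx pi) powr (- s) = exp (- (s * cx (ln 2))) * exp (- (s * cx (ln pi)))"
 proof -
  have "ln (2 * cx pi) = cx (ln (2 * pi))" using Ln_of_real[of "2 * pi"] by simp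
  also have "ln (2 * pi) = ln 2 + ln pi" by (simp add: ln_mult)
  finally show ?thesis by (simp add: powr_def algebra_simps flip: exp_add)
 qed
 have "exp ((1 - 2 * (s / 2)) * cx (ln 2)) = 2 * exp (- (s * cx (ln 2)))"
 proof -
  have "exp (cx (ln 2)) = 2" by (simp add: exp_of_real)
  moreover have "(1 - 2 * (s / 2)) * cx (ln 2) = cx (ln 2) + - (s * cx (ln 2))" by (simp add: algebra_simps)
  ultimately show ?thesis by (simp only: exp_add)
 qed
 hence dup: "2 * exp (- (s * cx (ln 2))) * Gamma s * cx (sqrt pi) = Gamma (s / 2) * Gamma (s / 2 + 1 / 2)"
  using Gamma_legendre_duplication[OF n1 n2] by simp
 have sp: "exp ((1/2 - s) * cx (ln pi)) = cx (sqrt pi) * exp (- (s * cx (ln pi)))"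
 proof -
  have "exp (1/2 * cx (ln pi)) = cx (sqrt pi)"
  proof -
   have "exp (1/2 * cx (ln pi)) = cx (exp (1/2 * ln pi))" by (simp flip: exp_of_real)
   also have "exp (1/2 * ln pi) = sqrt pi" using powr_half_sqrt[of pi] by (simp add: powr_def)
   finally show ?thesis .
  qed
  moreover have "(1/2 - s) * cx (ln pi) = 1/2 * cx (ln pi) + - (s * cx (ln pi))" by (simp add: algebra_simps)
  ultimately show ?thesis by (simp only: exp_add)
 qed
 \<comment> \<open>For either d, the arguments s/2 and (s+1)/2 of the duplication formula are z and
   (s + d)/2; z is the one that cancels against the cosine.\<close>
 define z where "z = (s + 1 - of_nat d) / 2"
 have "2 * z - s = 1 - of_nat d" by (simp add: z_def field_simps)
 hence z: "z \<notin> \<int>\<^sub>\<le>\<^sub>0" by (intro ni) (simp add: Ints_diff)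
 have z2: "1 - z = (1 + of_nat d - s) / 2" by (simp add: z_def field_simps)
 have "cos (cx pi * (s - of_nat d) / 2) = sin (cx pi * z)"
 proof -
  have "cx pi * z = cx pi / 2 - (- (cx pi * (s - of_nat d) / 2))" by (simp add: z_def field_simps)
  hence "sin (cx pi * z) = cos (- (cx pi * (s - of_nat d) / 2))" by (simp only: sin_cos_eq) simp
  thus ?thesis by simp
 qed
 also have "... = cx pi * (rGamma z * rGamma (1 - z))" by (simp add: rGamma_reflection_complex)
 finally have c: "cos (cx pi * (s - of_nat d) / 2) = cx pi * (rGamma z * rGamma ((1 + of_nat d - s) / 2))" unfolding z2 .
 have zz: "Gamma (s / 2) * Gamma (s / 2 + 1 / 2) = Gamma z * Gamma ((s + of_nat d) / 2)"
  using d by (auto simp: z_def add_divide_distrib mult.commute)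
 have gz: "Gamma z * rGamma z = 1" using z by (simp add: rGamma_inverse_Gamma Gamma_eq_zero_iff)
 have pp: "cx pi = cx (sqrt pi) * cx (sqrt pi)" by (simp flip: of_real_mult)
 have c2: "cos (cx pi * (s - of_nat d) / 2) = (cx (sqrt pi) * cx (sqrt pi)) * (rGamma z * rGamma ((1 + of_nat d - s) / 2))"
  unfolding pp[symmetric] by (rule c)
 have "2 * \<i> ^ d * (2 * cx pi) powr (- s) * Gamma s * cos (cx pi * (s - of_nat d) / 2)
  = \<i> ^ d * (2 * exp (- (s * cx (ln 2))) * Gamma s * cx (sqrt pi)) * cx (sqrt pi) * exp (- (s * cx (ln pi))) * rGamma z * rGamma ((1 + of_nat d - s) / 2)"
  unfolding pw c2 by (simp only: mult_ac)
 also have "... = \<i> ^ d * (cx (sqrt pi) * exp (- (s * cx (ln pi)))) * Gamma ((s + of_nat d) / 2) * rGamma ((1 + of_nat d - s) / 2) * (Gamma z * rGamma z)"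
  unfolding dup zz by (simp only: mult_ac)
 finally show ?thesis unfolding gamma_factor_def sp gz by simp
qed

lemma eventually_at_not_Ints: "\<forall>\<^sub>F z in at s. z \<notin> (\<int> :: complex set)"
proof (cases "s \<in> \<int>")
 case True
 then obtain k where k: "s = of_int k" by (auto elim: Ints_cases)
 have "z \<notin> \<int>" if z: "z ~= s" "dist z s < 1" for z
 proof
  assume "z \<in> \<int>"
  then obtain l where l: "z = of_int l" by (auto elim: Ints_cases)
  have "norm (complex_of_int (l - k)) < 1" using z by (simp add: dist_norm l k)
  thus False using z unfolding norm_of_int by (simp add: l k)
 qed
 thus ?thesis unfolding eventually_at by (intro exI[of _ 1]) auto
next
 case False
 have "\<forall>\<^sub>F z in nhds s. z \<in> - \<int>" by (rule eventually_nhds_in_open) (use False in \<open>auto simp: open_Compl\<close>)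
 thus ?thesis by (simp add: eventually_at_filter eventually_mono)
qed

lemma isCont_gamma_factor:
 assumes "(s + of_nat d) / 2 \<notin> \<int>\<^sub>\<le>\<^sub>0" shows "isCont (gamma_factor d) s"
 unfolding gamma_factor_def by (intro continuous_intros assms) auto

text \<open>Off the integers both functions agree, and \<open>gamma_factor\<close> is continuous at
  s, so its value is the limit that \<open>remove_sings\<close> takes.\<close>

lemma G_factor_eq:
 assumes d: "d \<in> {0, 1}" and s: "(s + of_nat d) / 2 \<notin> \<int>\<^sub>\<le>\<^sub>0"
 shows "G_factor d s = gamma_factor d s"
 unfolding G_factor_def
proof (rule remove_sings_eqI)
 have "gamma_factor d \<midarrow>s\<rightarrow> gamma_factor d s" using isCont_gamma_factor[OF s] by (simp add: isCont_def)
 thus "(\<lambda>s. 2 * \<i> ^ d * (2 * cx pi) powr (- s) * Gamma s * cos (cx pi * (s - of_nat d) / 2)) \<midarrow>s\<rightarrow> gamma_factor d s"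
  by (rule Lim_transform_eventually) (use eventually_at_not_Ints[of s] gamma_factor_nonint[OF d] in \<open>auto elim!: eventually_mono\<close>)
qed

section \<open>Distributions flat at the origin\<close>

lemma adm_schwartz: "adm 0 schwartz"
 using adm_Sz[of 0 0] by (simp add: Sz_0)

lemma test_away_subset_Sz: "test0 \<subseteq> Sz n"
 using test_away_Sz by blast

lemma test_away_subset_schwartz: "test0 \<subseteq> schwartz"
 using test_schwartz by blast

text \<open>The exponent N at infinity does not depend on k, because it comes from the
  representation away from 0, chosen once.\<close>

lemma flat_rep:
 assumes T: "tempered T" and v: "vanishes T 0 Infinite_Order"
 obtains N :: nat where "!!k. rep schwartz (real k) (real N) T"
proof -
 obtain N M :: nat where N: "rep (test0) (- real M) (real N) T"
  using rep_away_from_zero[OF T] by blast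
 show ?thesis by (rule that[of N], rule tempered_vanishing_rep[OF T _ N]) (use v in auto)
qed

text \<open>A single division by x^M gives the same exponent -M at both ends and hence an empty
  strip of convergence. Gluing the form for M near 0 to the form for M + 2 near infinity opens the
  strip M < Re s < M + 2.\<close>

lemma rep_fourier_flat:
 assumes T: "tempered T" and r: "!!k. rep schwartz (real k) (real N) T" and M: "M >= N + 2"
 shows "rep (Sz (M + 2)) (- real M) (- real (M + 2)) (fourier T)" and "vanishes_to (fourier T) 0 (- int M)"
proof -
 have F: "tempered (fourier T)" by (rule tempered_fourier[OF T])
 have 1: "rep (Sz M) (- real M) (- real M) (fourier T)"
  by (rule rep_fourier[OF r[of "M + 2"]]) (use M in auto)
 have 2: "rep (Sz (M + 2)) (- real (M + 2)) (- real (M + 2)) (fourier T)"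
  by (rule rep_fourier[OF r[of "M + 2"]]) (use M in auto)
 show "vanishes_to (fourier T) 0 (- int M)" by (rule rep_Sz_vanishes[OF 1])
 show "rep (Sz (M + 2)) (- real M) (- real (M + 2)) (fourier T)"
 proof (rule rep_combine[OF adm_Sz[OF order_refl] _ _ 1 2 cutoff_test])
  show "fourier T f = fourier T (\<lambda>x. cutoff x * f x) + fourier T (\<lambda>x. (1 - cutoff x) * f x)" if "f \<in> Sz (M + 2)" for f
   by (rule tempered_split[OF F Sz_schwartz[OF that] cutoff_test])
  show "(\<lambda>x. cutoff x * f x) \<in> Sz M" if "f \<in> Sz (M + 2)" for f
   using Sz_mono[OF Sz_mult[OF that bdd_smooth_test[OF cutoff_test]], of M] by simp
  show "(\<lambda>x. (1 - cutoff x) * f x) \<in> Sz (M + 2)" if "f \<in> Sz (M + 2)" for f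
   by (rule Sz_mult[OF that bdd_smooth_compl[OF cutoff_test]])
  show "cutoff x = 1" if "abs x < 1" for x using that by (simp add: cutoff_1)
 qed auto
qed

lemma minus_i_power: "(- \<i>) ^ d = (- 1) ^ d * \<i> ^ d"
 by (simp flip: power_mult_distrib)

lemma gamma_regular:
 assumes "Re s > 0" shows "(s + of_nat d) / 2 \<notin> \<int>\<^sub>\<le>\<^sub>0"
 using assms by (auto elim!: nonpos_Ints_cases simp: complex_eq_iff)

lemma mellin_fourier:
 fixes a b a' b' :: int
 assumes d: "d \<in> {0, 1}" and T: "tempered T" "vanishes_to T 0 a" "rep schwartz (of_int a) (of_int b) T"
  and F: "vanishes_to (fourier T) 0 a'" "rep (Sz M) (of_int a') (of_int b') (fourier T)"
  and s: "- of_int a' < Re s" "Re s < - of_int b'" "- of_int a < 1 - Re s" "1 - Re s < - of_int b" "0 < Re s"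
 shows "s \<in> mellin_domain (fourier T)" and "1 - s \<in> mellin_domain T"
  and "mellin d (fourier T) s = (- 1) ^ d * gamma_factor d s * mellin d T (1 - s)"
proof -
 obtain m h where h: "!!i. wbd (of_int a) (of_int b) (h i)" "!!f. f \<in> schwartz ==> T f = euler_form m h f"
  using T(3) unfolding rep_def by blast
 obtain m' h' where h': "!!i. wbd (of_int a') (of_int b') (h' i)" "!!f. f \<in> Sz M ==> fourier T f = euler_form m' h' f"
  using F(2) unfolding rep_def by blast
 have 1: "1 - s \<in> mellin_domain T \<and> mellin d T (1 - s) = (\<Sum>i\<le>m. (1 - s) ^ i * (LB x. h i x * sp d (1 - s - 1) x))"
  using mellin_eq(1)[where s = "1 - s", OF T(1,2) h(1) h(2)[OF test_schwartz]]
   mellin_eq(2)[where s = "1 - s" and \<delta> = d, OF T(1,2) h(1) h(2)[OF test_schwartz]] s by simp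
 have 2: "s \<in> mellin_domain (fourier T) \<and> mellin d (fourier T) s = (\<Sum>i\<le>m'. s ^ i * (LB x. h' i x * sp d (s - 1) x))"
  using mellin_eq(1)[OF tempered_fourier[OF T(1)] F(1) h'(1) h'(2)[OF test_away_Sz], where s = s]
   mellin_eq(2)[OF tempered_fourier[OF T(1)] F(1) h'(1) h'(2)[OF test_away_Sz], where s = s and \<delta> = d] s by simp
 show "s \<in> mellin_domain (fourier T)" "1 - s \<in> mellin_domain T" using 1 2 by auto
 have "(\<Sum>i\<le>m'. s ^ i * (LB x. h' i x * sp d (s - 1) x)) =
  (- \<i>) ^ d * exp ((1/2 - s) * cx (ln pi)) * Gamma ((s + of_nat d) / 2) * rGamma ((1 + of_nat d - s) / 2) *
  (\<Sum>i\<le>m. (1 - s) ^ i * (LB x. h i x * sp d ((1 - s) - 1) x))"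
  by (rule functional_equation[where T = T, OF d h h' s])
 thus "mellin d (fourier T) s = (- 1) ^ d * gamma_factor d s * mellin d T (1 - s)"
  using 1 2 by (simp only: gamma_factor_def minus_i_power mult.assoc)
qed

lemma flat_functional_equation:
 assumes d: "d \<in> {0, 1}" and T: "tempered T" "vanishes T 0 Infinite_Order"
 shows "\<exists>A::real. \<forall>s. A < Re s --> s \<in> mellin_domain (fourier T) \<and> 1 - s \<in> mellin_domain T \<and>
      mellin d (fourier T) s = (- 1) ^ d * G_factor d s * mellin d T (1 - s)"
proof -
 obtain N :: nat where r: "!!k. rep schwartz (real k) (real N) T" using flat_rep[OF T] by blast
 show ?thesis
 proof (intro exI[of _ "real N + 3"] allI impI)
  fix s assume s: "real N + 3 < Re s"
  \<comment> \<open>This M satisfies M < Re s <= M + 1, so s lies in the strip of width 2.\<close>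
  define M where "M = nat (\<lceil>Re s\<rceil> - 1)"
  have c: "\<lceil>Re s\<rceil> > int N + 3" using s by linarith
  have M: "real M = of_int \<lceil>Re s\<rceil> - 1" "M >= N + 2" using c by (auto simp: M_def)
  have Ms: "real M < Re s" "Re s < real M + 2" unfolding M(1) by linarith+
  note F = rep_fourier_flat[OF T(1) r M(2)]
  have F': "rep (Sz (M + 2)) (of_int (- int M)) (of_int (- int (M + 2))) (fourier T)" using F(1) by simp
  have T': "rep schwartz (of_int (int (M + 2))) (of_int (int N)) T" using r[of "M + 2"] by simp
  have v: "vanishes_to T 0 (int (M + 2))" using T(2) by simp
  show "s \<in> mellin_domain (fourier T) \<and> 1 - s \<in> mellin_domain T \<and>
      mellin d (fourier T) s = (- 1) ^ d * G_factor d s * mellin d T (1 - s)"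
   using mellin_fourier[OF d T(1) v T' F(2) F', of s] Ms s G_factor_eq[OF d gamma_regular] by simp
 qed
qed

section \<open>Holomorphy and continuation in s\<close>

lemma mellin_holomorphic:
 fixes T :: distr
 assumes T: "tempered T" and S: "open S"
  and r: "!!s. s \<in> S ==> \<exists>a b::int. vanishes_to T 0 a \<and> rep (test0) (of_int a) (of_int b) T \<and> - of_int a < Re s \<and> Re s < - of_int b"
 shows "S \<subseteq> mellin_domain T" and "mellin d T holomorphic_on S"
proof -
 have *: "s \<in> mellin_domain T \<and> mellin d T field_differentiable (at s)" if s: "s \<in> S" for s
 proof -
  obtain a b :: int where v: "vanishes_to T 0 a" and R: "rep (test0) (of_int a) (of_int b) T"
   and ab: "- of_int a < Re s" "Re s < - of_int b" using r[OF s] by blast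
  obtain m h where h: "!!i. wbd (of_int a) (of_int b) (h i)" "!!f. f \<in> test0 ==> T f = euler_form m h f"
   using R unfolding rep_def by blast
  define V where "V = {s. - of_int a < Re s} \<inter> {s. Re s < - of_int b}"
  have V: "open V" "s \<in> V" unfolding V_def using ab by (auto intro!: open_Int open_halfspace_Re_gt open_halfspace_Re_lt)
  have c: "\<forall>\<^sub>F x in nhds 0. cutoff x = 1"
   by (auto simp: eventually_nhds_metric dist_norm cutoff_1 intro!: exI[of _ 1])
  define h' where "h' = (\<lambda>i x. (-1) ^ i * h i (1 / x))"
  have h': "wbd (- of_int b) (- of_int a) (h' i)" for i
   unfolding h'_def by (rule wbd_cmult[OF wbd_recip[OF h(1)]])
  define \<psi> where "\<psi> = (\<lambda>x. if x = 0 then 1 else 1 - cutoff (1 / x))"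
  have \<psi>: "\<psi> \<in> schwartz" unfolding \<psi>_def by (rule test_schwartz[OF recip_cutoff_test[OF cutoff_test c]])
  \<comment> \<open>The splitting by one fixed cutoff writes the value as two forms on Schwartz
    functions, whose holomorphy is known.\<close>
  have 1: "mellin d T z = mellin_form d m h z cutoff + mellin_form d m h' (- z) \<psi>" if "z \<in> V" for z
   using mellin_eq(2)[OF T v h, where s = z and \<delta> = d] mellin_form_sum[where h = h and s = z and \<delta> = d and m = m, OF h(1) _ _ cutoff_test c] that
   by (simp add: V_def h'_def \<psi>_def)
  have "(\<lambda>z. mellin_form d m h z cutoff) holomorphic_on V"
   by (rule holomorphic_on_subset[OF mellin_form_holomorphic[OF h(1) test_schwartz[OF cutoff_test]]]) (auto simp: V_def)
  moreover have "((\<lambda>z. mellin_form d m h' z \<psi>) \<circ> uminus) holomorphic_on V"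
   by (rule holomorphic_on_compose_gen[OF _ mellin_form_holomorphic[OF h' \<psi>]]) (auto simp: V_def intro!: holomorphic_intros)
  ultimately have "(\<lambda>z. mellin_form d m h z cutoff + mellin_form d m h' (- z) \<psi>) holomorphic_on V"
   by (intro holomorphic_on_add) (auto simp: o_def)
  hence "mellin d T holomorphic_on V" by (rule holomorphic_transform) (simp add: 1)
  hence "mellin d T field_differentiable (at s)" using V by (rule holomorphic_on_imp_differentiable_at)
  moreover have "s \<in> mellin_domain T" using mellin_eq(1)[OF T v h ab] .
  ultimately show ?thesis by blast
 qed
 thus "S \<subseteq> mellin_domain T" by blast
 show "mellin d T holomorphic_on S" by (rule holomorphic_onI) (use * field_differentiable_at_within in blast)
qed

lemma not_Ints_regular:
 assumes "(z :: complex) \<notin> \<int>" shows "(z + of_nat d) / 2 \<notin> \<int>\<^sub>\<le>\<^sub>0"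
proof
 assume "(z + of_nat d) / 2 \<in> \<int>\<^sub>\<le>\<^sub>0"
 then obtain n where "(z + of_nat d) / 2 = of_int n" by (auto elim!: nonpos_Ints_cases)
 hence "z = of_int (2 * n - int d)" by (simp add: field_simps)
 thus False using assms by (metis Ints_of_int)
qed

lemma G_mellin_eq:
 assumes d: "d \<in> {0, 1}" and H: "(\<lambda>s. mellin d T (1 - s)) holomorphic_on U" "open U" "s \<in> U"
  and s: "(s + of_nat d) / 2 \<notin> \<int>\<^sub>\<le>\<^sub>0"
 shows "G_mellin d T s = gamma_factor d s * mellin d T (1 - s)"
 unfolding G_mellin_def
proof (rule remove_sings_eqI)
 have "isCont (\<lambda>s. mellin d T (1 - s)) s"
  using H holomorphic_on_imp_continuous_on continuous_on_eq_continuous_at by blast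
 hence "(\<lambda>s. gamma_factor d s * mellin d T (1 - s)) \<midarrow>s\<rightarrow> gamma_factor d s * mellin d T (1 - s)"
  using isCont_gamma_factor[OF s] by (intro tendsto_mult) (auto simp: isCont_def)
 moreover have "\<forall>\<^sub>F z in at s. gamma_factor d z * mellin d T (1 - z) = G_factor d z * mellin d T (1 - z)"
  using eventually_at_not_Ints[of s]
 proof eventually_elim
  case (elim z)
  thus ?case using G_factor_eq[OF d not_Ints_regular] by simp
 qed
 ultimately show "(\<lambda>s. G_factor d s * mellin d T (1 - s)) \<midarrow>s\<rightarrow> gamma_factor d s * mellin d T (1 - s)"
  by (rule Lim_transform_eventually)
qed

lemma eventually_regular:
 fixes s :: complex
 assumes "open U" "s \<in> U" shows "\<forall>\<^sub>F z in at s. z \<in> U \<and> (z + of_nat d) / 2 \<notin> \<int>\<^sub>\<le>\<^sub>0"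
 using eventually_at_not_Ints[of s] eventually_at_in_open'[OF assms]
proof eventually_elim
 case (elim z)
 thus ?case using not_Ints_regular by simp
qed

text \<open>The entire part of the Gamma factor: removing Gamma((s + d)/2) removes all its
  poles.\<close>

definition gamma_numerator :: "nat => complex => complex" where
 "gamma_numerator d s = \<i> ^ d * exp ((1/2 - s) * cx (ln pi)) * rGamma ((1 + of_nat d - s) / 2)"

lemma gamma_factor_numerator: "gamma_factor d s = Gamma ((s + of_nat d) / 2) * gamma_numerator d s"
 by (simp only: gamma_factor_def gamma_numerator_def mult_ac)

lemma Gamma_rGamma: "(z::complex) \<notin> \<int>\<^sub>\<le>\<^sub>0 ==> Gamma z * rGamma z = 1"
 by (simp add: rGamma_inverse_Gamma Gamma_eq_zero_iff)

lemma gamma_numerator_holomorphic: "gamma_numerator d holomorphic_on A"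
 unfolding gamma_numerator_def by (intro holomorphic_intros) auto

text \<open>The point \<open>d + 2j + 1\<close> is \<open>1 - s\<close> for the pole \<open>s = - (d + 2j)\<close> of the Gamma factor.\<close>

lemma regular_imp_zero:
 assumes d: "d \<in> {0, 1}" and H: "(\<lambda>s. mellin d T (1 - s)) holomorphic_on {s. Re s < 1}"
  and G: "G_mellin d T holomorphic_on {s. Re s < 1}"
 shows "mellin d T (of_nat (d + 2 * j + 1)) = 0"
proof -
 define U where "U = {s. Re s < 1}"
 define s where "s = - complex_of_nat (d + 2 * j)"
 have U: "open U" "s \<in> U" by (auto simp: U_def open_halfspace_Re_lt s_def)
 have "isCont f s" if "f holomorphic_on U" for f
  using that U holomorphic_on_imp_continuous_on continuous_on_eq_continuous_at by blast
 note c = this[unfolded isCont_def]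
 \<comment> \<open>Multiplication by \<open>rGamma ((z + d) / 2)\<close> turns the product into the
   entire numerator times the Mellin transform. At the pole this factor is 0 while the numerator is
   not, so the Mellin transform must vanish.\<close>
 have 1: "(\<lambda>z. rGamma ((z + of_nat d) / 2) * G_mellin d T z) \<midarrow>s\<rightarrow> rGamma ((s + of_nat d) / 2) * G_mellin d T s"
  by (rule c) (use G in \<open>auto simp: U_def intro!: holomorphic_intros\<close>)
 have 2: "(\<lambda>z. gamma_numerator d z * mellin d T (1 - z)) \<midarrow>s\<rightarrow> gamma_numerator d s * mellin d T (1 - s)"
  by (rule c, rule holomorphic_on_mult[OF gamma_numerator_holomorphic]) (use H in \<open>simp add: U_def\<close>)
 have "(\<lambda>z. gamma_numerator d z * mellin d T (1 - z)) \<midarrow>s\<rightarrow> rGamma ((s + of_nat d) / 2) * G_mellin d T s"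
 proof (rule Lim_transform_eventually[OF 1])
  show "\<forall>\<^sub>F z in at s. rGamma ((z + of_nat d) / 2) * G_mellin d T z = gamma_numerator d z * mellin d T (1 - z)"
   using eventually_regular[OF U, of d]
  proof eventually_elim
   case (elim z)
   have "rGamma ((z + of_nat d) / 2) * G_mellin d T z = (Gamma ((z + of_nat d) / 2) * rGamma ((z + of_nat d) / 2)) * (gamma_numerator d z * mellin d T (1 - z))"
    using G_mellin_eq[OF d H[folded U_def] U(1), of z] elim by (simp add: gamma_factor_numerator mult_ac)
   also have "Gamma ((z + of_nat d) / 2) * rGamma ((z + of_nat d) / 2) = 1" using Gamma_rGamma elim by simp
   finally show ?case by simp
  qed
 qed
 from LIM_unique[OF this 2]
 have e: "rGamma ((s + of_nat d) / 2) * G_mellin d T s = gamma_numerator d s * mellin d T (1 - s)" .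
 have "(s + of_nat d) / 2 = - of_nat j" by (simp add: s_def)
 hence "rGamma ((s + of_nat d) / 2) = 0" by (simp add: rGamma_eq_zero_iff)
 moreover have "gamma_numerator d s ~= 0"
 proof -
  have "(1 + of_nat d - s) / 2 \<notin> \<int>\<^sub>\<le>\<^sub>0" by (auto elim!: nonpos_Ints_cases simp: complex_eq_iff s_def)
  thus ?thesis by (simp add: gamma_numerator_def rGamma_eq_zero_iff)
 qed
 ultimately have "mellin d T (1 - s) = 0" using e by simp
 moreover have "1 - s = of_nat (d + 2 * j + 1)" by (simp add: s_def)
 ultimately show ?thesis by (simp only:)
qed

text \<open>The Gamma factor has poles in Re s < 1, so the identity is first cleared of them with
  \<open>rGamma\<close>, then continued from the strip to the half plane, and finally divided again
  near each point; removable singularities are then filled with the values of N.\<close>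

lemma identity_continuation:
 assumes d: "d \<in> {0, 1}" and H: "(\<lambda>s. mellin d T (1 - s)) holomorphic_on {s. Re s < 1}"
  and N: "N holomorphic_on {s. Re s < 1}" and eq: "!!s. 0 < Re s ==> Re s < 1 ==> N s = gamma_factor d s * mellin d T (1 - s)"
  and s: "Re s < 1"
 shows "G_mellin d T s = N s"
proof -
 define U where "U = {s. Re s < 1}"
 have U: "open U" "s \<in> U" "convex U" using s by (auto simp: U_def open_halfspace_Re_lt convex_halfspace_Re_lt)
 \<comment> \<open>Both sides are holomorphic on the whole half plane and agree on the strip 0 < Re
   s < 1.\<close>
 have cont: "rGamma ((z + of_nat d) / 2) * N z = gamma_numerator d z * mellin d T (1 - z)" if z: "z \<in> U" for z
 proof (rule analytic_continuation_open[where s = "{s. 0 < Re s} \<inter> U" and s' = U and f = "\<lambda>z. rGamma ((z + of_nat d) / 2) * N z" and g = "\<lambda>z. gamma_numerator d z * mellin d T (1 - z)" and z = z])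
  show "open ({s. 0 < Re s} \<inter> U)" by (intro open_Int open_halfspace_Re_gt U)
  have "1/2 \<in> {s. 0 < Re s} \<inter> U" by (simp add: U_def)
  thus "{s. 0 < Re s} \<inter> U ~= {}" by blast
  show "connected U" by (rule convex_connected[OF U(3)])
  show "(\<lambda>z. rGamma ((z + of_nat d) / 2) * N z) holomorphic_on U" using N by (auto simp: U_def intro!: holomorphic_intros)
  show "(\<lambda>z. gamma_numerator d z * mellin d T (1 - z)) holomorphic_on U"
   by (rule holomorphic_on_mult[OF gamma_numerator_holomorphic]) (use H in \<open>simp add: U_def\<close>)
  fix z assume z: "z \<in> {s. 0 < Re s} \<inter> U"
  hence "rGamma ((z + of_nat d) / 2) * N z = (Gamma ((z + of_nat d) / 2) * rGamma ((z + of_nat d) / 2)) * (gamma_numerator d z * mellin d T (1 - z))"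
   using eq[of z] by (simp only: gamma_factor_numerator mult_ac U_def Int_iff mem_Collect_eq)
  also have "Gamma ((z + of_nat d) / 2) * rGamma ((z + of_nat d) / 2) = 1" using Gamma_rGamma[OF gamma_regular] z by simp
  finally show "rGamma ((z + of_nat d) / 2) * N z = gamma_numerator d z * mellin d T (1 - z)" by simp
 qed (use U z in auto)
 have "N \<midarrow>s\<rightarrow> N s"
  using N U holomorphic_on_imp_continuous_on continuous_on_eq_continuous_at unfolding U_def isCont_def[symmetric] by blast
 hence "(\<lambda>s. G_factor d s * mellin d T (1 - s)) \<midarrow>s\<rightarrow> N s"
 proof (rule Lim_transform_eventually)
  show "\<forall>\<^sub>F z in at s. N z = G_factor d z * mellin d T (1 - z)"
   using eventually_regular[OF U(1,2), of d]
  proof eventually_elim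
   case (elim z)
   have "N z = (Gamma ((z + of_nat d) / 2) * rGamma ((z + of_nat d) / 2)) * N z" using Gamma_rGamma elim by simp
   also have "... = gamma_factor d z * mellin d T (1 - z)"
    using cont[of z] elim by (simp only: gamma_factor_numerator mult.assoc)
   finally show ?case using G_factor_eq[OF d] elim by simp
  qed
 qed
 thus ?thesis unfolding G_mellin_def by (rule remove_sings_eqI)
qed

section \<open>Parity and moments\<close>

lemma wbd_reflect:
 assumes "wbd a b h" shows "wbd a b (\<lambda>x. h (- x))"
proof -
 obtain C where C: "!!x. x ~= 0 ==> norm (h x) <= C * wt a b x" using assms unfolding wbd_def by blast
 note [measurable] = wbd_measurable[OF assms]
 show ?thesis
 proof (rule wbdI[of _ C])
  fix x :: real assume "x ~= 0"
  moreover have "wt a b (- x) = wt a b x" by (simp add: wt_def)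
  ultimately show "norm (h (- x)) <= C * wt a b x" using C[of "- x"] by simp
 qed measurable
qed

lemma integral_reflect: "(LB x. f (- x)) = (LB x. f (x::real) :: complex)"
 using lborel_integral_real_affine[of "-1" f 0] by simp

text \<open>The Euler operator commutes with reflection, so averaging a form with its reflection
  averages the coefficients and leaves T unchanged.\<close>

lemma rep_parity:
 assumes T: "rep schwartz a b T" and a: "a > -1" and p: "!!f. f \<in> schwartz ==> T (\<lambda>x. f (- x)) = (- 1) ^ d * T f"
 obtains m h where "!!i. wbd a b (h i)" "!!f. f \<in> schwartz ==> T f = euler_form m h f" "!!i x. h i (- x) = (- 1) ^ d * h i x"
proof -
 obtain m h where h: "!!i. wbd a b (h i)" "!!f. f \<in> schwartz ==> T f = euler_form m h f"
  using T unfolding rep_def by blast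
 define k where "k i x = (h i x + (- 1) ^ d * h i (- x)) / 2" for i x
 have dd: "(- 1) ^ d * (- 1) ^ d = (1::complex)" by (simp flip: power_mult_distrib)
 show ?thesis
 proof (rule that[of k m])
  have "wbd a b (\<lambda>x. (1/2) * (h i x + (- 1) ^ d * h i (- x)))" for i
   by (intro wbd_cmult wbd_add h wbd_reflect)
  thus "wbd a b (k i)" for i by (simp add: k_def[abs_def])
  show "k i (- x) = (- 1) ^ d * k i x" for i x
   using dd by (simp add: k_def distrib_left add.commute flip: mult.assoc)
  fix f :: "real => complex" assume f: "f \<in> schwartz"
  have sf: "smooth f" by (rule schwartz_smooth[OF f])
  have fm: "(\<lambda>x. f (- x)) \<in> schwartz"
  proof -
   have "nderiv n (\<lambda>x. f (- x)) y = (-1) ^ n * nderiv n f (- y)" for n y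
    using smooth_affine(2)[OF sf, of n "-1" 0 y] by simp
   hence e: "norm (cx x ^ i * nderiv n (\<lambda>x. f (- x)) x) = norm (cx (- x) ^ i * nderiv n f (- x))" for i n x
    by (simp add: norm_mult norm_power)
   have "\<exists>B. \<forall>x. norm (cx x ^ i * nderiv n (\<lambda>x. f (- x)) x) <= B" for i n
    unfolding e using schwartz_bound[OF f, of i n] by blast
   thus ?thesis unfolding schwartz_iff using smooth_dilate[OF sf, of "-1"] by simp
  qed
  have ki: "lb_int (\<lambda>x. g x * (Eop ^^ i) f x)" if "wbd a b g" for g i
   by (rule adm_integrable[OF adm_schwartz _ that adm_funpow[OF adm_schwartz f]]) (use a in simp)
  have "T f = (T f + (- 1) ^ d * T (\<lambda>x. f (- x))) / 2"
   using p[OF f] dd by (simp flip: mult.assoc)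
  also have "T (\<lambda>x. f (- x)) = (\<Sum>i\<le>m. LB x. h i (- x) * (Eop ^^ i) f x)"
  proof -
   have "(LB x. h i x * (Eop ^^ i) (\<lambda>x. f (- x)) x) = (LB x. h i (- x) * (Eop ^^ i) f x)" for i
   proof -
    have "(Eop ^^ i) (\<lambda>x. f (- x)) = (\<lambda>x. (Eop ^^ i) f (- x))" using Eop_funpow_dilate[OF sf, of i "-1"] by simp
    thus ?thesis using integral_reflect[of "\<lambda>x. h i (- x) * (Eop ^^ i) f x"] by simp
   qed
   thus ?thesis unfolding h(2)[OF fm] euler_form_def by simp
  qed
  also have "(T f + (- 1) ^ d * (\<Sum>i\<le>m. LB x. h i (- x) * (Eop ^^ i) f x)) / 2 = (\<Sum>i\<le>m. LB x. k i x * (Eop ^^ i) f x)"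
   unfolding h(2)[OF f] euler_form_def sum_distrib_left sum.distrib[symmetric] sum_divide_distrib
  proof (intro sum.cong refl)
   fix i
   have e: "k i x * (Eop ^^ i) f x = (1/2) * (h i x * (Eop ^^ i) f x + (- 1) ^ d * (h i (- x) * (Eop ^^ i) f x))" for x
    by (simp add: k_def algebra_simps)
   show "((LB x. h i x * (Eop ^^ i) f x) + (- 1) ^ d * (LB x. h i (- x) * (Eop ^^ i) f x)) / 2 = (LB x. k i x * (Eop ^^ i) f x)"
    unfolding e using ki[OF h(1)] ki[OF wbd_reflect[OF h(1)]] by simp
  qed
  finally show "T f = euler_form m k f" by (simp add: euler_form_def)
 qed
qed

lemma schwartz_moment_integrable: "f \<in> schwartz ==> lb_int (\<lambda>x. cx x ^ n * f x)"
 by (rule schwartz_integrable[OF schwartz_xpow])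

text \<open>Integration by parts: the n-th moment is an eigenfunctional of \<open>mth\<close> with
  eigenvalue n + 1.\<close>

lemma moment_mth:
 assumes f: "f \<in> schwartz"
 shows "(LB x. cx x ^ n * mth f x) = of_nat (n + 1) * (LB x. cx x ^ n * f x)"
proof -
 have g: "(\<lambda>x. cx x ^ Suc n * f x) \<in> schwartz" by (rule schwartz_xpow[OF f])
 have "nderiv 1 (\<lambda>x. cx x ^ Suc n * f x) x = of_nat (n + 1) * (cx x ^ n * f x) - cx x ^ n * mth f x" for x
 proof -
  have "nderiv 1 (\<lambda>x. cx x ^ Suc n * f x) x = cx x ^ Suc n * nderiv 1 f x + nderiv 1 (\<lambda>x. cx x ^ Suc n) x * f x"
   by (rule nderiv_1_mult[OF open_UNIV smooth_xpow schwartz_smooth[OF f]]) simp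
  moreover have "nderiv 1 (\<lambda>x. cx x ^ Suc n) x = of_nat (n + 1) * cx x ^ n"
   unfolding nderiv_xpow by (simp add: One_nat_def lessThan_Suc)
  ultimately show ?thesis by (simp add: mth_def th_def)
 qed
 hence "0 = (LB x. of_nat (n + 1) * (cx x ^ n * f x) - cx x ^ n * mth f x)"
  using integral_nderiv_schwartz[OF g] by simp
 also have "... = of_nat (n + 1) * (LB x. cx x ^ n * f x) - (LB x. cx x ^ n * mth f x)"
  using schwartz_moment_integrable[OF f] schwartz_moment_integrable[OF tame_schwartz[OF tame_mth f]]
  by (simp del: of_nat_add)
 finally show ?thesis by simp
qed

lemma moment_mth_funpow:
 assumes f: "f \<in> schwartz"
 shows "(LB x. cx x ^ n * (mth ^^ i) f x) = of_nat (n + 1) ^ i * (LB x. cx x ^ n * f x)"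
 by (induction i) (simp_all add: moment_mth[OF schwartz_mth_funpow[OF f]] del: of_nat_add)

text \<open>The exponent -(K + 2) at infinity makes the moments up to K converge. The exponential
  minus its Taylor polynomial of degree K - 1 is at most (2 pi |x y|)^K for all y, so the remainder
  has exponent K at both ends.\<close>

lemma fourier_taylor:
 fixes h :: "real => complex"
 assumes h: "wbd 1 (- real (K + 2)) h"
 defines "r \<equiv> \<lambda>y. FT h y - (\<Sum>n<K. (- (2 * cx pi * \<i>)) ^ n / fact n * (LB x. h x * cx x ^ n) * cx y ^ n)"
 shows "lb_int h" and "wbd K K r"
proof -
 have hi: "lb_int (\<lambda>x. h x * cx x ^ n)" if "n <= K" for n
  by (rule wbd_integrable_mult[OF h wbd_xpow]) (use that in auto)
 thus h0: "lb_int h" using hi[of 0] by simp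
 have hn: "lb_int (\<lambda>x. norm (h x) * abs x ^ K)"
  using integrable_norm[OF hi[of K]] by (simp add: norm_mult norm_power)
 show "wbd K K r"
 proof (rule wbdI)
  show "r \<in> BM"
   unfolding r_def using FT_measurable[OF wbd_measurable[OF h]] by measurable
  fix y :: real assume y: "y ~= 0"
  let ?t = "\<lambda>n x. (- (2 * cx pi * \<i>) * cx x) ^ n / fact n * cx y ^ n"
  have te: "h x * ?t n x = ((- (2 * cx pi * \<i>)) ^ n / fact n * cx y ^ n) * (h x * cx x ^ n)" for n x
   unfolding power_mult_distrib by (simp add: mult_ac)
  have ti: "lb_int (\<lambda>x. h x * ?t n x)" if "n < K" for n
   unfolding te using hi[of n] that by (intro integrable_mult_right) auto
  have "(LB x. h x * ?t n x) = (- (2 * cx pi * \<i>)) ^ n / fact n * (LB x. h x * cx x ^ n) * cx y ^ n" for n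
   unfolding te integral_mult_right_zero by (simp only: mult_ac)
  hence "r y = (LB x. h x * ek y x) - (\<Sum>n<K. (LB x. h x * ?t n x))"
   unfolding r_def FT_ek by simp
  also have "(\<Sum>n<K. (LB x. h x * ?t n x)) = (LB x. (\<Sum>n<K. h x * ?t n x))"
   by (rule LB_integral_sum[symmetric]) (use ti in auto)
  also have "(LB x. h x * ek y x) - ... = (LB x. h x * ek y x - (\<Sum>n<K. h x * ?t n x))"
   by (rule LB_integral_diff[symmetric]) (use ti ek_mult_integrable[OF h0] in \<open>auto intro!: LB_integrable_sum\<close>)
  finally have ry: "r y = (LB x. h x * ek y x - (\<Sum>n<K. h x * ?t n x))" .
  have "norm (r y) <= (LB x. (2 * pi * abs y) ^ K * (norm (h x) * abs x ^ K))"
   unfolding ry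
  proof (rule LB_norm_le)
   show "lb_int (\<lambda>x. h x * ek y x - (\<Sum>n<K. h x * ?t n x))"
    using ti ek_mult_integrable[OF h0] by (intro LB_integrable_diff LB_integrable_sum) auto
   show "lb_int (\<lambda>x. (2 * pi * abs y) ^ K * (norm (h x) * abs x ^ K))"
    using hn by (rule integrable_mult_right)
   fix x
   have "norm (h x * ek y x - (\<Sum>n<K. h x * ?t n x)) = norm (h x) * norm (ek y x - (\<Sum>n<K. ?t n x))"
    by (simp only: sum_distrib_left[symmetric] right_diff_distrib[symmetric] norm_mult)
   also have "... <= norm (h x) * (2 * pi * abs x * abs y) ^ K"
    by (intro mult_left_mono ek_taylor) simp
   finally show "norm (h x * ek y x - (\<Sum>n<K. h x * ?t n x)) <= (2 * pi * abs y) ^ K * (norm (h x) * abs x ^ K)"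
    by (simp add: power_mult_distrib mult_ac)
  qed
  also have "... = ((2 * pi) ^ K * (LB x. norm (h x) * abs x ^ K)) * wt K K y"
   unfolding integral_mult_right_zero using y by (simp add: wt_def powr_realpow power_mult_distrib mult_ac)
  finally show "norm (r y) <= ((2 * pi) ^ K * (LB x. norm (h x) * abs x ^ K)) * wt K K y" .
 qed
qed

text \<open>The Taylor coefficients of \<open>fourier T\<close> at the origin are the moments of \<open>T\<close>, that is, the values
 of its Mellin transform at the positive integers.\<close>

lemma moments_zero_imp_vanishes:
 assumes d: "d \<in> {0, 1}" and T: "tempered T" "vanishes_to T 0 1" "rep schwartz 1 (- real (K + 2)) T"
  and p: "!!f. f \<in> schwartz ==> T (\<lambda>x. f (- x)) = (- 1) ^ d * T f"
  and z: "!!j. mellin d T (of_nat (d + 2 * j + 1)) = 0"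
 shows "vanishes_to (fourier T) 0 (int K)"
proof -
 obtain m h where h: "!!i. wbd 1 (- real (K + 2)) (h i)" "!!f. f \<in> schwartz ==> T f = euler_form m h f"
   and hp: "!!i x. h i (- x) = (- 1) ^ d * h i x"
  by (rule rep_parity[OF T(3) _ p]) auto
 define mo where "mo i n = (LB x. h i x * cx x ^ n)" for i n
 \<comment> \<open>For n of the parity of d the sum is the value of the Mellin transform at n + 1,
   where the signed power is x^n; for the other parity every moment vanishes because the integrand
   is odd.\<close>
 have c: "(\<Sum>i\<le>m. of_nat (n + 1) ^ i * mo i n) = 0" if n: "n < K" for n
 proof (cases "even (n + d)")
  case True
  have "h i x * sp d (of_nat (n + 1) - 1) x = h i x * cx x ^ n" if "x ~= 0" for i x
  proof -
   have "cx (sgn x) ^ d = cx (sgn x) ^ n"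
    using True d that by (auto simp: sgn_real_def)
   moreover have "cx (abs x) powr (of_nat (n + 1) - 1) = cx (abs x) ^ n"
    using that by simp
   ultimately have "sp d (of_nat (n + 1) - 1) x = (cx (sgn x) * cx (abs x)) ^ n"
    by (simp only: signed_power_def power_mult_distrib)
   also have "cx (sgn x) * cx (abs x) = cx x" by (simp add: sgn_mult_abs flip: of_real_mult)
   finally show ?thesis by simp
  qed
  hence "(LB x. h i x * sp d (of_nat (n + 1) - 1) x) = mo i n" for i
   unfolding mo_def using wbd_measurable[OF h(1)] AE_lborel_not_0
   by (intro integral_cong_AE) (measurable, auto elim!: eventually_mono)
  hence "mellin d T (of_nat (n + 1)) = (\<Sum>i\<le>m. of_nat (n + 1) ^ i * mo i n)"
   using mellin_eq(2)[where a = 1 and b = "- int (K + 2)" and s = "of_nat (n + 1)" and h = h and m = m and \<delta> = d, OF T(1,2)] h n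
   by (simp add: test_schwartz del: of_nat_add)
  \<comment> \<open>A nonnegative n of the parity of d is d + 2 j, except that n = 0 with d = 1
    would escape; that case has the wrong parity and is ruled out next.\<close>
  moreover have "\<exists>j. n = d + 2 * j \<or> n = 0 \<and> d = 1"
   using True d by (auto elim!: evenE oddE)
  moreover have "n ~= 0 \<or> d ~= 1" using True by auto
  ultimately show ?thesis using z by force
 next
  case False
  have "mo i n = 0" for i
  proof -
   have "h i (- x) * cx (- x) ^ n = (- 1) ^ (n + d) * (h i x * cx x ^ n)" for x
   proof -
    have "cx (- x) ^ n = (- 1) ^ n * cx x ^ n" by (simp flip: power_mult_distrib)
    thus ?thesis by (simp only: hp power_add mult_ac)
   qed
   hence "mo i n = (LB x. (- 1) ^ (n + d) * (h i x * cx x ^ n))"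
    using integral_reflect[of "\<lambda>x. h i x * cx x ^ n"] unfolding mo_def by (simp only:)
   also have "... = - mo i n" unfolding integral_mult_right_zero mo_def using False by (simp add: minus_one_power_iff)
   finally show ?thesis by simp
  qed
  thus ?thesis by simp
 qed
 define r where "r i = (\<lambda>y. FT (h i) y - (\<Sum>n<K. (- (2 * cx pi * \<i>)) ^ n / fact n * mo i n * cx y ^ n))" for i
 have r: "wbd K K (r i)" and hint: "lb_int (h i)" for i
  using fourier_taylor[OF h(1)[of i]] unfolding r_def mo_def by auto
 have "rep schwartz (real K) (real K) (\<lambda>f. \<Sum>i\<le>m. (LB x. r i x * (mth ^^ i) f x))"
 proof (rule rep_sum[OF adm_schwartz])
  show "rep schwartz (real K) (real K) (\<lambda>f. LB x. r i x * (mth ^^ i) f x)" for i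
   by (rule rep_mth_funpow[OF adm_schwartz _ tame_schwartz[OF tame_mth] rep_int[OF r]]) auto
 qed simp
 hence "rep schwartz (real K) (real K) (fourier T)"
 proof (rule rep_cong)
  fix f assume f: "f \<in> schwartz"
  have "fourier T f = (\<Sum>i\<le>m. (LB y. FT (h i) y * (mth ^^ i) f y))"
  proof -
   have "(LB x. h i x * FT ((mth ^^ i) f) x) = (LB y. FT (h i) y * (mth ^^ i) f y)" for i
    by (rule parseval[OF hint schwartz_integrable[OF schwartz_mth_funpow[OF f]]])
   thus ?thesis
    unfolding fourier_def h(2)[OF tame_schwartz[OF tame_FT f]] euler_form_def Eop_funpow_FT[OF f] by simp
  qed
  also have "... = (\<Sum>i\<le>m. (LB x. r i x * (mth ^^ i) f x) + (\<Sum>n<K. (- (2 * cx pi * \<i>)) ^ n / fact n * mo i n * (of_nat (n + 1) ^ i * (LB x. cx x ^ n * f x))))"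
  proof (intro sum.cong refl)
   fix i
   define g where "g = (mth ^^ i) f"
   have g: "g \<in> schwartz" unfolding g_def by (rule schwartz_mth_funpow[OF f])
   have ri: "lb_int (\<lambda>x. r i x * g x)"
    by (rule adm_integrable[OF adm_schwartz _ r g]) simp
   have "FT (h i) y * g y = r i y * g y + (\<Sum>n<K. (- (2 * cx pi * \<i>)) ^ n / fact n * mo i n * (cx y ^ n * g y))" for y
    by (simp add: r_def algebra_simps sum_distrib_left)
   hence "(LB y. FT (h i) y * g y) = (LB y. r i y * g y) + (\<Sum>n<K. (- (2 * cx pi * \<i>)) ^ n / fact n * mo i n * (LB y. cx y ^ n * g y))"
    using ri schwartz_moment_integrable[OF g] by (simp add: LB_integral_sum)
   thus "(LB y. FT (h i) y * (mth ^^ i) f y) = (LB x. r i x * (mth ^^ i) f x) + (\<Sum>n<K. (- (2 * cx pi * \<i>)) ^ n / fact n * mo i n * (of_nat (n + 1) ^ i * (LB x. cx x ^ n * f x)))"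
    unfolding g_def moment_mth_funpow[OF f] .
  qed
  \<comment> \<open>Exchanging the sums collects, for each n, the combination of moments with
    weights (n + 1)^i, which is the vanishing sum \<open>c\<close>: only the remainders
    survive.\<close>
  also have "... = (\<Sum>i\<le>m. (LB x. r i x * (mth ^^ i) f x)) + (\<Sum>n<K. (- (2 * cx pi * \<i>)) ^ n / fact n * (LB x. cx x ^ n * f x) * (\<Sum>i\<le>m. of_nat (n + 1) ^ i * mo i n))"
   unfolding sum.distrib sum_distrib_left by (subst sum.swap) (simp only: mult_ac)
  also have "... = (\<Sum>i\<le>m. (LB x. r i x * (mth ^^ i) f x))" using c by simp
  finally show "(\<Sum>i\<le>m. (LB x. r i x * (mth ^^ i) f x)) = fourier T f" ..
 qed
 hence "rep (TF {-1<..<1}) (real K) (real K) (fourier T)"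
  by (rule rep_mono) (auto intro: test_schwartz)
 thus ?thesis by (rule rep_imp_vanishes) auto
qed

text \<open>The Mellin transform of T is holomorphic on Re s > -1. If the transform is flat at 0,
  its Mellin transform is holomorphic on Re s < 1, and the equation, known on 0 < Re s < 1,
  continues to that half plane. Conversely, regularity kills the moments, and
  \<open>moments_zero_imp_vanishes\<close> gives each order K.\<close>

lemma canonical_functional_equation:
 assumes d: "d \<in> {0, 1}" and T: "tempered_parity d T" "extends_canonically_across_infinity T"
  and k0: "1 <= order_val k0" "vanishes T 0 k0"
 shows "\<forall>s. Re s < 1 --> 1 - s \<in> mellin_domain T"
  and "vanishes (fourier T) 0 Infinite_Order \<longleftrightarrow> G_mellin d T holomorphic_on {s. Re s < 1}"
  and "vanishes (fourier T) 0 Infinite_Order ==> Re s < 1 ==> s \<in> mellin_domain (fourier T) \<and> mellin d (fourier T) s = (- 1) ^ d * G_mellin d T s"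
proof -
 have te: "tempered T" and par: "!!f. f \<in> schwartz ==> T (\<lambda>x. f (- x)) = (- 1) ^ d * T f"
  using T(1) by (auto simp: tempered_parity_def)
 obtain N M :: nat where N: "rep (test0) (- real M) (real N) T" using rep_away_from_zero[OF te] by blast
 obtain k :: nat where k: "k >= 1" "vanishes_to T 0 (int k)"
 proof (cases k0)
  case (Finite_Order l)
  hence "l >= 1" using k0 by (simp add: one_ereal_def)
  thus ?thesis using k0 that[of "nat l"] by (simp add: Finite_Order)
 next
  case Infinite_Order
  thus ?thesis using k0 that[of 1] by simp
 qed
 \<comment> \<open>Any order k >= 1 yields the exponent 1 at 0; the canonical extension then gives
   every exponent -K at infinity.\<close>
 have r1: "rep schwartz 1 (real N) T"
  by (rule rep_mono[OF tempered_vanishing_rep[OF te k(2) N]]) (use k in auto)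
 have r: "rep schwartz 1 (- real K) T" for K
  by (rule tempered_canonical_rep[OF te r1 _ T(2)]) simp
 have v: "vanishes_to T 0 1"
 proof (rule rep_imp_vanishes)
  show "rep (TF {-1<..<1}) 1 (real N) T" by (rule rep_mono[OF r1]) (auto intro: test_schwartz)
 qed auto
 define V where "V = {z::complex. - 1 < Re z}"
 have V: "\<exists>a b::int. vanishes_to T 0 a \<and> rep (test0) (of_int a) (of_int b) T \<and> - of_int a < Re s \<and> Re s < - of_int b" if "s \<in> V" for s
 proof -
  obtain K :: nat where K: "Re s < real K" using reals_Archimedean2 by blast
  show ?thesis
  proof (rule exI[of _ 1], rule exI[of _ "- int K"], intro conjI v)
   show "rep (test0) (of_int 1) (of_int (- int K)) T"
    by (rule rep_mono[OF r[of K]]) (use test_away_subset_schwartz in auto)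
  qed (use that K in \<open>auto simp: V_def\<close>)
 qed
 have Vo: "open V" unfolding V_def by (rule open_halfspace_Re_gt)
 note HV = mellin_holomorphic[OF te Vo V]
 show "\<forall>s. Re s < 1 --> 1 - s \<in> mellin_domain T" using HV(1) by (auto simp: V_def)
 have H: "(\<lambda>s. mellin d T (1 - s)) holomorphic_on {s. Re s < 1}"
 proof -
  have "(mellin d T \<circ> (\<lambda>s. 1 - s)) holomorphic_on {s. Re s < 1}"
   by (rule holomorphic_on_compose_gen[OF _ HV(2)]) (auto simp: V_def intro!: holomorphic_intros)
  thus ?thesis by (simp add: o_def)
 qed
 have main: "s \<in> mellin_domain (fourier T) \<and> mellin d (fourier T) s = (- 1) ^ d * G_mellin d T s"
   "mellin d (fourier T) holomorphic_on {s. Re s < 1}"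
  if F: "vanishes (fourier T) 0 Infinite_Order" and s: "Re s < 1" for s
 proof -
  define U where "U = {z::complex. Re z < 1}"
  have Ft: "tempered (fourier T)" by (rule tempered_fourier[OF te])
  \<comment> \<open>Exponent -1 at infinity for the transform costs only one division by x; flatness
    then raises the exponent at 0 to any K.\<close>
  have "rep (Sz 1) (- real 1) (- real 1) (fourier T)" by (rule rep_fourier[OF r[of 1]]) auto
  hence Fa: "rep (test0) (- 1) (- 1) (fourier T)"
   using rep_mono[OF _ test_away_subset_Sz] by auto
  have FK: "rep schwartz (real K) (- 1) (fourier T)" for K
   by (rule tempered_vanishing_rep[OF Ft _ Fa]) (use F in simp)
  have U: "\<exists>a b::int. vanishes_to (fourier T) 0 a \<and> rep (test0) (of_int a) (of_int b) (fourier T) \<and> - of_int a < Re s \<and> Re s < - of_int b" if "s \<in> U" for s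
  proof -
   obtain K :: nat where K: "- Re s < real K" using reals_Archimedean2 by blast
   show ?thesis
   proof (rule exI[of _ "int K"], rule exI[of _ "- 1"], intro conjI)
    show "rep (test0) (of_int (int K)) (of_int (- 1)) (fourier T)"
     by (rule rep_mono[OF FK[of K]]) (use test_away_subset_schwartz in auto)
    show "vanishes_to (fourier T) 0 (int K)" using F by simp
   qed (use that K in \<open>auto simp: U_def\<close>)
  qed
  have Uo: "open U" unfolding U_def by (rule open_halfspace_Re_lt)
  note HU = mellin_holomorphic[OF Ft Uo U]
  show hol: "mellin d (fourier T) holomorphic_on {s. Re s < 1}" using HU(2) by (simp add: U_def)
  \<comment> \<open>The functional equation is used only on 0 < Re s < 1, with exponents (1, -1) for
    T and (0, -1) for its transform.\<close>
  have "G_mellin d T s = (- 1) ^ d * mellin d (fourier T) s"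
  proof (rule identity_continuation[OF d H _ _ s])
   show "(\<lambda>s. (- 1) ^ d * mellin d (fourier T) s) holomorphic_on {s. Re s < 1}" using hol by (intro holomorphic_intros)
   fix s assume s: "0 < Re s" "Re s < 1"
   have "mellin d (fourier T) s = (- 1) ^ d * gamma_factor d s * mellin d T (1 - s)"
   proof (rule mellin_fourier[OF d te v])
    show "rep schwartz (of_int 1) (of_int (- 1)) T" using r[of 1] by simp
    show "vanishes_to (fourier T) 0 0" using F by simp
    show "rep (Sz 0) (of_int 0) (of_int (- 1)) (fourier T)" using FK[of 0] by (simp add: Sz_0)
   qed (use s in auto)
   thus "(- 1) ^ d * mellin d (fourier T) s = gamma_factor d s * mellin d T (1 - s)"
    by (simp flip: mult.assoc power_mult_distrib)
  qed
  thus "s \<in> mellin_domain (fourier T) \<and> mellin d (fourier T) s = (- 1) ^ d * G_mellin d T s"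
   using HU(1) s by (auto simp: U_def simp flip: mult.assoc power_mult_distrib)
 qed
 show "vanishes (fourier T) 0 Infinite_Order ==> Re s < 1 ==> s \<in> mellin_domain (fourier T) \<and> mellin d (fourier T) s = (- 1) ^ d * G_mellin d T s"
  by (rule main(1))
 show "vanishes (fourier T) 0 Infinite_Order \<longleftrightarrow> G_mellin d T holomorphic_on {s. Re s < 1}"
 proof
  assume F: "vanishes (fourier T) 0 Infinite_Order"
  have "(\<lambda>s. (- 1) ^ d * mellin d (fourier T) s) holomorphic_on {s. Re s < 1}"
   using main(2)[OF F, of 0] by (intro holomorphic_intros) simp
  thus "G_mellin d T holomorphic_on {s. Re s < 1}"
   by (rule holomorphic_transform) (use main(1)[OF F] in \<open>simp flip: mult.assoc power_mult_distrib\<close>)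
 next
  assume G: "G_mellin d T holomorphic_on {s. Re s < 1}"
  have z: "mellin d T (of_nat (d + 2 * j + 1)) = 0" for j by (rule regular_imp_zero[OF d H G])
  have vK: "vanishes_to (fourier T) 0 (int K)" for K
   by (rule moments_zero_imp_vanishes[OF d te v r par z])
  \<comment> \<open>Negative orders follow from order 0, since a form with exponent 0 also
    represents the distribution to every lower order.\<close>
  have "vanishes_to (fourier T) 0 l" for l
  proof (cases "l >= 0")
   case True thus ?thesis using vK[of "nat l"] by simp
  next
   case False
   obtain r where r: "0 < r" "!!c. rep (TF {-r<..<r}) (of_int 0) c (fourier T)"
    using vanishes_imp_rep[OF vK[of 0]] by auto
   show ?thesis by (rule rep_imp_vanishes[OF r(2)[of 0] r(1)]) (use False in auto)
  qed
  thus "vanishes (fourier T) 0 Infinite_Order" by simp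
 qed
qed

theorem theorem4p12:
  fixes \<delta> :: nat
  assumes "\<delta> \<in> {0, 1}"
  shows
    "(\<forall>\<sigma>. tempered \<sigma> \<and> vanishes \<sigma> 0 Infinite_Order \<longrightarrow>
        (\<exists>A::real. \<forall>s. A < Re s \<longrightarrow>
           s \<in> mellin_domain (fourier \<sigma>) \<and> 1 - s \<in> mellin_domain \<sigma> \<and>
           mellin \<delta> (fourier \<sigma>) s = (- 1) ^ \<delta> * G_factor \<delta> s * mellin \<delta> \<sigma> (1 - s)))
     \<and>
     (\<forall>\<sigma> k0. tempered_parity \<delta> \<sigma> \<and> extends_canonically_across_infinity \<sigma> \<and>
              1 \<le> order_val k0 \<and> vanishes \<sigma> 0 k0 \<longrightarrow>
        (\<forall>s. Re s < 1 \<longrightarrow> 1 - s \<in> mellin_domain \<sigma>) \<and>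
        (vanishes (fourier \<sigma>) 0 Infinite_Order \<longleftrightarrow> G_mellin \<delta> \<sigma> holomorphic_on {s. Re s < 1}) \<and>
        (vanishes (fourier \<sigma>) 0 Infinite_Order \<longrightarrow>
           (\<forall>s. Re s < 1 \<longrightarrow>
              s \<in> mellin_domain (fourier \<sigma>) \<and>
              mellin \<delta> (fourier \<sigma>) s = (- 1) ^ \<delta> * G_mellin \<delta> \<sigma> s)))"
  using flat_functional_equation[OF assms] canonical_functional_equation[OF assms] by blast

end
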